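(* There exists a smooth complete Ricci flow $g(t)$ on $\mathbb{R}^2$, for $t\in(0,\infty)$, which achieves the standard Euclidean metric $g_0$ on $\mathbb{R}^2$ as initial data in the sense that $$d_{g(t)}\to d_{g_0}\quad\text{locally uniformly on }\mathbb{R}^2\times\mathbb{R}^2\text{ as }t\downarrow 0,$$ which satisfies the curvature estimate $|K_{g(t)}|\leq \frac{1}{2t}$ throughout $\mathbb{R}^2$ for all $t>0$, but which is not the static Ricci flow, i.e. it is not the case that $g(t)=g_0$ for all $t>0$.
   Context: A smooth Ricci flow on a manifold $M$ over a time interval $I$ is a smooth family of Riemannian metrics $g(t)$, $t\in I$, on $M$ satisfying $\frac{\partial g}{\partial t}=-2\,\mathrm{Ric}_{g(t)}$ (on a surface, $\frac{\partial g}{\partial t}=-2K_{g(t)}\,g$). It is called complete if $(M,g(t))$ is a complete Riemannian manifold for each $t\in I$. For a Riemannian metric $g$, $d_g$ denotes its Riemannian distance function and, on a surface, $K_g$ denotes its Gauss curvature. *)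

theory Defs
  imports "HOL-Analysis.Analysis"
begin

section \<open>Smooth maps\<close>

text \<open>The derivatives are two-sided, so these notions are meant for open sets \<open>S\<close>.\<close>

primrec Ck_on :: "nat \<Rightarrow> ('a::real_normed_vector \<Rightarrow> 'b::real_normed_vector) \<Rightarrow> 'a set \<Rightarrow> bool" where
  "Ck_on 0 f S \<longleftrightarrow> continuous_on S f"
| "Ck_on (Suc k) f S \<longleftrightarrow>
     (\<forall>x\<in>S. f differentiable (at x)) \<and> (\<forall>v. Ck_on k (\<lambda>x. frechet_derivative f (at x) v) S)"

definition smooth_map_on :: "('a::real_normed_vector \<Rightarrow> 'b::real_normed_vector) \<Rightarrow> 'a set \<Rightarrow> bool" where
  "smooth_map_on f S \<longleftrightarrow> (\<forall>k. Ck_on k f S)"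


section \<open>Riemannian metrics on Euclidean space in the standard global coordinates\<close>

text \<open>A metric is given by its matrix \<open>g x $ i $ j = g\<^sub>x(\<partial>\<^sub>i, \<partial>\<^sub>j)\<close>.\<close>

type_synonym 'n metric_field = "real ^ 'n \<Rightarrow> real ^ 'n ^ 'n"

definition riemannian_metric :: "('n::finite) metric_field \<Rightarrow> bool" where
  "riemannian_metric g \<longleftrightarrow>
     smooth_map_on g UNIV \<and>
     (\<forall>x. transpose (g x) = g x) \<and>
     (\<forall>x v. v \<noteq> 0 \<longrightarrow> v \<bullet> (g x *v v) > 0)"

definition standard_metric :: "('n::finite) metric_field" where
  "standard_metric = (\<lambda>x. mat 1)"


subsection \<open>Riemannian distance and completeness\<close>

definition riem_speed :: "('n::finite) metric_field \<Rightarrow> (real \<Rightarrow> real ^ 'n) \<Rightarrow> real \<Rightarrow> real" where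
  "riem_speed g \<gamma> t =
     (let v = vector_derivative \<gamma> (at t) in sqrt (v \<bullet> (g (\<gamma> t) *v v)))"

definition riem_length :: "('n::finite) metric_field \<Rightarrow> (real \<Rightarrow> real ^ 'n) \<Rightarrow> real" where
  "riem_length g \<gamma> = integral {0..1} (riem_speed g \<gamma>)"

text \<open>
  The infimum is over piecewise \<open>C\<^sup>1\<close> curves. The library's \<^const>\<open>valid_path\<close> allows the derivative
  to be unbounded near a break point, so the length may be infinite, in which case \<^const>\<open>integral\<close>
  would return the junk value \<open>0\<close>; the integrability condition discards exactly these curves.
\<close>

definition riem_dist :: "('n::finite) metric_field \<Rightarrow> real ^ 'n \<Rightarrow> real ^ 'n \<Rightarrow> real" where
  "riem_dist g x y =
     Inf {riem_length g \<gamma> | \<gamma>.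
            valid_path \<gamma> \<and> pathstart \<gamma> = x \<and> pathfinish \<gamma> = y \<and>
            riem_speed g \<gamma> integrable_on {0..1}}"

definition complete_metric :: "('n::finite) metric_field \<Rightarrow> bool" where
  "complete_metric g \<longleftrightarrow> Metric_space.mcomplete UNIV (riem_dist g)"


subsection \<open>Curvature\<close>

definition pderiv_at :: "'n::finite \<Rightarrow> (real ^ 'n \<Rightarrow> real) \<Rightarrow> real ^ 'n \<Rightarrow> real" where
  "pderiv_at i f x = frechet_derivative f (at x) (axis i 1)"

text \<open>\<open>christoffel g k i j\<close> is \<open>\<Gamma>\<^sup>k\<^sub>i\<^sub>j\<close>.\<close>

definition christoffel :: "('n::finite) metric_field \<Rightarrow> 'n \<Rightarrow> 'n \<Rightarrow> 'n \<Rightarrow> real ^ 'n \<Rightarrow> real" where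
  "christoffel g k i j x =
     (1/2) * (\<Sum>l\<in>UNIV. matrix_inv (g x) $ k $ l *
        (pderiv_at i (\<lambda>y. g y $ j $ l) x + pderiv_at j (\<lambda>y. g y $ i $ l) x
          - pderiv_at l (\<lambda>y. g y $ i $ j) x))"

text \<open>
  \<open>riemann g i j k l\<close> is the \<open>\<partial>\<^sub>l\<close>-component of
  \<open>R(\<partial>\<^sub>i, \<partial>\<^sub>j)\<partial>\<^sub>k = \<nabla>\<^sub>i\<nabla>\<^sub>j\<partial>\<^sub>k - \<nabla>\<^sub>j\<nabla>\<^sub>i\<partial>\<^sub>k\<close>.
  With this sign convention the Ricci tensor and the Gauss curvature below are positive on round
  spheres.
\<close>

definition riemann :: "('n::finite) metric_field \<Rightarrow> 'n \<Rightarrow> 'n \<Rightarrow> 'n \<Rightarrow> 'n \<Rightarrow> real ^ 'n \<Rightarrow> real" where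
  "riemann g i j k l x =
     pderiv_at i (christoffel g l j k) x - pderiv_at j (christoffel g l i k) x
     + (\<Sum>m\<in>UNIV. christoffel g l i m x * christoffel g m j k x
                 - christoffel g l j m x * christoffel g m i k x)"

definition ricci :: "('n::finite) metric_field \<Rightarrow> 'n metric_field" where
  "ricci g x = (\<chi> j k. \<Sum>i\<in>UNIV. riemann g i j k i x)"

text \<open>\<open>K = g(R(\<partial>\<^sub>1, \<partial>\<^sub>2)\<partial>\<^sub>2, \<partial>\<^sub>1) / det g\<close>\<close>

definition gauss_curvature :: "2 metric_field \<Rightarrow> real ^ 2 \<Rightarrow> real" where
  "gauss_curvature g x = (\<Sum>l\<in>UNIV. riemann g 1 2 2 l x * g x $ l $ 1) / det (g x)"


section \<open>Ricci flow\<close>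

text \<open>\<open>I\<close> is meant to be an open interval.\<close>

definition smooth_ricci_flow :: "real set \<Rightarrow> (real \<Rightarrow> ('n::finite) metric_field) \<Rightarrow> bool" where
  "smooth_ricci_flow I g \<longleftrightarrow>
     (\<forall>t\<in>I. riemannian_metric (g t)) \<and>
     smooth_map_on (\<lambda>(t, x). g t x) (I \<times> UNIV) \<and>
     (\<forall>t\<in>I. \<forall>x. ((\<lambda>s. g s x) has_vector_derivative (-2) *\<^sub>R ricci (g t) x) (at t))"

definition complete_ricci_flow :: "real set \<Rightarrow> (real \<Rightarrow> ('n::finite) metric_field) \<Rightarrow> bool" where
  "complete_ricci_flow I g \<longleftrightarrow> smooth_ricci_flow I g \<and> (\<forall>t\<in>I. complete_metric (g t))"


section \<open>Locally uniform convergence\<close>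

definition locally_uniform_limit ::
  "('a::topological_space) set \<Rightarrow> ('b \<Rightarrow> 'a \<Rightarrow> 'c::metric_space) \<Rightarrow> ('a \<Rightarrow> 'c) \<Rightarrow> 'b filter \<Rightarrow> bool" where
  "locally_uniform_limit S f l F \<longleftrightarrow>
     (\<forall>p\<in>S. \<exists>U. open U \<and> p \<in> U \<and> uniform_limit (S \<inter> U) f l F)"

end

theory Submission
imports Defs "HOL-Complex_Analysis.Cauchy_Integral_Formula" "HOL-Probability.Probability"
begin

text \<open>
  A conformal metric \<open>g = u I\<close> on the plane evolves by Ricci flow iff \<open>u\<^sub>t = \<Delta> ln u\<close>. The flow starts from
  \<open>u\<^sub>0 = 1 + h\<^sub>0\<close>, where \<open>h\<^sub>0 \<ge> 0\<close> is a small bounded measurable function that is not almost everywhere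
  zero but vanishes on a dense family of lines. It is a decreasing limit of products of factors
  \<open>1 - cos\<^sup>2\<^sup>n(\<pi>(a x + b y))\<close> over all integer directions \<open>(a, b)\<close>; each factor vanishes on the lines
  \<open>a x + b y \<in> \<int>\<close>, and a large exponent \<open>n\<close> makes its Gaussian mean as close to \<open>1\<close> as desired.
  Since \<open>h\<^sub>0\<close> is not almost everywhere zero, \<open>u\<close> stays strictly above \<open>1\<close> somewhere, while by comparison
  with the flows of the continuous partial products \<open>u \<rightarrow> 1\<close> uniformly along each segment of the dense
  family, so that distances, which are at least Euclidean because \<open>u \<ge> 1\<close>, converge to Euclidean ones.

  The solution is the fixed point of \<open>h = e\<^sup>t\<^sup>\<Delta> h\<^sub>0 + \<integral> \<Delta> e\<^sup>(\<^sup>t\<^sup>-\<^sup>s\<^sup>)\<^sup>\<Delta> (ln (1 + h) - h) ds\<close>, found by iteration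
  in a space of bounded functions whose Hoelder seminorm of exponent \<open>1/2\<close> is at most of order \<open>t powr (-1/4)\<close>. Rescaling
  time and space by complex factors close to \<open>1\<close> leaves the iteration intact, so the solution extends
  holomorphically to complex times and positions within distances \<open>t/4\<close> and \<open>\<surd>t/4\<close>. Cauchy estimates
  give smoothness and \<open>\<bar>t \<Delta> ln u\<bar> \<le> 1\<close>, that is, the curvature bound.
\<close>

section \<open>Functions holomorphic in three parameters\<close>

text \<open>Continuous data vanishing on a dense set vanish identically, so the data have to be
  discontinuous, and every estimate is made for bounded measurable data. The kernel of
  \<open>\<Delta> e^(q\<Delta>)\<close> has size \<open>1/q\<close>, which is not integrable in
  \<open>q\<close>; a Hoelder bound of exponent \<open>1/2\<close> on the source gains
  \<open>q powr (1/4)\<close> by cancellation. Supremum norm and seminorm weighted by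
  \<open>t powr (1/4)\<close> are invariant under parabolic scaling. Small data therefore give a
  fixed point for all times at once, and Cauchy estimates cost the same at every time relative to
  \<open>t\<close>. As \<open>ln (1 + h) - h\<close> is quadratic in \<open>h\<close>, smallness of
  the data alone yields the contraction.

  Rough data enter through limits only. The solution depends continuously on the data under bounded
  pointwise convergence, so inequalities proved by the maximum principle for Hoelder data, where
  initial values are attained uniformly, pass to the limit. The nonlinear correction at time
  \<open>1\<close> is quadratic in the size of the data and the heat mean is linear, which keeps the
  solution away from the flat one.\<close>

lemma holomorphic_ball_bounds:
  assumes "f holomorphic_on ball c R" "\<And>z. z \<in> ball c R \<Longrightarrow> norm (f z) \<le> M" "z \<in> ball c r" "0 < s" "r + s \<le> R"
  shows "norm ((deriv ^^ n) f z) \<le> fact n * M / s ^ n"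
proof -
  have sub: "cball z t \<subseteq> ball c R" if "t < s" for t
  proof
    fix w assume "w \<in> cball z t"
    moreover have "dist c w \<le> dist c z + dist z w" by (rule dist_triangle)
    ultimately show "w \<in> ball c R" using assms that by auto
  qed
  have "norm ((deriv ^^ n) f z) \<le> fact n * M / t ^ n" if "0 < t" "t < s" for t
  proof (rule Cauchy_inequality)
    show "f holomorphic_on ball z t" using assms(1) sub[OF that(2)] ball_subset_cball holomorphic_on_subset by (metis subset_trans)
    show "continuous_on (cball z t) f" using assms(1) sub[OF that(2)] holomorphic_on_imp_continuous_on continuous_on_subset by blast
    fix x assume "norm (z - x) = t"
    then have "x \<in> cball z t" by (simp add: dist_norm)
    then show "norm (f x) \<le> M" using sub[OF that(2)] assms(2) by blast
  qed (use that in auto)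
  then have ev: "\<forall>\<^sub>F t in at_left s. norm ((deriv ^^ n) f z) \<le> fact n * M / t ^ n"
    using eventually_at_left_real[OF assms(4)] by (auto elim!: eventually_mono)
  have "((\<lambda>t. fact n * M / t ^ n) \<longlongrightarrow> fact n * M / s ^ n) (at_left s)"
    using assms(4) by (intro tendsto_intros) auto
  then show ?thesis using ev tendsto_lowerbound trivial_limit_at_left_real by blast
qed

lemma holomorphic_on_deriv_ball:
  assumes "f holomorphic_on ball c R" "z \<in> ball c R"
  shows "(f has_field_derivative deriv f z) (at z)"
  using assms by (meson holomorphic_derivI open_ball)

lemma holomorphic_ball_lipschitz:
  assumes "f holomorphic_on ball c R" "\<And>z. z \<in> ball c R \<Longrightarrow> norm (f z) \<le> M" "0 < s" "r + s \<le> R"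
    "z \<in> ball c r" "w \<in> ball c r"
  shows "norm (f w - f z) \<le> M / s * norm (w - z)"
proof (rule field_differentiable_bound[of "ball c r" f "deriv f"])
  fix y assume y: "y \<in> ball c r"
  then have "y \<in> ball c R" using assms by auto
  then show "(f has_field_derivative deriv f y) (at y within ball c r)"
    using holomorphic_on_deriv_ball[OF assms(1)] has_field_derivative_at_within by blast
  show "norm (deriv f y) \<le> M / s"
    using holomorphic_ball_bounds[OF assms(1,2) y assms(3,4), of 1] by simp
qed (use assms in auto)

lemma holomorphic_ball_taylor:
  assumes "f holomorphic_on ball c R" "\<And>z. z \<in> ball c R \<Longrightarrow> norm (f z) \<le> M" "0 < s" "r + s \<le> R"
    "z \<in> ball c r" "w \<in> ball c r"
  shows "norm (f w - (\<Sum>i\<le>n. (deriv ^^ i) f z * (w - z) ^ i / fact i))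
    \<le> real (Suc n) * M / s ^ Suc n * norm (w - z) ^ Suc n"
proof -
  have hol: "(deriv ^^ i) f holomorphic_on ball c R" for i
    by (intro holomorphic_higher_deriv assms) auto
  have "norm ((deriv ^^ 0) f w - (\<Sum>i\<le>n. (deriv ^^ i) f z * (w - z) ^ i / fact i))
    \<le> (fact (Suc n) * M / s ^ Suc n) * norm (w - z) ^ Suc n / fact n"
  proof (rule complex_Taylor[of "ball c r"])
    fix i x assume "x \<in> ball c r"
    then have x: "x \<in> ball c R" using assms by auto
    show "((deriv ^^ i) f has_field_derivative (deriv ^^ Suc i) f x) (at x within ball c r)"
      using holomorphic_on_deriv_ball[OF hol x] by (auto intro: has_field_derivative_at_within)
  next
    fix x assume "x \<in> ball c r"
    then show "norm ((deriv ^^ Suc n) f x) \<le> fact (Suc n) * M / s ^ Suc n"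
      using holomorphic_ball_bounds[OF assms(1,2) _ assms(3,4)] by blast
  qed (use assms in auto)
  also have "\<dots> = real (Suc n) * M / s ^ Suc n * norm (w - z) ^ Suc n"
    by simp
  finally show ?thesis by simp
qed

text \<open>Differentiation under the integral sign without a hypothesis on derivatives: the Cauchy
  estimate on a disc of radius \<open>R\<close> turns the bound \<open>g\<close> into the bound
  \<open>2 g / R\<close> for difference quotients, and dominated convergence applies.\<close>

lemma holomorphic_on_integral:
  fixes \<phi> :: "'w \<Rightarrow> complex \<Rightarrow> complex"
  assumes S: "open S"
    and hol: "\<And>w. w \<in> space M \<Longrightarrow> \<phi> w holomorphic_on S"
    and meas: "\<And>z. z \<in> S \<Longrightarrow> (\<lambda>w. \<phi> w z) \<in> borel_measurable M"
    and bd: "\<And>w z. w \<in> space M \<Longrightarrow> z \<in> S \<Longrightarrow> norm (\<phi> w z) \<le> g w"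
    and g: "integrable M g"
  shows "(\<lambda>z. \<integral>w. \<phi> w z \<partial>M) holomorphic_on S"
proof -
  have int: "integrable M (\<lambda>w. \<phi> w z)" if "z \<in> S" for z
    using meas[OF that] bd[OF _ that] g by (intro Bochner_Integration.integrable_bound[OF g]) (auto intro!: AE_I2 order_trans[OF _ abs_ge_self])
  have "\<exists>f'. ((\<lambda>z. \<integral>w. \<phi> w z \<partial>M) has_field_derivative f') (at z)" if z: "z \<in> S" for z
  proof -
    obtain R where R: "R > 0" "ball z R \<subseteq> S" using S z openE by blast
    have holz: "\<phi> w holomorphic_on ball z R" if "w \<in> space M" for w
      using hol[OF that] R holomorphic_on_subset by blast
    have lip: "norm (\<phi> w y - \<phi> w z) \<le> g w / (R/2) * norm (y - z)" if "w \<in> space M" "y \<in> ball z (R/2)" for w y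
      by (rule holomorphic_ball_lipschitz[OF holz[OF that(1)] bd[OF that(1) subsetD[OF R(2)]], where s="R/2" and r="R/2"]) (use R that in auto)
    have der: "((\<lambda>y. (\<phi> w y - \<phi> w z) / (y - z)) \<longlongrightarrow> deriv (\<phi> w) z) (at z)" if "w \<in> space M" for w
      using holomorphic_on_deriv_ball[OF holz, of w z] that R
      by (simp add: has_field_derivative_iff)
    have seq: "(\<lambda>n. ((\<integral>w. \<phi> w (X n) \<partial>M) - (\<integral>w. \<phi> w z \<partial>M)) / (X n - z)) \<longlonglongrightarrow> (\<integral>w. deriv (\<phi> w) z \<partial>M)"
      if X: "\<And>n. X n \<in> ball z (R/2)" "\<And>n. X n \<noteq> z" "X \<longlonglongrightarrow> z" for X
    proof -
      have XS: "X n \<in> S" for n using X(1)[of n] R by (auto intro: subsetD[OF R(2)])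
      have lim: "(\<lambda>n. (\<phi> w (X n) - \<phi> w z) / (X n - z)) \<longlonglongrightarrow> deriv (\<phi> w) z" if "w \<in> space M" for w
        using der[OF that] X(2,3) unfolding tendsto_at_iff_sequentially comp_def by auto
      have ms: "(\<lambda>w. (\<phi> w (X n) - \<phi> w z) / (X n - z)) \<in> borel_measurable M" for n
        using meas[OF XS[of n]] meas[OF z] by measurable
      have "(\<lambda>n. \<integral>w. (\<phi> w (X n) - \<phi> w z) / (X n - z) \<partial>M) \<longlonglongrightarrow> (\<integral>w. deriv (\<phi> w) z \<partial>M)"
      proof (rule integral_dominated_convergence[where w="\<lambda>w. g w / (R/2)"])
        show "(\<lambda>w. deriv (\<phi> w) z) \<in> borel_measurable M"
          by (rule borel_measurable_LIMSEQ_metric[OF ms lim])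
        show "AE w in M. norm ((\<phi> w (X n) - \<phi> w z) / (X n - z)) \<le> g w / (R/2)" for n
          using lip[OF _ X(1)[of n]] X(2)[of n] by (intro AE_I2) (simp add: norm_divide divide_le_eq)
      qed (use g ms lim in auto)
      moreover have "(\<integral>w. (\<phi> w (X n) - \<phi> w z) / (X n - z) \<partial>M) = ((\<integral>w. \<phi> w (X n) \<partial>M) - (\<integral>w. \<phi> w z \<partial>M)) / (X n - z)" for n
        using Bochner_Integration.integral_diff[OF int[OF XS[of n]] int[OF z]] by (simp only: integral_divide_zero)
      ultimately show ?thesis by (simp only:)
    qed
    have "((\<lambda>y. ((\<integral>w. \<phi> w y \<partial>M) - (\<integral>w. \<phi> w z \<partial>M)) / (y - z)) \<longlongrightarrow> (\<integral>w. deriv (\<phi> w) z \<partial>M)) (at z within ball z (R/2))"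
      unfolding tendsto_at_iff_sequentially comp_def using seq by auto
    then have "((\<lambda>y. ((\<integral>w. \<phi> w y \<partial>M) - (\<integral>w. \<phi> w z \<partial>M)) / (y - z)) \<longlongrightarrow> (\<integral>w. deriv (\<phi> w) z \<partial>M)) (at z)"
      using R by (subst (asm) at_within_open) auto
    then show ?thesis by (auto simp: has_field_derivative_iff)
  qed
  then show ?thesis using S by (simp add: holomorphic_on_open)
qed

text \<open>Separate holomorphy together with a bound is all that the parameter dependence of the flow
  provides directly; Cauchy estimates turn it into smoothness.\<close>

definition hol3 :: "real \<Rightarrow> real \<Rightarrow> (complex \<Rightarrow> complex \<Rightarrow> complex \<Rightarrow> complex) \<Rightarrow> bool" where
  "hol3 r M f \<longleftrightarrow>
    (\<forall>x\<in>ball 0 r. \<forall>y\<in>ball 0 r. \<forall>z\<in>ball 0 r. norm (f x y z) \<le> M) \<and>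
    (\<forall>y\<in>ball 0 r. \<forall>z\<in>ball 0 r. (\<lambda>x. f x y z) holomorphic_on ball 0 r) \<and>
    (\<forall>x\<in>ball 0 r. \<forall>z\<in>ball 0 r. (\<lambda>y. f x y z) holomorphic_on ball 0 r) \<and>
    (\<forall>x\<in>ball 0 r. \<forall>y\<in>ball 0 r. (\<lambda>z. f x y z) holomorphic_on ball 0 r)"

lemma hol3_subset: "hol3 r M f \<Longrightarrow> r' \<le> r \<Longrightarrow> M \<le> M' \<Longrightarrow> hol3 r' M' f"
proof -
  assume *: "hol3 r M f" "r' \<le> r" "M \<le> M'"
  have sub: "x \<in> ball 0 r' \<Longrightarrow> x \<in> ball 0 r" for x :: complex using *(2) by auto
  have "norm (f x y z) \<le> M'" if "x\<in>ball 0 r'" "y\<in>ball 0 r'" "z\<in>ball 0 r'" for x y z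
    using * that[THEN sub] unfolding hol3_def by (meson order_trans)
  moreover have "g holomorphic_on ball 0 r'" if "g holomorphic_on ball 0 r" for g
    using that sub holomorphic_on_subset by blast
  ultimately show ?thesis using *(1) sub unfolding hol3_def by blast
qed

lemma hol3_swap12: "hol3 r M f \<Longrightarrow> hol3 r M (\<lambda>x y z. f y x z)"
  unfolding hol3_def by auto

lemma hol3_swap23: "hol3 r M f \<Longrightarrow> hol3 r M (\<lambda>x y z. f x z y)"
  unfolding hol3_def by auto

lemma hol3_lin:
  assumes "hol3 r M f" "hol3 r M' g"
  shows "hol3 r (norm a * M + norm b * M') (\<lambda>x y z. a * f x y z + b * g x y z)"
  using assms unfolding hol3_def
  by (auto intro!: holomorphic_intros order_trans[OF norm_triangle_ineq] add_mono mult_left_mono simp: norm_mult)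

text \<open>The point is holomorphy in the other two variables. Difference quotients in
  \<open>x\<close> are holomorphic in \<open>y\<close> and \<open>z\<close>, and by Taylor's formula
  they converge to the derivative uniformly, so the limit inherits holomorphy.\<close>

lemma hol3_deriv1:
  assumes "hol3 r M f" "r > 0"
  shows "hol3 (r/2) (2*M/r) (\<lambda>x y z. deriv (\<lambda>x. f x y z) x)"
proof -
  have bd: "norm (f x y z) \<le> M" if "x\<in>ball 0 r" "y\<in>ball 0 r" "z\<in>ball 0 r" for x y z
    using assms that by (auto simp: hol3_def)
  have h: "(\<lambda>x. f x y z) holomorphic_on ball 0 r" if "y\<in>ball 0 r" "z\<in>ball 0 r" for y z
    using assms that by (auto simp: hol3_def)
  have sub: "x \<in> ball 0 r" if "x \<in> ball 0 (r/2)" for x :: complex using that assms(2) by auto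
  \<comment> \<open>Increments of at most \<open>r / 8\<close> keep points of the half ball within
    radius \<open>3 r / 4\<close>, which leaves the margin \<open>r / 4\<close> for the Taylor
    estimate.\<close>
  define X where "X n = r / (8 * Suc n)" for n
  have X: "0 < X n" "X n \<le> r/8" for n using assms(2) by (auto simp: X_def field_simps)
  have Xr: "x + of_real (X n) \<in> ball 0 (3*r/4)" if "x \<in> ball 0 (r/2)" for x :: complex and n
  proof -
    have "norm (x + of_real (X n)) \<le> norm x + X n"
      using norm_triangle_ineq[of x "of_real (X n)"] X(1)[of n] by simp
    then show ?thesis using X(2)[of n] that assms(2) by auto
  qed
  define K where "K = 2 * M / (r/4)^2"
  define Q where "Q n x y z = (f (x + of_real (X n)) y z - f x y z) / of_real (X n)" for n x y z
  have tay: "norm (Q n x y z - deriv (\<lambda>x. f x y z) x) \<le> K * X n"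
    if "x \<in> ball 0 (r/2)" "y\<in>ball 0 r" "z\<in>ball 0 r" for n x y z
  proof -
    have x: "x \<in> ball 0 (3*r/4)" using that(1) assms(2) by auto
    have xn: "x + of_real (X n) \<in> ball 0 (3*r/4)" by (rule Xr[OF that(1)])
    have s: "r / 4 > 0" "3*r/4 + r/4 \<le> r" using assms(2) by auto
    have "norm (f (x + of_real (X n)) y z - f x y z - deriv (\<lambda>x. f x y z) x * of_real (X n)) \<le> K * (X n)^2"
      using holomorphic_ball_taylor[where f="\<lambda>x. f x y z" and n=1, OF h[OF that(2,3)] bd[OF _ that(2,3)] s x xn] X(1)[of n]
      by (simp add: K_def power2_eq_square diff_diff_eq norm_mult)
    moreover have "Q n x y z - deriv (\<lambda>x. f x y z) x = (f (x + of_real (X n)) y z - f x y z - deriv (\<lambda>x. f x y z) x * of_real (X n)) / of_real (X n)"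
      using X(1)[of n] by (simp add: Q_def field_simps)
    ultimately show ?thesis using X(1)[of n] by (simp add: norm_divide divide_le_eq power2_eq_square)
  qed
  have X0: "X \<longlonglongrightarrow> 0"
  proof -
    have "(\<lambda>n. r / 8 * inverse (real (Suc n))) \<longlonglongrightarrow> r / 8 * 0"
      by (intro tendsto_intros LIMSEQ_inverse_real_of_nat)
    then show ?thesis by (simp add: X_def[abs_def] field_simps)
  qed
  have ev: "\<forall>\<^sub>F n in sequentially. K * X n < e" if "e > 0" for e
  proof -
    have "(\<lambda>n. K * X n) \<longlonglongrightarrow> K * 0" by (intro tendsto_intros X0)
    then show ?thesis using that by (simp add: order_tendstoD(2))
  qed
  have ul: "uniform_limit A (\<lambda>n p. Q n (u p) (v p) (w p)) (\<lambda>p. deriv (\<lambda>x. f x (v p) (w p)) (u p)) sequentially"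
    if "\<And>p. p \<in> A \<Longrightarrow> u p \<in> ball 0 (r/2)" "\<And>p. p \<in> A \<Longrightarrow> v p \<in> ball 0 r" "\<And>p. p \<in> A \<Longrightarrow> w p \<in> ball 0 r"
    for A :: "complex set" and u v w
    unfolding uniform_limit_iff
  proof (intro allI impI)
    fix e :: real assume "e > 0"
    show "\<forall>\<^sub>F n in sequentially. \<forall>p\<in>A. dist (Q n (u p) (v p) (w p)) (deriv (\<lambda>x. f x (v p) (w p)) (u p)) < e"
      using ev[OF \<open>e > 0\<close>]
    proof eventually_elim
      case (elim n)
      show ?case
      proof
        fix p assume p: "p \<in> A"
        show "dist (Q n (u p) (v p) (w p)) (deriv (\<lambda>x. f x (v p) (w p)) (u p)) < e"
          using tay[OF that(1)[OF p] that(2)[OF p] that(3)[OF p], of n] elim by (simp add: dist_norm)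
      qed
    qed
  qed
  have cb: "\<exists>d>0. cball x d \<subseteq> ball 0 (r/2) \<and> P d" if "x \<in> ball 0 (r/2)" "\<And>d. cball x d \<subseteq> ball 0 (r/2) \<Longrightarrow> P d" for x::complex and P
    using that open_contains_cball[THEN iffD1, OF open_ball, of "0::complex" "r/2"] by blast
  show ?thesis unfolding hol3_def
  proof (intro conjI ballI)
    fix x y z :: complex assume *: "x \<in> ball 0 (r/2)" "y \<in> ball 0 (r/2)" "z \<in> ball 0 (r/2)"
    show "norm (deriv (\<lambda>x. f x y z) x) \<le> 2*M/r"
      using holomorphic_ball_bounds[where n=1, OF h bd *(1), of y z "r/2"] sub * assms(2) by (auto simp: mult.commute)
  next
    fix y z :: complex assume *: "y \<in> ball 0 (r/2)" "z \<in> ball 0 (r/2)"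
    show "(\<lambda>x. deriv (\<lambda>x. f x y z) x) holomorphic_on ball 0 (r/2)"
      using holomorphic_deriv[OF h[OF sub[OF *(1)] sub[OF *(2)]]] assms(2)
      by (auto intro: holomorphic_on_subset)
  next
    fix x z :: complex assume *: "x \<in> ball 0 (r/2)" "z \<in> ball 0 (r/2)"
    show "(\<lambda>y. deriv (\<lambda>x. f x y z) x) holomorphic_on ball 0 (r/2)"
    proof (rule holomorphic_uniform_sequence[where f="\<lambda>n y. Q n x y z"])
      show "(\<lambda>y. Q n x y z) holomorphic_on ball 0 (r/2)" for n
        unfolding Q_def using assms(1) Xr[OF *(1), of n] sub[OF *(1)] sub[OF *(2)] X(1)[of n] assms(2)
        unfolding hol3_def by (intro holomorphic_intros) (auto intro!: holomorphic_on_subset[where s="ball 0 r" and t="ball 0 (r/2)"])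
      show "\<exists>d>0. cball y d \<subseteq> ball 0 (r/2) \<and> uniform_limit (cball y d) (\<lambda>n y. Q n x y z) (\<lambda>y. deriv (\<lambda>x. f x y z) x) sequentially"
        if "y \<in> ball 0 (r/2)" for y
      proof (rule cb[OF that])
        fix d assume "cball y d \<subseteq> ball 0 (r/2)"
        then show "uniform_limit (cball y d) (\<lambda>n y. Q n x y z) (\<lambda>y. deriv (\<lambda>x. f x y z) x) sequentially"
          using ul[of "cball y d" "\<lambda>_. x" "\<lambda>y. y" "\<lambda>_. z"] * sub by blast
      qed
    qed auto
  next
    fix x y :: complex assume *: "x \<in> ball 0 (r/2)" "y \<in> ball 0 (r/2)"
    show "(\<lambda>z. deriv (\<lambda>x. f x y z) x) holomorphic_on ball 0 (r/2)"
    proof (rule holomorphic_uniform_sequence[where f="\<lambda>n z. Q n x y z"])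
      show "(\<lambda>z. Q n x y z) holomorphic_on ball 0 (r/2)" for n
        unfolding Q_def using assms(1) Xr[OF *(1), of n] sub[OF *(1)] sub[OF *(2)] X(1)[of n] assms(2)
        unfolding hol3_def by (intro holomorphic_intros) (auto intro!: holomorphic_on_subset[where s="ball 0 r" and t="ball 0 (r/2)"])
      show "\<exists>d>0. cball z d \<subseteq> ball 0 (r/2) \<and> uniform_limit (cball z d) (\<lambda>n z. Q n x y z) (\<lambda>z. deriv (\<lambda>x. f x y z) x) sequentially"
        if "z \<in> ball 0 (r/2)" for z
      proof (rule cb[OF that])
        fix d assume "cball z d \<subseteq> ball 0 (r/2)"
        then show "uniform_limit (cball z d) (\<lambda>n z. Q n x y z) (\<lambda>z. deriv (\<lambda>x. f x y z) x) sequentially"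
          using ul[of "cball z d" "\<lambda>_. x" "\<lambda>_. y" "\<lambda>z. z"] * sub by blast
      qed
    qed auto
  qed
qed

lemma hol3_deriv2:
  assumes "hol3 r M f" "r > 0"
  shows "hol3 (r/2) (2*M/r) (\<lambda>x y z. deriv (\<lambda>y. f x y z) y)"
  using hol3_swap12[OF hol3_deriv1[OF hol3_swap12[OF assms(1)] assms(2)]] .

lemma hol3_deriv3:
  assumes "hol3 r M f" "r > 0"
  shows "hol3 (r/2) (2*M/r) (\<lambda>x y z. deriv (\<lambda>z. f x y z) z)"
  using hol3_swap23[OF hol3_deriv2[OF hol3_swap23[OF assms(1)] assms(2)]] .


lemma hol3_lipschitz:
  assumes "hol3 r M f" "r > 0"
    and "x \<in> ball 0 (r/2)" "y \<in> ball 0 (r/2)" "z \<in> ball 0 (r/2)"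
    and "x' \<in> ball 0 (r/2)" "y' \<in> ball 0 (r/2)" "z' \<in> ball 0 (r/2)"
  shows "norm (f x' y' z' - f x y z) \<le> 2 * M / r * (norm (x' - x) + norm (y' - y) + norm (z' - z))"
proof -
  have sub: "x \<in> ball 0 r" if "x \<in> ball 0 (r/2)" for x :: complex using that assms(2) by auto
  have s: "r/2 > 0" "r/2 + r/2 \<le> r" using assms(2) by auto
  have M: "M / (r/2) = 2 * M / r" by simp
  have "norm (f x' y' z' - f x y' z') \<le> 2 * M / r * norm (x' - x)"
    using holomorphic_ball_lipschitz[where f="\<lambda>x. f x y' z'" and c=0 and R=r and M=M, OF _ _ s assms(3,6)]
      assms(1) sub[OF assms(7)] sub[OF assms(8)] unfolding hol3_def M by blast
  moreover have "norm (f x y' z' - f x y z') \<le> 2 * M / r * norm (y' - y)"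
    using holomorphic_ball_lipschitz[where f="\<lambda>y. f x y z'" and c=0 and R=r and M=M, OF _ _ s assms(4,7)]
      assms(1) sub[OF assms(3)] sub[OF assms(8)] unfolding hol3_def M by blast
  moreover have "norm (f x y z' - f x y z) \<le> 2 * M / r * norm (z' - z)"
    using holomorphic_ball_lipschitz[where f="\<lambda>z. f x y z" and c=0 and R=r and M=M, OF _ _ s assms(5,8)]
      assms(1) sub[OF assms(3)] sub[OF assms(4)] unfolding hol3_def M by blast
  moreover have "norm (f x' y' z' - f x y z) \<le> norm (f x' y' z' - f x y' z') + norm (f x y' z' - f x y z') + norm (f x y z' - f x y z)"
    using norm_triangle_ineq[of "f x' y' z' - f x y' z'" "f x y' z' - f x y z"]
      norm_triangle_ineq[of "f x y' z' - f x y z'" "f x y z' - f x y z"] by simp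
  ultimately show ?thesis by (simp only: distrib_left)
qed

lemma hol3_taylor1:
  assumes "hol3 r M f" "r > 0"
    and "x \<in> ball 0 (r/2)" "y \<in> ball 0 (r/2)" "z \<in> ball 0 (r/2)" "x' \<in> ball 0 (r/2)"
  shows "norm (f x' y z - f x y z - (x' - x) * deriv (\<lambda>x. f x y z) x) \<le> 8 * M / r\<^sup>2 * norm (x' - x)^2"
proof -
  have sub: "x \<in> ball 0 r" if "x \<in> ball 0 (r/2)" for x :: complex using that assms(2) by auto
  have s: "r/2 > 0" "r/2 + r/2 \<le> r" using assms(2) by auto
  have "norm (f x' y z - (\<Sum>i\<le>1. (deriv ^^ i) (\<lambda>x. f x y z) x * (x' - x) ^ i / fact i))
    \<le> real (Suc 1) * M / (r/2) ^ Suc 1 * norm (x' - x) ^ Suc 1"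
    by (rule holomorphic_ball_taylor[where f="\<lambda>x. f x y z" and c=0 and R=r and M=M, OF _ _ s assms(3,6)])
      (use assms(1) sub[OF assms(4)] sub[OF assms(5)] in \<open>unfold hol3_def, blast+\<close>)
  then show ?thesis by (simp add: diff_diff_eq power2_eq_square algebra_simps)
qed

text \<open>Separate holomorphy becomes total differentiability by moving one variable at a time.
  The pure second-order errors are one-variable Taylor remainders. The mixed ones come from first
  derivatives evaluated at displaced points and are controlled by \<open>hol3_lipschitz\<close> for
  these derivatives, themselves \<open>hol3\<close> functions of radius
  \<open>r / 2\<close>.\<close>

lemma hol3_quadratic:
  assumes f: "hol3 r M f" "r > 0"
    and x: "x \<in> ball 0 (r/4)" "y \<in> ball 0 (r/4)" "z \<in> ball 0 (r/4)"
    and x': "x' \<in> ball 0 (r/4)" "y' \<in> ball 0 (r/4)" "z' \<in> ball 0 (r/4)"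
  shows "norm (f x' y' z' - f x y z - ((x' - x) * deriv (\<lambda>x. f x y z) x
      + (y' - y) * deriv (\<lambda>y. f x y z) y + (z' - z) * deriv (\<lambda>z. f x y z) z))
    \<le> 16 * M / r\<^sup>2 * (norm (x' - x) + norm (y' - y) + norm (z' - z))^2"
proof -
  have sub: "x \<in> ball 0 (r/2)" if "x \<in> ball 0 (r/4)" for x :: complex using that assms(2) by auto
  have M: "M \<ge> 0" using f unfolding hol3_def by (metis centre_in_ball norm_ge_zero order_trans)
  note x2 = x[THEN sub] and x'2 = x'[THEN sub]
  let ?u = "x' - x" and ?v = "y' - y" and ?w = "z' - z"
  let ?f1 = "\<lambda>x y z. deriv (\<lambda>x. f x y z) x" and ?f2 = "\<lambda>x y z. deriv (\<lambda>y. f x y z) y"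
    and ?f3 = "\<lambda>x y z. deriv (\<lambda>z. f x y z) z"
  define K where "K = 8 * M / r\<^sup>2"
  have K: "K \<ge> 0" using M by (simp add: K_def)
  have r4: "r / 2 > 0" "ball 0 (r/4) = ball (0::complex) (r/2/2)" using f by auto
  have M4: "2 * (2*M/r) / (r/2) = K" by (simp add: K_def power2_eq_square)
  have a1: "norm (f x' y' z' - f x y' z' - ?u * ?f1 x y' z') \<le> K * norm ?u^2"
    unfolding K_def by (rule hol3_taylor1[OF f x2(1) x'2(2,3,1)])
  have a2: "norm (f x y' z' - f x y z' - ?v * ?f2 x y z') \<le> K * norm ?v^2"
    using hol3_taylor1[OF hol3_swap12[OF f(1)] f(2) x2(2,1) x'2(3,2)] unfolding K_def .
  have a3: "norm (f x y z' - f x y z - ?w * ?f3 x y z) \<le> K * norm ?w^2"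
    using hol3_taylor1[OF hol3_swap12[OF hol3_swap23[OF f(1)]] f(2) x2(3,1,2) x'2(3)] unfolding K_def .
  have b1: "norm (?f1 x y' z' - ?f1 x y z) \<le> K * (norm ?v + norm ?w)"
    using hol3_lipschitz[OF hol3_deriv1[OF f] r4(1), folded r4(2), OF x(1-3) x(1) x'(2,3)] unfolding M4 by simp
  have b2: "norm (?f2 x y z' - ?f2 x y z) \<le> K * norm ?w"
    using hol3_lipschitz[OF hol3_deriv2[OF f] r4(1), folded r4(2), OF x(1-3) x(1,2) x'(3)] unfolding M4 by simp
  have c1: "norm (?u * (?f1 x y' z' - ?f1 x y z)) \<le> norm ?u * (K * (norm ?v + norm ?w))"
    unfolding norm_mult using b1 by (rule mult_left_mono) auto
  have c2: "norm (?v * (?f2 x y z' - ?f2 x y z)) \<le> norm ?v * (K * norm ?w)"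
    unfolding norm_mult using b2 by (rule mult_left_mono) auto
  have "f x' y' z' - f x y z - (?u * ?f1 x y z + ?v * ?f2 x y z + ?w * ?f3 x y z) =
    (f x' y' z' - f x y' z' - ?u * ?f1 x y' z') + (f x y' z' - f x y z' - ?v * ?f2 x y z')
    + (f x y z' - f x y z - ?w * ?f3 x y z) + ?u * (?f1 x y' z' - ?f1 x y z) + ?v * (?f2 x y z' - ?f2 x y z)"
    by (simp add: algebra_simps)
  also have "norm \<dots> \<le> K * norm ?u^2 + K * norm ?v^2 + K * norm ?w^2 + norm ?u * (K * (norm ?v + norm ?w)) + norm ?v * (K * norm ?w)"
    by (intro norm_triangle_le add_mono a1 a2 a3 c1 c2)
  also have "\<dots> \<le> 2 * K * (norm ?u + norm ?v + norm ?w)^2"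
  proof -
    have "0 \<le> K * (norm ?u^2 + norm ?v^2 + norm ?w^2 + 3 * norm ?u * norm ?v + 3 * norm ?u * norm ?w + 3 * norm ?v * norm ?w)"
      using K by (intro mult_nonneg_nonneg add_nonneg_nonneg) auto
    then show ?thesis by (simp add: algebra_simps power2_eq_square)
  qed
  finally show ?thesis by (simp add: K_def)
qed

section \<open>Smoothness of real traces of holomorphic functions\<close>

lemma has_derivative_quadratic:
  fixes f :: "'a::real_normed_vector \<Rightarrow> 'b::real_normed_vector"
  assumes "bounded_linear L" "d > 0"
    and "\<And>h. norm h < d \<Longrightarrow> norm (f (x + h) - f x - L h) \<le> C * norm h ^ 2"
  shows "(f has_derivative L) (at x)"
  unfolding has_derivative_at
proof (intro conjI assms(1), rule Lim_null_comparison)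
  show "\<forall>\<^sub>F h in at 0. norm (norm (f (x + h) - f x - L h) / norm h) \<le> C * norm h"
    unfolding eventually_at
    by (intro exI[of _ d]) (use assms in \<open>auto simp: divide_le_eq power2_eq_square mult.assoc\<close>)
  show "((\<lambda>h. C * norm h) \<longlongrightarrow> 0) (at (0::'a))"
    using tendsto_mult[OF tendsto_const[of C] tendsto_norm[OF tendsto_ident_at[of "0::'a" UNIV]]] by simp
qed

text \<open>The extension is local and centred at each point because its radius shrinks towards time
  zero. Taking real parts commutes with derivatives in real directions, so the class is closed under
  directional derivatives, and smoothness of every order reduces to differentiability.\<close>

definition param_analytic :: "(real \<times> (real^2) \<Rightarrow> real) \<Rightarrow> (real \<times> (real^2)) set \<Rightarrow> bool" where
  "param_analytic U S \<longleftrightarrow> (\<forall>q\<in>S. \<exists>r>0. \<exists>M f. hol3 r M f \<and>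
    (\<forall>\<tau> y. \<bar>\<tau>\<bar> < r \<longrightarrow> \<bar>y$1\<bar> < r \<longrightarrow> \<bar>y$2\<bar> < r \<longrightarrow>
      U (q + (\<tau>, y)) = Re (f (of_real \<tau>) (of_real (y$1)) (of_real (y$2)))))"

text \<open>The derivative is computed on a whole neighbourhood of \<open>q\<close>, so that it is
  again the trace of a holomorphic function there. The radius \<open>r / 8\<close> keeps base points
  and increments inside the range \<open>r / 4\<close> of \<open>hol3_quadratic\<close>.\<close>

lemma hol3_trace_has_derivative:
  assumes f: "hol3 r M f" "r > 0"
    and U: "\<And>\<tau> y. \<bar>\<tau>\<bar> < r \<Longrightarrow> \<bar>y$1\<bar> < r \<Longrightarrow> \<bar>y$2\<bar> < r \<Longrightarrow>
      U (q + (\<tau>, y)) = Re (f (of_real \<tau>) (of_real (y$1)) (of_real (y$2)))"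
    and y: "\<bar>\<tau>\<bar> < r/8" "\<bar>y$1\<bar> < r/8" "\<bar>(y::real^2)$2\<bar> < r/8"
  shows "(U has_derivative (\<lambda>v. Re (of_real (fst v) * deriv (\<lambda>x. f x (y$1) (y$2)) \<tau>
     + of_real (snd v $ 1) * deriv (\<lambda>b. f \<tau> b (y$2)) (y$1) + of_real (snd v $ 2) * deriv (\<lambda>c. f \<tau> (y$1) c) (y$2))))
     (at (q + (\<tau>, y)))"
proof (rule has_derivative_quadratic)
  show "bounded_linear (\<lambda>v::real \<times> (real^2). Re (of_real (fst v) * deriv (\<lambda>x. f x (y$1) (y$2)) \<tau>
     + of_real (snd v $ 1) * deriv (\<lambda>b. f \<tau> b (y$2)) (y$1) + of_real (snd v $ 2) * deriv (\<lambda>c. f \<tau> (y$1) c) (y$2)))"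
    by (rule linear_conv_bounded_linear[THEN iffD1], rule linearI) (auto simp: algebra_simps)
  show "r/8 > 0" using f by simp
  fix h :: "real \<times> (real^2)" assume h: "norm h < r/8"
  obtain t p where hp: "h = (t, p)" by (cases h)
  have n: "\<bar>t\<bar> \<le> norm h" "norm p \<le> norm h" unfolding hp
    using norm_fst_le[of t p] norm_snd_le[of p t] by auto
  have n': "\<bar>p$1\<bar> \<le> norm h" "\<bar>p$2\<bar> \<le> norm h"
    using component_le_norm_cart[of p 1] component_le_norm_cart[of p 2] n by auto
  have eq: "q + (\<tau>, y) + h = q + (\<tau> + t, y + p)" by (simp add: hp algebra_simps)
  have U1: "U (q + (\<tau>, y) + h) = Re (f (of_real (\<tau> + t)) (of_real (y$1 + p$1)) (of_real (y$2 + p$2)))"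
    unfolding eq by (subst U) (use y n n' h in auto)
  have U0: "U (q + (\<tau>, y)) = Re (f (of_real \<tau>) (of_real (y$1)) (of_real (y$2)))"
    by (rule U) (use y f in auto)
  have M: "M \<ge> 0" using f unfolding hol3_def by (metis centre_in_ball norm_ge_zero order_trans)
  have bb: "complex_of_real a \<in> ball 0 (r/4)" if "\<bar>a\<bar> < r/4" for a using that by simp
  have "\<bar>\<tau>\<bar> < r/4 \<and> \<bar>y$1\<bar> < r/4 \<and> \<bar>y$2\<bar> < r/4 \<and> \<bar>\<tau> + t\<bar> < r/4 \<and> \<bar>y$1 + p$1\<bar> < r/4 \<and> \<bar>y$2 + p$2\<bar> < r/4"
  proof -
    have "\<bar>a + b\<bar> < r/4" if "\<bar>a\<bar> < r/8" "\<bar>b\<bar> \<le> norm h" for a b using that h by linarith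
    then show ?thesis using y n n' f(2) by auto
  qed
  then have *: "norm (f (of_real (\<tau> + t)) (of_real (y$1 + p$1)) (of_real (y$2 + p$2)) - f (of_real \<tau>) (of_real (y$1)) (of_real (y$2))
      - ((of_real (\<tau>+t) - of_real \<tau>) * deriv (\<lambda>x. f x (y$1) (y$2)) \<tau>
     + (of_real (y$1 + p$1) - of_real (y$1)) * deriv (\<lambda>b. f \<tau> b (y$2)) (y$1) + (of_real (y$2+p$2) - of_real (y$2)) * deriv (\<lambda>c. f \<tau> (y$1) c) (y$2)))
     \<le> 16 * M / r\<^sup>2 * (norm (complex_of_real (\<tau>+t) - of_real \<tau>) + norm (complex_of_real (y$1 + p$1) - of_real (y$1)) + norm (complex_of_real (y$2 + p$2) - of_real (y$2)))^2"
    by (intro hol3_quadratic[OF f] bb) auto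
  have e: "complex_of_real (a+b) - of_real a = of_real b" for a b by simp
  have "(\<bar>t\<bar> + \<bar>p$1\<bar> + \<bar>p$2\<bar>)^2 \<le> (3 * norm h)^2"
    using n n' by (intro power_mono) auto
  then have "16 * M / r\<^sup>2 * (\<bar>t\<bar> + \<bar>p$1\<bar> + \<bar>p$2\<bar>)^2 \<le> 16 * M / r\<^sup>2 * (3 * norm h)^2"
    using M by (intro mult_left_mono) auto
  also have "\<dots> = 144 * M / r\<^sup>2 * norm h ^ 2" by (simp add: power_mult_distrib)
  finally have **: "16 * M / r\<^sup>2 * (\<bar>t\<bar> + \<bar>p$1\<bar> + \<bar>p$2\<bar>)^2 \<le> 144 * M / r\<^sup>2 * norm h ^ 2" .
  let ?E = "f (of_real (\<tau> + t)) (of_real (y$1 + p$1)) (of_real (y$2 + p$2)) - f (of_real \<tau>) (of_real (y$1)) (of_real (y$2))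
      - (of_real t * deriv (\<lambda>x. f x (y$1) (y$2)) \<tau>
     + of_real (p$1) * deriv (\<lambda>b. f \<tau> b (y$2)) (y$1) + of_real (p$2) * deriv (\<lambda>c. f \<tau> (y$1) c) (y$2))"
  have "norm ?E \<le> 16 * M / r\<^sup>2 * (\<bar>t\<bar> + \<bar>p$1\<bar> + \<bar>p$2\<bar>)^2"
    using * unfolding e norm_of_real .
  then have "\<bar>Re ?E\<bar> \<le> 144 * M / r\<^sup>2 * norm h ^ 2"
    using abs_Re_le_cmod[of ?E] ** by linarith
  then show "norm (U (q + (\<tau>, y) + h) - U (q + (\<tau>, y)) - Re (of_real (fst h) * deriv (\<lambda>x. f x (y$1) (y$2)) \<tau>
     + of_real (snd h $ 1) * deriv (\<lambda>b. f \<tau> b (y$2)) (y$1) + of_real (snd h $ 2) * deriv (\<lambda>c. f \<tau> (y$1) c) (y$2)))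
     \<le> 144 * M / r\<^sup>2 * norm h ^ 2"
    unfolding U0 U1 by (simp add: hp)
qed

lemma param_analytic_differentiable:
  assumes "param_analytic U S" "q \<in> S"
  shows "U differentiable (at q)"
proof -
  obtain r M f where f: "r > 0" "hol3 r M f" "\<And>\<tau> y. \<bar>\<tau>\<bar> < r \<Longrightarrow> \<bar>y$1\<bar> < r \<Longrightarrow> \<bar>y$2\<bar> < r \<Longrightarrow>
      U (q + (\<tau>, y)) = Re (f (of_real \<tau>) (of_real (y$1)) (of_real (y$2)))"
    using assms unfolding param_analytic_def by meson
  show ?thesis
    using hol3_trace_has_derivative[OF f(2,1,3), of 0 0] f(1) unfolding differentiable_def
    by (auto simp flip: zero_prod_def)
qed

lemma param_analytic_frechet_derivative:
  assumes "param_analytic U S"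
  shows "param_analytic (\<lambda>q. frechet_derivative U (at q) v) S"
  unfolding param_analytic_def
proof
  fix q assume "q \<in> S"
  then obtain r M f where f: "r > 0" "hol3 r M f" "\<And>\<tau> y. \<bar>\<tau>\<bar> < r \<Longrightarrow> \<bar>y$1\<bar> < r \<Longrightarrow> \<bar>y$2\<bar> < r \<Longrightarrow>
      U (q + (\<tau>, y)) = Re (f (of_real \<tau>) (of_real (y$1)) (of_real (y$2)))"
    using assms unfolding param_analytic_def by meson
  let ?g = "\<lambda>a b c. of_real (fst v) * deriv (\<lambda>x. f x b c) a
     + 1 * (of_real (snd v $ 1) * deriv (\<lambda>y. f a y c) b + of_real (snd v $ 2) * deriv (\<lambda>z. f a b z) c)"
  obtain M' where "hol3 (r/2) M' ?g"
    using hol3_lin[OF hol3_deriv1[OF f(2,1)] hol3_lin[OF hol3_deriv2[OF f(2,1)] hol3_deriv3[OF f(2,1)]]] by blast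
  then have "hol3 (r/8) M' ?g" by (rule hol3_subset) (use f(1) in auto)
  moreover have "frechet_derivative U (at (q + (\<tau>, y))) v = Re (?g (of_real \<tau>) (of_real (y$1)) (of_real (y$2)))"
    if "\<bar>\<tau>\<bar> < r/8" "\<bar>y$1\<bar> < r/8" "\<bar>y$2\<bar> < r/8" for \<tau> y
    using frechet_derivative_at[OF hol3_trace_has_derivative[OF f(2,1,3) that], symmetric] by simp
  ultimately show "\<exists>r>0. \<exists>M f. hol3 r M f \<and> (\<forall>\<tau> y. \<bar>\<tau>\<bar> < r \<longrightarrow> \<bar>y$1\<bar> < r \<longrightarrow> \<bar>y$2\<bar> < r \<longrightarrow>
      frechet_derivative U (at (q + (\<tau>, y))) v = Re (f (of_real \<tau>) (of_real (y$1)) (of_real (y$2))))"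
    using f(1) by (intro exI[of _ "r/8"] conjI exI[of _ M'] exI[of _ ?g]) auto
qed

text \<open>Both functions have the same set of derivatives at \<open>x\<close>, so the choice
  inside \<open>frechet_derivative\<close> returns the same map, also where there is no
  derivative.\<close>

lemma frechet_derivative_cong_open:
  assumes "open S" "x \<in> S" "\<And>y. y \<in> S \<Longrightarrow> f y = g y"
  shows "frechet_derivative f (at x) = frechet_derivative g (at x)"
proof -
  have "(f has_derivative D) (at x) \<longleftrightarrow> (g has_derivative D) (at x)" for D
    using has_derivative_transform_within_open[OF _ assms(1,2)] assms(3) by metis
  then show ?thesis by (simp add: frechet_derivative_def)
qed

lemma Ck_on_cong:
  assumes "open S" "\<And>x. x \<in> S \<Longrightarrow> f x = g x" "Ck_on k f S"
  shows "Ck_on k g S"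
  using assms(2,3)
proof (induction k arbitrary: f g)
  case 0
  then show ?case by (simp cong: continuous_on_cong)
next
  case (Suc k)
  have "g differentiable (at x)" if x: "x \<in> S" for x
  proof -
    obtain D where "(f has_derivative D) (at x)" using Suc(3) x unfolding Ck_on.simps differentiable_def by meson
    then have "(g has_derivative D) (at x)" using has_derivative_transform_within_open[OF _ assms(1) x] Suc by metis
    then show ?thesis by (auto simp: differentiable_def)
  qed
  moreover have "Ck_on k (\<lambda>x. frechet_derivative g (at x) v) S" for v
    using Suc.IH[of "\<lambda>x. frechet_derivative f (at x) v" "\<lambda>x. frechet_derivative g (at x) v"]
      frechet_derivative_cong_open[OF assms(1) _ Suc(2)] Suc(3) by simp
  ultimately show ?case by simp
qed

text \<open>The constant vector \<open>c\<close> stands for the matrix \<open>mat 1\<close>: the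
  metric is a scalar multiple of it, and its smoothness is that of the scalar.\<close>

lemma param_analytic_Ck_on:
  assumes "param_analytic U S" "open S"
  shows "Ck_on k (\<lambda>q. U q *\<^sub>R (c :: 'b :: real_normed_vector)) S"
  using assms(1)
proof (induction k arbitrary: U)
  case 0
  have "U differentiable_on S"
    using param_analytic_differentiable[OF 0] by (auto simp: differentiable_on_def intro: differentiable_at_withinI)
  then show ?case by (auto intro!: continuous_intros dest: differentiable_imp_continuous_on)
next
  case (Suc k)
  have d: "((\<lambda>q. U q *\<^sub>R c) has_derivative (\<lambda>v. frechet_derivative U (at q) v *\<^sub>R c)) (at q)" if "q \<in> S" for q
    using param_analytic_differentiable[OF Suc(2) that]
    by (intro has_derivative_scaleR_left) (simp add: frechet_derivative_works)
  have "Ck_on k (\<lambda>q. frechet_derivative (\<lambda>q. U q *\<^sub>R c) (at q) v) S" for v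
    by (rule Ck_on_cong[OF assms(2) _ Suc.IH[OF param_analytic_frechet_derivative[OF Suc(2), of v]]])
      (simp add: frechet_derivative_at[OF d, symmetric])
  then show ?case using d unfolding Ck_on.simps differentiable_def by meson
qed

lemma Ck_on_slice:
  fixes F :: "'a::real_normed_vector \<times> 'b::real_normed_vector \<Rightarrow> 'c::real_normed_vector"
  assumes "Ck_on k F (S \<times> UNIV)" "t \<in> S"
  shows "Ck_on k (\<lambda>x. F (t, x)) UNIV"
  using assms(1)
proof (induction k arbitrary: F)
  case 0
  then have "continuous_on ((\<lambda>x. (t, x)) ` UNIV) F" using assms(2) by (auto elim: continuous_on_subset)
  then show ?case
    using continuous_on_compose[of UNIV "\<lambda>x. (t, x)" F] by (simp add: o_def continuous_intros)
next
  case (Suc k)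
  have d: "((\<lambda>x. F (t, x)) has_derivative (\<lambda>v. frechet_derivative F (at (t, x)) (0, v))) (at x)" for x
  proof -
    have "(F has_derivative frechet_derivative F (at (t, x))) (at (t, x))"
      using Suc(2) assms(2) by (auto simp: frechet_derivative_works)
    moreover have "((\<lambda>x. (t, x)) has_derivative (\<lambda>v. (0, v))) (at x)" by (auto intro!: derivative_eq_intros)
    ultimately show ?thesis using diff_chain_at[of "\<lambda>x. (t, x)" "\<lambda>v. (0, v)" x F] by (simp add: o_def)
  qed
  have "Ck_on k (\<lambda>x. frechet_derivative F (at (t, x)) (0, v)) UNIV" for v
    using Suc.IH[of "\<lambda>q. frechet_derivative F (at q) (0, v)"] Suc(2) by simp
  then have "Ck_on k (\<lambda>x. frechet_derivative (\<lambda>x. F (t, x)) (at x) v) UNIV" for v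
    by (simp add: frechet_derivative_at[OF d, symmetric])
  then show ?case using d by (auto simp: differentiable_def)
qed

section \<open>Gaussian kernels\<close>

lemma lborel_integral_affine:
  fixes f :: "'a::euclidean_space \<Rightarrow> 'b::{banach, second_countable_topology}"
  assumes [measurable]: "f \<in> borel_measurable borel" and c: "c \<noteq> 0"
  shows "(\<integral>x. f x \<partial>lborel) = \<bar>c\<bar>^DIM('a) *\<^sub>R (\<integral>x. f (t + c *\<^sub>R x) \<partial>lborel)"
  by (subst lborel_affine[OF c, of t]) (simp add: integral_density integral_distr)

lemma has_bochner_integral_lborel_prod:
  fixes f g :: "real \<Rightarrow> 'a::{real_normed_field, banach, second_countable_topology}"
  assumes "has_bochner_integral lborel f x" "has_bochner_integral lborel g y"
  shows "has_bochner_integral lborel (\<lambda>z::real\<times>real. f (fst z) * g (snd z)) (x * y)"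
proof -
  have fi: "integrable lborel f" "integrable lborel g" using assms has_bochner_integral_iff by blast+
  note [measurable] = borel_measurable_integrable[OF fi(1)] borel_measurable_integrable[OF fi(2)]
  have i: "integrable (lborel \<Otimes>\<^sub>M lborel) (\<lambda>z::real\<times>real. f (fst z) * g (snd z))"
    using fi by (intro lborel_pair.Fubini_integrable) (auto simp: norm_mult intro!: integrable_mult_right integrable_norm)
  moreover have "(\<integral>z. f (fst z) * g (snd z) \<partial>(lborel \<Otimes>\<^sub>M lborel)) = x * y"
    using lborel_pair.integral_fst'[OF i, symmetric] has_bochner_integral_integral_eq[OF assms(1)]
      has_bochner_integral_integral_eq[OF assms(2)] by simp
  ultimately show ?thesis by (simp add: lborel_prod has_bochner_integral_iff)
qed

text \<open>The rate \<open>1/32\<close> is what remains of the \<open>1/4\<close> in the heat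
  kernel: complex time and complex shifts reduce it to \<open>1/16\<close>, and half of that pays
  for polynomial factors.\<close>

definition gauss_weight :: "real \<times> real \<Rightarrow> real" where
  "gauss_weight z = exp (- (norm z)\<^sup>2 / 32)"

text \<open>The cubic moment is dictated by the third-order Taylor remainder in
  \<open>kernel_taylor\<close>; the slower growth of Hoelder differences is dominated by the same
  weight.\<close>

definition gauss_mass :: real where
  "gauss_mass = (\<integral>z. (1 + norm z) ^ 3 * gauss_weight z \<partial>lborel)"

lemma gauss_weight_nonneg [simp]: "0 \<le> gauss_weight z" by (simp add: gauss_weight_def)

lemma gauss_weight_measurable [measurable]: "gauss_weight \<in> borel_measurable borel"
  unfolding gauss_weight_def by (intro borel_measurable_continuous_onI continuous_intros) auto

lemma norm_prod_sq: "(norm z)\<^sup>2 = (fst z)\<^sup>2 + (snd (z::real\<times>real))\<^sup>2"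
  by (cases z) (simp add: norm_Pair)

lemma integrable_gauss1:
  assumes "c > 0"
  shows "integrable lborel (\<lambda>x::real. exp (- x\<^sup>2 / c))"
proof -
  have "integrable lborel (\<lambda>x. sqrt (pi * c) * normal_density 0 (sqrt (c/2)) x)"
    using integrable_normal_density[of "sqrt (c/2)" 0] assms by simp
  also have "(\<lambda>x. sqrt (pi * c) * normal_density 0 (sqrt (c/2)) x) = (\<lambda>x. exp (- x\<^sup>2 / c))"
    using assms by (auto simp: normal_density_def fun_eq_iff)
  finally show ?thesis .
qed

lemma integrable_gauss2:
  assumes "c > 0"
  shows "integrable lborel (\<lambda>z::real\<times>real. exp (- (norm z)\<^sup>2 / c))"
proof -
  have h: "has_bochner_integral lborel (\<lambda>x::real. exp (- x\<^sup>2 / c)) (\<integral>x. exp (- x\<^sup>2 / c) \<partial>lborel)"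
    using integrable_gauss1[OF assms] by (simp add: has_bochner_integral_iff)
  have "integrable lborel (\<lambda>z::real\<times>real. exp (- (fst z)\<^sup>2 / c) * exp (- (snd z)\<^sup>2 / c))"
    using has_bochner_integral_lborel_prod[OF h h] by (simp add: has_bochner_integral_iff)
  also have "(\<lambda>z::real\<times>real. exp (- (fst z)\<^sup>2 / c) * exp (- (snd z)\<^sup>2 / c)) = (\<lambda>z. exp (- (norm z)\<^sup>2 / c))"
    by (auto simp: fun_eq_iff norm_prod_sq add_divide_distrib diff_divide_distrib simp flip: exp_add)
  finally show ?thesis .
qed

lemma gauss_weight_moment_integrable: "integrable lborel (\<lambda>z. (1 + norm z) ^ 3 * gauss_weight z)"
proof (rule Bochner_Integration.integrable_bound)
  show "integrable lborel (\<lambda>z::real\<times>real. (8 * (1 + 2 * 4096)) * exp (- (norm z)\<^sup>2 / 64))"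
    by (intro integrable_mult_right integrable_gauss2) auto
  show "AE z in lborel. norm ((1 + norm (z::real\<times>real)) ^ 3 * gauss_weight z) \<le> norm ((8 * (1 + 2 * 4096)) * exp (- (norm z)\<^sup>2 / 64))"
  proof (rule AE_I2)
    fix z :: "real \<times> real"
    define n where "n = norm z"
    have n: "n \<ge> 0" by (simp add: n_def)
    let ?t = "n\<^sup>2 / 64"
    have 1: "(1 + n)^3 \<le> 8 * (1 + n^4)"
    proof (cases "n \<le> 1")
      case True
      then have "(1 + n)^3 \<le> 2^3" using n by (intro power_mono) auto
      also have "(2::real)^3 \<le> 8 * (1 + n^4)" using n by simp
      finally show ?thesis .
    next
      case False
      then have "(1 + n)^3 \<le> (2*n)^3" using n by (intro power_mono) auto
      also have "\<dots> = 8 * n^3" by (simp add: power_mult_distrib)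
      also have "n^3 \<le> n^4" using False by (intro power_increasing) auto
      finally show ?thesis by simp
    qed
    \<comment> \<open>The quadratic Taylor term of \<open>exp ?t\<close> is
      \<open>n^4 / (2 * 4096)\<close>, which dominates the fourth power and explains the
      constant.\<close>
    have "1 + ?t + ?t\<^sup>2 / 2 \<le> exp ?t" using exp_lower_Taylor_quadratic[of ?t] n by simp
    moreover have "?t\<^sup>2 = n^4 / 4096" by (simp add: power2_eq_square power4_eq_xxxx)
    moreover have "?t \<ge> 0" by simp
    ultimately have "1 + n^4 / 4096 / 2 \<le> exp ?t" by linarith
    then have "n^4 \<le> 2 * 4096 * exp ?t" by simp
    moreover have "1 \<le> exp ?t" by simp
    ultimately have "1 + n^4 \<le> (1 + 2*4096) * exp ?t" unfolding distrib_right by linarith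
    then have "8 * (1 + n^4) \<le> (8 * (1 + 2*4096)) * exp ?t" by simp
    with 1 have "(1+n)^3 \<le> (8 * (1 + 2*4096)) * exp ?t" by (rule order_trans)
    then have "(1+n)^3 * exp (- n\<^sup>2 / 32) \<le> (8 * (1 + 2*4096)) * exp ?t * exp (- n\<^sup>2 / 32)"
      by (rule mult_right_mono) simp
    also have "\<dots> = (8 * (1 + 2*4096)) * exp (- n\<^sup>2 / 64)" by (simp add: mult.assoc flip: exp_add)
    finally show "norm ((1 + norm z) ^ 3 * gauss_weight z) \<le> norm ((8 * (1 + 2 * 4096)) * exp (- (norm z)\<^sup>2 / 64))"
      using n by (simp add: gauss_weight_def n_def abs_mult)
  qed
qed measurable

lemma gauss_mass_nonneg: "gauss_mass \<ge> 0"
  unfolding gauss_mass_def by (intro integral_nonneg_AE) auto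

section \<open>Heat kernels with complex time and complex shifts\<close>

definition heat_kernel :: "complex \<Rightarrow> complex \<Rightarrow> complex \<Rightarrow> complex" where
  "heat_kernel l v w = exp (- (v\<^sup>2 + w\<^sup>2) / (4 * l)) / (4 * of_real pi * l)"

text \<open>This is \<open>l\<close> times the derivative of \<open>heat_kernel\<close> in
  \<open>l\<close>, equivalently \<open>l\<close> times its Laplacian in \<open>(v, w)\<close>. The
  factor \<open>l\<close> makes both kernels scale in the same way.\<close>

definition heat_kernel_deriv :: "complex \<Rightarrow> complex \<Rightarrow> complex \<Rightarrow> complex" where
  "heat_kernel_deriv l v w = ((v\<^sup>2 + w\<^sup>2) / (4 * l) - 1) * heat_kernel l v w"

lemma param_bounds:
  assumes "norm (l - 1) \<le> 1/4"
  shows "l \<noteq> 0" "Re l \<ge> 3/4" "norm l \<le> 5/4" "norm l \<ge> 3/4" "Re (1/l) \<ge> 12/25" "norm (1/l) \<le> 4/3"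
proof -
  have r: "\<bar>Re (l - 1)\<bar> \<le> 1/4" using abs_Re_le_cmod[of "l-1"] assms by simp
  then have "\<bar>Re l - 1\<bar> \<le> 1/4" by simp
  then show 1: "Re l \<ge> 3/4" by linarith
  then show 0: "l \<noteq> 0" by auto
  have "norm l \<le> norm (l - 1) + norm (1::complex)" using norm_triangle_ineq[of "l-1" 1] by simp
  then show 2: "norm l \<le> 5/4" using assms by simp
  show 3: "norm l \<ge> 3/4" using 1 complex_Re_le_cmod[of l] by linarith
  \<comment> \<open>\<open>Re (1/l)\<close> is \<open>Re l\<close> divided by the square of
    \<open>norm l\<close>, and \<open>(3/4) / (5/4)^2 = 12/25\<close>.\<close>
  have "(norm l)\<^sup>2 \<le> (5/4)\<^sup>2" using 2 by (intro power_mono) auto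
  moreover have "(norm l)\<^sup>2 > 0" using 0 by simp
  ultimately have "12/25 * (norm l)\<^sup>2 \<le> Re l" using 1 by (simp add: power2_eq_square)
  then show "Re (1/l) \<ge> 12/25" using \<open>(norm l)\<^sup>2 > 0\<close> by (simp add: Re_divide' cmod_power2 field_simps)
  show "norm (1/l) \<le> 4/3" using 0 3 by (simp add: norm_divide field_simps)
qed

text \<open>Shifts up to \<open>3\<close> are needed because \<open>kernI\<close> applies a Cauchy
  estimate on a disc of radius \<open>2\<close> around shifts of norm at most
  \<open>1\<close>.\<close>

lemma gauss_exponent_bound:
  assumes "norm (l - 1) \<le> 1/4" "norm a \<le> 3"
  shows "Re (- (of_real x + a)\<^sup>2 / (4 * l)) \<le> 23 - x\<^sup>2 / 16"
proof -
  note p = param_bounds[OF assms(1)]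
  have "Re ((of_real x + a)\<^sup>2 / l) = x\<^sup>2 * Re (1/l) + Re ((2 * of_real x * a + a\<^sup>2) * (1/l))"
    by (simp add: power2_eq_square algebra_simps add_divide_distrib Re_divide')
  moreover have "\<bar>Re ((2 * of_real x * a + a\<^sup>2) * (1/l))\<bar> \<le> (6 * \<bar>x\<bar> + 9) * (4/3)"
  proof (rule order_trans[OF abs_Re_le_cmod], unfold norm_mult, rule mult_mono[OF _ p(6)])
    have "norm (2 * of_real x * a + a\<^sup>2) \<le> 2 * \<bar>x\<bar> * norm a + (norm a)\<^sup>2"
      using norm_triangle_ineq[of "2 * of_real x * a" "a\<^sup>2"] by (simp add: norm_mult norm_power)
    also have "\<dots> \<le> 2 * \<bar>x\<bar> * 3 + 3\<^sup>2" using assms(2) by (intro add_mono mult_left_mono power_mono) auto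
    finally show "norm (2 * of_real x * a + a\<^sup>2) \<le> 6 * \<bar>x\<bar> + 9" by simp
  qed auto
  moreover have "x\<^sup>2 * Re (1/l) \<ge> x\<^sup>2 * (12/25)" using p(5) by (intro mult_left_mono) auto
  \<comment> \<open>Young's inequality absorbs the cross term
    \<open>(6 * \<bar>x\<bar> + 9) * (4/3)\<close> at the price \<open>x^2 / 5 + 92\<close>.
    Division by \<open>4\<close> produces the \<open>23\<close> and leaves the rate
    \<open>(12/25 - 1/5) / 4 = 7/100\<close>, above \<open>1/16\<close>.\<close>
  moreover have "8 * \<bar>x\<bar> \<le> x\<^sup>2 / 5 + 80"
    using zero_le_power2[of "\<bar>x\<bar> - 20"] by (simp add: power2_eq_square algebra_simps)
  ultimately have "Re ((of_real x + a)\<^sup>2 / l) \<ge> x\<^sup>2 * (12/25) - x\<^sup>2/5 - 92" by argo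
  moreover have "Re (- (of_real x + a)\<^sup>2 / (4 * l)) = - Re ((of_real x + a)\<^sup>2 / l) / 4"
    by (metis (no_types, opaque_lifting) Re_divide_numeral divide_divide_eq_left mult.commute divide_minus_left uminus_complex.sel(1))
  ultimately show ?thesis using zero_le_power2[of x] by argo
qed

definition kC1 :: real where "kC1 = 32 * exp 46"

lemma kernel_bounds:
  assumes l: "norm (l - 1) \<le> 1/4" and a: "norm a \<le> 3" and b: "norm b \<le> 3"
  shows "norm (heat_kernel l (of_real (fst z) + a) (of_real (snd z) + b)) \<le> kC1 * gauss_weight z" "norm (heat_kernel_deriv l (of_real (fst z) + a) (of_real (snd z) + b)) \<le> kC1 * gauss_weight z"
proof -
  obtain x y where z: "z = (x, y)" by (cases z)
  note p = param_bounds[OF l]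
  let ?s = "x\<^sup>2 + y\<^sup>2" let ?v = "of_real x + a" let ?w = "of_real y + b"
  have "norm (exp (- (?v\<^sup>2 + ?w\<^sup>2) / (4 * l))) = exp (Re (- ?v\<^sup>2 / (4*l)) + Re (- ?w\<^sup>2 / (4*l)))"
    by (simp add: norm_exp_eq_Re diff_divide_distrib)
  also have "\<dots> \<le> exp (46 - ?s / 16)"
    using gauss_exponent_bound[OF l a, of x] gauss_exponent_bound[OF l b, of y] by (subst exp_le_cancel_iff) argo
  finally have e: "norm (exp (- (?v\<^sup>2 + ?w\<^sup>2) / (4 * l))) \<le> exp (46 - ?s / 16)" .
  have "1 \<le> 4 * pi * norm l"
  proof -
    have "3 * (3/4) \<le> pi * norm l" using p(4) pi_gt3 by (intro mult_mono) auto
    then show ?thesis by simp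
  qed
  then have g: "norm (heat_kernel l ?v ?w) \<le> exp (46 - ?s / 16)"
    using e unfolding heat_kernel_def norm_divide norm_mult
    by (subst divide_le_eq) (auto intro: order_trans[OF _ mult_left_mono[of 1]])
  have sq: "norm ((of_real t + c)\<^sup>2) \<le> 2 * t\<^sup>2 + 18" if "norm c \<le> 3" for t :: real and c :: complex
  proof -
    have "norm ((of_real t + c)\<^sup>2) \<le> (\<bar>t\<bar> + norm c)\<^sup>2"
      unfolding norm_power using norm_triangle_ineq[of "of_real t" c] by (intro power_mono) auto
    also have "\<dots> \<le> 2 * \<bar>t\<bar>\<^sup>2 + 2 * (norm c)\<^sup>2"
      using zero_le_power2[of "\<bar>t\<bar> - norm c"] by (simp add: power2_eq_square algebra_simps)
    also have "(norm c)\<^sup>2 \<le> 3\<^sup>2" using that by (intro power_mono) auto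
    finally show ?thesis by simp
  qed
  have "norm ((?v\<^sup>2 + ?w\<^sup>2) * (1/l)) \<le> ((2 * x\<^sup>2 + 18) + (2 * y\<^sup>2 + 18)) * (4/3)"
    unfolding norm_mult using sq[OF a, of x] sq[OF b, of y] p(6)
    by (intro mult_mono norm_triangle_le add_mono) auto
  moreover have "norm ((?v\<^sup>2 + ?w\<^sup>2) / (4 * l) - 1) \<le> norm ((?v\<^sup>2 + ?w\<^sup>2) * (1/l)) / 4 + 1"
    using norm_triangle_ineq4[of "(?v\<^sup>2 + ?w\<^sup>2) / (4 * l)" 1] by (simp add: norm_divide norm_mult)
  moreover have "1 + ?s/32 \<le> exp (?s / 32)" by (rule exp_ge_add_one_self)
  \<comment> \<open>The quadratic factor is bounded by \<open>exp (?s / 32)\<close>, which uses up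
    half of the decay \<open>exp (- ?s / 16)\<close>.\<close>
  ultimately have q: "norm ((?v\<^sup>2 + ?w\<^sup>2) / (4 * l) - 1) \<le> 32 * exp (?s/32)"
    using zero_le_power2[of x] zero_le_power2[of y] by argo
  have ex: "exp (46 - ?s/16) * exp (?s/32) = exp 46 * exp (- ?s/32)"
    unfolding exp_add[symmetric] by (rule arg_cong[where f=exp]) argo
  have gsz: "gauss_weight z = exp (- ?s / 32)" by (simp add: gauss_weight_def z norm_prod_sq)
  have "exp (46 - ?s/16) \<le> exp (46 - ?s/16) * exp (?s/32)" by simp
  also have "\<dots> \<le> 32 * (exp 46 * exp (- ?s/32))" unfolding ex by simp
  also have "\<dots> = kC1 * gauss_weight z" by (simp add: kC1_def gsz)
  finally have "exp (46 - ?s/16) \<le> kC1 * gauss_weight z" .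
  then show "norm (heat_kernel l (of_real (fst z) + a) (of_real (snd z) + b)) \<le> kC1 * gauss_weight z" using g z by simp
  have "norm (heat_kernel_deriv l ?v ?w) \<le> (32 * exp (?s/32)) * exp (46 - ?s/16)"
    unfolding heat_kernel_deriv_def norm_mult by (intro mult_mono q g) auto
  also have "\<dots> = kC1 * gauss_weight z" using ex unfolding kC1_def gsz by (simp add: mult_ac)
  finally show "norm (heat_kernel_deriv l (of_real (fst z) + a) (of_real (snd z) + b)) \<le> kC1 * gauss_weight z" using z by simp
qed

text \<open>The interface for all convolution estimates: one constant serves both kernels uniformly
  in their complex parameters.\<close>

definition kern :: "real \<Rightarrow> (real \<times> real \<Rightarrow> complex) \<Rightarrow> bool" where
  "kern C k \<longleftrightarrow> k \<in> borel_measurable borel \<and> (\<forall>z. norm (k z) \<le> C * gauss_weight z) \<and>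
     (\<forall>z d. norm d \<le> 1 \<longrightarrow> norm (k (z + d) - k z) \<le> C * norm d * gauss_weight z)"

definition kC :: real where "kC = 2 * kC1"

lemma kC_pos: "kC > 0" by (simp add: kC_def kC1_def)

text \<open>The Lipschitz bound needs no derivative of the kernel: along the complex line through
  \<open>z\<close> in direction \<open>d\<close> the kernel is entire and bounded on a disc of
  radius \<open>2\<close>, so a Cauchy estimate bounds its real increments.\<close>

lemma kernI:
  assumes K: "\<And>z a b. norm a \<le> 3 \<Longrightarrow> norm b \<le> 3 \<Longrightarrow> norm (K (of_real (fst z) + a) (of_real (snd z) + b)) \<le> kC1 * gauss_weight z"
    and hol: "\<And>p q u v. (\<lambda>s. K (p + s * u) (q + s * v)) holomorphic_on UNIV"
    and meas: "(\<lambda>z. K (of_real (fst z) + a) (of_real (snd z) + b)) \<in> borel_measurable borel"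
    and a: "norm a \<le> 1" and b: "norm b \<le> 1"
  shows "kern kC (\<lambda>z::real\<times>real. K (of_real (fst z) + a) (of_real (snd z) + b))"
  unfolding kern_def
proof (intro conjI allI impI)
  fix z d :: "real \<times> real"
  have pos: "0 \<le> kC1 * gauss_weight z" by (simp add: kC1_def)
  show "norm (K (of_real (fst z) + a) (of_real (snd z) + b)) \<le> kC * gauss_weight z"
    using K[of a b z] a b pos unfolding kC_def by simp
  assume d: "norm d \<le> 1"
  show "norm (K (of_real (fst (z+d)) + a) (of_real (snd (z+d)) + b) - K (of_real (fst z) + a) (of_real (snd z) + b)) \<le> kC * norm d * gauss_weight z"
  proof (cases "d = 0")
    case False
    define n where "n = norm d"
    have n: "n > 0" "n \<le> 1" using False d by (auto simp: n_def)
    define u v where "u = complex_of_real (fst d / n)" and "v = complex_of_real (snd d / n)"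
    have "\<bar>fst d\<bar> \<le> n" "\<bar>snd d\<bar> \<le> n" unfolding n_def
      using norm_fst_le[of "fst d" "snd d"] norm_snd_le[of "snd d" "fst d"] by auto
    then have uv: "norm u \<le> 1" "norm v \<le> 1" using n unfolding u_def v_def norm_of_real by auto
    let ?f = "\<lambda>s. K ((of_real (fst z) + a) + s * u) ((of_real (snd z) + b) + s * v)"
    have bd: "norm (?f s) \<le> kC1 * gauss_weight z" if "s \<in> ball 0 2" for s
    proof -
      have "norm s * norm u \<le> 2 * 1" "norm s * norm v \<le> 2 * 1"
        using that uv by (intro mult_mono; simp)+
      then have "norm (a + s * u) \<le> 1 + 2 * 1" "norm (b + s * v) \<le> 1 + 2 * 1"
        using a b by (intro norm_triangle_le add_mono; simp add: norm_mult)+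
      then show ?thesis using K[of "a + s * u" "b + s * v" z] by (simp add: add.assoc)
    qed
    have "norm (?f (of_real n) - ?f 0) \<le> kC1 * gauss_weight z / (1/2) * norm (complex_of_real n - 0)"
      by (rule holomorphic_ball_lipschitz[where c=0 and R=2 and r="3/2" and s="1/2", OF holomorphic_on_subset[OF hol] bd])
        (use n in auto)
    moreover have "of_real n * u = complex_of_real (fst d)" "of_real n * v = complex_of_real (snd d)"
      using n by (auto simp: u_def v_def)
    ultimately show ?thesis using n by (simp add: kC_def n_def algebra_simps)
  qed simp
qed (use meas in auto)

lemma heat_kernel_kern:
  assumes "norm (l - 1) \<le> 1/4" "norm a \<le> 1" "norm b \<le> 1"
  shows "kern kC (\<lambda>z. heat_kernel l (of_real (fst z) + a) (of_real (snd z) + b))"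
proof (rule kernI[OF kernel_bounds(1)[OF assms(1)]])
  show "(\<lambda>s. heat_kernel l (p + s * u) (q + s * v)) holomorphic_on UNIV" for p q u v
    unfolding heat_kernel_def using param_bounds(1)[OF assms(1)] by (intro holomorphic_intros) auto
  show "(\<lambda>z. heat_kernel l (complex_of_real (fst z) + a) (complex_of_real (snd z) + b)) \<in> borel_measurable borel"
    unfolding heat_kernel_def using param_bounds(1)[OF assms(1)]
    by (intro borel_measurable_continuous_onI continuous_intros) auto
qed (use assms in auto)

lemma heat_kernel_deriv_kern:
  assumes "norm (l - 1) \<le> 1/4" "norm a \<le> 1" "norm b \<le> 1"
  shows "kern kC (\<lambda>z. heat_kernel_deriv l (of_real (fst z) + a) (of_real (snd z) + b))"
proof (rule kernI[OF kernel_bounds(2)[OF assms(1)]])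
  show "(\<lambda>s. heat_kernel_deriv l (p + s * u) (q + s * v)) holomorphic_on UNIV" for p q u v
    unfolding heat_kernel_def heat_kernel_deriv_def using param_bounds(1)[OF assms(1)] by (intro holomorphic_intros) auto
  show "(\<lambda>z. heat_kernel_deriv l (complex_of_real (fst z) + a) (complex_of_real (snd z) + b)) \<in> borel_measurable borel"
    unfolding heat_kernel_def heat_kernel_deriv_def using param_bounds(1)[OF assms(1)]
    by (intro borel_measurable_continuous_onI continuous_intros) auto
qed (use assms in auto)

lemma kern_integrable:
  assumes k: "kern C k" and [measurable]: "\<phi> \<in> borel_measurable borel"
    and B: "\<And>z. norm (\<phi> z) \<le> B * (1 + norm z)^3"
  shows "integrable lborel (\<lambda>z. k z * \<phi> z)" "norm (\<integral>z. k z * \<phi> z \<partial>lborel) \<le> C * B * gauss_mass"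
proof -
  have [measurable]: "k \<in> borel_measurable borel" using k by (auto simp: kern_def)
  have b: "norm (k z * \<phi> z) \<le> C * B * ((1 + norm z)^3 * gauss_weight z)" for z
  proof -
    have "norm (k z * \<phi> z) \<le> (C * gauss_weight z) * (B * (1 + norm z)^3)"
      unfolding norm_mult
    proof (rule mult_mono)
      show *: "norm (k z) \<le> C * gauss_weight z" using k unfolding kern_def by blast
      show "0 \<le> C * gauss_weight z" using * norm_ge_zero order_trans by blast
    qed (use B in auto)
    then show ?thesis by (simp add: mult_ac)
  qed
  have i: "integrable lborel (\<lambda>z. C * B * ((1 + norm z)^3 * gauss_weight z))"
    by (intro integrable_mult_right gauss_weight_moment_integrable)
  show 1: "integrable lborel (\<lambda>z. k z * \<phi> z)"
    by (rule Bochner_Integration.integrable_bound[OF i]) (use b in \<open>auto intro!: AE_I2 intro: order_trans[OF _ abs_ge_self]\<close>)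
  have "norm (\<integral>z. k z * \<phi> z \<partial>lborel) \<le> (\<integral>z. C * B * ((1 + norm z)^3 * gauss_weight z) \<partial>lborel)"
    by (rule Bochner_Integration.integral_norm_bound_integral[OF 1 i b])
  then show "norm (\<integral>z. k z * \<phi> z \<partial>lborel) \<le> C * B * gauss_mass" by (simp add: gauss_mass_def)
qed

text \<open>With \<open>v = x + a\<close>, the integrand is the derivative of
  \<open>- (v / 2) * exp (- v^2 / (4 * l))\<close>, which vanishes at both ends of the line.\<close>

lemma gauss_moment_1d:
  fixes l a :: complex
  assumes "norm (l - 1) \<le> 1/4" "norm a \<le> 1"
  shows "has_bochner_integral lborel (\<lambda>x::real. ((of_real x + a)\<^sup>2 / (4 * l) - 1/2) * exp (- (of_real x + a)\<^sup>2 / (4 * l))) 0"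
    and "integrable lborel (\<lambda>x::real. exp (- (of_real x + a)\<^sup>2 / (4 * l)))"
proof -
  note p = param_bounds[OF assms(1)]
  have a3: "norm a \<le> 3" using assms by simp
  let ?v = "\<lambda>x::real. of_real x + a"
  let ?e = "\<lambda>x::real. exp (- (?v x)\<^sup>2 / (4 * l))"
  let ?f = "\<lambda>x::real. ((?v x)\<^sup>2 / (4 * l) - 1/2) * ?e x"
  let ?F = "\<lambda>x::real. - (?v x / 2) * ?e x"
  have e: "norm (?e x) \<le> exp 23 * exp (- x\<^sup>2 / 16)" for x
    using gauss_exponent_bound[OF assms(1) a3, of x] by (simp add: norm_exp_eq_Re flip: exp_add)
  have m1: "norm (?v x) \<le> 32 * exp (x\<^sup>2 / 32)" for x
  proof -
    have "norm (?v x) \<le> \<bar>x\<bar> + 1" using norm_triangle_ineq[of "of_real x" a] assms by simp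
    moreover have "2 * \<bar>x\<bar> \<le> x\<^sup>2 + 1" using zero_le_power2[of "\<bar>x\<bar> - 1"] by (simp add: power2_eq_square algebra_simps)
    moreover have "1 + x\<^sup>2/32 \<le> exp (x\<^sup>2/32)" by (rule exp_ge_add_one_self)
    ultimately show ?thesis using zero_le_power2[of x] by argo
  qed
  have m2: "norm ((?v x)\<^sup>2 / (4 * l) - 1/2) \<le> 32 * exp (x\<^sup>2 / 32)" for x
  proof -
    have "norm (?v x) \<le> \<bar>x\<bar> + 1" using norm_triangle_ineq[of "of_real x" a] assms by simp
    then have "norm (?v x)^2 \<le> (\<bar>x\<bar> + 1)^2" by (intro power_mono) auto
    also have "\<dots> \<le> 2 * x\<^sup>2 + 2" using zero_le_power2[of "\<bar>x\<bar> - 1"] by (simp add: power2_eq_square algebra_simps)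
    finally have "norm ((?v x)\<^sup>2 * (1/l)) \<le> (2 * x\<^sup>2 + 2) * (4/3)"
      unfolding norm_mult norm_power using p(6) by (intro mult_mono) auto
    moreover have "norm ((?v x)\<^sup>2 / (4 * l) - 1/2) \<le> norm ((?v x)\<^sup>2 * (1/l)) / 4 + 1/2"
      using norm_triangle_ineq4[of "(?v x)\<^sup>2 / (4 * l)" "1/2"] by (simp add: norm_divide norm_mult)
    moreover have "1 + x\<^sup>2/32 \<le> exp (x\<^sup>2/32)" by (rule exp_ge_add_one_self)
    ultimately show ?thesis using zero_le_power2[of x] by argo
  qed
  have ee: "32 * exp (x\<^sup>2/32) * (exp 23 * exp (- x\<^sup>2 / 16)) = 32 * exp 23 * exp (- x\<^sup>2 / 32)" for x :: real
  proof -
    have "exp (x\<^sup>2/32) * exp (- x\<^sup>2 / 16) = exp (- x\<^sup>2 / 32)"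
      unfolding exp_add[symmetric] by (rule arg_cong[where f=exp]) argo
    then show ?thesis by (simp add: mult_ac)
  qed
  have fb: "norm (?f x) \<le> 32 * exp 23 * exp (- x\<^sup>2 / 32)" for x
  proof -
    have "norm (?f x) \<le> 32 * exp (x\<^sup>2 / 32) * (exp 23 * exp (- x\<^sup>2 / 16))"
      unfolding norm_mult by (intro mult_mono m2 e) auto
    then show ?thesis by (simp only: ee)
  qed
  have Fb: "norm (?F x) \<le> 32 * exp 23 * exp (- x\<^sup>2 / 32)" for x
  proof -
    have "norm (?F x) \<le> 32 * exp (x\<^sup>2 / 32) * (exp 23 * exp (- x\<^sup>2 / 16))"
      unfolding norm_mult
    proof (intro mult_mono e)
      show "norm (- (?v x / 2)) \<le> 32 * exp (x\<^sup>2 / 32)"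
        using order_trans[OF m1[of x], of "64 * exp (x\<^sup>2 / 32)"] unfolding norm_minus_cancel norm_divide by simp
    qed auto
    then show ?thesis by (simp only: ee)
  qed
  have i32: "integrable lborel (\<lambda>x::real. 32 * exp 23 * exp (- x\<^sup>2 / 32))"
    by (intro integrable_mult_right integrable_gauss1) auto
  have cf: "continuous_on UNIV ?f" and ce: "continuous_on UNIV ?e" using p(1) by (auto intro!: continuous_intros)
  have fi: "integrable lborel ?f"
    by (rule Bochner_Integration.integrable_bound[OF i32])
      (use fb cf in \<open>auto intro!: AE_I2 intro: borel_measurable_continuous_onI order_trans[OF _ abs_ge_self]\<close>)
  show "integrable lborel ?e"
  proof (rule Bochner_Integration.integrable_bound)
    show "integrable lborel (\<lambda>x::real. exp 23 * exp (- x\<^sup>2 / 16))"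
      by (intro integrable_mult_right integrable_gauss1) auto
  qed (use e ce in \<open>auto intro!: AE_I2 intro: borel_measurable_continuous_onI\<close>)
  have dF: "(?F has_vector_derivative ?f x) (at x)" for x
  proof -
    have "((\<lambda>z. - ((z + a) / 2) * exp (- (z + a)\<^sup>2 / (4 * l))) has_field_derivative ?f x) (at (of_real x))"
    proof -
      define q where "q z = - (z + a)\<^sup>2 / (4 * l)" for z
      have q: "(q has_field_derivative - (of_real x + a) / (2 * l)) (at (of_real x))"
        unfolding q_def using p(1) by (auto intro!: derivative_eq_intros simp: field_simps)
      have "((\<lambda>z. - ((z + a) / 2) * exp (q z)) has_field_derivative
          - (1/2) * exp (q x) + - ((of_real x + a) / 2) * (exp (q x) * (- (of_real x + a) / (2 * l)))) (at (of_real x))"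
        using p(1) by (auto intro!: derivative_eq_intros q simp: field_simps)
      moreover have "- (1/2) * E + - (w / 2) * (E * (- w / (2 * l))) = (w\<^sup>2 / (4 * l) - 1/2) * E" for E w :: complex
        by (simp add: power2_eq_square algebra_simps)
      ultimately show ?thesis unfolding q_def by metis
    qed
    from has_vector_derivative_real_field[OF this] show ?thesis by simp
  qed
  have lim: "((\<lambda>x. 32 * exp 23 * exp (- x\<^sup>2 / 32 :: real)) \<longlongrightarrow> 0) at_top" "((\<lambda>x. 32 * exp 23 * exp (- x\<^sup>2 / 32 :: real)) \<longlongrightarrow> 0) at_bot"
    by real_asymp+
  have F0: "(?F \<longlongrightarrow> 0) at_top" "(?F \<longlongrightarrow> 0) at_bot"
    using Lim_null_comparison[OF _ lim(1), of ?F] Lim_null_comparison[OF _ lim(2), of ?F] Fb by (auto intro!: always_eventually)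
  have "(LBINT x=-\<infinity>..\<infinity>. ?f x) = 0 - 0"
  proof (rule interval_integral_FTC_integrable[where F="?F"])
    show "isCont ?f x" for x using cf by (auto simp: continuous_on_eq_continuous_at)
    show "set_integrable lborel (einterval (- \<infinity>) \<infinity>) ?f"
      using fi by (simp add: einterval_eq_UNIV set_integrable_def)
    show "((?F \<circ> real_of_ereal) \<longlongrightarrow> 0) (at_right (- \<infinity>))" "((?F \<circ> real_of_ereal) \<longlongrightarrow> 0) (at_left \<infinity>)"
      using F0 by (simp_all add: ereal_tendsto_simps1 comp_def at_left_PInf at_right_MInf filterlim_filtermap)
  qed (use dF in auto)
  then have "(\<integral>x. ?f x \<partial>lborel) = 0"
    by (simp add: interval_lebesgue_integral_def einterval_eq_UNIV set_lebesgue_integral_def)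
  then show "has_bochner_integral lborel ?f 0" using fi by (simp add: has_bochner_integral_iff)
qed

text \<open>Split the \<open>1\<close> of the prefactor evenly between the two coordinates; each
  half is a one-dimensional integral that vanishes by \<open>gauss_moment_1d\<close>. Mass zero is
  the cancellation on which the Duhamel estimates rest.\<close>

lemma heat_kernel_deriv_integral_zero:
  assumes "norm (l - 1) \<le> 1/4" "norm a \<le> 1" "norm b \<le> 1"
  shows "(\<integral>z. heat_kernel_deriv l (of_real (fst z) + a) (of_real (snd z) + b) \<partial>(lborel :: (real\<times>real) measure)) = 0"
proof -
  let ?e = "\<lambda>a (x::real). exp (- (of_real x + a)\<^sup>2 / (4 * l))"
  let ?f = "\<lambda>a (x::real). ((of_real x + a)\<^sup>2 / (4 * l) - 1/2) * ?e a x"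
  note ma = gauss_moment_1d[OF assms(1,2)] and mb = gauss_moment_1d[OF assms(1,3)]
  have ea: "has_bochner_integral lborel (?e a) (\<integral>x. ?e a x \<partial>lborel)" "has_bochner_integral lborel (?e b) (\<integral>x. ?e b x \<partial>lborel)"
    using ma(2) mb(2) by (simp_all add: has_bochner_integral_iff)
  have "has_bochner_integral lborel (\<lambda>z::real\<times>real. (1 / (4 * of_real pi * l)) * (?f a (fst z) * ?e b (snd z) + ?e a (fst z) * ?f b (snd z))) 0"
    using has_bochner_integral_mult_right[OF has_bochner_integral_add[OF has_bochner_integral_lborel_prod[OF ma(1) ea(2)] has_bochner_integral_lborel_prod[OF ea(1) mb(1)]], of "1 / (4 * of_real pi * l)"]
    by simp
  also have "(\<lambda>z::real\<times>real. (1 / (4 * of_real pi * l)) * (?f a (fst z) * ?e b (snd z) + ?e a (fst z) * ?f b (snd z))) = (\<lambda>z. heat_kernel_deriv l (of_real (fst z) + a) (of_real (snd z) + b))"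
  proof
    fix z :: "real \<times> real"
    have alg: "c * ((A - 1/2) * p * q + p * ((B - 1/2) * q)) = (A + B - 1) * (c * (p * q))" for A B c p q :: complex
      by (simp add: algebra_simps)
    have "exp (- ((of_real (fst z) + a)\<^sup>2 + (of_real (snd z) + b)\<^sup>2) / (4 * l)) = ?e a (fst z) * ?e b (snd z)"
      by (simp add: diff_divide_distrib flip: exp_add)
    then show "(1 / (4 * of_real pi * l)) * (?f a (fst z) * ?e b (snd z) + ?e a (fst z) * ?f b (snd z)) = heat_kernel_deriv l (of_real (fst z) + a) (of_real (snd z) + b)"
      unfolding heat_kernel_deriv_def heat_kernel_def by (simp only: alg add_divide_distrib) simp
  qed
  finally show ?thesis by (rule has_bochner_integral_integral_eq)
qed

section \<open>Convolutions and the Hoelder seminorm\<close>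

text \<open>The range of the rescaled Duhamel time: \<open>\<sigma>\<close> is the time elapsed
  since the source acted, as a fraction of \<open>t\<close>.\<close>

definition W :: "real measure" where
  "W = restrict_space lborel {0<..<1}"

lemma space_W [simp]: "space W = {0<..<1}"
  by (simp add: W_def space_restrict_space)

lemma W_measurable: "f \<in> borel_measurable borel \<Longrightarrow> f \<in> borel_measurable W"
  unfolding W_def by (intro measurable_restrict_space1) simp

text \<open>The integrals known in closed form extend over sets \<open>S\<close> other than the unit
  interval; nonnegativity allows cutting them down, at the price of an inequality.\<close>

lemma W_integral_le:
  assumes [measurable]: "f \<in> borel_measurable borel" "S \<in> sets borel"
    and f: "\<And>x::real. f x \<ge> (0::real)" "(f has_integral I) S"
  shows "integrable W (\<lambda>x. indicator S x * f x)" "(\<integral>x. indicator S x * f x \<partial>W) \<le> I"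
proof -
  have I: "I \<ge> 0" using has_integral_nonneg[OF f(2)] f(1) by auto
  have "has_bochner_integral lborel (\<lambda>x. indicator S x * f x) I"
  proof (rule has_bochner_integral_nn_integral)
    have "((\<lambda>x. if x \<in> S then f x else 0) has_integral I) UNIV" using f(2) by (simp only: has_integral_restrict_UNIV)
    also have "(\<lambda>x. if x \<in> S then f x else 0) = (\<lambda>x. indicator S x * f x)" by (auto simp: indicator_def)
    finally have h: "((\<lambda>x. indicator S x * f x) has_integral I) UNIV" .
    show "(\<integral>\<^sup>+ x. ennreal (indicator S x * f x) \<partial>lborel) = ennreal I"
    proof (rule nn_integral_has_integral_lborel[OF _ _ h])
      show "(\<lambda>x. indicator S x * f x) \<in> borel_measurable borel" by measurable
      show "0 \<le> indicator S x * f x" for x by (intro mult_nonneg_nonneg f(1)) simp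
    qed
    show "(\<lambda>x. indicator S x * f x) \<in> borel_measurable lborel" by measurable
    show "AE x in lborel. 0 \<le> indicator S x * f x" by (intro AE_I2 mult_nonneg_nonneg f(1)) simp
  qed (rule I)
  then have i: "integrable lborel (\<lambda>x. indicator S x * f x)" and e: "(\<integral>x. indicator S x * f x \<partial>lborel) = I"
    by (auto simp: has_bochner_integral_iff)
  have i': "integrable lborel (\<lambda>x. indicator {0<..<1} x *\<^sub>R (indicator S x * f x))"
    using i by (rule integrable_mult_indicator[rotated]) simp
  then show "integrable W (\<lambda>x. indicator S x * f x)"
    unfolding W_def by (subst integrable_restrict_space) auto
  have "(\<integral>x. indicator S x * f x \<partial>W) = (\<integral>x. indicator {0<..<1} x *\<^sub>R (indicator S x * f x) \<partial>lborel)"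
    unfolding W_def by (subst integral_restrict_space) auto
  also have "\<dots> \<le> (\<integral>x. indicator S x * f x \<partial>lborel)"
    using f(1) by (intro integral_mono i i') (auto simp: indicator_def)
  finally show "(\<integral>x. indicator S x * f x \<partial>W) \<le> I" using e by simp
qed

text \<open>The Duhamel singularity: \<open>1 / \<sigma>\<close> improved by the gain
  \<open>\<sigma> powr (1/4)\<close> from the Hoelder bound, times the blow-up of that bound at the
  source time \<open>t * (1 - \<sigma>)\<close>.\<close>

definition wt :: "real \<Rightarrow> real" where
  "wt \<sigma> = \<sigma> powr (-3/4) * (1 - \<sigma>) powr (-1/4)"

definition w0 :: real where "w0 = (\<integral>\<sigma>. wt \<sigma> \<partial>W)"
definition w1 :: real where "w1 = 16 + 4 * Beta 1 (3/4)"

lemma wt_measurable [measurable]: "wt \<in> borel_measurable borel"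
  unfolding wt_def by measurable

lemma wt_nonneg [simp]: "wt \<sigma> \<ge> 0" by (simp add: wt_def)

lemma W_beta:
  assumes "a > 0" "b > 0"
  shows "integrable W (\<lambda>t. t powr (a - 1) * (1 - t) powr (b - 1))"
    "(\<integral>t. t powr (a - 1) * (1 - t) powr (b - 1) \<partial>W) \<le> Beta a b"
proof -
  let ?f = "\<lambda>t. t powr (a - 1) * (1 - t) powr (b - 1)"
  have m: "?f \<in> borel_measurable borel" by measurable
  have c: "(\<integral>x. indicator {0..1} x * ?f x \<partial>W) = (\<integral>x. ?f x \<partial>W)"
    by (rule Bochner_Integration.integral_cong) auto
  have "integrable W (\<lambda>x. indicator {0..1} x * ?f x)"
    using W_integral_le(1)[OF m _ _ has_integral_Beta_real[OF assms]] by simp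
  also have "integrable W (\<lambda>x. indicator {0..1} x * ?f x) = integrable W ?f"
    by (rule Bochner_Integration.integrable_cong) auto
  finally show "integrable W ?f" .
  show "(\<integral>t. ?f t \<partial>W) \<le> Beta a b"
    using W_integral_le(2)[OF m _ _ has_integral_Beta_real[OF assms]] c by simp
qed

lemma wt_integrable: "integrable W wt"
  using W_beta(1)[of "1/4" "3/4"] by (simp add: wt_def[abs_def])

lemma w0_nonneg: "w0 \<ge> 0" unfolding w0_def by (intro integral_nonneg_AE) auto

lemma w1_nonneg: "w1 \<ge> 0"
proof -
  have "0 \<le> (\<integral>t. t powr (1 - 1) * (1 - t) powr (3/4 - 1) \<partial>W)" by (intro integral_nonneg_AE) auto
  also have "\<dots> \<le> Beta 1 (3/4)" by (rule W_beta) auto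
  finally show ?thesis by (simp add: w1_def)
qed

lemma powr_three_quarters_le: "x \<ge> 1/2 \<Longrightarrow> 0 \<le> p \<Longrightarrow> p \<le> 1 \<Longrightarrow> (x::real) powr (-p) \<le> 2"
proof -
  assume x: "x \<ge> 1/2" and p: "0 \<le> p" "p \<le> 1"
  have "x powr (-p) \<le> (1/2) powr (-p)" using x p by (intro powr_mono2') auto
  also have "\<dots> = 2 powr p" by (simp add: powr_minus powr_divide)
  also have "\<dots> \<le> 2 powr 1" using p by (intro powr_mono) auto
  finally show ?thesis by simp
qed

lemma min_one_le_sqrt: "0 \<le> r \<Longrightarrow> min 1 r \<le> sqrt r"
proof (cases "r \<le> 1")
  case True
  assume r: "0 \<le> r"
  have "r = sqrt r * sqrt r" using r by simp
  also have "\<dots> \<le> sqrt r * 1" using r True by (intro mult_left_mono) auto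
  finally show ?thesis by simp
qed auto

text \<open>Near \<open>\<sigma> = 0\<close> the integral splits at
  \<open>\<sigma> = \<rho>^2\<close>, and both pieces are multiples of \<open>sqrt \<rho>\<close>;
  on the upper half of the interval \<open>min 1 r \<le> sqrt r\<close> suffices. Since
  \<open>\<rho>\<close> is going to be \<open>norm d / sqrt t\<close>, this is the Hoelder exponent
  \<open>1/2\<close> reappearing in the output.\<close>

lemma wt_min_integral:
  assumes r: "\<rho> > 0"
  shows "integrable W (\<lambda>\<sigma>. wt \<sigma> * min 1 (\<rho> / sqrt \<sigma>))" "(\<integral>\<sigma>. wt \<sigma> * min 1 (\<rho> / sqrt \<sigma>) \<partial>W) \<le> w1 * sqrt \<rho>"
proof -
  let ?g1 = "\<lambda>\<sigma>. indicator {0..\<rho>\<^sup>2} \<sigma> * \<sigma> powr (-3/4)"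
  let ?g2 = "\<lambda>\<sigma>. indicator {\<rho>\<^sup>2..} \<sigma> * \<sigma> powr (-5/4)"
  let ?g3 = "\<lambda>\<sigma>. \<sigma> powr (1 - 1) * (1 - \<sigma>) powr (3/4 - 1)"
  have g1: "integrable W ?g1" "(\<integral>\<sigma>. ?g1 \<sigma> \<partial>W) \<le> 4 * sqrt \<rho>"
  proof -
    have "((\<lambda>x. x powr (-3/4)) has_integral (\<rho>\<^sup>2) powr (-3/4+1) / (-3/4+1)) {0..\<rho>\<^sup>2}"
      by (rule has_integral_powr_from_0) auto
    also have "(\<rho>\<^sup>2) powr (-3/4+1) / (-3/4+1) = 4 * sqrt \<rho>"
      using r by (simp add: powr_half_sqrt[symmetric] powr_powr flip: powr_numeral)
    finally have "((\<lambda>x. x powr (-3/4)) has_integral 4 * sqrt \<rho>) {0..\<rho>\<^sup>2}" .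
    then show "integrable W ?g1" "(\<integral>\<sigma>. ?g1 \<sigma> \<partial>W) \<le> 4 * sqrt \<rho>" by (intro W_integral_le; simp)+
  qed
  have g2: "integrable W ?g2" "(\<integral>\<sigma>. ?g2 \<sigma> \<partial>W) \<le> 4 / sqrt \<rho>"
  proof -
    have "((\<lambda>x. x powr (-5/4)) has_integral - ((\<rho>\<^sup>2) powr (-5/4+1)) / (-5/4+1)) {\<rho>\<^sup>2..}"
      by (rule has_integral_powr_to_inf) (use r in auto)
    also have "- ((\<rho>\<^sup>2) powr (-5/4+1)) / (-5/4+1) = 4 / sqrt \<rho>"
      using r by (simp add: powr_half_sqrt[symmetric] powr_powr powr_minus field_simps flip: powr_numeral)
    finally have "((\<lambda>x. x powr (-5/4)) has_integral 4 / sqrt \<rho>) {\<rho>\<^sup>2..}" .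
    then show "integrable W ?g2" "(\<integral>\<sigma>. ?g2 \<sigma> \<partial>W) \<le> 4 / sqrt \<rho>" by (intro W_integral_le; simp)+
  qed
  have g3: "integrable W ?g3" "(\<integral>\<sigma>. ?g3 \<sigma> \<partial>W) \<le> Beta 1 (3/4)" by (rule W_beta; simp)+
  let ?G = "\<lambda>\<sigma>. 2 * ?g1 \<sigma> + 2 * \<rho> * ?g2 \<sigma> + 4 * sqrt \<rho> * ?g3 \<sigma>"
  have G: "integrable W ?G" using g1 g2 g3 by (intro Bochner_Integration.integrable_add integrable_mult_right) auto
  have bd: "wt \<sigma> * min 1 (\<rho> / sqrt \<sigma>) \<le> ?G \<sigma>" if s: "\<sigma> \<in> {0<..<1}" for \<sigma>
  proof (cases "\<sigma> \<le> 1/2")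
    case True
    have a: "(1 - \<sigma>) powr (-1/4) \<le> 2" using powr_three_quarters_le[of "1-\<sigma>" "1/4"] True by simp
    have g30: "0 \<le> 4 * sqrt \<rho> * ?g3 \<sigma>" using r by simp
    have "wt \<sigma> * min 1 (\<rho> / sqrt \<sigma>) \<le> 2 * (\<sigma> powr (-3/4) * min 1 (\<rho> / sqrt \<sigma>))"
      using mult_right_mono[OF a, of "\<sigma> powr (-3/4) * min 1 (\<rho> / sqrt \<sigma>)"] s r by (simp add: wt_def mult_ac)
    also have "\<dots> \<le> 2 * ?g1 \<sigma> + 2 * \<rho> * ?g2 \<sigma>"
    proof (cases "\<sigma> \<le> \<rho>\<^sup>2")
      case True
      have "\<sigma> powr (-3/4) * min 1 (\<rho> / sqrt \<sigma>) \<le> \<sigma> powr (-3/4) * 1" by (intro mult_left_mono) auto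
      moreover have "0 \<le> 2 * \<rho> * ?g2 \<sigma>" using r by (intro mult_nonneg_nonneg) auto
      moreover have "?g1 \<sigma> = \<sigma> powr (-3/4)" using True s by simp
      ultimately show ?thesis by linarith
    next
      case False
      have "\<sigma> powr (-3/4) * min 1 (\<rho> / sqrt \<sigma>) \<le> \<sigma> powr (-3/4) * (\<rho> / sqrt \<sigma>)" by (intro mult_left_mono) auto
      also have "\<dots> = \<rho> * (\<sigma> powr (-3/4) * \<sigma> powr (-1/2))"
        using s by (simp add: powr_minus powr_half_sqrt field_simps)
      also have "\<dots> = \<rho> * \<sigma> powr (-5/4)" unfolding powr_add[symmetric] by simp
      finally show ?thesis using False s by (simp add: indicator_def)
    qed
    finally show ?thesis using g30 by linarith
  next
    case False
    have a: "\<sigma> powr (-3/4) \<le> 2" using powr_three_quarters_le[of \<sigma> "3/4"] False by simp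
    have "1/2 \<le> sqrt \<sigma>"
    proof (rule real_le_rsqrt)
      show "(1/2)\<^sup>2 \<le> \<sigma>" using False by (simp add: power2_eq_square)
    qed
    then have "\<rho> / sqrt \<sigma> \<le> 4 * \<rho>" using r s by (simp add: field_simps)
    then have "sqrt (\<rho> / sqrt \<sigma>) \<le> sqrt (4 * \<rho>)" by simp
    then have m: "min 1 (\<rho> / sqrt \<sigma>) \<le> 2 * sqrt \<rho>"
      using min_one_le_sqrt[of "\<rho> / sqrt \<sigma>"] r s by (simp add: real_sqrt_mult)
    have "wt \<sigma> * min 1 (\<rho> / sqrt \<sigma>) \<le> (2 * (1 - \<sigma>) powr (-1/4)) * (2 * sqrt \<rho>)"
      unfolding wt_def using a m r s by (intro mult_mono mult_right_mono) auto
    moreover have "0 \<le> 2 * ?g1 \<sigma> + 2 * \<rho> * ?g2 \<sigma>"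
      using r by (intro add_nonneg_nonneg mult_nonneg_nonneg) auto
    moreover have "(2 * (1 - \<sigma>) powr (-1/4)) * (2 * sqrt \<rho>) = 4 * sqrt \<rho> * ?g3 \<sigma>" using s by simp
    ultimately show ?thesis by linarith
  qed
  show i: "integrable W (\<lambda>\<sigma>. wt \<sigma> * min 1 (\<rho> / sqrt \<sigma>))"
  proof (rule Bochner_Integration.integrable_bound[OF wt_integrable])
    show "AE \<sigma> in W. norm (wt \<sigma> * min 1 (\<rho> / sqrt \<sigma>)) \<le> norm (wt \<sigma>)"
      using r by (intro AE_I2) (auto simp: abs_mult intro!: mult_left_le)
  qed (rule W_measurable, measurable)
  have "(\<integral>\<sigma>. wt \<sigma> * min 1 (\<rho> / sqrt \<sigma>) \<partial>W) \<le> (\<integral>\<sigma>. ?G \<sigma> \<partial>W)"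
    using bd by (intro integral_mono i G) auto
  also have "\<dots> = 2 * (\<integral>\<sigma>. ?g1 \<sigma> \<partial>W) + 2 * \<rho> * (\<integral>\<sigma>. ?g2 \<sigma> \<partial>W) + 4 * sqrt \<rho> * (\<integral>\<sigma>. ?g3 \<sigma> \<partial>W)"
    using g1(1) g2(1) g3(1) by (simp only: Bochner_Integration.integral_add integral_mult_right_zero integrable_mult_right Bochner_Integration.integrable_add)
  also have "\<dots> \<le> 2 * (4 * sqrt \<rho>) + 2 * \<rho> * (4 / sqrt \<rho>) + 4 * sqrt \<rho> * Beta 1 (3/4)"
    using g1(2) g2(2) g3(2) r by (intro add_mono mult_left_mono) auto
  also have "2 * \<rho> * (4 / sqrt \<rho>) = 8 * sqrt \<rho>" using r by (simp add: field_simps)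
  finally show "(\<integral>\<sigma>. wt \<sigma> * min 1 (\<rho> / sqrt \<sigma>) \<partial>W) \<le> w1 * sqrt \<rho>" by (simp add: w1_def algebra_simps)
qed

text \<open>The kernel stays fixed and the argument of \<open>\<phi>\<close> is scaled, so that one
  \<open>kern\<close> bound serves all times. With \<open>s = sqrt t\<close> this is the usual
  convolution with the kernel at time \<open>t\<close>; the normalising power of \<open>t\<close> is
  absorbed by the substitution.\<close>

definition kconv :: "(real \<times> real \<Rightarrow> complex) \<Rightarrow> real \<Rightarrow> (real \<times> real \<Rightarrow> complex) \<Rightarrow> real \<times> real \<Rightarrow> complex" where
  "kconv k s \<phi> x = (\<integral>z. k z * \<phi> (x - s *\<^sub>R z) \<partial>lborel)"

lemma cube_ge: "0 \<le> n \<Longrightarrow> 1 \<le> (1 + n :: real)^3" "0 \<le> n \<Longrightarrow> sqrt n \<le> (1 + n :: real)^3"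
proof -
  assume n: "0 \<le> n"
  show "1 \<le> (1 + n)^3" using n by (intro one_le_power) auto
  have "sqrt n \<le> 1 + n"
    using n by (intro real_le_lsqrt) (auto simp: power2_eq_square algebra_simps)
  also have "\<dots> \<le> (1 + n)^3" using n by (intro self_le_power) auto
  finally show "sqrt n \<le> (1 + n)^3" .
qed

lemma kern_nonneg: "kern C k \<Longrightarrow> 0 \<le> C"
proof -
  assume "kern C k"
  then have "norm (k 0) \<le> C * gauss_weight 0" unfolding kern_def by blast
  then have "0 \<le> C * gauss_weight 0" using norm_ge_zero order_trans by blast
  then show ?thesis by (simp add: gauss_weight_def)
qed

lemma kconv_bound:
  assumes k: "kern C k" and [measurable]: "\<phi> \<in> borel_measurable borel" and B: "\<And>y. norm (\<phi> y) \<le> B"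
  shows "integrable lborel (\<lambda>z. k z * \<phi> (x - s *\<^sub>R z))" "norm (kconv k s \<phi> x) \<le> C * B * gauss_mass"
proof -
  have B0: "0 \<le> B" using B[of 0] norm_ge_zero order_trans by blast
  have m: "(\<lambda>z. \<phi> (x - s *\<^sub>R z)) \<in> borel_measurable borel" by measurable
  have b: "norm (\<phi> (x - s *\<^sub>R z)) \<le> B * (1 + norm z)^3" for z
    using B[of "x - s *\<^sub>R z"] mult_left_mono[OF cube_ge(1)[of "norm z"] B0] by simp
  show "integrable lborel (\<lambda>z. k z * \<phi> (x - s *\<^sub>R z))" "norm (kconv k s \<phi> x) \<le> C * B * gauss_mass"
    unfolding kconv_def using kern_integrable[OF k m b] by auto
qed

definition hoelder :: "real \<Rightarrow> (real \<times> real \<Rightarrow> complex) \<Rightarrow> bool" where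
  "hoelder A \<phi> \<longleftrightarrow> (\<forall>x y. norm (\<phi> x - \<phi> y) \<le> A * sqrt (norm (x - y)))"

lemma hoelder_nonneg: "hoelder A \<phi> \<Longrightarrow> 0 \<le> A"
proof -
  assume "hoelder A \<phi>"
  then have "norm (\<phi> (1,0) - \<phi> (0,0)) \<le> A * sqrt (norm ((1,0) - (0,0) :: real \<times> real))"
    unfolding hoelder_def by blast
  then have "norm (\<phi> (1,0) - \<phi> (0,0)) \<le> A" by (simp add: norm_Pair)
  then show ?thesis using norm_ge_zero order_trans by blast
qed

text \<open>Mass zero allows replacing \<open>\<phi>\<close> by its difference from
  \<open>\<phi> x\<close>, which is of order \<open>sqrt s\<close> on the scale of the kernel. This
  gain makes the singularity \<open>1 / \<sigma>\<close> of the Duhamel integral integrable.\<close>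

lemma kconv_zero_bound:
  assumes k: "kern C k" "(\<integral>z. k z \<partial>lborel) = 0" and [measurable]: "\<phi> \<in> borel_measurable borel"
    and B: "\<And>y. norm (\<phi> y) \<le> B" and A: "hoelder A \<phi>" and s: "s \<ge> 0"
  shows "norm (kconv k s \<phi> x) \<le> C * A * gauss_mass * sqrt s"
proof -
  have m: "(\<lambda>z. \<phi> (x - s *\<^sub>R z) - \<phi> x) \<in> borel_measurable borel" by measurable
  have b: "norm (\<phi> (x - s *\<^sub>R z) - \<phi> x) \<le> (A * sqrt s) * (1 + norm z)^3" for z
  proof -
    have "norm (\<phi> (x - s *\<^sub>R z) - \<phi> x) \<le> A * sqrt (norm ((x - s *\<^sub>R z) - x))" using A unfolding hoelder_def by blast
    also have "\<dots> = A * sqrt s * sqrt (norm z)" using s by (simp add: real_sqrt_mult)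
    also have "\<dots> \<le> A * sqrt s * (1 + norm z)^3"
      using cube_ge(2)[of "norm z"] hoelder_nonneg[OF A] s by (intro mult_left_mono) auto
    finally show ?thesis .
  qed
  have ki: "integrable lborel k" using kern_integrable(1)[OF k(1), of "\<lambda>_. 1" 1] cube_ge(1) by simp
  have "(\<integral>z. k z * (\<phi> (x - s *\<^sub>R z) - \<phi> x) \<partial>lborel) = kconv k s \<phi> x - (\<integral>z. k z * \<phi> x \<partial>lborel)"
    unfolding kconv_def right_diff_distrib
    by (intro Bochner_Integration.integral_diff kconv_bound(1)[OF k(1) _ B] integrable_mult_left ki) measurable
  also have "(\<integral>z. k z * \<phi> x \<partial>lborel) = 0" using k(2) by simp
  finally show ?thesis using kern_integrable(2)[OF k(1) m b] by (simp add: mult_ac)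
qed

lemma kconv_shift:
  assumes [measurable]: "k \<in> borel_measurable borel" "\<phi> \<in> borel_measurable borel" and s: "s > 0"
  shows "kconv k s \<phi> (x + d) = (\<integral>z. k (z + d /\<^sub>R s) * \<phi> (x - s *\<^sub>R z) \<partial>lborel)"
  unfolding kconv_def
  by (subst lborel_integral_affine[where c=1 and t="d /\<^sub>R s"]) (use s in \<open>auto simp: algebra_simps\<close>)

text \<open>For \<open>norm d > s\<close> apply the triangle inequality. Otherwise move the shift to
  the kernel: its increment has size \<open>norm d / s\<close> and again mass zero, so the gain
  \<open>sqrt s\<close> is retained.\<close>

lemma kconv_diff_zero:
  assumes k: "kern C k" "(\<integral>z. k z \<partial>lborel) = 0" and \<phi>[measurable]: "\<phi> \<in> borel_measurable borel"
    and B: "\<And>y. norm (\<phi> y) \<le> B" and A: "hoelder A \<phi>" and s: "s > 0"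
  shows "norm (kconv k s \<phi> (x + d) - kconv k s \<phi> x) \<le> 2 * C * A * gauss_mass * sqrt s * min 1 (norm d / s)"
proof (cases "norm d \<le> s")
  case False
  have "norm (kconv k s \<phi> (x + d) - kconv k s \<phi> x) \<le> C * A * gauss_mass * sqrt s + C * A * gauss_mass * sqrt s"
    using s by (intro norm_triangle_le_diff add_mono kconv_zero_bound[OF k \<phi> B A]) auto
  moreover have "min 1 (norm d / s) = 1" using False s by simp
  ultimately show ?thesis by (simp add: algebra_simps)
next
  case True
  define e where "e = d /\<^sub>R s"
  have e: "norm e = norm d / s" using s by (simp add: e_def field_simps)
  have e1: "norm e \<le> 1" using True s by (simp add: e)
  have [measurable]: "k \<in> borel_measurable borel" using k by (simp add: kern_def)
  have C: "0 \<le> C" by (rule kern_nonneg[OF k(1)])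
  have ki: "integrable lborel k" using kern_integrable(1)[OF k(1), of "\<lambda>_. 1" 1] cube_ge(1) by simp
  have ke: "integrable lborel (\<lambda>z. k (z + e))" "(\<integral>z. k (z + e) \<partial>lborel) = 0"
  proof -
    have "lborel = distr lborel borel ((+) e)" by (simp add: lborel_distr_plus)
    then have "integrable (distr lborel borel ((+) e)) k" "(\<integral>z. k z \<partial>(distr lborel borel ((+) e))) = 0" using ki k(2) by auto
    then show "integrable lborel (\<lambda>z. k (z + e))" "(\<integral>z. k (z + e) \<partial>lborel) = 0"
      by (simp_all add: integrable_distr_eq integral_distr add.commute)
  qed
  let ?q = "\<lambda>z. k (z + e) - k z"
  have qb: "norm (?q z) \<le> C * norm e * gauss_weight z" for z using k(1) e1 unfolding kern_def by blast
  have b: "norm (?q z * (\<phi> (x - s *\<^sub>R z) - \<phi> x)) \<le> C * norm e * (A * sqrt s) * ((1 + norm z)^3 * gauss_weight z)" for z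
  proof -
    have "norm (\<phi> (x - s *\<^sub>R z) - \<phi> x) \<le> A * sqrt (norm ((x - s *\<^sub>R z) - x))" using A unfolding hoelder_def by blast
    also have "\<dots> = A * sqrt s * sqrt (norm z)" using s by (simp add: real_sqrt_mult)
    also have "\<dots> \<le> A * sqrt s * (1 + norm z)^3"
      using cube_ge(2)[of "norm z"] hoelder_nonneg[OF A] s by (intro mult_left_mono) auto
    finally have "norm (?q z) * norm (\<phi> (x - s *\<^sub>R z) - \<phi> x) \<le> (C * norm e * gauss_weight z) * (A * sqrt s * (1 + norm z)^3)"
      using qb C by (intro mult_mono) auto
    then show ?thesis by (simp add: norm_mult mult_ac)
  qed
  have i1: "integrable lborel (\<lambda>z. k (z + e) * \<phi> (x - s *\<^sub>R z))" 
  proof -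
    have "integrable lborel (\<lambda>z. B * norm (k (z + e)))" using ke(1) by (intro integrable_mult_right integrable_norm)
    then show ?thesis
    proof (rule Bochner_Integration.integrable_bound)
      have "norm (k (z + e) * \<phi> (x - s *\<^sub>R z)) \<le> norm (B * norm (k (z + e)))" for z
        using mult_left_mono[OF B, of "norm (k (z + e))" "x - s *\<^sub>R z"] abs_ge_self[of "B * norm (k (z + e))"]
        by (simp add: norm_mult mult.commute)
      then show "AE z in lborel. norm (k (z + e) * \<phi> (x - s *\<^sub>R z)) \<le> norm (B * norm (k (z + e)))" by simp
    qed measurable
  qed
  have i2: "integrable lborel (\<lambda>z. k z * \<phi> (x - s *\<^sub>R z))" by (rule kconv_bound(1)[OF k(1) \<phi> B])
  have "(\<integral>z. ?q z * (\<phi> (x - s *\<^sub>R z) - \<phi> x) \<partial>lborel) =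
      (\<integral>z. (k (z + e) * \<phi> (x - s *\<^sub>R z) - k z * \<phi> (x - s *\<^sub>R z)) - (k (z + e) * \<phi> x - k z * \<phi> x) \<partial>lborel)"
    by (simp add: algebra_simps)
  also have "\<dots> = (kconv k s \<phi> (x + d) - kconv k s \<phi> x) - ((\<integral>z. k (z + e) * \<phi> x \<partial>lborel) - (\<integral>z. k z * \<phi> x \<partial>lborel))"
    unfolding kconv_shift[OF \<open>k \<in> borel_measurable borel\<close> \<phi> s, of x d, folded e_def] unfolding kconv_def
    using i1 i2 ke(1) ki by (subst Bochner_Integration.integral_diff; (intro Bochner_Integration.integrable_diff integrable_mult_left)?; simp)+
  also have "\<dots> = kconv k s \<phi> (x + d) - kconv k s \<phi> x" using ke(2) k(2) by simp
  finally have eq: "kconv k s \<phi> (x + d) - kconv k s \<phi> x = (\<integral>z. ?q z * (\<phi> (x - s *\<^sub>R z) - \<phi> x) \<partial>lborel)" by simp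
  have i3: "integrable lborel (\<lambda>z. C * norm e * (A * sqrt s) * ((1 + norm z)^3 * gauss_weight z))"
    by (intro integrable_mult_right gauss_weight_moment_integrable)
  have "norm (\<integral>z. ?q z * (\<phi> (x - s *\<^sub>R z) - \<phi> x) \<partial>lborel) \<le> (\<integral>z. C * norm e * (A * sqrt s) * ((1 + norm z)^3 * gauss_weight z) \<partial>lborel)"
    by (rule Bochner_Integration.integral_norm_bound_integral[OF Bochner_Integration.integrable_bound[OF i3] i3])
      (use b in \<open>auto intro!: AE_I2 order_trans[OF b abs_ge_self]\<close>)
  also have "\<dots> = C * norm e * (A * sqrt s) * gauss_mass" by (simp add: gauss_mass_def)
  also have "\<dots> \<le> 2 * (C * norm e * (A * sqrt s) * gauss_mass)"
    using C hoelder_nonneg[OF A] s gauss_mass_nonneg by simp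
  also have "\<dots> = 2 * C * A * gauss_mass * sqrt s * min 1 (norm d / s)" using True s by (simp add: e min_def)
  finally show ?thesis unfolding eq .
qed

text \<open>The counterpart of \<open>kconv_diff_zero\<close> for merely bounded
  \<open>\<phi>\<close>: the smoothness comes from the kernel alone.\<close>

lemma kconv_diff_bound:
  assumes k: "kern C k" and \<phi>[measurable]: "\<phi> \<in> borel_measurable borel"
    and B: "\<And>y. norm (\<phi> y) \<le> B" and s: "s > 0"
  shows "norm (kconv k s \<phi> (x + d) - kconv k s \<phi> x) \<le> 2 * C * B * gauss_mass * min 1 (norm d / s)"
proof (cases "norm d \<le> s")
  case False
  have "norm (kconv k s \<phi> (x + d) - kconv k s \<phi> x) \<le> C * B * gauss_mass + C * B * gauss_mass"
    by (intro norm_triangle_le_diff add_mono kconv_bound(2)[OF k \<phi> B])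
  moreover have "min 1 (norm d / s) = 1" using False s by simp
  ultimately show ?thesis by (simp add: algebra_simps)
next
  case True
  define e where "e = d /\<^sub>R s"
  have e: "norm e = norm d / s" using s by (simp add: e_def field_simps)
  have e1: "norm e \<le> 1" using True s by (simp add: e)
  have [measurable]: "k \<in> borel_measurable borel" using k by (simp add: kern_def)
  have C: "0 \<le> C" by (rule kern_nonneg[OF k])
  have B0: "0 \<le> B" using B[of 0] norm_ge_zero order_trans by blast
  let ?q = "\<lambda>z. k (z + e) - k z"
  have i2: "integrable lborel (\<lambda>z. k z * \<phi> (x - s *\<^sub>R z))" by (rule kconv_bound(1)[OF k \<phi> B])
  have i3: "integrable lborel (\<lambda>z. C * norm e * B * ((1 + norm z)^3 * gauss_weight z))"
    by (intro integrable_mult_right gauss_weight_moment_integrable)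
  have b: "norm (?q z * \<phi> (x - s *\<^sub>R z)) \<le> C * norm e * B * ((1 + norm z)^3 * gauss_weight z)" for z
  proof -
    have "norm (?q z) \<le> C * norm e * gauss_weight z" using k e1 unfolding kern_def by blast
    then have "norm (?q z) * norm (\<phi> (x - s *\<^sub>R z)) \<le> (C * norm e * gauss_weight z) * (B * 1)"
      using B C by (intro mult_mono) auto
    also have "\<dots> \<le> (C * norm e * gauss_weight z) * (B * (1 + norm z)^3)"
      using C B0 cube_ge(1)[of "norm z"] by (intro mult_left_mono) auto
    finally show ?thesis by (simp add: norm_mult mult_ac)
  qed
  have i4: "integrable lborel (\<lambda>z. ?q z * \<phi> (x - s *\<^sub>R z))"
    by (rule Bochner_Integration.integrable_bound[OF i3]) (use b in \<open>auto intro!: AE_I2 order_trans[OF b abs_ge_self]\<close>)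
  have "kconv k s \<phi> (x + d) = (\<integral>z. ?q z * \<phi> (x - s *\<^sub>R z) + k z * \<phi> (x - s *\<^sub>R z) \<partial>lborel)"
    unfolding kconv_shift[OF \<open>k \<in> borel_measurable borel\<close> \<phi> s, of x d, folded e_def] by (simp add: algebra_simps)
  also have "\<dots> = (\<integral>z. ?q z * \<phi> (x - s *\<^sub>R z) \<partial>lborel) + kconv k s \<phi> x"
    unfolding kconv_def by (rule Bochner_Integration.integral_add[OF i4 i2])
  finally have eq: "kconv k s \<phi> (x + d) - kconv k s \<phi> x = (\<integral>z. ?q z * \<phi> (x - s *\<^sub>R z) \<partial>lborel)" by simp
  have "norm (\<integral>z. ?q z * \<phi> (x - s *\<^sub>R z) \<partial>lborel) \<le> (\<integral>z. C * norm e * B * ((1 + norm z)^3 * gauss_weight z) \<partial>lborel)"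
    by (rule Bochner_Integration.integral_norm_bound_integral[OF i4 i3 b])
  also have "\<dots> = C * norm e * B * gauss_mass" by (simp add: gauss_mass_def)
  also have "\<dots> \<le> 2 * (C * norm e * B * gauss_mass)" using C B0 gauss_mass_nonneg by simp
  also have "\<dots> = 2 * C * B * gauss_mass * min 1 (norm d / s)" using True s by (simp add: e min_def)
  finally show ?thesis unfolding eq .
qed

section \<open>Heat flow and Duhamel integral with complex parameters\<close>

definition th :: "real \<Rightarrow> real" where
  "th \<sigma> = (1 - sqrt (1 - \<sigma>)) / sqrt \<sigma>"

definition par :: "complex \<Rightarrow> complex \<Rightarrow> complex \<Rightarrow> bool" where
  "par l a b \<longleftrightarrow> norm (l - 1) \<le> 1/4 \<and> norm a \<le> 1 \<and> norm b \<le> 1"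

text \<open>For real parameters, \<open>heat\<close> and \<open>duhamel\<close> are the free heat flow and the Duhamel integral of
  \<open>\<Delta> f\<close>, evaluated at time \<open>l t\<close> and position \<open>x + \<surd>t (a, b)\<close>, after rescaling the integration
  variables; the factor \<open>th \<sigma>\<close> accounts for the drift \<open>\<surd>t - \<surd>(t(1 - \<sigma>)) = \<surd>(t \<sigma>) th \<sigma>\<close>.\<close>

definition heat :: "(real \<times> real \<Rightarrow> complex) \<Rightarrow> real \<Rightarrow> real \<times> real \<Rightarrow> complex \<Rightarrow> complex \<Rightarrow> complex \<Rightarrow> complex" where
  "heat \<phi> t x l a b = kconv (\<lambda>z. heat_kernel l (of_real (fst z) + a) (of_real (snd z) + b)) (sqrt t) \<phi> x"

definition duhamel_integrand :: "(real \<Rightarrow> real \<times> real \<Rightarrow> complex) \<Rightarrow> real \<Rightarrow> real \<times> real \<Rightarrow> complex \<Rightarrow> complex \<Rightarrow> complex \<Rightarrow> real \<Rightarrow> complex" where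
  "duhamel_integrand f t x l a b \<sigma> = kconv (\<lambda>z. heat_kernel_deriv l (of_real (fst z) + of_real (th \<sigma>) * a) (of_real (snd z) + of_real (th \<sigma>) * b))
     (sqrt (t * \<sigma>)) (f (t * (1 - \<sigma>))) x"

definition duhamel :: "(real \<Rightarrow> real \<times> real \<Rightarrow> complex) \<Rightarrow> real \<Rightarrow> real \<times> real \<Rightarrow> complex \<Rightarrow> complex \<Rightarrow> complex \<Rightarrow> complex" where
  "duhamel f t x l a b = (\<integral>\<sigma>. duhamel_integrand f t x l a b \<sigma> / of_real \<sigma> \<partial>W)"

text \<open>Two weights occur. \<open>\<beta> = 1/4\<close> is invariant under parabolic scaling and
  belongs to bounded data; \<open>\<beta> = 0\<close> expresses that the seminorm of Hoelder data is
  preserved down to time zero. Joint measurability lets the function be a source again.\<close>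

definition admissible :: "real \<Rightarrow> real \<Rightarrow> real \<Rightarrow> (real \<Rightarrow> real \<times> real \<Rightarrow> complex) \<Rightarrow> bool" where
  "admissible A B \<beta> f \<longleftrightarrow> (\<lambda>q. f (fst q) (snd q)) \<in> borel_measurable borel \<and>
     (\<forall>s>0. \<forall>y. norm (f s y) \<le> B) \<and> (\<forall>s>0. hoelder (A * s powr (-\<beta>)) (f s))"

lemma admissible_bound: "admissible A B \<beta> f \<Longrightarrow> s > 0 \<Longrightarrow> norm (f s y) \<le> B"
  unfolding admissible_def by blast

lemma admissible_hoelder: "admissible A B \<beta> f \<Longrightarrow> s > 0 \<Longrightarrow> hoelder (A * s powr (-\<beta>)) (f s)"
  unfolding admissible_def by blast

text \<open>The bound rests on \<open>sqrt \<sigma> + sqrt (1 - \<sigma>) \<ge> 1\<close> and keeps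
  the drifts \<open>th \<sigma> * a\<close> and \<open>th \<sigma> * b\<close> in the unit disc,
  where the kernels are controlled.\<close>

lemma th_bounds: "0 < \<sigma> \<Longrightarrow> \<sigma> < 1 \<Longrightarrow> 0 \<le> th \<sigma> \<and> th \<sigma> \<le> 1"
proof -
  assume s: "0 < \<sigma>" "\<sigma> < 1"
  have "1 = \<sigma> + (1 - \<sigma>)" by simp
  also have "\<dots> \<le> (sqrt \<sigma> + sqrt (1 - \<sigma>))\<^sup>2" using s by (simp add: power2_sum)
  finally have "1 \<le> sqrt \<sigma> + sqrt (1 - \<sigma>)" using s by (smt (verit) power_le_one_iff real_sqrt_ge_0_iff one_less_power power2_eq_square mult_less_cancel_left1 real_sqrt_ge_zero mult_le_one)
  then show ?thesis using s by (simp add: th_def divide_le_eq)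
qed

lemma th_measurable [measurable]: "th \<in> borel_measurable borel"
  unfolding th_def by measurable

lemma par_th:
  assumes "par l a b" "0 < \<sigma>" "\<sigma> < 1"
  shows "par l (of_real (th \<sigma>) * a) (of_real (th \<sigma>) * b)"
proof -
  have "\<bar>th \<sigma>\<bar> * norm c \<le> 1 * 1" if "norm c \<le> 1" for c :: complex
    using th_bounds[OF assms(2,3)] that by (intro mult_mono) auto
  then show ?thesis using assms(1) unfolding par_def norm_mult norm_of_real by simp
qed

lemma admissible_slice:
  assumes "admissible A B \<beta> f"
  shows "f s \<in> borel_measurable borel"
proof -
  have "(\<lambda>y. f (fst (s, y)) (snd (s, y))) \<in> borel_measurable borel"
    by (rule measurable_compose[where f="\<lambda>y. (s, y)" and N=borel])
      (use assms in \<open>auto simp: admissible_def intro!: borel_measurable_continuous_onI continuous_intros\<close>)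
  then show ?thesis by simp
qed

lemma admissible_nonneg: "admissible A B \<beta> f \<Longrightarrow> 0 \<le> A" "admissible A B \<beta> f \<Longrightarrow> 0 \<le> B"
proof -
  assume a: "admissible A B \<beta> f"
  then have "hoelder (A * 1 powr (-\<beta>)) (f 1)" unfolding admissible_def using zero_less_one by blast
  then show "0 \<le> A" using hoelder_nonneg by fastforce
  have "norm (f 1 0) \<le> B" using admissible_bound[OF a] by simp
  then show "0 \<le> B" using norm_ge_zero order_trans by blast
qed

lemma sqrt_sqrt_powr:
  assumes "t > 0"
  shows "sqrt (sqrt t) = t powr (1/4)" "1 / sqrt (sqrt t) = t powr (-1/4)"
proof -
  show *: "sqrt (sqrt t) = t powr (1/4)" using assms by (simp add: powr_half_sqrt[symmetric] powr_powr)
  show "1 / sqrt (sqrt t) = t powr (-1/4)" unfolding * using powr_minus_divide[of t "1/4"] by simp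
qed

section \<open>Pointwise bounds for the Duhamel integrand\<close>

lemma wt_ineq:
  assumes "0 \<le> \<beta>" "\<beta> \<le> 1/4" "t > 0" "0 < \<sigma>" "\<sigma> < 1"
  shows "(t * (1 - \<sigma>)) powr (-\<beta>) * sqrt (sqrt (t * \<sigma>)) \<le> t powr (1/4 - \<beta>) * (wt \<sigma> * \<sigma>)"
proof -
  have "sqrt (sqrt (t * \<sigma>)) = (t * \<sigma>) powr (1/4)"
    using assms by (simp add: powr_half_sqrt[symmetric] powr_powr)
  also have "\<dots> = t powr (1/4) * \<sigma> powr (1/4)" using assms by (simp add: powr_mult)
  finally have 1: "sqrt (sqrt (t * \<sigma>)) = t powr (1/4) * \<sigma> powr (1/4)" .
  have 2: "(t * (1 - \<sigma>)) powr (-\<beta>) = t powr (-\<beta>) * (1 - \<sigma>) powr (-\<beta>)" using assms by (simp add: powr_mult)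
  have 3: "(1 - \<sigma>) powr (-\<beta>) \<le> (1 - \<sigma>) powr (-1/4)" using assms by (intro powr_mono') auto
  have "\<sigma> powr (-3/4) * \<sigma> = \<sigma> powr (-3/4) * \<sigma> powr 1" using assms by simp
  also have "\<dots> = \<sigma> powr (1/4)" unfolding powr_add[symmetric] by simp
  finally have 4: "\<sigma> powr (1/4) = \<sigma> powr (-3/4) * \<sigma>" ..
  have 5: "t powr (1/4 - \<beta>) = t powr (-\<beta>) * t powr (1/4)" unfolding powr_add[symmetric] by simp
  have "(t * (1 - \<sigma>)) powr (-\<beta>) * sqrt (sqrt (t * \<sigma>)) = t powr (1/4 - \<beta>) * (\<sigma> powr (-3/4) * \<sigma>) * (1 - \<sigma>) powr (-\<beta>)"
    unfolding 1 2 5 4 by (simp add: mult_ac)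
  also have "\<dots> \<le> t powr (1/4 - \<beta>) * (\<sigma> powr (-3/4) * \<sigma>) * (1 - \<sigma>) powr (-1/4)"
    using assms by (intro mult_left_mono 3) auto
  finally show ?thesis by (simp add: wt_def mult_ac)
qed

lemma heat_kernel_deriv_th_kern:
  assumes "par l a b" "0 < \<sigma>" "\<sigma> < 1"
  shows "kern kC (\<lambda>z. heat_kernel_deriv l (of_real (fst z) + of_real (th \<sigma>) * a) (of_real (snd z) + of_real (th \<sigma>) * b))"
    "(\<integral>z. heat_kernel_deriv l (of_real (fst z) + of_real (th \<sigma>) * a) (of_real (snd z) + of_real (th \<sigma>) * b) \<partial>(lborel::(real\<times>real) measure)) = 0"
  using heat_kernel_deriv_kern heat_kernel_deriv_integral_zero par_th[OF assms] unfolding par_def by blast+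

lemma duhamel_integrand_bound:
  assumes p: "par l a b" and f: "admissible A B \<beta> f" "0 \<le> \<beta>" "\<beta> \<le> 1/4" and t: "t > 0" and s: "0 < \<sigma>" "\<sigma> < 1"
  shows "norm (duhamel_integrand f t x l a b \<sigma> / of_real \<sigma>) \<le> kC * gauss_mass * A * t powr (1/4 - \<beta>) * wt \<sigma>"
proof -
  have ts: "t * (1 - \<sigma>) > 0" using t s by simp
  have B: "norm (f (t * (1 - \<sigma>)) y) \<le> B" for y by (rule admissible_bound[OF f(1) ts])
  have A: "hoelder (A * (t * (1 - \<sigma>)) powr (-\<beta>)) (f (t * (1 - \<sigma>)))" using f(1) ts by (auto simp: admissible_def)
  have "norm (duhamel_integrand f t x l a b \<sigma>) \<le> kC * (A * (t * (1 - \<sigma>)) powr (-\<beta>)) * gauss_mass * sqrt (sqrt (t * \<sigma>))"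
    unfolding duhamel_integrand_def using t s by (intro kconv_zero_bound[OF heat_kernel_deriv_th_kern[OF p s] admissible_slice[OF f(1)] B A]) auto
  also have "\<dots> = (kC * gauss_mass * A) * ((t * (1 - \<sigma>)) powr (-\<beta>) * sqrt (sqrt (t * \<sigma>)))" by (simp add: mult_ac)
  also have "\<dots> \<le> (kC * gauss_mass * A) * (t powr (1/4 - \<beta>) * (wt \<sigma> * \<sigma>))"
    using kC_pos gauss_mass_nonneg admissible_nonneg(1)[OF f(1)] by (intro mult_left_mono wt_ineq f t s) auto
  finally show ?thesis using s by (simp add: norm_divide divide_le_eq mult_ac)
qed

lemma duhamel_integrand_diff_bound:
  assumes p: "par l a b" and f: "admissible A B \<beta> f" "0 \<le> \<beta>" "\<beta> \<le> 1/4" and t: "t > 0" and s: "0 < \<sigma>" "\<sigma> < 1"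
  shows "norm (duhamel_integrand f t (x + d) l a b \<sigma> / of_real \<sigma> - duhamel_integrand f t x l a b \<sigma> / of_real \<sigma>)
    \<le> 2 * kC * gauss_mass * A * t powr (1/4 - \<beta>) * (wt \<sigma> * min 1 ((norm d / sqrt t) / sqrt \<sigma>))"
proof -
  have ts: "t * (1 - \<sigma>) > 0" using t s by simp
  have B: "norm (f (t * (1 - \<sigma>)) y) \<le> B" for y by (rule admissible_bound[OF f(1) ts])
  have A: "hoelder (A * (t * (1 - \<sigma>)) powr (-\<beta>)) (f (t * (1 - \<sigma>)))" using f(1) ts by (auto simp: admissible_def)
  let ?m = "min 1 ((norm d / sqrt t) / sqrt \<sigma>)"
  have m0: "?m \<ge> 0" using t s by simp
  have "norm (duhamel_integrand f t (x + d) l a b \<sigma> - duhamel_integrand f t x l a b \<sigma>)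
    \<le> 2 * kC * (A * (t * (1 - \<sigma>)) powr (-\<beta>)) * gauss_mass * sqrt (sqrt (t * \<sigma>)) * min 1 (norm d / sqrt (t * \<sigma>))"
    unfolding duhamel_integrand_def using t s by (intro kconv_diff_zero[OF heat_kernel_deriv_th_kern[OF p s] admissible_slice[OF f(1)] B A]) auto
  also have "\<dots> = (2 * kC * gauss_mass * A * ?m) * ((t * (1 - \<sigma>)) powr (-\<beta>) * sqrt (sqrt (t * \<sigma>)))"
    by (simp add: mult_ac real_sqrt_mult divide_divide_eq_left)
  also have "\<dots> \<le> (2 * kC * gauss_mass * A * ?m) * (t powr (1/4 - \<beta>) * (wt \<sigma> * \<sigma>))"
    using kC_pos gauss_mass_nonneg admissible_nonneg(1)[OF f(1)] m0 by (intro mult_left_mono wt_ineq f t s) auto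
  finally show ?thesis using s by (simp add: norm_divide divide_le_eq mult_ac flip: diff_divide_distrib)
qed

section \<open>Joint measurability\<close>

lemma borel_measurable_param_integral:
  fixes F :: "'p::euclidean_space \<times> 'z::euclidean_space \<Rightarrow> complex"
  assumes "F \<in> borel_measurable borel"
  shows "(\<lambda>p. \<integral>z. F (p, z) \<partial>lborel) \<in> borel_measurable borel"
proof (rule lborel.borel_measurable_lebesgue_integral)
  have "sets (borel \<Otimes>\<^sub>M lborel :: ('p \<times> 'z) measure) = sets borel"
    by (metis borel_prod sets_lborel sets_pair_measure_cong)
  then have "borel_measurable (borel \<Otimes>\<^sub>M lborel :: ('p \<times> 'z) measure) = (borel_measurable borel :: ('p \<times> 'z \<Rightarrow> complex) set)"
    by (rule measurable_cong_sets) simp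
  then show "(\<lambda>(p, z). F (p, z)) \<in> borel_measurable (borel \<Otimes>\<^sub>M (lborel :: 'z measure))"
    using assms by (simp add: case_prod_beta')
qed

lemma measurable_two_args:
  fixes f :: "real \<Rightarrow> real \<times> real \<Rightarrow> complex"
  assumes "(\<lambda>q. f (fst q) (snd q)) \<in> borel_measurable borel"
    and [measurable]: "g \<in> borel_measurable M" "h \<in> borel_measurable M"
  shows "(\<lambda>p. f (g p) (h p)) \<in> borel_measurable M"
proof -
  have "(\<lambda>p. (g p, h p)) \<in> measurable M borel"
    unfolding borel_prod[symmetric, where 'a=real and 'b="real \<times> real"]
    by (rule measurable_Pair) (rule assms)+
  from measurable_compose[OF this assms(1)] show ?thesis by simp
qed

lemma heat_kernel_deriv_measurable [measurable]:
  assumes [measurable]: "f \<in> borel_measurable M" "g \<in> borel_measurable M"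
  shows "(\<lambda>x. heat_kernel_deriv l (f x) (g x)) \<in> borel_measurable M"
  unfolding heat_kernel_deriv_def heat_kernel_def by measurable

lemma heat_kernel_measurable [measurable]:
  assumes [measurable]: "f \<in> borel_measurable M" "g \<in> borel_measurable M"
  shows "(\<lambda>x. heat_kernel l (f x) (g x)) \<in> borel_measurable M"
  unfolding heat_kernel_def by measurable

lemma duhamel_integrand_measurable:
  assumes f: "(\<lambda>q. f (fst q) (snd q)) \<in> borel_measurable borel"
  shows "(\<lambda>p::(real \<times> (real \<times> real)) \<times> real. duhamel_integrand f (fst (fst p)) (snd (fst p)) l a b (snd p) / of_real (snd p)) \<in> borel_measurable borel"
proof -
  let ?F = "\<lambda>q::((real \<times> (real \<times> real)) \<times> real) \<times> (real \<times> real).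
    heat_kernel_deriv l (of_real (fst (snd q)) + of_real (th (snd (fst q))) * a) (of_real (snd (snd q)) + of_real (th (snd (fst q))) * b)
    * f (fst (fst (fst q)) * (1 - snd (fst q))) (snd (fst (fst q)) - sqrt (fst (fst (fst q)) * snd (fst q)) *\<^sub>R snd q)"
  have [measurable]: "(\<lambda>q::((real \<times> (real \<times> real)) \<times> real) \<times> (real \<times> real). fst (fst (fst q))) \<in> borel_measurable borel"
    "(\<lambda>q::((real \<times> (real \<times> real)) \<times> real) \<times> (real \<times> real). snd (fst (fst q))) \<in> borel_measurable borel"
    "(\<lambda>q::((real \<times> (real \<times> real)) \<times> real) \<times> (real \<times> real). snd (fst q)) \<in> borel_measurable borel"
    "(\<lambda>q::((real \<times> (real \<times> real)) \<times> real) \<times> (real \<times> real). snd q) \<in> borel_measurable borel"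
    "(\<lambda>q::((real \<times> (real \<times> real)) \<times> real) \<times> (real \<times> real). fst (snd q)) \<in> borel_measurable borel"
    "(\<lambda>q::((real \<times> (real \<times> real)) \<times> real) \<times> (real \<times> real). snd (snd q)) \<in> borel_measurable borel"
    by (intro borel_measurable_continuous_onI continuous_intros)+
  have [measurable]: "(\<lambda>p::(real \<times> (real \<times> real)) \<times> real. snd p) \<in> borel_measurable borel"
    by (intro borel_measurable_continuous_onI continuous_intros)+
  have "?F \<in> borel_measurable borel"
    by (intro borel_measurable_times measurable_two_args[OF f]) measurable
  from borel_measurable_param_integral[OF this]
  have [measurable]: "(\<lambda>p::(real \<times> (real \<times> real)) \<times> real. duhamel_integrand f (fst (fst p)) (snd (fst p)) l a b (snd p)) \<in> borel_measurable borel"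
    unfolding duhamel_integrand_def kconv_def fst_conv snd_conv .
  show ?thesis by measurable
qed

lemma duhamel_integrand_measurable_W:
  assumes "admissible A B \<beta> f"
  shows "(\<lambda>\<sigma>. duhamel_integrand f t x l a b \<sigma> / of_real \<sigma>) \<in> borel_measurable W"
proof (rule W_measurable)
  have "(\<lambda>\<sigma>. ((t, x), \<sigma>)) \<in> measurable borel borel"
    by (intro borel_measurable_continuous_onI continuous_intros)
  from measurable_compose[OF this duhamel_integrand_measurable[of f l a b]] show "(\<lambda>\<sigma>. duhamel_integrand f t x l a b \<sigma> / of_real \<sigma>) \<in> borel_measurable borel"
    using assms by (simp add: admissible_def)
qed

lemma duhamel_measurable:
  assumes f: "(\<lambda>q. f (fst q) (snd q)) \<in> borel_measurable borel"
  shows "(\<lambda>q. duhamel f (fst q) (snd q) l a b) \<in> borel_measurable borel"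
proof -
  have [measurable]: "(\<lambda>p::(real \<times> (real \<times> real)) \<times> real. snd p) \<in> borel_measurable borel"
    by (intro borel_measurable_continuous_onI continuous_intros)+
  note [measurable] = duhamel_integrand_measurable[OF f, of l a b]
  have "(\<lambda>p::(real \<times> (real \<times> real)) \<times> real. indicator {0<..<1} (snd p) *\<^sub>R (duhamel_integrand f (fst (fst p)) (snd (fst p)) l a b (snd p) / of_real (snd p))) \<in> borel_measurable borel"
    by measurable
  from borel_measurable_param_integral[OF this] show ?thesis
    unfolding duhamel_def W_def by (subst integral_restrict_space) simp_all
qed

lemma heat_measurable:
  assumes \<phi>: "\<phi> \<in> borel_measurable borel"
  shows "(\<lambda>q. heat \<phi> (fst q) (snd q) l a b) \<in> borel_measurable borel"
proof -
  let ?F = "\<lambda>q::(real \<times> (real \<times> real)) \<times> (real \<times> real).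
    heat_kernel l (of_real (fst (snd q)) + a) (of_real (snd (snd q)) + b) * \<phi> (snd (fst q) - sqrt (fst (fst q)) *\<^sub>R snd q)"
  have [measurable]: "(\<lambda>q::(real \<times> (real \<times> real)) \<times> (real \<times> real). fst (fst q)) \<in> borel_measurable borel"
    "(\<lambda>q::(real \<times> (real \<times> real)) \<times> (real \<times> real). snd (fst q)) \<in> borel_measurable borel"
    "(\<lambda>q::(real \<times> (real \<times> real)) \<times> (real \<times> real). snd q) \<in> borel_measurable borel"
    "(\<lambda>q::(real \<times> (real \<times> real)) \<times> (real \<times> real). fst (snd q)) \<in> borel_measurable borel"
    "(\<lambda>q::(real \<times> (real \<times> real)) \<times> (real \<times> real). snd (snd q)) \<in> borel_measurable borel"
    by (intro borel_measurable_continuous_onI continuous_intros)+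
  have "?F \<in> borel_measurable borel"
    by (intro borel_measurable_times measurable_compose[OF _ \<phi>]) measurable
  from borel_measurable_param_integral[OF this] show ?thesis by (simp add: heat_def kconv_def)
qed

section \<open>Size and Hoelder continuity of the heat flow and the Duhamel integral\<close>

lemma duhamel_integrable:
  assumes p: "par l a b" and f: "admissible A B \<beta> f" "0 \<le> \<beta>" "\<beta> \<le> 1/4" and t: "t > 0"
  shows "integrable W (\<lambda>\<sigma>. duhamel_integrand f t x l a b \<sigma> / of_real \<sigma>)"
proof (rule Bochner_Integration.integrable_bound[OF _ duhamel_integrand_measurable_W[OF f(1)]])
  show "integrable W (\<lambda>\<sigma>. kC * gauss_mass * A * t powr (1/4 - \<beta>) * wt \<sigma>)" by (intro integrable_mult_right wt_integrable)
  show "AE \<sigma> in W. norm (duhamel_integrand f t x l a b \<sigma> / of_real \<sigma>) \<le> norm (kC * gauss_mass * A * t powr (1/4 - \<beta>) * wt \<sigma>)"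
    using order_trans[OF duhamel_integrand_bound[OF p f t] abs_ge_self] by (intro AE_I2) (simp only: space_W greaterThanLessThan_iff real_norm_def)
qed

lemma duhamel_bound:
  assumes p: "par l a b" and f: "admissible A B \<beta> f" "0 \<le> \<beta>" "\<beta> \<le> 1/4" and t: "t > 0"
  shows "norm (duhamel f t x l a b) \<le> kC * gauss_mass * w0 * A * t powr (1/4 - \<beta>)"
proof -
  have "norm (duhamel f t x l a b) \<le> (\<integral>\<sigma>. kC * gauss_mass * A * t powr (1/4 - \<beta>) * wt \<sigma> \<partial>W)"
    unfolding duhamel_def using duhamel_integrand_bound[OF p f t]
    by (intro Bochner_Integration.integral_norm_bound_integral duhamel_integrable[OF p f t] integrable_mult_right wt_integrable) auto
  also have "\<dots> = kC * gauss_mass * A * t powr (1/4 - \<beta>) * w0" by (simp add: w0_def)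
  finally show ?thesis by (simp add: mult_ac)
qed

definition kH :: real where "kH = 2 * kC * gauss_mass * w1"

text \<open>The factor \<open>sqrt (norm d / sqrt t)\<close> supplied by
  \<open>wt_min_integral\<close> contains \<open>t powr (-1/4)\<close>, which cancels the gained
  \<open>t powr (1/4)\<close>. The seminorm is reproduced with the same weight
  \<open>\<beta>\<close> and no power of \<open>t\<close> left over, so the iteration closes on all
  positive times simultaneously.\<close>

lemma duhamel_hoelder:
  assumes p: "par l a b" and f: "admissible A B \<beta> f" "0 \<le> \<beta>" "\<beta> \<le> 1/4" and t: "t > 0"
  shows "hoelder (kH * A * t powr (-\<beta>)) (\<lambda>x. duhamel f t x l a b)"
  unfolding hoelder_def
proof (intro allI)
  fix y x :: "real \<times> real"
  define d where "d = y - x"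
  show "norm (duhamel f t y l a b - duhamel f t x l a b) \<le> kH * A * t powr (-\<beta>) * sqrt (norm (y - x))"
  proof (cases "d = 0")
    case True then show ?thesis by (simp add: d_def)
  next
    case False
    let ?\<rho> = "norm d / sqrt t" let ?c = "2 * kC * gauss_mass * A * t powr (1/4 - \<beta>)"
    have r: "?\<rho> > 0" using False t by simp
    have c: "?c \<ge> 0" using kC_pos gauss_mass_nonneg admissible_nonneg(1)[OF f(1)] by simp
    have y: "y = x + d" by (simp add: d_def)
    have "duhamel f t (x + d) l a b - duhamel f t x l a b = (\<integral>\<sigma>. duhamel_integrand f t (x + d) l a b \<sigma> / of_real \<sigma> - duhamel_integrand f t x l a b \<sigma> / of_real \<sigma> \<partial>W)"
      unfolding duhamel_def by (intro Bochner_Integration.integral_diff[symmetric] duhamel_integrable[OF p f t])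
    moreover have "norm (\<integral>\<sigma>. duhamel_integrand f t (x + d) l a b \<sigma> / of_real \<sigma> - duhamel_integrand f t x l a b \<sigma> / of_real \<sigma> \<partial>W) \<le> (\<integral>\<sigma>. ?c * (wt \<sigma> * min 1 (?\<rho> / sqrt \<sigma>)) \<partial>W)"
    proof (rule Bochner_Integration.integral_norm_bound_integral)
      show "integrable W (\<lambda>\<sigma>. duhamel_integrand f t (x + d) l a b \<sigma> / of_real \<sigma> - duhamel_integrand f t x l a b \<sigma> / of_real \<sigma>)"
        by (rule Bochner_Integration.integrable_diff[OF duhamel_integrable[OF p f t] duhamel_integrable[OF p f t]])
      show "integrable W (\<lambda>\<sigma>. ?c * (wt \<sigma> * min 1 (?\<rho> / sqrt \<sigma>)))"
        by (rule integrable_mult_right[OF wt_min_integral(1)[OF r]])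
      fix \<sigma> assume "\<sigma> \<in> space W"
      then have "0 < \<sigma>" "\<sigma> < 1" by auto
      then show "norm (duhamel_integrand f t (x + d) l a b \<sigma> / of_real \<sigma> - duhamel_integrand f t x l a b \<sigma> / of_real \<sigma>) \<le> ?c * (wt \<sigma> * min 1 (?\<rho> / sqrt \<sigma>))"
        by (rule duhamel_integrand_diff_bound[OF p f t])
    qed
    moreover have "(\<integral>\<sigma>. ?c * (wt \<sigma> * min 1 (?\<rho> / sqrt \<sigma>)) \<partial>W) = ?c * (\<integral>\<sigma>. wt \<sigma> * min 1 (?\<rho> / sqrt \<sigma>) \<partial>W)"
      by (subst integral_mult_right_zero) (rule refl)
    moreover have "?c * (\<integral>\<sigma>. wt \<sigma> * min 1 (?\<rho> / sqrt \<sigma>) \<partial>W) \<le> ?c * (w1 * sqrt ?\<rho>)" by (rule mult_left_mono[OF wt_min_integral(2)[OF r] c])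
    ultimately have "norm (duhamel f t (x + d) l a b - duhamel f t x l a b) \<le> ?c * (w1 * sqrt ?\<rho>)"
      by (simp only:)
    also have "\<dots> = kH * A * (t powr (1/4 - \<beta>) / sqrt (sqrt t)) * sqrt (norm d)"
      using t by (simp add: kH_def real_sqrt_divide mult_ac)
    also have "t powr (1/4 - \<beta>) / sqrt (sqrt t) = t powr (-\<beta>)"
      unfolding sqrt_sqrt_powr(1)[OF t] powr_diff[symmetric] by simp
    finally show ?thesis by (simp add: y)
  qed
qed

lemma heat_bound:
  assumes p: "par l a b" and \<phi>: "\<phi> \<in> borel_measurable borel" "\<And>y. norm (\<phi> y) \<le> B"
  shows "norm (heat \<phi> t x l a b) \<le> kC * gauss_mass * B"
  using kconv_bound(2)[OF heat_kernel_kern \<phi>] p unfolding heat_def par_def by (simp add: mult_ac)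

lemma heat_hoelder:
  assumes p: "par l a b" and \<phi>: "\<phi> \<in> borel_measurable borel" "\<And>y. norm (\<phi> y) \<le> B" and t: "t > 0"
  shows "hoelder (2 * kC * gauss_mass * B * t powr (-1/4)) (\<lambda>x. heat \<phi> t x l a b)"
  unfolding hoelder_def
proof (intro allI)
  fix y x :: "real \<times> real"
  define d where "d = y - x"
  have y: "y = x + d" by (simp add: d_def)
  have B0: "0 \<le> B" using \<phi>(2)[of 0] norm_ge_zero order_trans by blast
  have "norm (heat \<phi> t (x + d) l a b - heat \<phi> t x l a b) \<le> 2 * kC * B * gauss_mass * min 1 (norm d / sqrt t)"
    unfolding heat_def using p t by (intro kconv_diff_bound[OF heat_kernel_kern \<phi>]) (auto simp: par_def)
  also have "\<dots> \<le> 2 * kC * B * gauss_mass * sqrt (norm d / sqrt t)"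
    using kC_pos B0 gauss_mass_nonneg t by (intro mult_left_mono min_one_le_sqrt) auto
  also have "sqrt (norm d / sqrt t) = sqrt (norm d) * t powr (-1/4)"
    unfolding sqrt_sqrt_powr(2)[OF t, symmetric] by (simp add: real_sqrt_divide)
  finally show "norm (heat \<phi> t y l a b - heat \<phi> t x l a b) \<le> 2 * kC * gauss_mass * B * t powr (-1/4) * sqrt (norm (y - x))"
    by (simp add: y mult_ac)
qed

text \<open>Convolution commutes with translations: the increment of the flow is the flow of the
  increment.\<close>

lemma heat_hold':
  assumes p: "par l a b" and \<phi>: "\<phi> \<in> borel_measurable borel" "\<And>y. norm (\<phi> y) \<le> B" "hoelder A \<phi>"
  shows "hoelder (kC * gauss_mass * A) (\<lambda>x. heat \<phi> t x l a b)"
  unfolding hoelder_def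
proof (intro allI)
  fix y x :: "real \<times> real"
  have [measurable]: "\<phi> \<in> borel_measurable borel" by (rule \<phi>(1))
  have k: "kern kC (\<lambda>z. heat_kernel l (of_real (fst z) + a) (of_real (snd z) + b))" using p heat_kernel_kern by (simp add: par_def)
  let ?\<psi> = "\<lambda>w. \<phi> (w + (y - x)) - \<phi> w"
  have "heat \<phi> t y l a b - heat \<phi> t x l a b = kconv (\<lambda>z. heat_kernel l (of_real (fst z) + a) (of_real (snd z) + b)) (sqrt t) ?\<psi> x"
    unfolding heat_def kconv_def
    by (subst Bochner_Integration.integral_diff[symmetric, OF kconv_bound(1)[OF k \<phi>(1,2)] kconv_bound(1)[OF k \<phi>(1,2)]])
      (simp add: algebra_simps)
  also have "norm \<dots> \<le> kC * (A * sqrt (norm (y - x))) * gauss_mass"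
  proof (rule kconv_bound(2)[OF k])
    show "norm (?\<psi> w) \<le> A * sqrt (norm (y - x))" for w
      using \<phi>(3) unfolding hoelder_def by (metis add_diff_cancel_left')
  qed measurable
  finally show "norm (heat \<phi> t y l a b - heat \<phi> t x l a b) \<le> kC * gauss_mass * A * sqrt (norm (y - x))" by (simp add: mult_ac)
qed

section \<open>Dependence on the source and on the complex parameters\<close>

lemma duhamel_integrand_diff:
  assumes p: "par l a b" and f: "admissible A B \<beta> f" and g: "admissible A' B' \<beta> g" and t: "t > 0" and s: "0 < \<sigma>" "\<sigma> < 1"
  shows "duhamel_integrand (\<lambda>s y. f s y - g s y) t x l a b \<sigma> = duhamel_integrand f t x l a b \<sigma> - duhamel_integrand g t x l a b \<sigma>"
proof -
  have ts: "t * (1 - \<sigma>) > 0" using t s by simp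
  have B: "norm (f (t * (1 - \<sigma>)) y) \<le> B" "norm (g (t * (1 - \<sigma>)) y) \<le> B'" for y
    by (rule admissible_bound[OF f ts], rule admissible_bound[OF g ts])
  show ?thesis unfolding duhamel_integrand_def kconv_def
    by (subst Bochner_Integration.integral_diff[symmetric, OF kconv_bound(1)[OF heat_kernel_deriv_th_kern(1)[OF p s] admissible_slice[OF f] B(1)]
      kconv_bound(1)[OF heat_kernel_deriv_th_kern(1)[OF p s] admissible_slice[OF g] B(2)]]) (simp add: algebra_simps)
qed

lemma duhamel_diff:
  assumes p: "par l a b" and f: "admissible A B \<beta> f" and g: "admissible A' B' \<beta> g" and b: "0 \<le> \<beta>" "\<beta> \<le> 1/4" and t: "t > 0"
  shows "duhamel (\<lambda>s y. f s y - g s y) t x l a b = duhamel f t x l a b - duhamel g t x l a b"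
  unfolding duhamel_def
  by (subst Bochner_Integration.integral_diff[symmetric, OF duhamel_integrable[OF p f b t] duhamel_integrable[OF p g b t]])
    (rule Bochner_Integration.integral_cong, auto simp: duhamel_integrand_diff[OF p f g t] diff_divide_distrib)

lemma kconv_tendsto:
  assumes k: "kern C k" and [measurable]: "\<And>n. \<phi> n \<in> borel_measurable borel" "\<psi> \<in> borel_measurable borel"
    and B: "\<And>n y. norm (\<phi> n y) \<le> B" and lim: "\<And>y. (\<lambda>n. \<phi> n y) \<longlonglongrightarrow> \<psi> y"
  shows "(\<lambda>n. kconv k s (\<phi> n) x) \<longlonglongrightarrow> kconv k s \<psi> x"
  unfolding kconv_def
proof (rule integral_dominated_convergence)
  have [measurable]: "k \<in> borel_measurable borel" using k by (simp add: kern_def)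
  show "(\<lambda>z. k z * \<psi> (x - s *\<^sub>R z)) \<in> borel_measurable lborel" "(\<lambda>z. k z * \<phi> n (x - s *\<^sub>R z)) \<in> borel_measurable lborel" for n
    by measurable
  have ki: "integrable lborel k" using kern_integrable(1)[OF k(1), of "\<lambda>_. 1" 1] cube_ge(1) by simp
  show "integrable lborel (\<lambda>z. norm (k z) * B)" using ki by (intro integrable_mult_left integrable_norm)
  show "AE z in lborel. (\<lambda>n. k z * \<phi> n (x - s *\<^sub>R z)) \<longlonglongrightarrow> k z * \<psi> (x - s *\<^sub>R z)"
    using lim by (intro AE_I2 tendsto_intros)
  show "AE z in lborel. norm (k z * \<phi> n (x - s *\<^sub>R z)) \<le> norm (k z) * B" for n
    by (intro AE_I2) (simp only: norm_mult mult_left_mono B norm_ge_zero)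
qed

text \<open>Pointwise convergence under common bounds is enough, by dominated convergence in space
  and then in \<open>\<sigma>\<close>. The sources may fail to converge in any Hoelder norm, which
  is what limits with discontinuous data require.\<close>

lemma duhamel_tendsto:
  assumes p: "par l a b" and f: "\<And>n. admissible A B \<beta> (f n)" and g: "admissible A B \<beta> g" and b: "0 \<le> \<beta>" "\<beta> \<le> 1/4" and t: "t > 0"
    and lim: "\<And>s y. s > 0 \<Longrightarrow> (\<lambda>n. f n s y) \<longlonglongrightarrow> g s y"
  shows "(\<lambda>n. duhamel (f n) t x l a b) \<longlonglongrightarrow> duhamel g t x l a b"
  unfolding duhamel_def
proof (rule integral_dominated_convergence)
  show "integrable W (\<lambda>\<sigma>. kC * gauss_mass * A * t powr (1/4 - \<beta>) * wt \<sigma>)" by (intro integrable_mult_right wt_integrable)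
  show "AE \<sigma> in W. norm (duhamel_integrand (f n) t x l a b \<sigma> / of_real \<sigma>) \<le> kC * gauss_mass * A * t powr (1/4 - \<beta>) * wt \<sigma>" for n
    using duhamel_integrand_bound[OF p f b t] by (intro AE_I2) auto
  have "(\<lambda>n. duhamel_integrand (f n) t x l a b \<sigma>) \<longlonglongrightarrow> duhamel_integrand g t x l a b \<sigma>" if s: "0 < \<sigma>" "\<sigma> < 1" for \<sigma>
  proof -
    have ts: "t * (1 - \<sigma>) > 0" using t s by simp
    show ?thesis unfolding duhamel_integrand_def
    proof (rule kconv_tendsto[OF heat_kernel_deriv_th_kern(1)[OF p s] admissible_slice[OF f] admissible_slice[OF g]])
      show "norm (f n (t * (1 - \<sigma>)) y) \<le> B" for n y by (rule admissible_bound[OF f ts])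
      show "(\<lambda>n. f n (t * (1 - \<sigma>)) y) \<longlonglongrightarrow> g (t * (1 - \<sigma>)) y" for y by (rule lim[OF ts])
    qed
  qed
  then show "AE \<sigma> in W. (\<lambda>n. duhamel_integrand (f n) t x l a b \<sigma> / of_real \<sigma>) \<longlonglongrightarrow> duhamel_integrand g t x l a b \<sigma> / of_real \<sigma>"
    by (intro AE_I2 tendsto_divide) auto
qed (use duhamel_integrand_measurable_W f g in blast)+

lemma kconv_holomorphic:
  assumes S: "open S" and m: "\<And>p. p \<in> S \<Longrightarrow> (\<lambda>z. K p z) \<in> borel_measurable borel"
    "\<And>p. p \<in> S \<Longrightarrow> F p \<in> borel_measurable borel"
    and K: "\<And>p z. p \<in> S \<Longrightarrow> norm (K p z) \<le> C * gauss_weight z" and B: "\<And>p y. p \<in> S \<Longrightarrow> norm (F p y) \<le> B"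
    and hol: "\<And>z. (\<lambda>p. K p z) holomorphic_on S" "\<And>y. (\<lambda>p. F p y) holomorphic_on S"
  shows "(\<lambda>p. kconv (K p) s (F p) x) holomorphic_on S"
  unfolding kconv_def
proof (rule holomorphic_on_integral[OF S])
  show "integrable lborel (\<lambda>z. \<bar>C\<bar> * \<bar>B\<bar> * ((1 + norm z)^3 * gauss_weight z))"
    by (intro integrable_mult_right gauss_weight_moment_integrable)
  fix z p assume p: "p \<in> S"
  have "norm (K p z) * norm (F p (x - s *\<^sub>R z)) \<le> (\<bar>C\<bar> * gauss_weight z) * (\<bar>B\<bar> * 1)"
  proof (rule mult_mono)
    show "norm (K p z) \<le> \<bar>C\<bar> * gauss_weight z" using K[OF p, of z] mult_right_mono[OF abs_ge_self[of C], of "gauss_weight z"] by simp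
    show "norm (F p (x - s *\<^sub>R z)) \<le> \<bar>B\<bar> * 1" using B[OF p, of "x - s *\<^sub>R z"] by simp
  qed auto
  also have "\<dots> \<le> (\<bar>C\<bar> * gauss_weight z) * (\<bar>B\<bar> * (1 + norm z)^3)"
    using cube_ge(1)[of "norm z"] by (intro mult_left_mono) auto
  finally show "norm (K p z * F p (x - s *\<^sub>R z)) \<le> \<bar>C\<bar> * \<bar>B\<bar> * ((1 + norm z)^3 * gauss_weight z)"
    by (simp add: norm_mult mult_ac)
next
  fix p assume p: "p \<in> S"
  note [measurable] = m[OF p]
  show "(\<lambda>z. K p z * F p (x - s *\<^sub>R z)) \<in> borel_measurable lborel" by measurable
qed (intro holomorphic_intros hol)

lemma heat_holomorphic:
  assumes S: "open S" and p: "\<And>z. z \<in> S \<Longrightarrow> par (l z) (a z) (b z)"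
    and hol: "l holomorphic_on S" "a holomorphic_on S" "b holomorphic_on S"
    and \<phi>: "\<phi> \<in> borel_measurable borel" "\<And>y. norm (\<phi> y) \<le> B"
  shows "(\<lambda>z. heat \<phi> t x (l z) (a z) (b z)) holomorphic_on S"
  unfolding heat_def
proof (rule kconv_holomorphic[OF S])
  fix z assume z: "z \<in> S"
  have k: "kern kC (\<lambda>\<zeta>. heat_kernel (l z) (of_real (fst \<zeta>) + a z) (of_real (snd \<zeta>) + b z))"
    using p[OF z] heat_kernel_kern by (simp add: par_def)
  then show "(\<lambda>\<zeta>. heat_kernel (l z) (of_real (fst \<zeta>) + a z) (of_real (snd \<zeta>) + b z)) \<in> borel_measurable borel" by (simp add: kern_def)
  show "norm (heat_kernel (l z) (of_real (fst \<zeta>) + a z) (of_real (snd \<zeta>) + b z)) \<le> kC * gauss_weight \<zeta>" for \<zeta> using k unfolding kern_def by blast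
next
  have l0: "l z \<noteq> 0" if "z \<in> S" for z using p[OF that] param_bounds(1) by (auto simp: par_def)
  show "(\<lambda>z. heat_kernel (l z) (of_real (fst \<zeta>) + a z) (of_real (snd \<zeta>) + b z)) holomorphic_on S" for \<zeta>
    unfolding heat_kernel_def using l0 by (intro holomorphic_intros hol) auto
qed (use \<phi> in auto)

lemma duhamel_holomorphic:
  assumes S: "open S" and p: "\<And>z. z \<in> S \<Longrightarrow> par (l z) (a z) (b z)"
    and hol: "l holomorphic_on S" "a holomorphic_on S" "b holomorphic_on S"
    and f: "\<And>z. z \<in> S \<Longrightarrow> admissible A B \<beta> (f z)" "\<And>s y. s > 0 \<Longrightarrow> (\<lambda>z. f z s y) holomorphic_on S"
    and b: "0 \<le> \<beta>" "\<beta> \<le> 1/4" and t: "t > 0"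
  shows "(\<lambda>z. duhamel (f z) t x (l z) (a z) (b z)) holomorphic_on S"
  unfolding duhamel_def
proof (rule holomorphic_on_integral[OF S])
  show "integrable W (\<lambda>\<sigma>. kC * gauss_mass * A * t powr (1/4 - \<beta>) * wt \<sigma>)" by (intro integrable_mult_right wt_integrable)
  show "(\<lambda>\<sigma>. duhamel_integrand (f z) t x (l z) (a z) (b z) \<sigma> / of_real \<sigma>) \<in> borel_measurable W" if "z \<in> S" for z
    by (rule duhamel_integrand_measurable_W[OF f(1)[OF that]])
  fix \<sigma> assume "\<sigma> \<in> space W"
  then have s: "0 < \<sigma>" "\<sigma> < 1" by auto
  show "norm (duhamel_integrand (f z) t x (l z) (a z) (b z) \<sigma> / of_real \<sigma>) \<le> kC * gauss_mass * A * t powr (1/4 - \<beta>) * wt \<sigma>" if "z \<in> S" for z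
    by (rule duhamel_integrand_bound[OF p[OF that] f(1)[OF that] b t s])
  have ts: "t * (1 - \<sigma>) > 0" using t s by simp
  have l0: "l z \<noteq> 0" if "z \<in> S" for z using p[OF that] param_bounds(1) by (auto simp: par_def)
  have "(\<lambda>z. duhamel_integrand (f z) t x (l z) (a z) (b z) \<sigma>) holomorphic_on S"
    unfolding duhamel_integrand_def
  proof (rule kconv_holomorphic[OF S])
    fix z assume z: "z \<in> S"
    note k = heat_kernel_deriv_th_kern(1)[OF p[OF z] s]
    show "(\<lambda>\<zeta>. heat_kernel_deriv (l z) (of_real (fst \<zeta>) + of_real (th \<sigma>) * a z) (of_real (snd \<zeta>) + of_real (th \<sigma>) * b z)) \<in> borel_measurable borel"
      using k unfolding kern_def by blast
    show "norm (heat_kernel_deriv (l z) (of_real (fst \<zeta>) + of_real (th \<sigma>) * a z) (of_real (snd \<zeta>) + of_real (th \<sigma>) * b z)) \<le> kC * gauss_weight \<zeta>" for \<zeta>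
      using k unfolding kern_def by blast
    show "f z (t * (1 - \<sigma>)) \<in> borel_measurable borel" by (rule admissible_slice[OF f(1)[OF z]])
    show "norm (f z (t * (1 - \<sigma>)) y) \<le> B" for y by (rule admissible_bound[OF f(1)[OF z] ts])
  next
    show "(\<lambda>z. heat_kernel_deriv (l z) (of_real (fst \<zeta>) + of_real (th \<sigma>) * a z) (of_real (snd \<zeta>) + of_real (th \<sigma>) * b z)) holomorphic_on S" for \<zeta>
      unfolding heat_kernel_deriv_def heat_kernel_def using l0 by (intro holomorphic_intros hol) auto
  qed (rule f(2)[OF ts])
  then show "(\<lambda>z. duhamel_integrand (f z) t x (l z) (a z) (b z) \<sigma> / of_real \<sigma>) holomorphic_on S"
    using s by (intro holomorphic_intros) auto
qed

section \<open>Picard iteration\<close>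

text \<open>The nonlinear remainder after the linear part has gone into the heat flow. It vanishes
  to second order at \<open>0\<close>, so its Lipschitz constant on a ball of radius
  \<open>M\<close> is of order \<open>M\<close>.\<close>

definition log_rest :: "complex \<Rightarrow> complex" where
  "log_rest z = Ln (1 + z) - z"

lemma one_plus_small:
  fixes z :: complex
  assumes "norm z \<le> 1/4"
  shows "1 + z \<notin> \<real>\<^sub>\<le>\<^sub>0" "norm (1 + z) \<ge> 3/4" "1 + z \<noteq> 0"
proof -
  have "\<bar>Re z\<bar> \<le> 1/4" using abs_Re_le_cmod[of z] assms by simp
  then have r: "Re (1 + z) \<ge> 3/4" by simp
  then show "1 + z \<notin> \<real>\<^sub>\<le>\<^sub>0" using complex_nonpos_Reals_iff by fastforce
  show "norm (1 + z) \<ge> 3/4" using r complex_Re_le_cmod[of "1+z"] by linarith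
  then show "1 + z \<noteq> 0" by auto
qed

lemma log_rest_deriv:
  assumes "norm z \<le> 1/4"
  shows "(log_rest has_field_derivative (1 / (1 + z) - 1)) (at z)"
  unfolding log_rest_def
  by (rule derivative_eq_intros refl one_plus_small[OF assms])+ (simp add: divide_inverse)

lemma log_rest_deriv_bound:
  fixes z :: complex
  assumes "norm z \<le> M" "M \<le> 1/4"
  shows "norm (1 / (1 + z) - 1) \<le> 2 * M"
proof -
  note o = one_plus_small[of z]
  have "1 / (1 + z) - 1 = - z / (1 + z)" using o assms by (simp add: field_simps)
  moreover have M0: "0 \<le> M" using assms norm_ge_zero order_trans by blast
  moreover have "norm z / norm (1 + z) \<le> M / (3/4)" using o assms M0 by (intro frac_le) auto
  moreover have "norm (1 / (1 + z) - 1) = norm z / norm (1 + z)" using calculation(1) by (simp add: norm_divide)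
  moreover have "M / (3/4) \<le> 2 * M" using M0 by simp
  ultimately show ?thesis by linarith
qed

lemma log_rest_0 [simp]: "log_rest 0 = 0" by (simp add: log_rest_def)

lemma log_rest_lipschitz:
  assumes "norm a \<le> M" "norm b \<le> M" "M \<le> 1/4"
  shows "norm (log_rest a - log_rest b) \<le> 2 * M * norm (a - b)"
proof (rule field_differentiable_bound[of "cball 0 M"])
  show "(log_rest has_field_derivative (1 / (1 + z) - 1)) (at z within cball 0 M)" if "z \<in> cball 0 M" for z :: complex
    using log_rest_deriv[of z] that assms by (auto intro: has_field_derivative_at_within)
  show "norm (1 / (1 + z) - 1) \<le> 2 * M" if "z \<in> cball 0 M" for z :: complex
    using log_rest_deriv_bound[of z M] that assms by auto
qed (use assms in auto)

text \<open>The four-point estimate is what makes the iteration contract in the Hoelder seminorm.\<close>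

lemma log_rest_four_point:
  assumes "norm a \<le> M" "norm b \<le> M" "norm c \<le> M" "norm d \<le> M" "M \<le> 1/4"
  shows "norm ((log_rest a - log_rest c) - (log_rest b - log_rest d)) \<le> 2 * M * norm ((a - c) - (b - d)) + 2 * (norm (a - b) + norm (c - d)) * norm (b - d)"
proof -
  \<comment> \<open>Two segments run in parallel, from \<open>c\<close> to \<open>a\<close> and from
    \<open>d\<close> to \<open>b\<close>. The mean value inequality for
    \<open>log_rest (P \<theta>) - log_rest (Q \<theta>)\<close> bounds the mixed difference: one
    part of the derivative contains the difference of the two velocities, the other the distance
    between the segments.\<close>
  define P Q where "P \<theta> = c + of_real \<theta> * (a - c)" and "Q \<theta> = d + of_real \<theta> * (b - d)" for \<theta> :: real
  have conv: "norm (u + of_real \<theta> * (v - u)) \<le> max (norm u) (norm v)" if "\<theta> \<in> {0..1}" for \<theta> :: real and u v :: complex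
  proof -
    have "norm ((1 - \<theta>) *\<^sub>R u + \<theta> *\<^sub>R v) \<le> (1 - \<theta>) * norm u + \<theta> * norm v"
      using that norm_triangle_ineq[of "(1 - \<theta>) *\<^sub>R u" "\<theta> *\<^sub>R v"] by simp
    also have "\<dots> \<le> (1 - \<theta>) * max (norm u) (norm v) + \<theta> * max (norm u) (norm v)"
      using that by (intro add_mono mult_left_mono) auto
    also have "(1 - \<theta>) *\<^sub>R u + \<theta> *\<^sub>R v = u + of_real \<theta> * (v - u)" by (simp add: scaleR_conv_of_real algebra_simps)
    finally show ?thesis by (simp add: algebra_simps)
  qed
  have PM: "norm (P \<theta>) \<le> M" and QM: "norm (Q \<theta>) \<le> M" if "\<theta> \<in> {0..1}" for \<theta>
    using conv[OF that, of c a] conv[OF that, of d b] assms by (auto simp: P_def Q_def)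
  have PQ: "norm (P \<theta> - Q \<theta>) \<le> norm (a - b) + norm (c - d)" if "\<theta> \<in> {0..1}" for \<theta>
  proof -
    have "P \<theta> - Q \<theta> = (c - d) + of_real \<theta> * ((a - b) - (c - d))" by (simp add: P_def Q_def algebra_simps)
    then have "norm (P \<theta> - Q \<theta>) \<le> max (norm (c - d)) (norm (a - b))" using conv[OF that, of "c - d" "a - b"] by simp
    then show ?thesis by (smt (verit) norm_ge_zero)
  qed
  let ?g = "\<lambda>\<theta>. log_rest (P \<theta>) - log_rest (Q \<theta>)"
  let ?g' = "\<lambda>\<theta>. (1 / (1 + P \<theta>) - 1) * (a - c) - (1 / (1 + Q \<theta>) - 1) * (b - d)"
  have dP: "((\<lambda>\<theta>. log_rest (u + of_real \<theta> * w)) has_vector_derivative (1 / (1 + (u + of_real \<theta> * w)) - 1) * w) (at \<theta> within {0..1})"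
    if "norm (u + of_real \<theta> * w) \<le> M" for u w \<theta>
  proof -
    have "((\<lambda>z. log_rest (u + z * w)) has_field_derivative (1 / (1 + (u + of_real \<theta> * w)) - 1) * w) (at (of_real \<theta>))"
      by (rule DERIV_chain2[OF log_rest_deriv]) (use that assms in \<open>auto intro!: derivative_eq_intros\<close>)
    from has_vector_derivative_real_field[OF this] show ?thesis by (simp add: has_vector_derivative_at_within)
  qed
  have "norm (?g 1 - ?g 0) \<le> (2 * M * norm ((a - c) - (b - d)) + 2 * (norm (a - b) + norm (c - d)) * norm (b - d)) * norm (1 - 0 :: real)"
  proof (rule differentiable_bound[of "{0..1}" ?g "\<lambda>\<theta> h. h *\<^sub>R ?g' \<theta>"])
    show "(?g has_derivative (\<lambda>h. h *\<^sub>R ?g' \<theta>)) (at \<theta> within {0..1})" if "\<theta> \<in> {0..1}" for \<theta>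
      using dP[of c \<theta> "a - c"] dP[of d \<theta> "b - d"] PM[OF that] QM[OF that]
      unfolding P_def Q_def has_vector_derivative_def[symmetric]
      by (intro has_vector_derivative_diff) auto
    have gb: "norm (?g' \<theta>) \<le> 2 * M * norm ((a - c) - (b - d)) + 2 * (norm (a - b) + norm (c - d)) * norm (b - d)" if "\<theta> \<in> {0..1}" for \<theta>
    proof -
      note p = one_plus_small[of "P \<theta>"] and q = one_plus_small[of "Q \<theta>"]
      have p3: "norm (1 + P \<theta>) \<ge> 3/4" and q3: "norm (1 + Q \<theta>) \<ge> 3/4" and nz: "1 + P \<theta> \<noteq> 0" "1 + Q \<theta> \<noteq> 0"
        using p q PM[OF that] QM[OF that] assms by auto
      have alg: "(p - 1) * A - (q - 1) * B = (p - 1) * (A - B) + (p - q) * B" for p q A B :: complex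
        by (simp add: algebra_simps)
      have "?g' \<theta> = (1 / (1 + P \<theta>) - 1) * ((a - c) - (b - d)) + (1 / (1 + P \<theta>) - 1 / (1 + Q \<theta>)) * (b - d)"
        by (rule alg)
      also have "norm \<dots> \<le> 2 * M * norm ((a - c) - (b - d)) + 2 * (norm (a - b) + norm (c - d)) * norm (b - d)"
      proof (intro norm_triangle_le add_mono; unfold norm_mult; intro mult_right_mono)
        show "norm (1 / (1 + P \<theta>) - 1) \<le> 2 * M" by (rule log_rest_deriv_bound[OF PM[OF that] assms(5)])
        have "1 / (1 + P \<theta>) - 1 / (1 + Q \<theta>) = (Q \<theta> - P \<theta>) / ((1 + P \<theta>) * (1 + Q \<theta>))"
          using nz by (simp add: field_simps)
        also have "norm \<dots> = norm (P \<theta> - Q \<theta>) / (norm (1 + P \<theta>) * norm (1 + Q \<theta>))" by (simp add: norm_divide norm_mult norm_minus_commute)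
        also have "\<dots> \<le> (norm (a - b) + norm (c - d)) / (3/4 * (3/4))"
          using PQ[OF that] p3 q3 by (intro frac_le mult_mono) auto
        also have "\<dots> \<le> 2 * (norm (a - b) + norm (c - d))" by simp
        finally show "norm (1 / (1 + P \<theta>) - 1 / (1 + Q \<theta>)) \<le> 2 * (norm (a - b) + norm (c - d))" .
      qed auto
      finally show ?thesis .
    qed
    have "norm (h *\<^sub>R ?g' \<theta>) \<le> (2 * M * norm ((a - c) - (b - d)) + 2 * (norm (a - b) + norm (c - d)) * norm (b - d)) * norm h"
      if "\<theta> \<in> {0..1}" for \<theta> h
      unfolding norm_scaleR real_norm_def using mult_left_mono[OF gb[OF that] abs_ge_zero[of h]] by (simp only: mult.commute)
    then show "onorm (\<lambda>h. h *\<^sub>R ?g' \<theta>) \<le> 2 * M * norm ((a - c) - (b - d)) + 2 * (norm (a - b) + norm (c - d)) * norm (b - d)"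
      if "\<theta> \<in> {0..1}" for \<theta>
      using that by (intro onorm_le)
  qed auto
  moreover have "?g 1 - ?g 0 = (log_rest a - log_rest c) - (log_rest b - log_rest d)" by (simp add: P_def Q_def)
  ultimately show ?thesis by simp
qed

lemma log_rest_measurable [measurable]:
  assumes [measurable]: "f \<in> borel_measurable M"
  shows "(\<lambda>x. log_rest (f x)) \<in> borel_measurable M"
  unfolding log_rest_def by measurable

text \<open>The complex parameters are constants of the iteration and are never integrated over:
  each triple \<open>l a b\<close> has its own fixed point, and holomorphy in the triple passes from
  step to step.\<close>

primrec picard :: "(real \<times> real \<Rightarrow> complex) \<Rightarrow> nat \<Rightarrow> real \<Rightarrow> real \<times> real \<Rightarrow> complex \<Rightarrow> complex \<Rightarrow> complex \<Rightarrow> complex" where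
  "picard \<phi> 0 = (\<lambda>t x l a b. 0)"
| "picard \<phi> (Suc n) = (\<lambda>t x l a b. heat \<phi> t x l a b + duhamel (\<lambda>s y. log_rest (picard \<phi> n s y l a b)) t x l a b)"

definition KK :: real where "KK = 1 + 2 * kC * gauss_mass + kC * gauss_mass * w0 + kH"
text \<open>Chosen such that \<open>M = 2 * KK * e\<close> satisfies
  \<open>12 * M * KK \<le> 1\<close>. This makes the contraction factor \<open>6 * M * KK\<close> at
  most \<open>1/2\<close> and keeps the nonlinear term \<open>2 * M * M * KK\<close> below
  \<open>M / 2\<close>.\<close>

definition e0 :: real where "e0 = 1 / (24 * KK\<^sup>2)"

lemma KK_bounds: "KK \<ge> 1" "kC * gauss_mass \<le> KK" "2 * kC * gauss_mass \<le> KK" "kC * gauss_mass * w0 \<le> KK" "kH \<le> KK" "kC * gauss_mass \<ge> 0" "kH \<ge> 0"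
proof -
  have "kC * gauss_mass \<ge> 0" "kC * gauss_mass * w0 \<ge> 0" "kH \<ge> 0"
    using kC_pos gauss_mass_nonneg w0_nonneg w1_nonneg by (simp_all add: kH_def)
  then show "KK \<ge> 1" "kC * gauss_mass \<le> KK" "2 * kC * gauss_mass \<le> KK" "kC * gauss_mass * w0 \<le> KK" "kH \<le> KK" "kC * gauss_mass \<ge> 0" "kH \<ge> 0"
    unfolding KK_def by linarith+
qed

lemma hoelder_mono: "hoelder A \<phi> \<Longrightarrow> A \<le> A' \<Longrightarrow> hoelder A' \<phi>"
  unfolding hoelder_def by (meson mult_right_mono norm_ge_zero order_trans real_sqrt_ge_zero)

lemma hoelder_D: "hoelder A \<phi> \<Longrightarrow> norm (\<phi> x - \<phi> y) \<le> A * sqrt (norm (x - y))"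
  unfolding hoelder_def by blast

lemma hoelder_add:
  assumes "hoelder A \<phi>" "hoelder B \<psi>"
  shows "hoelder (A + B) (\<lambda>x. \<phi> x + \<psi> x)"
  unfolding hoelder_def
proof (intro allI)
  fix x y
  have "norm ((\<phi> x + \<psi> x) - (\<phi> y + \<psi> y)) \<le> norm (\<phi> x - \<phi> y) + norm (\<psi> x - \<psi> y)"
    using norm_triangle_ineq[of "\<phi> x - \<phi> y" "\<psi> x - \<psi> y"] by (simp add: algebra_simps)
  also have "\<dots> \<le> A * sqrt (norm (x - y)) + B * sqrt (norm (x - y))"
    using assms unfolding hoelder_def by (intro add_mono) blast+
  finally show "norm ((\<phi> x + \<psi> x) - (\<phi> y + \<psi> y)) \<le> (A + B) * sqrt (norm (x - y))" by (simp add: algebra_simps)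
qed

lemma admissible_log_rest:
  assumes f: "admissible A M \<beta> f" and M: "M \<le> 1/4"
  shows "admissible (2 * M * A) M \<beta> (\<lambda>s y. log_rest (f s y))"
  unfolding admissible_def
proof (intro conjI allI impI)
  have [measurable]: "(\<lambda>q. f (fst q) (snd q)) \<in> borel_measurable borel" using f by (simp add: admissible_def)
  show "(\<lambda>q. log_rest (f (fst q) (snd q))) \<in> borel_measurable borel" by measurable
  have M0: "0 \<le> M" by (rule admissible_nonneg(2)[OF f])
  fix s :: real assume s: "s > 0"
  note b = admissible_bound[OF f s]
  show "norm (log_rest (f s y)) \<le> M" for y
  proof -
    have "norm (log_rest (f s y) - log_rest 0) \<le> 2 * M * norm (f s y - 0)" using b M M0 by (intro log_rest_lipschitz) auto
    also have "\<dots> \<le> 1 * M" using b M M0 by (intro mult_mono) auto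
    finally show ?thesis by simp
  qed
  show "hoelder (2 * M * A * s powr - \<beta>) (\<lambda>y. log_rest (f s y))" unfolding hoelder_def
  proof (intro allI)
    fix x y
    have "norm (log_rest (f s x) - log_rest (f s y)) \<le> 2 * M * norm (f s x - f s y)" by (rule log_rest_lipschitz[OF b b M])
    also have "\<dots> \<le> 2 * M * (A * s powr - \<beta> * sqrt (norm (x - y)))"
      using M0 by (intro mult_left_mono hoelder_D[OF admissible_hoelder[OF f s]]) auto
    finally show "norm (log_rest (f s x) - log_rest (f s y)) \<le> 2 * M * A * s powr - \<beta> * sqrt (norm (x - y))" by (simp add: mult_ac)
  qed
qed

lemma picard_measurable:
  assumes "\<phi> \<in> borel_measurable borel"
  shows "(\<lambda>q. picard \<phi> n (fst q) (snd q) l a b) \<in> borel_measurable borel"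
proof (induction n)
  case (Suc n)
  note [measurable] = Suc
  have "(\<lambda>q. log_rest (picard \<phi> n (fst q) (snd q) l a b)) \<in> borel_measurable borel" by measurable
  from duhamel_measurable[OF this] heat_measurable[OF assms] show ?case
    unfolding picard.simps by (intro borel_measurable_add)
qed simp

text \<open>\<open>e\<close> bounds the initial data, and \<open>M\<close> the solution together with its weighted Hoelder seminorm.\<close>

locale small_data =
  fixes e M :: real
  assumes e: "0 \<le> e" "e \<le> e0" and M_def: "M = 2 * KK * e"
begin

lemma M: "0 \<le> M" "M \<le> 1/12" "M \<le> 1/4" "12 * M * KK \<le> 1"
proof -
  show "0 \<le> M" using e KK_bounds(1) by (simp add: M_def)
  have "e * (24 * KK\<^sup>2) \<le> e0 * (24 * KK\<^sup>2)" using e by (intro mult_right_mono) auto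
  also have "\<dots> = 1" using KK_bounds(1) by (simp add: e0_def)
  finally show 1: "12 * M * KK \<le> 1" by (simp add: M_def power2_eq_square mult_ac)
  have "12 * M * 1 \<le> 12 * M * KK" using KK_bounds(1) \<open>0 \<le> M\<close> by (intro mult_left_mono) auto
  with 1 show "M \<le> 1/12" by simp
  then show "M \<le> 1/4" by simp
qed

lemma admissible_step:
  assumes p: "par l a b" and \<phi>: "\<phi> \<in> borel_measurable borel" "\<And>y. norm (\<phi> y) \<le> e"
    and f: "admissible M M (1/4) f" and m: "(\<lambda>q. heat \<phi> (fst q) (snd q) l a b + duhamel (\<lambda>s y. log_rest (f s y)) (fst q) (snd q) l a b) \<in> borel_measurable borel"
  shows "admissible M M (1/4) (\<lambda>t x. heat \<phi> t x l a b + duhamel (\<lambda>s y. log_rest (f s y)) t x l a b)"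
  unfolding admissible_def
proof (intro conjI allI impI m)
  fix t :: real assume t: "t > 0"
  note N = admissible_log_rest[OF f M(3)]
  \<comment> \<open>The bound \<open>M\<close> is shared equally: one half for the heat flow of the
    data, one half for the Duhamel term.\<close>
  have K2: "KK * (2 * M * M) \<le> M / 2" using mult_right_mono[OF M(4) M(1)] M(1) by (simp add: algebra_simps)
  have Ke: "KK * e = M / 2" by (simp add: M_def)
  have M2: "0 \<le> 2 * M * M" using M(1) by simp
  show "norm (heat \<phi> t x l a b + duhamel (\<lambda>s y. log_rest (f s y)) t x l a b) \<le> M" for x
  proof -
    have "norm (heat \<phi> t x l a b) \<le> kC * gauss_mass * e" by (rule heat_bound[OF p \<phi>])
    also have "\<dots> \<le> KK * e" using KK_bounds e by (intro mult_right_mono) auto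
    finally have 1: "norm (heat \<phi> t x l a b) \<le> M / 2" unfolding Ke .
    have "norm (duhamel (\<lambda>s y. log_rest (f s y)) t x l a b) \<le> kC * gauss_mass * w0 * (2 * M * M) * t powr (1/4 - 1/4)"
      by (rule duhamel_bound[OF p N _ _ t]) auto
    also have "\<dots> = kC * gauss_mass * w0 * (2 * M * M)" using t by simp
    also have "\<dots> \<le> KK * (2 * M * M)" using KK_bounds M2 by (intro mult_right_mono) auto
    finally have 2: "norm (duhamel (\<lambda>s y. log_rest (f s y)) t x l a b) \<le> M / 2" using K2 by linarith
    show ?thesis using norm_triangle_mono[OF 1 2] by simp
  qed
  have tp: "t powr (-(1/4)) \<ge> 0" by simp
  have "t powr (-1/4) = t powr (-(1/4))" by simp
  with heat_hoelder[OF p \<phi> t] have h: "hoelder (2 * kC * gauss_mass * e * t powr (-(1/4))) (\<lambda>x. heat \<phi> t x l a b)" by (simp only:)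
  have "2 * kC * gauss_mass * e \<le> M / 2" using mult_right_mono[OF KK_bounds(3) e(1)] unfolding Ke .
  then have 1: "hoelder (M / 2 * t powr (-(1/4))) (\<lambda>x. heat \<phi> t x l a b)"
    by (rule hoelder_mono[OF h mult_right_mono[OF _ tp]])
  have h2: "hoelder (kH * (2 * M * M) * t powr (-(1/4))) (\<lambda>x. duhamel (\<lambda>s y. log_rest (f s y)) t x l a b)"
    by (rule duhamel_hoelder[OF p N _ _ t]) auto
  have "kH * (2 * M * M) \<le> M / 2" using mult_right_mono[OF KK_bounds(5) M2] K2 by linarith
  then have 2: "hoelder (M / 2 * t powr (-(1/4))) (\<lambda>x. duhamel (\<lambda>s y. log_rest (f s y)) t x l a b)"
    by (rule hoelder_mono[OF h2 mult_right_mono[OF _ tp]])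
  show "hoelder (M * t powr - (1/4)) (\<lambda>x. heat \<phi> t x l a b + duhamel (\<lambda>s y. log_rest (f s y)) t x l a b)"
    using hoelder_add[OF 1 2] by (simp add: algebra_simps)
qed

lemma picard_admissible:
  assumes p: "par l a b" and \<phi>: "\<phi> \<in> borel_measurable borel" "\<And>y. norm (\<phi> y) \<le> e"
  shows "admissible M M (1/4) (\<lambda>t x. picard \<phi> n t x l a b)"
proof (induction n)
  case 0
  then show ?case using M(1) by (simp add: admissible_def hoelder_def)
next
  case (Suc n)
  show ?case using admissible_step[OF p \<phi> Suc] picard_measurable[OF \<phi>(1), of "Suc n"] by simp
qed

lemma picard_diff_admissible:
  assumes p: "par l a b" and \<phi>: "\<phi> \<in> borel_measurable borel" "\<And>y. norm (\<phi> y) \<le> e"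
  shows "admissible (M * (1/2)^n) (M * (1/2)^n) (1/4) (\<lambda>t x. picard \<phi> (Suc n) t x l a b - picard \<phi> n t x l a b)"
proof (induction n)
  case 0
  show ?case using picard_admissible[OF p \<phi>, of "Suc 0"] by simp
next
  case (Suc n)
  define \<delta> where "\<delta> = M * (1/2)^n"
  have d0: "\<delta> \<ge> 0" using M(1) by (simp add: \<delta>_def)
  let ?H = "\<lambda>n s y. picard \<phi> n s y l a b"
  let ?g = "\<lambda>s y. log_rest (?H (Suc n) s y) - log_rest (?H n s y)"
  have H: "admissible M M (1/4) (?H n)" for n by (rule picard_admissible[OF p \<phi>])
  note D = Suc[folded \<delta>_def]
  have gauss_mass: "(\<lambda>q. ?g (fst q) (snd q)) \<in> borel_measurable borel"
    using picard_measurable[OF \<phi>(1), of _ l a b] by (intro borel_measurable_diff log_rest_measurable)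
  \<comment> \<open>In the four-point estimate the Hoelder increment of the difference contributes
    \<open>2 * M\<close>, and the increments of the two iterates, each of size \<open>M\<close>,
    contribute \<open>4 * M\<close>; hence the factor \<open>6\<close>.\<close>
  have g: "admissible (6 * M * \<delta>) \<delta> (1/4) ?g"
    unfolding admissible_def
  proof (intro conjI allI impI gauss_mass)
    fix s :: real assume s: "s > 0"
    note b = admissible_bound[OF H s] and db = admissible_bound[OF D s]
    show "norm (?g s y) \<le> \<delta>" for y
    proof -
      have "norm (?g s y) \<le> 2 * M * norm (?H (Suc n) s y - ?H n s y)" by (rule log_rest_lipschitz[OF b b M(3)])
      also have "\<dots> \<le> 1 * \<delta>" using db M d0 by (intro mult_mono) auto
      finally show ?thesis by simp
    qed
    show "hoelder (6 * M * \<delta> * s powr - (1/4)) (?g s)" unfolding hoelder_def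
    proof (intro allI)
      fix x y :: "real \<times> real"
      define r where "r = s powr - (1/4) * sqrt (norm (x - y))"
      have r: "r \<ge> 0" by (simp add: r_def)
      have h: "norm (?H m s x - ?H m s y) \<le> M * r" for m
        using hoelder_D[OF admissible_hoelder[OF H s], of m x y] unfolding r_def by (simp only: mult.assoc)
      have dh: "norm ((?H (Suc n) s x - ?H n s x) - (?H (Suc n) s y - ?H n s y)) \<le> \<delta> * r"
        using hoelder_D[OF admissible_hoelder[OF D s], of x y] unfolding r_def by (simp only: mult.assoc)
      have "norm (?g s x - ?g s y) \<le> 2 * M * norm ((?H (Suc n) s x - ?H n s x) - (?H (Suc n) s y - ?H n s y))
         + 2 * (norm (?H (Suc n) s x - ?H (Suc n) s y) + norm (?H n s x - ?H n s y)) * norm (?H (Suc n) s y - ?H n s y)"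
        by (rule log_rest_four_point[OF b b b b M(3)])
      also have "\<dots> \<le> 2 * M * (\<delta> * r) + 2 * (M * r + M * r) * \<delta>"
        using dh h[of n] h[of "Suc n"] db[of y] M(1) r by (intro add_mono mult_mono mult_left_mono) auto
      finally show "norm (?g s x - ?g s y) \<le> 6 * M * \<delta> * s powr - (1/4) * sqrt (norm (x - y))"
        by (simp add: r_def algebra_simps)
    qed
  qed
  have eq: "picard \<phi> (Suc (Suc n)) t x l a b - picard \<phi> (Suc n) t x l a b = duhamel ?g t x l a b" if t: "t > 0" for t x
    using duhamel_diff[OF p admissible_log_rest[OF H M(3)] admissible_log_rest[OF H M(3)] _ _ t, of "Suc n" n x] by simp
  have K: "KK * (6 * M * \<delta>) \<le> \<delta> / 2" using mult_right_mono[OF M(4) d0] by (simp add: algebra_simps)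
  have M6: "0 \<le> 6 * M * \<delta>" using M(1) d0 by simp
  have "admissible (\<delta>/2) (\<delta>/2) (1/4) (\<lambda>t x. picard \<phi> (Suc (Suc n)) t x l a b - picard \<phi> (Suc n) t x l a b)"
    unfolding admissible_def
  proof (intro conjI allI impI)
    show "(\<lambda>q. picard \<phi> (Suc (Suc n)) (fst q) (snd q) l a b - picard \<phi> (Suc n) (fst q) (snd q) l a b) \<in> borel_measurable borel"
      by (intro borel_measurable_diff picard_measurable[OF \<phi>(1)])
    fix t :: real assume t: "t > 0"
    show "norm (picard \<phi> (Suc (Suc n)) t x l a b - picard \<phi> (Suc n) t x l a b) \<le> \<delta>/2" for x
    proof -
      have "norm (duhamel ?g t x l a b) \<le> kC * gauss_mass * w0 * (6 * M * \<delta>) * t powr (1/4 - 1/4)"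
        by (rule duhamel_bound[OF p g _ _ t]) auto
      also have "\<dots> = kC * gauss_mass * w0 * (6 * M * \<delta>)" using t by simp
      also have "\<dots> \<le> KK * (6 * M * \<delta>)" using KK_bounds M6 by (intro mult_right_mono) auto
      finally show ?thesis unfolding eq[OF t] using K by linarith
    qed
    have h: "hoelder (kH * (6 * M * \<delta>) * t powr (-(1/4))) (\<lambda>x. duhamel ?g t x l a b)"
      by (rule duhamel_hoelder[OF p g _ _ t]) auto
    have "kH * (6 * M * \<delta>) \<le> \<delta> / 2" using mult_right_mono[OF KK_bounds(5) M6] K by linarith
    then show "hoelder (\<delta> / 2 * t powr -(1/4)) (\<lambda>x. picard \<phi> (Suc (Suc n)) t x l a b - picard \<phi> (Suc n) t x l a b)"
      unfolding eq[OF t] by (rule hoelder_mono[OF h mult_right_mono]) simp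
  qed
  then show ?case by (simp add: \<delta>_def)
qed

end

section \<open>The fixed point and its dependence on data and parameters\<close>

definition sol :: "(real \<times> real \<Rightarrow> complex) \<Rightarrow> real \<Rightarrow> real \<times> real \<Rightarrow> complex \<Rightarrow> complex \<Rightarrow> complex \<Rightarrow> complex" where
  "sol \<phi> t x l a b = lim (\<lambda>n. picard \<phi> n t x l a b)"

context small_data
begin

text \<open>The geometric rate depends neither on the data nor on \<open>t\<close>, \<open>x\<close>
  or the complex parameters. This uniformity permits the later interchanges of limits, both for
  convergent data and for holomorphy.\<close>

lemma picard_sol:
  assumes p: "par l a b" and \<phi>: "\<phi> \<in> borel_measurable borel" "\<And>y. norm (\<phi> y) \<le> e" and t: "t > 0"
  shows "(\<lambda>n. picard \<phi> n t x l a b) \<longlonglongrightarrow> sol \<phi> t x l a b"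
    "norm (sol \<phi> t x l a b - picard \<phi> n t x l a b) \<le> 2 * M * (1/2)^n"
proof -
  let ?u = "\<lambda>n. picard \<phi> n t x l a b"
  let ?d = "\<lambda>k. ?u (Suc k) - ?u k"
  have d: "norm (?d k) \<le> M * (1/2)^k" for k using admissible_bound[OF picard_diff_admissible[OF p \<phi>] t] .
  have s: "summable (\<lambda>k. M * (1/2)^k)" by (intro summable_mult) (simp add: summable_geometric)
  have ds: "summable ?d" by (rule summable_comparison_test[OF _ s]) (use d in blast)
  have part: "(\<Sum>k<n. ?d k) = ?u n" for n by (subst sum_lessThan_telescope) simp
  have "convergent ?u" using ds unfolding summable_iff_convergent part .
  then show lim: "?u \<longlonglongrightarrow> sol \<phi> t x l a b" unfolding sol_def by (simp add: convergent_LIMSEQ_iff)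
  have geo: "(\<Sum>k=n..<m. (1/2::real)^k) \<le> 2 * (1/2)^n" for m
  proof (cases "n \<le> m")
    case True
    then have "(\<Sum>k=n..<m. (1/2::real)^k) = 2 * (1/2)^n - 2 * (1/2)^m" by (induction rule: dec_induct) auto
    then show ?thesis by simp
  qed simp
  have "norm (?u m - ?u n) \<le> 2 * M * (1/2)^n" if "m \<ge> n" for m
  proof -
    have "?u m - ?u n = (\<Sum>k=n..<m. ?d k)" using sum_Suc_diff'[OF that, of ?u] by simp
    also have "norm \<dots> \<le> (\<Sum>k=n..<m. M * (1/2)^k)" using d by (intro sum_norm_le) auto
    also have "\<dots> = M * (\<Sum>k=n..<m. (1/2)^k)" by (simp add: sum_distrib_left)
    also have "\<dots> \<le> M * (2 * (1/2)^n)" by (intro mult_left_mono geo M(1))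
    finally show ?thesis by simp
  qed
  then show "norm (sol \<phi> t x l a b - ?u n) \<le> 2 * M * (1/2)^n"
    by (intro tendsto_upperbound[OF tendsto_norm[OF tendsto_diff[OF lim tendsto_const]]])
      (auto simp: eventually_sequentially)
qed

lemma hoelder_limit:
  assumes "\<And>n. hoelder A (f n)" "\<And>x. (\<lambda>n. f n x) \<longlonglongrightarrow> g x"
  shows "hoelder A g"
  unfolding hoelder_def
proof (intro allI)
  fix x y
  have "norm (f n x - f n y) \<le> A * sqrt (norm (x - y))" for n using assms(1) unfolding hoelder_def by blast
  then show "norm (g x - g y) \<le> A * sqrt (norm (x - y))"
    using assms(2) by (intro tendsto_upperbound[OF tendsto_norm[OF tendsto_diff[OF assms(2) assms(2)]]]) auto
qed

lemma sol_measurable: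
  assumes "\<phi> \<in> borel_measurable borel"
  shows "(\<lambda>q. sol \<phi> (fst q) (snd q) l a b) \<in> borel_measurable borel"
  unfolding sol_def using picard_measurable[OF assms] by (intro borel_measurable_lim_metric)

lemma sol_admissible:
  assumes p: "par l a b" and \<phi>: "\<phi> \<in> borel_measurable borel" "\<And>y. norm (\<phi> y) \<le> e"
  shows "admissible M M (1/4) (\<lambda>t x. sol \<phi> t x l a b)"
  unfolding admissible_def
proof (intro conjI allI impI sol_measurable \<phi>)
  fix t :: real assume t: "t > 0"
  note lim = picard_sol(1)[OF p \<phi> t]
  show "norm (sol \<phi> t x l a b) \<le> M" for x
    using tendsto_norm[OF lim] admissible_bound[OF picard_admissible[OF p \<phi>] t] by (intro tendsto_upperbound[OF tendsto_norm[OF lim]]) auto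
  show "hoelder (M * t powr -(1/4)) (\<lambda>x. sol \<phi> t x l a b)"
    by (rule hoelder_limit[OF admissible_hoelder[OF picard_admissible[OF p \<phi>] t] lim])
qed

lemma log_rest_tendsto:
  assumes "f \<longlonglongrightarrow> z" "norm z \<le> 1/4"
  shows "(\<lambda>n. log_rest (f n)) \<longlonglongrightarrow> log_rest z"
  using isCont_tendsto_compose[OF DERIV_isCont[OF log_rest_deriv[OF assms(2)]] assms(1)] .

lemma sol_eq:
  assumes p: "par l a b" and \<phi>: "\<phi> \<in> borel_measurable borel" "\<And>y. norm (\<phi> y) \<le> e" and t: "t > 0"
  shows "sol \<phi> t x l a b = heat \<phi> t x l a b + duhamel (\<lambda>s y. log_rest (sol \<phi> s y l a b)) t x l a b"
proof (rule LIMSEQ_unique)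
  show "(\<lambda>n. picard \<phi> (Suc n) t x l a b) \<longlonglongrightarrow> sol \<phi> t x l a b"
    using picard_sol(1)[OF p \<phi> t] by (rule LIMSEQ_Suc)
  have "norm (sol \<phi> s y l a b) \<le> 1/4" if "s > 0" for s y
    using admissible_bound[OF sol_admissible[OF p \<phi>] that, of y] M by linarith
  then have "(\<lambda>n. duhamel (\<lambda>s y. log_rest (picard \<phi> n s y l a b)) t x l a b) \<longlonglongrightarrow> duhamel (\<lambda>s y. log_rest (sol \<phi> s y l a b)) t x l a b"
    by (intro duhamel_tendsto[OF p admissible_log_rest[OF picard_admissible[OF p \<phi>] M(3)] admissible_log_rest[OF sol_admissible[OF p \<phi>] M(3)] _ _ t] log_rest_tendsto picard_sol(1)[OF p \<phi>]) auto
  then show "(\<lambda>n. picard \<phi> (Suc n) t x l a b) \<longlonglongrightarrow> heat \<phi> t x l a b + duhamel (\<lambda>s y. log_rest (sol \<phi> s y l a b)) t x l a b"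
    by (simp add: tendsto_add)
qed

lemma picard_data_tendsto:
  assumes p: "par l a b" and \<phi>: "\<And>k. \<phi> k \<in> borel_measurable borel" "\<And>k y. norm (\<phi> k y) \<le> e"
    and \<psi>: "\<psi> \<in> borel_measurable borel" "\<And>y. norm (\<psi> y) \<le> e" and lim: "\<And>y. (\<lambda>k. \<phi> k y) \<longlonglongrightarrow> \<psi> y" and t: "t > 0"
  shows "(\<lambda>k. picard (\<phi> k) n t x l a b) \<longlonglongrightarrow> picard \<psi> n t x l a b"
  using t
proof (induction n arbitrary: t x)
  case (Suc n)
  have "norm (picard \<psi> n s y l a b) \<le> 1/4" if "s > 0" for s y
    using admissible_bound[OF picard_admissible[OF p \<psi>] that, of n y] M by linarith
  then have "(\<lambda>k. duhamel (\<lambda>s y. log_rest (picard (\<phi> k) n s y l a b)) t x l a b) \<longlonglongrightarrow> duhamel (\<lambda>s y. log_rest (picard \<psi> n s y l a b)) t x l a b"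
    by (intro duhamel_tendsto[OF p admissible_log_rest[OF picard_admissible[OF p \<phi>] M(3)] admissible_log_rest[OF picard_admissible[OF p \<psi>] M(3)] _ _ Suc(2)] log_rest_tendsto Suc.IH) auto
  moreover have "(\<lambda>k. heat (\<phi> k) t x l a b) \<longlonglongrightarrow> heat \<psi> t x l a b"
    unfolding heat_def using p by (intro kconv_tendsto[OF heat_kernel_kern \<phi>(1) \<psi>(1) \<phi>(2) lim]) (auto simp: par_def)
  ultimately show ?case by (simp add: tendsto_add)
qed simp

text \<open>An \<open>r/3\<close> argument: finitely many Picard steps are continuous in the data by
  dominated convergence, and the error of stopping is uniform in the data. This carries inequalities
  from continuous data over to the rough limit.\<close>

lemma sol_data_tendsto:
  assumes p: "par l a b" and \<phi>: "\<And>k. \<phi> k \<in> borel_measurable borel" "\<And>k y. norm (\<phi> k y) \<le> e"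
    and \<psi>: "\<psi> \<in> borel_measurable borel" "\<And>y. norm (\<psi> y) \<le> e" and lim: "\<And>y. (\<lambda>k. \<phi> k y) \<longlonglongrightarrow> \<psi> y" and t: "t > 0"
  shows "(\<lambda>k. sol (\<phi> k) t x l a b) \<longlonglongrightarrow> sol \<psi> t x l a b"
proof (rule LIMSEQ_I)
  fix r :: real assume r: "r > 0"
  have "(\<lambda>n. 2 * M * (1/2)^n) \<longlonglongrightarrow> 2 * M * 0" by (intro tendsto_intros) (simp add: LIMSEQ_realpow_zero)
  then have "\<forall>\<^sub>F n in sequentially. 2 * M * (1/2)^n < r/3" by (rule order_tendstoD(2)) (use r in simp)
  then obtain n where n: "2 * M * (1/2)^n < r/3" by (auto simp: eventually_sequentially)
  obtain K where K: "\<And>k. k \<ge> K \<Longrightarrow> norm (picard (\<phi> k) n t x l a b - picard \<psi> n t x l a b) < r/3"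
    using LIMSEQ_D[OF picard_data_tendsto[OF p \<phi> \<psi> lim t, of n x], of "r/3"] r by auto
  show "\<exists>K. \<forall>k\<ge>K. norm (sol (\<phi> k) t x l a b - sol \<psi> t x l a b) < r"
  proof (intro exI allI impI)
    fix k assume "k \<ge> K"
    note 1 = K[OF this] and 2 = picard_sol(2)[OF p \<phi>(1)[of k] \<phi>(2) t, of x n] and 3 = picard_sol(2)[OF p \<psi> t, of x n]
    have "norm (sol (\<phi> k) t x l a b - sol \<psi> t x l a b) \<le> norm (sol (\<phi> k) t x l a b - picard (\<phi> k) n t x l a b)
      + norm (picard (\<phi> k) n t x l a b - picard \<psi> n t x l a b) + norm (sol \<psi> t x l a b - picard \<psi> n t x l a b)"
      using norm_triangle_ineq4[of "sol (\<phi> k) t x l a b - picard \<psi> n t x l a b" "sol \<psi> t x l a b - picard \<psi> n t x l a b"]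
        norm_triangle_ineq[of "sol (\<phi> k) t x l a b - picard (\<phi> k) n t x l a b" "picard (\<phi> k) n t x l a b - picard \<psi> n t x l a b"] by simp
    then show "norm (sol (\<phi> k) t x l a b - sol \<psi> t x l a b) < r" using 1 2 3 n by linarith
  qed
qed

lemma picard_holomorphic:
  assumes S: "open S" and p: "\<And>z. z \<in> S \<Longrightarrow> par (l z) (a z) (b z)"
    and hol: "l holomorphic_on S" "a holomorphic_on S" "b holomorphic_on S"
    and \<phi>: "\<phi> \<in> borel_measurable borel" "\<And>y. norm (\<phi> y) \<le> e" and t: "t > 0"
  shows "(\<lambda>z. picard \<phi> n t x (l z) (a z) (b z)) holomorphic_on S"
  using t
proof (induction n arbitrary: t x)
  case (Suc n)
  have "(\<lambda>z. log_rest (picard \<phi> n s y (l z) (a z) (b z))) holomorphic_on S" if s: "s > 0" for s y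
  proof -
    have "1 + picard \<phi> n s y (l z) (a z) (b z) \<notin> \<real>\<^sub>\<le>\<^sub>0" if "z \<in> S" for z
      using admissible_bound[OF picard_admissible[OF p[OF that] \<phi>] s, of n y] M by (intro one_plus_small) linarith
    then show ?thesis unfolding log_rest_def by (intro holomorphic_intros Suc.IH s) auto
  qed
  then have "(\<lambda>z. duhamel (\<lambda>s y. log_rest (picard \<phi> n s y (l z) (a z) (b z))) t x (l z) (a z) (b z)) holomorphic_on S"
    using Suc(2) by (intro duhamel_holomorphic[OF S p hol admissible_log_rest[OF picard_admissible[OF p \<phi>] M(3)]]) auto
  then show ?case unfolding picard.simps by (intro holomorphic_intros heat_holomorphic[OF S p hol \<phi>]) auto
qed simp

lemma sol_holomorphic:
  assumes S: "open S" and p: "\<And>z. z \<in> S \<Longrightarrow> par (l z) (a z) (b z)"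
    and hol: "l holomorphic_on S" "a holomorphic_on S" "b holomorphic_on S"
    and \<phi>: "\<phi> \<in> borel_measurable borel" "\<And>y. norm (\<phi> y) \<le> e" and t: "t > 0"
  shows "(\<lambda>z. sol \<phi> t x (l z) (a z) (b z)) holomorphic_on S"
proof (rule holomorphic_uniform_sequence[OF S picard_holomorphic[OF S p hol \<phi> t]])
  fix w assume "w \<in> S"
  then obtain d where d: "d > 0" "cball w d \<subseteq> S" using S open_contains_cball by blast
  have l0: "(\<lambda>n. 2 * M * (1/2)^n) \<longlonglongrightarrow> 0" using tendsto_mult_right_zero[OF LIMSEQ_realpow_zero[of "1/2::real"], of "2 * M"] by simp
  have "uniform_limit (cball w d) (\<lambda>n z. picard \<phi> n t x (l z) (a z) (b z)) (\<lambda>z. sol \<phi> t x (l z) (a z) (b z)) sequentially"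
  proof (rule uniform_limitI)
    fix r :: real assume "r > 0"
    then have "\<forall>\<^sub>F n in sequentially. 2 * M * (1/2)^n < r" using order_tendstoD(2)[OF l0] by simp
    then show "\<forall>\<^sub>F n in sequentially. \<forall>z\<in>cball w d. dist (picard \<phi> n t x (l z) (a z) (b z)) (sol \<phi> t x (l z) (a z) (b z)) < r"
    proof eventually_elim
      case (elim n)
      show ?case
      proof
        fix z assume "z \<in> cball w d"
        then have "z \<in> S" using d(2) by blast
        from picard_sol(2)[OF p[OF this] \<phi> t, of x n] elim
        show "dist (picard \<phi> n t x (l z) (a z) (b z)) (sol \<phi> t x (l z) (a z) (b z)) < r"
          unfolding dist_norm using norm_minus_commute[of "picard \<phi> n t x (l z) (a z) (b z)" "sol \<phi> t x (l z) (a z) (b z)"] by linarith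
      qed
    qed
  qed
  then show "\<exists>d>0. cball w d \<subseteq> S \<and> uniform_limit (cball w d) (\<lambda>n z. picard \<phi> n t x (l z) (a z) (b z)) (\<lambda>z. sol \<phi> t x (l z) (a z) (b z)) sequentially"
    using d by blast
qed

lemma sol_hol3:
  assumes \<phi>: "\<phi> \<in> borel_measurable borel" "\<And>y. norm (\<phi> y) \<le> e" and t: "t > 0"
  shows "hol3 (1/4) M (\<lambda>l a b. sol \<phi> t x (1 + l) a b)"
proof -
  have p: "par (1 + l) a b" if "l \<in> ball 0 (1/4)" "a \<in> ball 0 (1/4)" "b \<in> ball 0 (1/4)" for l a b
    using that by (auto simp: par_def)
  have h: "(\<lambda>z. sol \<phi> t x (1 + l z) (a z) (b z)) holomorphic_on ball 0 (1/4)"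
    if lab: "\<And>z. z \<in> ball 0 (1/4) \<Longrightarrow> l z \<in> ball 0 (1/4) \<and> a z \<in> ball 0 (1/4) \<and> b z \<in> ball 0 (1/4)"
      "l holomorphic_on ball 0 (1/4)" "a holomorphic_on ball 0 (1/4)" "b holomorphic_on ball 0 (1/4)" for l a b
  proof (rule sol_holomorphic[OF open_ball _ _ lab(3,4) \<phi> t])
    show "par (1 + l z) (a z) (b z)" if "z \<in> ball 0 (1/4)" for z using lab(1)[OF that] p by blast
    show "(\<lambda>z. 1 + l z) holomorphic_on ball 0 (1/4)" by (rule holomorphic_on_add[OF holomorphic_on_const lab(2)])
  qed
  show ?thesis unfolding hol3_def
  proof (intro conjI ballI)
    fix l a b :: complex assume *: "l \<in> ball 0 (1/4)" "a \<in> ball 0 (1/4)" "b \<in> ball 0 (1/4)"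
    show "norm (sol \<phi> t x (1 + l) a b) \<le> M" by (rule admissible_bound[OF sol_admissible[OF p[OF *] \<phi>] t])
  next
    fix a b :: complex assume *: "a \<in> ball 0 (1/4)" "b \<in> ball 0 (1/4)"
    show "(\<lambda>l. sol \<phi> t x (1 + l) a b) holomorphic_on ball 0 (1/4)"
      by (rule h[where l="\<lambda>l. l" and a="\<lambda>_. a" and b="\<lambda>_. b"]) (use * in \<open>auto intro!: holomorphic_intros simp del: mem_ball mem_ball_0\<close>)
    show "(\<lambda>l. sol \<phi> t x (1 + a) l b) holomorphic_on ball 0 (1/4)"
      by (rule h[where a="\<lambda>l. l" and l="\<lambda>_. a" and b="\<lambda>_. b"]) (use * in \<open>auto intro!: holomorphic_intros simp del: mem_ball mem_ball_0\<close>)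
    show "(\<lambda>l. sol \<phi> t x (1 + a) b l) holomorphic_on ball 0 (1/4)"
      by (rule h[where b="\<lambda>l. l" and l="\<lambda>_. a" and a="\<lambda>_. b"]) (use * in \<open>auto intro!: holomorphic_intros simp del: mem_ball mem_ball_0\<close>)
  qed
qed

end

section \<open>Parabolic scaling and the heat semigroup\<close>

lemma integral_Reals:
  assumes "\<And>w. w \<in> space M \<Longrightarrow> f w \<in> \<real>"
  shows "(\<integral>w. f w \<partial>M) \<in> (\<real> :: complex set)"
proof -
  have "(\<integral>w. f w \<partial>M) = (\<integral>w. complex_of_real (Re (f w)) \<partial>M)"
    using assms by (intro Bochner_Integration.integral_cong) (auto simp: of_real_Re)
  also have "\<dots> = of_real (\<integral>w. Re (f w) \<partial>M)" by (rule integral_complex_of_real)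
  finally show ?thesis by simp
qed

definition k1 :: "real \<times> real \<Rightarrow> complex" where "k1 z = heat_kernel 1 (of_real (fst z)) (of_real (snd z))"
definition l1 :: "real \<times> real \<Rightarrow> complex" where "l1 z = heat_kernel_deriv 1 (of_real (fst z)) (of_real (snd z))"

lemma k1_eq: "k1 z = of_real (exp (- (norm z)\<^sup>2 / 4) / (4 * pi))"
  unfolding k1_def heat_kernel_def norm_prod_sq of_real_divide exp_of_real[symmetric] by simp

lemma l1_eq: "l1 z = of_real ((norm z)\<^sup>2 / 4 - 1) * k1 z"
  by (simp add: l1_def heat_kernel_deriv_def k1_def norm_prod_sq)

lemma k1_measurable [measurable]: "k1 \<in> borel_measurable borel"
  unfolding k1_eq by (intro borel_measurable_continuous_onI continuous_intros) auto

lemma l1_measurable [measurable]: "l1 \<in> borel_measurable borel"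
  unfolding l1_eq k1_eq by (intro borel_measurable_continuous_onI continuous_intros) auto

lemma k1_kern: "kern kC k1" and l1_kern: "kern kC l1" and l1_zero: "(\<integral>z. l1 z \<partial>lborel) = 0"
  using heat_kernel_kern[of 1 0 0] heat_kernel_deriv_kern[of 1 0 0] heat_kernel_deriv_integral_zero[of 1 0 0] by (simp_all add: k1_def[abs_def] l1_def[abs_def])

lemma heat_1: "heat \<phi> t x 1 0 0 = kconv k1 (sqrt t) \<phi> x"
  by (simp add: heat_def k1_def[abs_def])

lemma duhamel_integrand_1: "duhamel_integrand f t x 1 0 0 \<sigma> = kconv l1 (sqrt (t * \<sigma>)) (f (t * (1 - \<sigma>))) x"
  by (simp add: duhamel_integrand_def l1_def[abs_def])

lemma par_1: "par 1 0 0" by (simp add: par_def)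

lemma kconv_Reals: "(\<And>z. k z \<in> \<real>) \<Longrightarrow> (\<And>y. \<phi> y \<in> \<real>) \<Longrightarrow> kconv k s \<phi> x \<in> \<real>"
  unfolding kconv_def by (intro integral_Reals Reals_mult) auto

lemma log_rest_Reals:
  assumes "z \<in> \<real>" "norm z \<le> 1/4"
  shows "log_rest z \<in> \<real>"
proof -
  have "Re (1 + z) > 0" using abs_Re_le_cmod[of z] assms by simp
  then show ?thesis unfolding log_rest_def using assms(1) Ln_Reals_eq[of "1 + z"] by (simp add: Reals_diff)
qed

context small_data
begin

lemma picard_Reals:
  assumes \<phi>: "\<phi> \<in> borel_measurable borel" "\<And>y. norm (\<phi> y) \<le> e" "\<And>y. \<phi> y \<in> \<real>" and t: "t > 0"
  shows "picard \<phi> n t x 1 0 0 \<in> \<real>"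
  using t
proof (induction n arbitrary: t x)
  case (Suc n)
  have N: "log_rest (picard \<phi> n s y 1 0 0) \<in> \<real>" if "s > 0" for s y
    using admissible_bound[OF picard_admissible[OF par_1 \<phi>(1,2)] that, of n y] M by (intro log_rest_Reals Suc.IH that) linarith
  have "duhamel (\<lambda>s y. log_rest (picard \<phi> n s y 1 0 0)) t x 1 0 0 \<in> \<real>"
    unfolding duhamel_def duhamel_integrand_1
    by (intro integral_Reals Reals_divide kconv_Reals N) (use Suc(2) in \<open>auto simp: l1_eq k1_eq\<close>)
  moreover have "heat \<phi> t x 1 0 0 \<in> \<real>" unfolding heat_1 by (intro kconv_Reals \<phi>) (simp add: k1_eq)
  ultimately show ?case unfolding picard.simps by (rule Reals_add[rotated])
qed simp

lemma sol_Reals: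
  assumes \<phi>: "\<phi> \<in> borel_measurable borel" "\<And>y. norm (\<phi> y) \<le> e" "\<And>y. \<phi> y \<in> \<real>" and t: "t > 0"
  shows "sol \<phi> t x 1 0 0 \<in> \<real>"
  by (rule closed_sequentially[OF closed_complex_Reals _ picard_sol(1)[OF par_1 \<phi>(1,2) t]])
    (rule picard_Reals[OF \<phi> t])

end

lemma kconv_translate: "kconv k s (\<lambda>y. \<phi> (y + c)) x = kconv k s \<phi> (x + c)"
  by (simp add: kconv_def algebra_simps)

text \<open>Substitute \<open>z = - d + sqrt \<kappa> *\<^sub>R w\<close>; in two dimensions the
  Jacobian is \<open>\<kappa>\<close> and cancels the denominator in the hypothesis
  \<open>K\<close>.\<close>

lemma kconv_affine:
  assumes [measurable]: "K \<in> borel_measurable borel" "\<phi> \<in> borel_measurable borel" and \<kappa>: "\<kappa> > 0"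
    and K: "\<And>w. K (- d + sqrt \<kappa> *\<^sub>R w) = K' w / of_real \<kappa>"
  shows "kconv K s \<phi> x = kconv K' (sqrt \<kappa> * s) \<phi> (x + s *\<^sub>R d)"
proof -
  have "kconv K s \<phi> x = \<bar>sqrt \<kappa>\<bar> ^ DIM(real \<times> real) *\<^sub>R (\<integral>w. K (- d + sqrt \<kappa> *\<^sub>R w) * \<phi> (x - s *\<^sub>R (- d + sqrt \<kappa> *\<^sub>R w)) \<partial>lborel)"
    unfolding kconv_def using \<kappa> by (intro lborel_integral_affine) auto
  also have "\<bar>sqrt \<kappa>\<bar> ^ DIM(real \<times> real) = \<kappa>" using \<kappa> by (simp add: power2_eq_square)
  also have "(\<integral>w. K (- d + sqrt \<kappa> *\<^sub>R w) * \<phi> (x - s *\<^sub>R (- d + sqrt \<kappa> *\<^sub>R w)) \<partial>lborel)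
      = (\<integral>w. K' w * \<phi> (x + s *\<^sub>R d - (sqrt \<kappa> * s) *\<^sub>R w) / of_real \<kappa> \<partial>lborel)"
    unfolding K by (simp add: algebra_simps)
  also have "\<dots> = kconv K' (sqrt \<kappa> * s) \<phi> (x + s *\<^sub>R d) / of_real \<kappa>"
    unfolding kconv_def by (rule integral_divide_zero)
  finally show ?thesis using \<kappa> by (simp add: scaleR_conv_of_real)
qed

lemma heat_kernel_scale: "\<kappa> > 0 \<Longrightarrow> heat_kernel (of_real \<kappa>) (of_real (sqrt \<kappa>) * v) (of_real (sqrt \<kappa>) * w) = heat_kernel 1 v w / of_real \<kappa>"
proof -
  assume l: "\<kappa> > 0"
  have "((of_real (sqrt \<kappa>) * v)\<^sup>2 + (of_real (sqrt \<kappa>) * w)\<^sup>2) = of_real \<kappa> * (v\<^sup>2 + w\<^sup>2)"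
    using l by (simp add: power_mult_distrib distrib_left flip: of_real_power)
  moreover have "- (of_real \<kappa> * X) / (4 * of_real \<kappa>) = - X / (4 * 1)" for X :: complex using l by simp
  ultimately have "- ((of_real (sqrt \<kappa>) * v)\<^sup>2 + (of_real (sqrt \<kappa>) * w)\<^sup>2) / (4 * of_real \<kappa>) = - (v\<^sup>2 + w\<^sup>2) / (4 * 1)" by metis
  then show ?thesis unfolding heat_kernel_def by (simp only: divide_divide_eq_left mult_ac mult_1_right mult_1_left)
qed

lemma heat_kernel_deriv_scale: "\<kappa> > 0 \<Longrightarrow> heat_kernel_deriv (of_real \<kappa>) (of_real (sqrt \<kappa>) * v) (of_real (sqrt \<kappa>) * w) = heat_kernel_deriv 1 v w / of_real \<kappa>"
proof -
  assume l: "\<kappa> > 0"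
  have "((of_real (sqrt \<kappa>) * v)\<^sup>2 + (of_real (sqrt \<kappa>) * w)\<^sup>2) = of_real \<kappa> * (v\<^sup>2 + w\<^sup>2)"
    using l by (simp add: power_mult_distrib distrib_left flip: of_real_power)
  then show ?thesis unfolding heat_kernel_deriv_def using l by (simp add: heat_kernel_scale)
qed

lemma heat_scale:
  assumes \<phi>: "\<phi> \<in> borel_measurable borel" and \<kappa>: "\<kappa> > 0"
  shows "heat \<phi> t x (of_real \<kappa>) (of_real \<alpha>) (of_real \<beta>) = heat \<phi> (\<kappa> * t) (x + sqrt t *\<^sub>R (\<alpha>, \<beta>)) 1 0 0"
proof -
  have [measurable]: "(\<lambda>z::real\<times>real. fst z) \<in> borel_measurable borel" "(\<lambda>z::real\<times>real. snd z) \<in> borel_measurable borel"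
    by (intro borel_measurable_continuous_onI continuous_intros)+
  have "heat \<phi> t x (of_real \<kappa>) (of_real \<alpha>) (of_real \<beta>) = kconv k1 (sqrt \<kappa> * sqrt t) \<phi> (x + sqrt t *\<^sub>R (\<alpha>, \<beta>))"
    unfolding heat_def
  proof (rule kconv_affine[OF _ \<phi> \<kappa>])
    show "(\<lambda>z::real\<times>real. heat_kernel (of_real \<kappa>) (of_real (fst z) + of_real \<alpha>) (of_real (snd z) + of_real \<beta>)) \<in> borel_measurable borel"
      by measurable
  qed (use heat_kernel_scale[OF \<kappa>] in \<open>simp add: k1_def\<close>)
  then show ?thesis by (simp add: heat_1 real_sqrt_mult)
qed

text \<open>The shift in the kernel and the shift of the source at the earlier time add up to
  \<open>sqrt t *\<^sub>R (\<alpha>, \<beta>)\<close> for every \<open>\<sigma>\<close>. The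
  function \<open>th\<close> is determined by this requirement.\<close>

lemma duhamel_integrand_scale:
  assumes f: "f (t * (1 - \<sigma>)) \<in> borel_measurable borel" and \<kappa>: "\<kappa> > 0" and t: "t > 0" and s: "0 < \<sigma>" "\<sigma> < 1"
    and F: "\<And>y. f (t * (1 - \<sigma>)) y = F (\<kappa> * t * (1 - \<sigma>)) (y + sqrt (t * (1 - \<sigma>)) *\<^sub>R (\<alpha>, \<beta>))"
  shows "duhamel_integrand f t x (of_real \<kappa>) (of_real \<alpha>) (of_real \<beta>) \<sigma> = duhamel_integrand F (\<kappa> * t) (x + sqrt t *\<^sub>R (\<alpha>, \<beta>)) 1 0 0 \<sigma>"
proof -
  have [measurable]: "(\<lambda>z::real\<times>real. fst z) \<in> borel_measurable borel" "(\<lambda>z::real\<times>real. snd z) \<in> borel_measurable borel"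
    by (intro borel_measurable_continuous_onI continuous_intros)+
  let ?d = "th \<sigma> *\<^sub>R (\<alpha>, \<beta>)"
  have "duhamel_integrand f t x (of_real \<kappa>) (of_real \<alpha>) (of_real \<beta>) \<sigma>
      = kconv l1 (sqrt \<kappa> * sqrt (t * \<sigma>)) (f (t * (1 - \<sigma>))) (x + sqrt (t * \<sigma>) *\<^sub>R ?d)"
    unfolding duhamel_integrand_def
  proof (rule kconv_affine[OF _ f \<kappa>])
    show "(\<lambda>z::real\<times>real. heat_kernel_deriv (of_real \<kappa>) (of_real (fst z) + of_real (th \<sigma>) * of_real \<alpha>) (of_real (snd z) + of_real (th \<sigma>) * of_real \<beta>)) \<in> borel_measurable borel"
      by measurable
  qed (use heat_kernel_deriv_scale[OF \<kappa>] in \<open>simp add: l1_def\<close>)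
  also have "f (t * (1 - \<sigma>)) = (\<lambda>y. F (\<kappa> * t * (1 - \<sigma>)) (y + sqrt (t * (1 - \<sigma>)) *\<^sub>R (\<alpha>, \<beta>)))" using F by auto
  also have "kconv l1 (sqrt \<kappa> * sqrt (t * \<sigma>)) \<dots> (x + sqrt (t * \<sigma>) *\<^sub>R ?d)
      = kconv l1 (sqrt (\<kappa> * t * \<sigma>)) (F (\<kappa> * t * (1 - \<sigma>))) (x + (sqrt (t * \<sigma>) * th \<sigma> + sqrt (t * (1 - \<sigma>))) *\<^sub>R (\<alpha>, \<beta>))"
    unfolding kconv_translate by (simp add: real_sqrt_mult algebra_simps)
  also have "sqrt (t * \<sigma>) * th \<sigma> + sqrt (t * (1 - \<sigma>)) = sqrt t"
  proof -
    have "sqrt (t * \<sigma>) * th \<sigma> = sqrt t * (1 - sqrt (1 - \<sigma>))" using s by (simp add: th_def real_sqrt_mult)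
    then show ?thesis by (simp only: real_sqrt_mult) (simp add: algebra_simps)
  qed
  finally show ?thesis by (simp add: duhamel_integrand_1)
qed

lemma picard_slice_measurable:
  assumes "\<phi> \<in> borel_measurable borel"
  shows "(\<lambda>y. picard \<phi> n s y l a b) \<in> borel_measurable borel"
proof -
  have "(\<lambda>y. (s, y)) \<in> measurable borel (borel :: (real \<times> (real \<times> real)) measure)"
    by (intro borel_measurable_continuous_onI continuous_intros)
  from measurable_compose[OF this picard_measurable[OF assms, of n l a b]] show ?thesis by simp
qed

text \<open>Real parameters only evaluate the same iterate at another time and position. Holomorphy
  in the parameters is thereby analyticity in space and time.\<close>

lemma picard_scale:
  assumes \<phi>: "\<phi> \<in> borel_measurable borel" and \<kappa>: "\<kappa> > 0" and t: "t > 0"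
  shows "picard \<phi> n t x (of_real \<kappa>) (of_real \<alpha>) (of_real \<beta>) = picard \<phi> n (\<kappa> * t) (x + sqrt t *\<^sub>R (\<alpha>, \<beta>)) 1 0 0"
  using t
proof (induction n arbitrary: t x)
  case (Suc n)
  let ?f = "\<lambda>s y. log_rest (picard \<phi> n s y (of_real \<kappa>) (of_real \<alpha>) (of_real \<beta>))" and ?F = "\<lambda>s y. log_rest (picard \<phi> n s y 1 0 0)"
  have "duhamel ?f t x (of_real \<kappa>) (of_real \<alpha>) (of_real \<beta>) = duhamel ?F (\<kappa> * t) (x + sqrt t *\<^sub>R (\<alpha>, \<beta>)) 1 0 0"
    unfolding duhamel_def
  proof (rule Bochner_Integration.integral_cong[OF refl])
    fix \<sigma> assume "\<sigma> \<in> space W"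
    then have s: "0 < \<sigma>" "\<sigma> < 1" by auto
    have "duhamel_integrand ?f t x (of_real \<kappa>) (of_real \<alpha>) (of_real \<beta>) \<sigma> = duhamel_integrand ?F (\<kappa> * t) (x + sqrt t *\<^sub>R (\<alpha>, \<beta>)) 1 0 0 \<sigma>"
      by (rule duhamel_integrand_scale[OF log_rest_measurable[OF picard_slice_measurable[OF \<phi>]] \<kappa> Suc(2) s])
        (use Suc.IH[of "t * (1 - \<sigma>)"] Suc(2) s in \<open>simp add: mult.assoc\<close>)
    then show "duhamel_integrand ?f t x (of_real \<kappa>) (of_real \<alpha>) (of_real \<beta>) \<sigma> / of_real \<sigma> = duhamel_integrand ?F (\<kappa> * t) (x + sqrt t *\<^sub>R (\<alpha>, \<beta>)) 1 0 0 \<sigma> / of_real \<sigma>"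
      by simp
  qed
  then show ?case by (simp add: heat_scale[OF \<phi> \<kappa>])
qed simp

lemma sol_scale:
  assumes \<phi>: "\<phi> \<in> borel_measurable borel" and \<kappa>: "\<kappa> > 0" and t: "t > 0"
  shows "sol \<phi> t x (of_real \<kappa>) (of_real \<alpha>) (of_real \<beta>) = sol \<phi> (\<kappa> * t) (x + sqrt t *\<^sub>R (\<alpha>, \<beta>)) 1 0 0"
  unfolding sol_def by (simp add: picard_scale[OF assms])

section \<open>Gaussian moments and the semigroup property\<close>

definition nd :: "real \<Rightarrow> real" where "nd = normal_density 0 (sqrt 2)"
definition mom :: "nat \<Rightarrow> real" where "mom i = (\<integral>x. nd x * x ^ i \<partial>lborel)"

lemma mom_has: "has_bochner_integral lborel (\<lambda>x. nd x * x ^ i) (mom i)"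
  using integrable_normal_moment[of "sqrt 2" 0 i] by (simp add: has_bochner_integral_iff mom_def nd_def)

lemma mom_values: "mom 0 = 1" "mom 1 = 0" "mom (Suc 0) = 0" "mom 2 = 2" "mom 3 = 0" "mom 4 = 12"
  using integral_normal_moment_even[of "sqrt 2" 0 0] integral_normal_moment_odd[of "sqrt 2" 0 0]
    integral_normal_moment_even[of "sqrt 2" 0 1] integral_normal_moment_odd[of "sqrt 2" 0 1]
    integral_normal_moment_even[of "sqrt 2" 0 2]
  by (simp_all add: mom_def nd_def eval_nat_numeral)

text \<open>The plane heat kernel at time \<open>1\<close> is the product of two normal densities of
  variance \<open>2\<close>, so its moments reduce to one-dimensional ones.\<close>

lemma k1_nd: "k1 z = of_real (nd (fst z) * nd (snd z))"
proof -
  have "nd (fst z) * nd (snd z) = exp (- (norm z)\<^sup>2 / 4) / (4 * pi)"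
    by (simp add: nd_def normal_density_def norm_prod_sq diff_divide_distrib add_divide_distrib real_sqrt_mult flip: exp_add)
  then show ?thesis by (simp add: k1_eq)
qed

lemma k1_moment: "has_bochner_integral lborel (\<lambda>z. k1 z * (of_real (fst z ^ i) * of_real (snd z ^ j))) (of_real (mom i * mom j))"
proof -
  have "has_bochner_integral lborel (\<lambda>z::real\<times>real. complex_of_real ((nd (fst z) * fst z ^ i) * (nd (snd z) * snd z ^ j))) (of_real (mom i * mom j))"
    by (intro has_bochner_integral_of_real has_bochner_integral_lborel_prod mom_has)
  then show ?thesis by (simp add: k1_nd mult_ac)
qed

lemma k1_quadratic_integral:
  fixes c0 c1 c2 c3 :: real
  shows "(\<integral>z. k1 z * of_real (c0 + c1 * fst z + c2 * snd z + c3 * (norm z)\<^sup>2) \<partial>lborel) = of_real (c0 + 4 * c3)"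
proof -
  have "has_bochner_integral lborel (\<lambda>z. of_real c0 * (k1 z * (of_real (fst z ^ 0) * of_real (snd z ^ 0)))
    + of_real c1 * (k1 z * (of_real (fst z ^ 1) * of_real (snd z ^ 0))) + of_real c2 * (k1 z * (of_real (fst z ^ 0) * of_real (snd z ^ 1)))
    + of_real c3 * (k1 z * (of_real (fst z ^ 2) * of_real (snd z ^ 0))) + of_real c3 * (k1 z * (of_real (fst z ^ 0) * of_real (snd z ^ 2))))
    (of_real c0 * of_real (mom 0 * mom 0) + of_real c1 * of_real (mom 1 * mom 0) + of_real c2 * of_real (mom 0 * mom 1)
     + of_real c3 * of_real (mom 2 * mom 0) + of_real c3 * of_real (mom 0 * mom 2))"
    by (intro has_bochner_integral_add has_bochner_integral_mult_right k1_moment)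
  from has_bochner_integral_integral_eq[OF this] show ?thesis
    by (simp add: mom_values norm_prod_sq algebra_simps)
qed

text \<open>The composition has displacement
  \<open>sqrt s *\<^sub>R \<zeta> + sqrt q *\<^sub>R \<eta>\<close>, which is
  \<open>sqrt (s + q) *\<^sub>R \<xi>\<close> for one coordinate \<open>\<xi>\<close> of a rotated
  pair \<open>(\<xi>, \<omega>)\<close>. Gaussian weights are invariant under the rotation, and
  integrating out \<open>\<omega>\<close> averages the polynomial factor \<open>P\<close> to
  \<open>R\<close>. The two instances are \<open>P = 1\<close> and the factor of the Laplacian
  kernel.\<close>

lemma chapman_kolmogorov:
  assumes k: "kern C k" and kP: "\<And>z. k z = k1 z * P z" and g[measurable]: "g \<in> borel_measurable borel" and B: "\<And>y. norm (g y) \<le> B"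
    and s: "s > 0" and q: "q > 0" and c: "c = sqrt s / sqrt (s + q)" and d: "d = sqrt q / sqrt (s + q)"
    and R: "\<And>\<xi>. (\<integral>\<omega>. k1 \<omega> * P (d *\<^sub>R \<xi> - c *\<^sub>R \<omega>) \<partial>lborel) = R \<xi>"
  shows "kconv k1 (sqrt s) (kconv k (sqrt q) g) x = kconv (\<lambda>\<xi>. k1 \<xi> * R \<xi>) (sqrt (s + q)) g x"
proof -
  define r where "r = sqrt (s + q)"
  have r: "r > 0" "r * r = s + q" using s q by (simp_all add: r_def)
  have rs: "sqrt s * sqrt s = s" "sqrt q * sqrt q = q" "sqrt s > 0" "sqrt q > 0" using s q by auto
  have cr: "c = sqrt s / r" and dr: "d = sqrt q / r" by (simp_all add: c d r_def)
  have d0: "d > 0" using dr r rs by simp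
  have cd: "c * c + d * d = 1" using r rs s q by (simp add: cr dr flip: add_divide_distrib)
  have [measurable]: "k \<in> borel_measurable borel" using k by (simp add: kern_def)
  let ?c0 = "r / sqrt q"
  have c0: "?c0 = 1 / d" "?c0 > 0" using r rs by (simp_all add: dr)
  \<comment> \<open>The integrand after replacing \<open>\<eta>\<close> by the total displacement
    \<open>r *\<^sub>R \<xi>\<close>; then \<open>g\<close> depends on \<open>\<xi>\<close> only,
    and Fubini isolates the integral in \<open>\<zeta>\<close>.\<close>
  let ?\<Phi> = "\<lambda>\<zeta> \<xi>. of_real (?c0^2) * (k1 \<zeta> * k ((1 / sqrt q) *\<^sub>R (r *\<^sub>R \<xi> - sqrt s *\<^sub>R \<zeta>)) * g (x - r *\<^sub>R \<xi>))"
  have inner: "(\<integral>\<eta>. h (k \<eta> * g (x - sqrt s *\<^sub>R \<zeta> - sqrt q *\<^sub>R \<eta>)) \<partial>lborel)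
      = ?c0^2 *\<^sub>R (\<integral>\<xi>. h (k ((1 / sqrt q) *\<^sub>R (r *\<^sub>R \<xi> - sqrt s *\<^sub>R \<zeta>)) * g (x - r *\<^sub>R \<xi>)) \<partial>lborel)"
    if [measurable]: "h \<in> borel_measurable borel" for \<zeta> and h :: "complex \<Rightarrow> complex"
    using r(1) rs(3,4) by (subst lborel_integral_affine[where c="?c0" and t="- (sqrt s / sqrt q) *\<^sub>R \<zeta>"])
      (simp_all add: algebra_simps power2_eq_square)
  have innern: "(\<integral>\<eta>. norm (k \<eta> * g (x - sqrt s *\<^sub>R \<zeta> - sqrt q *\<^sub>R \<eta>)) \<partial>lborel)
      = ?c0^2 *\<^sub>R (\<integral>\<xi>. norm (k ((1 / sqrt q) *\<^sub>R (r *\<^sub>R \<xi> - sqrt s *\<^sub>R \<zeta>)) * g (x - r *\<^sub>R \<xi>)) \<partial>lborel)" for \<zeta>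
    using r(1) rs(3,4) by (subst lborel_integral_affine[where c="?c0" and t="- (sqrt s / sqrt q) *\<^sub>R \<zeta>"])
      (simp_all add: algebra_simps power2_eq_square)
  have ki: "integrable lborel (\<lambda>\<eta>. k \<eta> * g (y - sqrt q *\<^sub>R \<eta>))" for y by (rule kconv_bound(1)[OF k g B])
  have nb: "(\<integral>\<eta>. norm (k \<eta> * g (y - sqrt q *\<^sub>R \<eta>)) \<partial>lborel) \<le> C * B * gauss_mass" for y
  proof -
    \<comment> \<open>The moduli satisfy the same bounds as \<open>k\<close> and \<open>g\<close>,
      so \<open>kconv_bound\<close> applied to them controls the absolute integral that Fubini asks
      for.\<close>
    have "kern C (\<lambda>z. of_real (norm (k z)))"
      using k unfolding kern_def norm_of_real abs_norm_cancel
      by (intro conjI) (auto simp: simp flip: of_real_diff intro: order_trans[OF norm_triangle_ineq3] simp del: split_paired_All)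
    moreover have "(\<lambda>y. complex_of_real (norm (g y))) \<in> borel_measurable borel" by measurable
    ultimately have "norm (kconv (\<lambda>z. of_real (norm (k z))) (sqrt q) (\<lambda>y. of_real (norm (g y))) y) \<le> C * B * gauss_mass"
      by (rule kconv_bound(2)) (use B in simp)
    moreover have "kconv (\<lambda>z. of_real (norm (k z))) (sqrt q) (\<lambda>y. of_real (norm (g y))) y = of_real (\<integral>\<eta>. norm (k \<eta> * g (y - sqrt q *\<^sub>R \<eta>)) \<partial>lborel)"
      unfolding kconv_def by (subst integral_complex_of_real[symmetric]) (simp add: norm_mult)
    ultimately show ?thesis by simp
  qed
  have k1i: "integrable lborel k1" using kern_integrable(1)[OF k1_kern, of "\<lambda>_. 1" 1] cube_ge(1) by simp
  have [measurable]: "(\<lambda>p::(real\<times>real)\<times>(real\<times>real). fst p) \<in> borel_measurable (lborel \<Otimes>\<^sub>M lborel)"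
    "(\<lambda>p::(real\<times>real)\<times>(real\<times>real). snd p) \<in> borel_measurable (lborel \<Otimes>\<^sub>M lborel)"
    using measurable_fst[of "lborel::(real\<times>real) measure" "lborel::(real\<times>real) measure"]
      measurable_snd[of "lborel::(real\<times>real) measure" "lborel::(real\<times>real) measure"] by simp_all
  have \<Phi>m: "(\<lambda>p. ?\<Phi> (fst p) (snd p)) \<in> borel_measurable (lborel \<Otimes>\<^sub>M lborel)" by measurable
  have \<Phi>i: "integrable lborel (\<lambda>\<xi>. ?\<Phi> \<zeta> \<xi>)" for \<zeta>
  proof -
    have "integrable lborel (\<lambda>\<xi>. k ((1 / sqrt q) *\<^sub>R (r *\<^sub>R \<xi> - sqrt s *\<^sub>R \<zeta>)) * g (x - r *\<^sub>R \<xi>))"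
    proof -
      let ?h = "\<lambda>\<eta>. k \<eta> * g (x - sqrt s *\<^sub>R \<zeta> - sqrt q *\<^sub>R \<eta>)"
      have "integrable (density (distr lborel borel (\<lambda>\<xi>. - (sqrt s / sqrt q) *\<^sub>R \<zeta> + ?c0 *\<^sub>R \<xi>)) (\<lambda>_. \<bar>?c0\<bar>^DIM(real\<times>real))) ?h"
        using ki[of "x - sqrt s *\<^sub>R \<zeta>"] lborel_affine[of "?c0" "- (sqrt s / sqrt q) *\<^sub>R \<zeta>"] c0(2) by (simp only: less_imp_neq[symmetric] not_False_eq_True)
      then have i: "integrable lborel (\<lambda>\<xi>. \<bar>?c0\<bar>^DIM(real\<times>real) *\<^sub>R ?h (- (sqrt s / sqrt q) *\<^sub>R \<zeta> + ?c0 *\<^sub>R \<xi>))"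
        by (subst (asm) integrable_density) (simp_all add: integrable_distr_eq)
      have cc: "(1 / ?c0^2) * \<bar>?c0\<bar>^DIM(real\<times>real) = 1" using r(1) rs(4) by (simp add: power2_eq_square)
      have "integrable lborel (\<lambda>\<xi>. ?h (- (sqrt s / sqrt q) *\<^sub>R \<zeta> + ?c0 *\<^sub>R \<xi>))"
        using integrable_scaleR_right[of "1 / ?c0^2", OF i] unfolding scaleR_scaleR cc scaleR_one .
      then show ?thesis using rs by (simp add: algebra_simps)
    qed
    then show ?thesis by (simp add: mult.assoc integrable_mult_right)
  qed
  have \<Phi>I: "integrable (lborel \<Otimes>\<^sub>M lborel) (\<lambda>(\<zeta>, \<xi>). ?\<Phi> \<zeta> \<xi>)"
  proof (rule lborel_pair.Fubini_integrable)
    show "(\<lambda>(\<zeta>, \<xi>). ?\<Phi> \<zeta> \<xi>) \<in> borel_measurable (lborel \<Otimes>\<^sub>M lborel)" using \<Phi>m by (simp add: case_prod_beta')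
    show "AE \<zeta> in lborel. integrable lborel (\<lambda>\<xi>. (\<lambda>(\<zeta>, \<xi>). ?\<Phi> \<zeta> \<xi>) (\<zeta>, \<xi>))" using \<Phi>i by simp
    have eqn: "(\<integral>\<xi>. norm (?\<Phi> \<zeta> \<xi>) \<partial>lborel) = norm (k1 \<zeta>) * (\<integral>\<eta>. norm (k \<eta> * g (x - sqrt s *\<^sub>R \<zeta> - sqrt q *\<^sub>R \<eta>)) \<partial>lborel)" for \<zeta>
    proof -
      have "(\<integral>\<xi>. norm (?\<Phi> \<zeta> \<xi>) \<partial>lborel) = (\<integral>\<xi>. (norm (k1 \<zeta>) * ?c0^2) * norm (k ((1 / sqrt q) *\<^sub>R (r *\<^sub>R \<xi> - sqrt s *\<^sub>R \<zeta>)) * g (x - r *\<^sub>R \<xi>)) \<partial>lborel)"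
        using r(1) rs(4) by (intro Bochner_Integration.integral_cong refl) (simp add: norm_mult norm_divide norm_power mult_ac)
      also have "\<dots> = (norm (k1 \<zeta>) * ?c0^2) * (\<integral>\<xi>. norm (k ((1 / sqrt q) *\<^sub>R (r *\<^sub>R \<xi> - sqrt s *\<^sub>R \<zeta>)) * g (x - r *\<^sub>R \<xi>)) \<partial>lborel)"
        by (rule integral_mult_right_zero)
      finally show ?thesis unfolding innern by (simp add: mult_ac)
    qed
    have "(\<lambda>\<zeta>. \<integral>\<xi>. norm (?\<Phi> \<zeta> \<xi>) \<partial>lborel) \<in> borel_measurable lborel"
      by (rule lborel.borel_measurable_lebesgue_integral) (use \<Phi>m in \<open>simp add: case_prod_beta'\<close>)
    moreover have "norm (\<integral>\<xi>. norm (?\<Phi> \<zeta> \<xi>) \<partial>lborel) \<le> norm (norm (k1 \<zeta>) * (C * B * gauss_mass))" for \<zeta>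
    proof -
      have "0 \<le> (\<integral>\<xi>. norm (?\<Phi> \<zeta> \<xi>) \<partial>lborel)" by (intro integral_nonneg_AE) simp
      moreover have "(\<integral>\<xi>. norm (?\<Phi> \<zeta> \<xi>) \<partial>lborel) \<le> norm (k1 \<zeta>) * (C * B * gauss_mass)"
        unfolding eqn by (rule mult_left_mono[OF nb norm_ge_zero])
      ultimately show ?thesis unfolding real_norm_def by linarith
    qed
    ultimately have "integrable lborel (\<lambda>\<zeta>. \<integral>\<xi>. norm (?\<Phi> \<zeta> \<xi>) \<partial>lborel)"
      by (intro Bochner_Integration.integrable_bound[OF integrable_mult_left[OF integrable_norm[OF k1i], of "C * B * gauss_mass"]] AE_I2)
    then show "integrable lborel (\<lambda>\<zeta>. \<integral>\<xi>. norm ((\<lambda>(\<zeta>, \<xi>). ?\<Phi> \<zeta> \<xi>) (\<zeta>, \<xi>)) \<partial>lborel)" by simp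
  qed
  have "kconv k1 (sqrt s) (kconv k (sqrt q) g) x = (\<integral>\<zeta>. (\<integral>\<xi>. ?\<Phi> \<zeta> \<xi> \<partial>lborel) \<partial>lborel)"
    unfolding kconv_def
  proof (rule Bochner_Integration.integral_cong[OF refl])
    fix \<zeta>
    have "(\<integral>\<xi>. ?\<Phi> \<zeta> \<xi> \<partial>lborel) = (\<integral>\<xi>. (of_real (?c0^2) * k1 \<zeta>) * (k ((1 / sqrt q) *\<^sub>R (r *\<^sub>R \<xi> - sqrt s *\<^sub>R \<zeta>)) * g (x - r *\<^sub>R \<xi>)) \<partial>lborel)"
      by (simp add: mult.assoc)
    also have "\<dots> = (of_real (?c0^2) * k1 \<zeta>) * (\<integral>\<xi>. k ((1 / sqrt q) *\<^sub>R (r *\<^sub>R \<xi> - sqrt s *\<^sub>R \<zeta>)) * g (x - r *\<^sub>R \<xi>) \<partial>lborel)"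
      by (rule integral_mult_right_zero)
    finally have 1: "(\<integral>\<xi>. ?\<Phi> \<zeta> \<xi> \<partial>lborel) = (of_real (?c0^2) * k1 \<zeta>) * (\<integral>\<xi>. k ((1 / sqrt q) *\<^sub>R (r *\<^sub>R \<xi> - sqrt s *\<^sub>R \<zeta>)) * g (x - r *\<^sub>R \<xi>) \<partial>lborel)" .
    have 2: "(\<integral>\<eta>. k \<eta> * g (x - sqrt s *\<^sub>R \<zeta> - sqrt q *\<^sub>R \<eta>) \<partial>lborel) = of_real (?c0^2) * (\<integral>\<xi>. k ((1 / sqrt q) *\<^sub>R (r *\<^sub>R \<xi> - sqrt s *\<^sub>R \<zeta>)) * g (x - r *\<^sub>R \<xi>) \<partial>lborel)"
      using inner[OF measurable_ident, of \<zeta>] unfolding id_apply scaleR_conv_of_real .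
    show "k1 \<zeta> * (\<integral>\<eta>. k \<eta> * g (x - sqrt s *\<^sub>R \<zeta> - sqrt q *\<^sub>R \<eta>) \<partial>lborel) = (\<integral>\<xi>. ?\<Phi> \<zeta> \<xi> \<partial>lborel)"
      unfolding 1 2 by (simp only: mult_ac)
  qed
  also have "\<dots> = (\<integral>\<xi>. (\<integral>\<zeta>. ?\<Phi> \<zeta> \<xi> \<partial>lborel) \<partial>lborel)"
    by (rule lborel_pair.Fubini_integral[OF \<Phi>I, symmetric])
  also have "\<dots> = (\<integral>\<xi>. (k1 \<xi> * R \<xi>) * g (x - r *\<^sub>R \<xi>) \<partial>lborel)"
  proof (rule Bochner_Integration.integral_cong[OF refl])
    fix \<xi> :: "real \<times> real"
    \<comment> \<open>Rotation invariance: since \<open>c * c + d * d = 1\<close>, the two exponents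
      have the same sum before and after the change of variables.\<close>
    have kk: "k1 (c *\<^sub>R \<xi> + d *\<^sub>R \<omega>) * k1 (d *\<^sub>R \<xi> - c *\<^sub>R \<omega>) = k1 \<xi> * k1 \<omega>" for \<omega>
    proof -
      have sq: "(c * a + d * b)\<^sup>2 + (d * a - c * b)\<^sup>2 = a\<^sup>2 + b\<^sup>2" for a b
      proof -
        have "(c * a + d * b)\<^sup>2 + (d * a - c * b)\<^sup>2 = (c * c + d * d) * (a\<^sup>2 + b\<^sup>2)" by (simp add: power2_eq_square algebra_simps)
        then show ?thesis by (simp add: cd)
      qed
      have "(norm (c *\<^sub>R \<xi> + d *\<^sub>R \<omega>))\<^sup>2 + (norm (d *\<^sub>R \<xi> - c *\<^sub>R \<omega>))\<^sup>2 = (norm \<xi>)\<^sup>2 + (norm \<omega>)\<^sup>2"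
        using sq[of "fst \<xi>" "fst \<omega>"] sq[of "snd \<xi>" "snd \<omega>"] by (simp add: norm_prod_sq)
      then have "exp (- (norm (c *\<^sub>R \<xi> + d *\<^sub>R \<omega>))\<^sup>2 / 4) * exp (- (norm (d *\<^sub>R \<xi> - c *\<^sub>R \<omega>))\<^sup>2 / 4) = exp (- (norm \<xi>)\<^sup>2 / 4) * exp (- (norm \<omega>)\<^sup>2 / 4)"
        unfolding exp_add[symmetric] by (intro arg_cong[where f=exp]) argo
      then show ?thesis by (simp add: k1_eq flip: of_real_mult)
    qed
    have ar: "(1 / sqrt q) *\<^sub>R (r *\<^sub>R \<xi> - sqrt s *\<^sub>R (c *\<^sub>R \<xi> + d *\<^sub>R \<omega>)) = d *\<^sub>R \<xi> - c *\<^sub>R \<omega>" for \<omega>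
    proof -
      have "(r - sqrt s * c) / sqrt q = d"
      proof -
        have "r - sqrt s * c = (r * r - s) / r" using r rs by (simp add: cr field_simps)
        also have "\<dots> = sqrt q * d" using r rs by (simp add: dr)
        finally show ?thesis using rs by simp
      qed
      moreover have "sqrt s * d / sqrt q = c" using rs by (simp add: cr dr)
      ultimately show ?thesis
        by (metis (no_types, lifting) diff_diff_eq divide_inverse_commute inverse_eq_divide scaleR_diff_left scaleR_diff_right scaleR_right_distrib scaleR_scaleR)
    qed
    have "(\<integral>\<zeta>. ?\<Phi> \<zeta> \<xi> \<partial>lborel) = \<bar>d\<bar>^DIM(real\<times>real) *\<^sub>R (\<integral>\<omega>. ?\<Phi> (c *\<^sub>R \<xi> + d *\<^sub>R \<omega>) \<xi> \<partial>lborel)"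
      by (rule lborel_integral_affine) (use d0 in auto)
    also have "(\<integral>\<omega>. ?\<Phi> (c *\<^sub>R \<xi> + d *\<^sub>R \<omega>) \<xi> \<partial>lborel) = (\<integral>\<omega>. (of_real (?c0^2) * k1 \<xi> * g (x - r *\<^sub>R \<xi>)) * (k1 \<omega> * P (d *\<^sub>R \<xi> - c *\<^sub>R \<omega>)) \<partial>lborel)"
      unfolding ar kP using kk by (intro Bochner_Integration.integral_cong refl) (simp add: mult_ac)
    also have "\<dots> = (of_real (?c0^2) * k1 \<xi> * g (x - r *\<^sub>R \<xi>)) * R \<xi>" unfolding R[symmetric] by (rule integral_mult_right_zero)
    also have "\<bar>d\<bar>^DIM(real\<times>real) *\<^sub>R \<dots> = (k1 \<xi> * R \<xi>) * g (x - r *\<^sub>R \<xi>)"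
      using d0 by (simp add: c0(1) scaleR_conv_of_real power2_eq_square)
    finally show "(\<integral>\<zeta>. ?\<Phi> \<zeta> \<xi> \<partial>lborel) = (k1 \<xi> * R \<xi>) * g (x - r *\<^sub>R \<xi>)" .
  qed
  finally show ?thesis by (simp add: kconv_def r_def)
qed

lemma heat_semigroup:
  assumes g: "g \<in> borel_measurable borel" "\<And>y. norm (g y) \<le> B" and s: "s > 0" "q > 0"
  shows "kconv k1 (sqrt s) (kconv k1 (sqrt q) g) x = kconv k1 (sqrt (s + q)) g x"
proof -
  have "(\<integral>\<omega>. k1 \<omega> * (1::complex) \<partial>lborel) = 1" using k1_quadratic_integral[of 1 0 0 0] by simp
  from chapman_kolmogorov[OF k1_kern _ g s refl refl this] show ?thesis by simp
qed

text \<open>The kernel \<open>l1\<close> at scale \<open>sqrt q\<close> is \<open>q\<close> times a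
  Laplacian, hence the division by the time on both sides. The mean of the squared norm under
  \<open>k1\<close> is \<open>4\<close>, so averaging the polynomial factor gives
  \<open>d^2 * (norm \<xi>)^2 / 4 + c^2 - 1\<close>, that is, \<open>d^2\<close> times the original
  factor, with \<open>d^2 = q / (s + q)\<close>.\<close>

lemma heat_duhamel_semigroup:
  assumes g: "g \<in> borel_measurable borel" "\<And>y. norm (g y) \<le> B" and s: "s > 0" "q > 0"
  shows "kconv k1 (sqrt s) (kconv l1 (sqrt q) g) x / of_real q = kconv l1 (sqrt (s + q)) g x / of_real (s + q)"
proof -
  define c d where "c = sqrt s / sqrt (s + q)" and "d = sqrt q / sqrt (s + q)"
  have c2: "c\<^sup>2 = s / (s + q)" and d2: "d\<^sup>2 = q / (s + q)" using s by (simp_all add: c_def d_def power_divide)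
  have R: "(\<integral>\<omega>. k1 \<omega> * of_real ((norm (d *\<^sub>R \<xi> - c *\<^sub>R \<omega>))\<^sup>2 / 4 - 1) \<partial>lborel) = of_real (d\<^sup>2) * of_real ((norm \<xi>)\<^sup>2 / 4 - 1)" for \<xi>
  proof -
    have e: "(norm (d *\<^sub>R \<xi> - c *\<^sub>R \<omega>))\<^sup>2 / 4 - 1 = (d\<^sup>2 * (norm \<xi>)\<^sup>2 / 4 - 1) + (- c * d * fst \<xi> / 2) * fst \<omega> + (- c * d * snd \<xi> / 2) * snd \<omega> + (c\<^sup>2 / 4) * (norm \<omega>)\<^sup>2" for \<omega>
      by (simp only: norm_prod_sq) (simp add: power2_eq_square field_simps)
    have "d\<^sup>2 * (norm \<xi>)\<^sup>2 / 4 - 1 + 4 * (c\<^sup>2 / 4) = d\<^sup>2 * ((norm \<xi>)\<^sup>2 / 4 - 1)"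
    proof -
      have "c\<^sup>2 = 1 - d\<^sup>2" using s by (simp add: c2 d2 field_simps)
      then show ?thesis by (simp add: algebra_simps)
    qed
    then show ?thesis unfolding e k1_quadratic_integral by (simp only: of_real_mult)
  qed
  have "kconv k1 (sqrt s) (kconv l1 (sqrt q) g) x = kconv (\<lambda>\<xi>. k1 \<xi> * (of_real (d\<^sup>2) * of_real ((norm \<xi>)\<^sup>2 / 4 - 1))) (sqrt (s + q)) g x"
    by (rule chapman_kolmogorov[OF l1_kern _ g s c_def d_def R]) (simp add: l1_eq mult.commute)
  also have "\<dots> = (\<integral>\<xi>. of_real (d\<^sup>2) * (l1 \<xi> * g (x - sqrt (s + q) *\<^sub>R \<xi>)) \<partial>lborel)"
    unfolding kconv_def l1_eq by (simp only: mult_ac)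
  also have "\<dots> = of_real (d\<^sup>2) * kconv l1 (sqrt (s + q)) g x" unfolding kconv_def by (rule integral_mult_right_zero)
  finally have "kconv k1 (sqrt s) (kconv l1 (sqrt q) g) x / of_real q = of_real (d\<^sup>2) / of_real q * kconv l1 (sqrt (s + q)) g x" by simp
  also have "complex_of_real (d\<^sup>2) / of_real q = 1 / of_real (s + q)"
  proof -
    have "d\<^sup>2 / q = 1 / (s + q)" using s unfolding d2 by simp
    then have "complex_of_real (d\<^sup>2 / q) = of_real (1 / (s + q))" by (simp only:)
    then show ?thesis unfolding of_real_divide of_real_1 .
  qed
  finally show ?thesis by simp
qed

section \<open>The Duhamel integral in elapsed time, and restarting\<close>

definition Ed :: "(real \<Rightarrow> real \<times> real \<Rightarrow> complex) \<Rightarrow> real \<Rightarrow> real \<times> real \<Rightarrow> real \<Rightarrow> complex" where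
  "Ed f t x q = indicator {0<..<t} q *\<^sub>R (kconv l1 (sqrt q) (f (t - q)) x / of_real q)"

text \<open>The substitution \<open>q = t * \<sigma>\<close>. In the unscaled elapsed time
  \<open>q\<close>, restarting the flow later merely cuts the range of integration.\<close>

lemma Ed_duhamel_integrand:
  assumes "t > 0"
  shows "Ed f t x q = (1 / t) *\<^sub>R (indicator {0<..<1} (q / t) *\<^sub>R (duhamel_integrand f t x 1 0 0 (q / t) / of_real (q / t)))"
proof -
  have "indicator {0<..<1} (q / t) = (indicator {0<..<t} q :: real)" using assms by (auto simp: indicator_def field_simps)
  moreover have "t * (q / t) = q" "t * (1 - q / t) = t - q" using assms by (simp_all add: field_simps)
  ultimately show ?thesis using assms by (simp add: Ed_def duhamel_integrand_1 scaleR_conv_of_real)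
qed

lemma Ed_integral:
  assumes f: "admissible A B (1/4) f" and t: "t > 0"
  shows "integrable lborel (Ed f t x)" "duhamel f t x 1 0 0 = (\<integral>q. Ed f t x q \<partial>lborel)"
proof -
  let ?h = "\<lambda>\<sigma>. indicator {0<..<1} \<sigma> *\<^sub>R (duhamel_integrand f t x 1 0 0 \<sigma> / of_real \<sigma>)"
  have i: "integrable lborel ?h"
    using duhamel_integrable[OF par_1 f _ _ t, of x] unfolding W_def by (simp add: integrable_restrict_space)
  have e: "Ed f t x = (\<lambda>q. (1 / t) *\<^sub>R ?h (0 + (1 / t) * q))" using Ed_duhamel_integrand[OF t] by (simp add: fun_eq_iff)
  have i2: "integrable lborel (\<lambda>q. ?h (0 + (1 / t) * q))" by (rule lborel_integrable_real_affine[OF i]) (use t in simp)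
  show "integrable lborel (Ed f t x)" unfolding e by (rule integrable_scaleR_right[OF i2])
  have "duhamel f t x 1 0 0 = (\<integral>\<sigma>. ?h \<sigma> \<partial>lborel)"
    unfolding duhamel_def W_def by (subst integral_restrict_space) auto
  also have "\<dots> = \<bar>1 / t\<bar> *\<^sub>R (\<integral>q. ?h (0 + (1 / t) * q) \<partial>lborel)" by (rule lborel_integral_real_affine) (use t in simp)
  also have "\<dots> = (\<integral>q. Ed f t x q \<partial>lborel)" unfolding e using t by (subst integral_scaleR_right) auto
  finally show "duhamel f t x 1 0 0 = (\<integral>q. Ed f t x q \<partial>lborel)" .
qed

lemma Ed_measurable:
  assumes f: "admissible A B (1/4) f" and t: "t > 0"
  shows "(\<lambda>p::(real\<times>real)\<times>real. Ed f t (fst p) (snd p)) \<in> borel_measurable borel"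
proof -
  have "(\<lambda>p::(real\<times>real)\<times>real. ((t, fst p), snd p / t)) \<in> measurable borel borel"
    using t by (intro borel_measurable_continuous_onI continuous_intros) auto
  from measurable_compose[OF this duhamel_integrand_measurable[of f 1 0 0]] have [measurable]:
    "(\<lambda>p::(real\<times>real)\<times>real. duhamel_integrand f t (fst p) 1 0 0 (snd p / t) / of_real (snd p / t)) \<in> borel_measurable borel"
    using f by (simp add: admissible_def)
  have [measurable]: "(\<lambda>p::(real\<times>real)\<times>real. snd p) \<in> borel_measurable borel"
    by (intro borel_measurable_continuous_onI continuous_intros)
  show ?thesis unfolding Ed_duhamel_integrand[OF t] by measurable
qed

definition Eb :: "real \<Rightarrow> real \<Rightarrow> real \<Rightarrow> real" where
  "Eb A t q = (1 / t) * (indicator {0<..<1} (q / t) * (kC * gauss_mass * A * wt (q / t)))"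

lemma Ed_bound:
  assumes f: "admissible A B (1/4) f" and t: "t > 0"
  shows "norm (Ed f t x q) \<le> Eb A t q" "integrable lborel (Eb A t)"
proof -
  show "norm (Ed f t x q) \<le> Eb A t q"
    unfolding Ed_duhamel_integrand[OF t] Eb_def using duhamel_integrand_bound[OF par_1 f _ _ t, of "q / t" x] t by (auto simp: indicator_def intro!: mult_left_mono divide_right_mono)
  let ?h = "\<lambda>\<sigma>. indicator {0<..<1} \<sigma> *\<^sub>R (kC * gauss_mass * A * wt \<sigma>)"
  have "integrable W (\<lambda>\<sigma>. kC * gauss_mass * A * wt \<sigma>)" by (intro integrable_mult_right wt_integrable)
  then have i: "integrable lborel ?h" unfolding W_def by (subst (asm) integrable_restrict_space) auto
  have "integrable lborel (\<lambda>q. ?h (0 + (1 / t) * q))" by (rule lborel_integrable_real_affine[OF i]) (use t in simp)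
  then show "integrable lborel (Eb A t)" unfolding Eb_def[abs_def] by (intro integrable_mult_right) simp
qed

text \<open>By Fubini the heat flow passes under the Duhamel integral, where the semigroup property
  adds \<open>s\<close> to every elapsed time.\<close>

lemma heat_of_duhamel:
  assumes f: "admissible A B (1/4) f" and a: "a > 0" and s: "s > 0"
  shows "kconv k1 (sqrt s) (\<lambda>y. duhamel f a y 1 0 0) x
    = (\<integral>q. indicator {0<..<a} q *\<^sub>R (kconv l1 (sqrt (s + q)) (f (a - q)) x / of_real (s + q)) \<partial>lborel)"
proof -
  let ?\<Psi> = "\<lambda>\<zeta> q. k1 \<zeta> * Ed f a (x - sqrt s *\<^sub>R \<zeta>) q"
  have [measurable]: "(\<lambda>p::(real\<times>real)\<times>real. fst p) \<in> borel_measurable (lborel \<Otimes>\<^sub>M lborel)"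
    "(\<lambda>p::(real\<times>real)\<times>real. snd p) \<in> borel_measurable (lborel \<Otimes>\<^sub>M lborel)"
    using measurable_fst[of "lborel::(real\<times>real) measure" "lborel::real measure"]
      measurable_snd[of "lborel::(real\<times>real) measure" "lborel::real measure"] by simp_all
  have "(\<lambda>p::(real\<times>real)\<times>real. (x - sqrt s *\<^sub>R fst p, snd p)) \<in> measurable (lborel \<Otimes>\<^sub>M lborel) borel"
    unfolding borel_prod[symmetric, where 'a="real\<times>real" and 'b=real] by (rule measurable_Pair) measurable
  from measurable_compose[OF this Ed_measurable[OF f a]]
  have [measurable]: "(\<lambda>p::(real\<times>real)\<times>real. Ed f a (x - sqrt s *\<^sub>R fst p) (snd p)) \<in> borel_measurable (lborel \<Otimes>\<^sub>M lborel)" by simp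
  have \<Psi>m: "(\<lambda>p. ?\<Psi> (fst p) (snd p)) \<in> borel_measurable (lborel \<Otimes>\<^sub>M lborel)" by measurable
  have k1i: "integrable lborel k1" using kern_integrable(1)[OF k1_kern, of "\<lambda>_. 1" 1] cube_ge(1) by simp
  have nb: "(\<integral>q. norm (?\<Psi> \<zeta> q) \<partial>lborel) \<le> norm (k1 \<zeta>) * (\<integral>q. Eb A a q \<partial>lborel)" for \<zeta>
  proof -
    have "(\<integral>q. norm (?\<Psi> \<zeta> q) \<partial>lborel) \<le> (\<integral>q. norm (k1 \<zeta>) * Eb A a q \<partial>lborel)"
      unfolding norm_mult
      by (intro integral_mono integrable_mult_right integrable_norm Ed_integral(1)[OF f a] Ed_bound(2)[OF f a] mult_left_mono Ed_bound(1)[OF f a]) auto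
    then show ?thesis by simp
  qed
  have \<Psi>I: "integrable (lborel \<Otimes>\<^sub>M lborel) (\<lambda>(\<zeta>, q). ?\<Psi> \<zeta> q)"
  proof (rule lborel_pair.Fubini_integrable)
    show "(\<lambda>(\<zeta>, q). ?\<Psi> \<zeta> q) \<in> borel_measurable (lborel \<Otimes>\<^sub>M lborel)" using \<Psi>m by (simp add: case_prod_beta')
    show "AE \<zeta> in lborel. integrable lborel (\<lambda>q. (\<lambda>(\<zeta>, q). ?\<Psi> \<zeta> q) (\<zeta>, q))"
      using Ed_integral(1)[OF f a] by (simp add: integrable_mult_right)
    have "(\<lambda>\<zeta>. \<integral>q. norm (?\<Psi> \<zeta> q) \<partial>lborel) \<in> borel_measurable lborel"
      by (rule lborel.borel_measurable_lebesgue_integral) (use \<Psi>m in \<open>simp add: case_prod_beta'\<close>)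
    moreover have "norm (\<integral>q. norm (?\<Psi> \<zeta> q) \<partial>lborel) \<le> norm (norm (k1 \<zeta>) * (\<integral>q. Eb A a q \<partial>lborel))" for \<zeta>
    proof -
      have "0 \<le> (\<integral>q. norm (?\<Psi> \<zeta> q) \<partial>lborel)" by (intro integral_nonneg_AE) simp
      then show ?thesis using nb[of \<zeta>] unfolding real_norm_def by linarith
    qed
    ultimately have "integrable lborel (\<lambda>\<zeta>. \<integral>q. norm (?\<Psi> \<zeta> q) \<partial>lborel)"
      by (intro Bochner_Integration.integrable_bound[OF integrable_mult_left[OF integrable_norm[OF k1i], of "\<integral>q. Eb A a q \<partial>lborel"]] AE_I2)
    then show "integrable lborel (\<lambda>\<zeta>. \<integral>q. norm ((\<lambda>(\<zeta>, q). ?\<Psi> \<zeta> q) (\<zeta>, q)) \<partial>lborel)" by simp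
  qed
  have "kconv k1 (sqrt s) (\<lambda>y. duhamel f a y 1 0 0) x = (\<integral>\<zeta>. (\<integral>q. ?\<Psi> \<zeta> q \<partial>lborel) \<partial>lborel)"
    unfolding kconv_def Ed_integral(2)[OF f a] integral_mult_right_zero ..
  also have "\<dots> = (\<integral>q. (\<integral>\<zeta>. ?\<Psi> \<zeta> q \<partial>lborel) \<partial>lborel)"
    by (rule lborel_pair.Fubini_integral[OF \<Psi>I, symmetric])
  also have "\<dots> = (\<integral>q. indicator {0<..<a} q *\<^sub>R (kconv l1 (sqrt (s + q)) (f (a - q)) x / of_real (s + q)) \<partial>lborel)"
  proof (rule Bochner_Integration.integral_cong[OF refl])
    fix q :: real
    show "(\<integral>\<zeta>. ?\<Psi> \<zeta> q \<partial>lborel) = indicator {0<..<a} q *\<^sub>R (kconv l1 (sqrt (s + q)) (f (a - q)) x / of_real (s + q))"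
    proof (cases "q \<in> {0<..<a}")
      case True
      have "(\<integral>\<zeta>. ?\<Psi> \<zeta> q \<partial>lborel) = (\<integral>\<zeta>. (k1 \<zeta> * kconv l1 (sqrt q) (f (a - q)) (x - sqrt s *\<^sub>R \<zeta>)) / of_real q \<partial>lborel)"
        using True by (simp add: Ed_def)
      also have "\<dots> = kconv k1 (sqrt s) (kconv l1 (sqrt q) (f (a - q))) x / of_real q"
        unfolding kconv_def[of k1] by (rule integral_divide_zero)
      also have "\<dots> = kconv l1 (sqrt (s + q)) (f (a - q)) x / of_real (s + q)"
        by (rule heat_duhamel_semigroup[OF admissible_slice[OF f] admissible_bound[OF f]]) (use True s in auto)
      finally show ?thesis using True by simp
    qed (simp add: Ed_def)
  qed
  finally show ?thesis .
qed

lemma duhamel_slice_measurable: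
  assumes "admissible A B \<beta> f"
  shows "(\<lambda>y. duhamel f t y 1 0 0) \<in> borel_measurable borel"
proof -
  have "(\<lambda>y. (t, y)) \<in> measurable borel (borel :: (real \<times> (real \<times> real)) measure)"
    by (intro borel_measurable_continuous_onI continuous_intros)
  from measurable_compose[OF this duhamel_measurable[of f 1 0 0]] show ?thesis using assms by (simp add: admissible_def)
qed

lemma heat_slice_measurable:
  assumes "\<phi> \<in> borel_measurable borel"
  shows "(\<lambda>y. heat \<phi> t y 1 0 0) \<in> borel_measurable borel"
proof -
  have "(\<lambda>y. (t, y)) \<in> measurable borel (borel :: (real \<times> (real \<times> real)) measure)"
    by (intro borel_measurable_continuous_onI continuous_intros)
  from measurable_compose[OF this heat_measurable[OF assms, of 1 0 0]] show ?thesis by simp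
qed

context small_data
begin

text \<open>Cut the Duhamel integral at elapsed time \<open>s\<close>. Sources older than
  \<open>a\<close> are the heat flow of the Duhamel integral up to time \<open>a\<close>, and join
  the heat flow of the data. What is left are sources from times after \<open>a\<close>, where the
  solution is analytic and can be expanded.\<close>

lemma sol_restart:
  assumes \<phi>: "\<phi> \<in> borel_measurable borel" "\<And>y. norm (\<phi> y) \<le> e" and a: "a > 0" and s: "s > 0"
  shows "sol \<phi> (a + s) x 1 0 0 = kconv k1 (sqrt s) (\<lambda>y. sol \<phi> a y 1 0 0) x
    + (\<integral>q. indicator {0<..<s} q *\<^sub>R Ed (\<lambda>s y. log_rest (sol \<phi> s y 1 0 0)) (a + s) x q \<partial>lborel)"
proof -
  define f where "f = (\<lambda>s y. log_rest (sol \<phi> s y 1 0 0))"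
  have f: "admissible (2 * M * M) M (1/4) f" unfolding f_def by (rule admissible_log_rest[OF sol_admissible[OF par_1 \<phi>] M(3)])
  have as: "a + s > 0" using a s by simp
  have H: "sol \<phi> t y 1 0 0 = heat \<phi> t y 1 0 0 + duhamel f t y 1 0 0" if "t > 0" for t y
    unfolding f_def by (rule sol_eq[OF par_1 \<phi> that])
  have B1: "norm (heat \<phi> a y 1 0 0) \<le> kC * gauss_mass * e" for y by (rule heat_bound[OF par_1 \<phi>])
  have B2: "norm (duhamel f a y 1 0 0) \<le> kC * gauss_mass * w0 * (2 * M * M) * a powr (1/4 - 1/4)" for y
    by (rule duhamel_bound[OF par_1 f _ _ a]) auto
  have "kconv k1 (sqrt s) (\<lambda>y. sol \<phi> a y 1 0 0) x = kconv k1 (sqrt s) (\<lambda>y. heat \<phi> a y 1 0 0) x + kconv k1 (sqrt s) (\<lambda>y. duhamel f a y 1 0 0) x"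
    unfolding H[OF a] kconv_def distrib_left
    by (intro Bochner_Integration.integral_add kconv_bound(1)[OF k1_kern heat_slice_measurable[OF \<phi>(1)] B1] kconv_bound(1)[OF k1_kern duhamel_slice_measurable[OF f] B2])
  moreover have "kconv k1 (sqrt s) (\<lambda>y. heat \<phi> a y 1 0 0) x = heat \<phi> (a + s) x 1 0 0"
    unfolding heat_1 using heat_semigroup[OF \<phi> s a] by (simp add: add.commute)
  moreover have "duhamel f (a + s) x 1 0 0 = (\<integral>q. indicator {0<..<s} q *\<^sub>R Ed f (a + s) x q \<partial>lborel) + kconv k1 (sqrt s) (\<lambda>y. duhamel f a y 1 0 0) x"
  proof -
    have i: "integrable lborel (Ed f (a + s) x)" by (rule Ed_integral(1)[OF f as])
    have i1: "integrable lborel (\<lambda>q. indicator {0<..<s} q *\<^sub>R Ed f (a + s) x q)"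
      and i2: "integrable lborel (\<lambda>q. indicator {s<..} q *\<^sub>R Ed f (a + s) x q)"
      by (rule integrable_mult_indicator[OF _ i], simp)+
    have "AE q in lborel. q \<noteq> s" by (rule AE_lborel_singleton)
    then have ae: "AE q in lborel. Ed f (a + s) x q = indicator {0<..<s} q *\<^sub>R Ed f (a + s) x q + indicator {s<..} q *\<^sub>R Ed f (a + s) x q"
    proof eventually_elim
      case (elim q)
      then show ?case using s by (cases "q \<le> 0"; cases "q < s") (auto simp: Ed_def)
    qed
    have "duhamel f (a + s) x 1 0 0 = (\<integral>q. Ed f (a + s) x q \<partial>lborel)" by (rule Ed_integral(2)[OF f as])
    also have "\<dots> = (\<integral>q. indicator {0<..<s} q *\<^sub>R Ed f (a + s) x q + indicator {s<..} q *\<^sub>R Ed f (a + s) x q \<partial>lborel)"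
      by (rule integral_cong_AE[OF _ _ ae]) (use i i1 i2 in \<open>auto intro: borel_measurable_integrable Bochner_Integration.integrable_add\<close>)
    also have "\<dots> = (\<integral>q. indicator {0<..<s} q *\<^sub>R Ed f (a + s) x q \<partial>lborel) + (\<integral>q. indicator {s<..} q *\<^sub>R Ed f (a + s) x q \<partial>lborel)"
      by (rule Bochner_Integration.integral_add[OF i1 i2])
    also have "(\<integral>q. indicator {s<..} q *\<^sub>R Ed f (a + s) x q \<partial>lborel) = \<bar>1\<bar> *\<^sub>R (\<integral>q. indicator {s<..} (s + 1 * q) *\<^sub>R Ed f (a + s) x (s + 1 * q) \<partial>lborel)"
      by (rule lborel_integral_real_affine) simp
    also have "\<dots> = (\<integral>q. indicator {0<..<a} q *\<^sub>R (kconv l1 (sqrt (s + q)) (f (a - q)) x / of_real (s + q)) \<partial>lborel)"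
      unfolding abs_one scaleR_one
    proof (rule Bochner_Integration.integral_cong[OF refl])
      fix q
      show "indicator {s<..} (s + 1 * q) *\<^sub>R Ed f (a + s) x (s + 1 * q) = indicator {0<..<a} q *\<^sub>R (kconv l1 (sqrt (s + q)) (f (a - q)) x / of_real (s + q))"
        using s by (cases "0 < q \<and> q < a") (auto simp: Ed_def indicator_def)
    qed
    also have "\<dots> = kconv k1 (sqrt s) (\<lambda>y. duhamel f a y 1 0 0) x" by (rule heat_of_duhamel[OF f a s, symmetric])
    finally show ?thesis .
  qed
  ultimately show ?thesis using H[OF as, of x] unfolding f_def[symmetric] by simp
qed

end

lemma moments_k1:
  fixes c0 c1 c2 d1 d2 d3 :: complex
  shows "has_bochner_integral lborel (\<lambda>z. k1 z * (c0 + c1 * of_real (fst z) + c2 * of_real (snd z) + d1 * of_real ((fst z)^2) + d2 * of_real ((snd z)^2) + d3 * (of_real (fst z) * of_real (snd z)))) (c0 + 2 * (d1 + d2))"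
proof -
  have "has_bochner_integral lborel (\<lambda>z. c0 * (k1 z * (of_real (fst z ^ 0) * of_real (snd z ^ 0))) + c1 * (k1 z * (of_real (fst z ^ 1) * of_real (snd z ^ 0)))
     + c2 * (k1 z * (of_real (fst z ^ 0) * of_real (snd z ^ 1))) + d1 * (k1 z * (of_real (fst z ^ 2) * of_real (snd z ^ 0))) + d2 * (k1 z * (of_real (fst z ^ 0) * of_real (snd z ^ 2)))
     + d3 * (k1 z * (of_real (fst z ^ 1) * of_real (snd z ^ 1))))
    (c0 * of_real (mom 0 * mom 0) + c1 * of_real (mom 1 * mom 0) + c2 * of_real (mom 0 * mom 1) + d1 * of_real (mom 2 * mom 0) + d2 * of_real (mom 0 * mom 2) + d3 * of_real (mom 1 * mom 1))"
    by (intro has_bochner_integral_add has_bochner_integral_mult_right k1_moment)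
  then show ?thesis by (simp add: mom_values algebra_simps)
qed

lemma l1_moment: "has_bochner_integral lborel (\<lambda>z. l1 z * (of_real (fst z ^ i) * of_real (snd z ^ j)))
   (of_real ((mom (i+2) * mom j + mom i * mom (j+2)) / 4 - mom i * mom j))"
proof -
  have "has_bochner_integral lborel (\<lambda>z. (1/4) * (k1 z * (of_real (fst z ^ (i+2)) * of_real (snd z ^ j))) + (1/4) * (k1 z * (of_real (fst z ^ i) * of_real (snd z ^ (j+2))))
      - k1 z * (of_real (fst z ^ i) * of_real (snd z ^ j)))
    ((1/4) * of_real (mom (i+2) * mom j) + (1/4) * of_real (mom i * mom (j+2)) - of_real (mom i * mom j))"
    by (intro has_bochner_integral_add has_bochner_integral_diff has_bochner_integral_mult_right k1_moment)
  moreover have "(1/4) * (k1 z * (of_real (fst z ^ (i+2)) * of_real (snd z ^ j))) + (1/4) * (k1 z * (of_real (fst z ^ i) * of_real (snd z ^ (j+2))))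
      - k1 z * (of_real (fst z ^ i) * of_real (snd z ^ j)) = l1 z * (of_real (fst z ^ i) * of_real (snd z ^ j))" for z
    unfolding l1_eq norm_prod_sq by (simp add: power_add power2_eq_square algebra_simps add_divide_distrib)
  ultimately show ?thesis by (simp add: add_divide_distrib)
qed

text \<open>Integration against \<open>l1\<close> takes the Laplacian: it annihilates affine and
  mixed terms and gives each square the value \<open>2\<close>, in agreement with \<open>k1\<close>
  apart from the mass.\<close>

lemma moments_l1:
  fixes c0 c1 c2 d1 d2 d3 :: complex
  shows "has_bochner_integral lborel (\<lambda>z. l1 z * (c0 + c1 * of_real (fst z) + c2 * of_real (snd z) + d1 * of_real ((fst z)^2) + d2 * of_real ((snd z)^2) + d3 * (of_real (fst z) * of_real (snd z)))) (2 * (d1 + d2))"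
proof -
  let ?m = "\<lambda>i j. complex_of_real ((mom (i+2) * mom j + mom i * mom (j+2)) / 4 - mom i * mom j)"
  have mm: "mom (Suc (Suc 0)) = 2" "mom (Suc (Suc (Suc 0))) = 0" "mom (Suc (Suc (Suc (Suc 0)))) = 12"
    using mom_values(4-6) by (simp_all add: numeral_eq_Suc)
  have v: "?m 0 0 = 0" "?m 1 0 = 0" "?m 0 1 = 0" "?m 2 0 = 2" "?m 0 2 = 2" "?m 1 1 = 0"
    by (simp_all add: numeral_eq_Suc mom_values(1,3) mm)
  have "has_bochner_integral lborel (\<lambda>z. c0 * (l1 z * (of_real (fst z ^ 0) * of_real (snd z ^ 0))) + c1 * (l1 z * (of_real (fst z ^ 1) * of_real (snd z ^ 0)))
     + c2 * (l1 z * (of_real (fst z ^ 0) * of_real (snd z ^ 1))) + d1 * (l1 z * (of_real (fst z ^ 2) * of_real (snd z ^ 0))) + d2 * (l1 z * (of_real (fst z ^ 0) * of_real (snd z ^ 2)))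
     + d3 * (l1 z * (of_real (fst z ^ 1) * of_real (snd z ^ 1))))
    (c0 * ?m 0 0 + c1 * ?m 1 0 + c2 * ?m 0 1 + d1 * ?m 2 0 + d2 * ?m 0 2 + d3 * ?m 1 1)"
    by (intro has_bochner_integral_add has_bochner_integral_mult_right l1_moment)
  then show ?thesis unfolding v by (simp add: algebra_simps)
qed

section \<open>The differential equation\<close>

text \<open>The Laplacian in the position parameters. For the solution at time \<open>t\<close>
  these are displacements divided by \<open>sqrt t\<close>, so \<open>lap\<close> is
  \<open>t\<close> times the spatial Laplacian.\<close>

definition lap :: "(complex \<Rightarrow> complex \<Rightarrow> complex \<Rightarrow> complex) \<Rightarrow> complex \<Rightarrow> complex" where
  "lap F l = deriv (\<lambda>\<alpha>. deriv (\<lambda>\<alpha>. F l \<alpha> 0) \<alpha>) 0 + deriv (\<lambda>\<beta>. deriv (\<lambda>\<beta>. F l 0 \<beta>) \<beta>) 0"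

lemma hol3_bound: "hol3 r M f \<Longrightarrow> x \<in> ball 0 r \<Longrightarrow> y \<in> ball 0 r \<Longrightarrow> z \<in> ball 0 r \<Longrightarrow> norm (f x y z) \<le> M"
  unfolding hol3_def by blast

lemma taylor_2:
  assumes "f holomorphic_on ball 0 r" "\<And>z. z \<in> ball 0 r \<Longrightarrow> norm (f z) \<le> M" "r > 0" "y \<in> ball 0 (r/2)"
  shows "norm (f y - (f 0 + deriv f 0 * y + deriv (deriv f) 0 * y\<^sup>2 / 2)) \<le> 24 * M / r^3 * norm y ^ 3"
proof -
  have "norm (f y - (\<Sum>i\<le>2. (deriv ^^ i) f 0 * (y - 0) ^ i / fact i)) \<le> real (Suc 2) * M / (r/2) ^ Suc 2 * norm (y - 0) ^ Suc 2"
    by (rule holomorphic_ball_taylor[OF assms(1,2), where r="r/2"]) (use assms in auto)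
  moreover have "(\<Sum>i\<le>2. (deriv ^^ i) f 0 * (y - 0) ^ i / fact i) = f 0 + deriv f 0 * y + deriv (deriv f) 0 * y\<^sup>2 / 2"
    by (simp add: numeral_2_eq_2)
  moreover have "real (Suc 2) * M / (r/2) ^ Suc 2 * norm (y - 0) ^ Suc 2 = 24 * M / r^3 * norm y ^ 3"
    by (simp add: power_divide numeral_3_eq_3)
  ultimately show ?thesis by simp
qed

text \<open>Expand in \<open>y\<close> with coefficients depending on \<open>z\<close>, then expand
  the coefficients in \<open>z\<close>, each to the order that leaves a remainder of total degree
  three. Besides the remainder, bounds for all coefficients are needed, to control the polynomial
  far from the origin.\<close>

lemma hol3_taylor_2:
  assumes F: "hol3 r M F" and r: "r > 0" and l: "l \<in> ball 0 (r/8)" and y: "y \<in> ball 0 (r/8)" "z \<in> ball 0 (r/8)"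
  defines "A1 \<equiv> deriv (\<lambda>\<alpha>. F l \<alpha> 0) 0" and "A2 \<equiv> deriv (\<lambda>\<beta>. F l 0 \<beta>) 0"
    and "A11 \<equiv> deriv (\<lambda>\<alpha>. deriv (\<lambda>\<alpha>. F l \<alpha> 0) \<alpha>) 0" and "A22 \<equiv> deriv (\<lambda>\<beta>. deriv (\<lambda>\<beta>. F l 0 \<beta>) \<beta>) 0"
    and "A12 \<equiv> deriv (\<lambda>\<beta>. deriv (\<lambda>\<alpha>. F l \<alpha> \<beta>) 0) 0"
  shows "norm (F l y z - (F l 0 0 + A1 * y + A2 * z + A11 * y\<^sup>2 / 2 + A22 * z\<^sup>2 / 2 + A12 * y * z)) \<le> 176 * M / r^3 * (norm y + norm z)^3"
    and "norm A1 \<le> 2 * M / r" "norm A2 \<le> 2 * M / r" "norm A11 \<le> 8 * M / r\<^sup>2" "norm A22 \<le> 8 * M / r\<^sup>2" "norm A12 \<le> 8 * M / r\<^sup>2"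
proof -
  have sub: "x \<in> ball 0 r" "x \<in> ball 0 (r/2)" "x \<in> ball 0 (r/2/2)" "x \<in> ball 0 (r/2/2/2)" if "x \<in> ball 0 (r/8)" for x :: complex
    using that r by auto
  have z0: "(0::complex) \<in> ball 0 (r/8)" using r by simp
  have M: "0 \<le> M" using hol3_bound[OF F, of 0 0 0] r by (simp add: order_trans[OF norm_ge_zero])
  let ?G2 = "\<lambda>x y z. deriv (\<lambda>y. F x y z) y" and ?G3 = "\<lambda>x y z. deriv (\<lambda>z. F x y z) z"
  have G2: "hol3 (r/2) (2*M/r) ?G2" by (rule hol3_deriv2[OF F r])
  have G3: "hol3 (r/2) (2*M/r) ?G3" by (rule hol3_deriv3[OF F r])
  have r2: "r/2 > 0" "r/2/2 > 0" using r by auto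
  have e: "2 * (2*M/r) / (r/2) = 8 * M / r\<^sup>2" by (simp add: power2_eq_square)
  have G22: "hol3 (r/2/2) (8*M/r\<^sup>2) (\<lambda>x y z. deriv (\<lambda>y. ?G2 x y z) y)" using hol3_deriv2[OF G2 r2(1)] unfolding e .
  have G33: "hol3 (r/2/2) (8*M/r\<^sup>2) (\<lambda>x y z. deriv (\<lambda>z. ?G3 x y z) z)" using hol3_deriv3[OF G3 r2(1)] unfolding e .
  have G23: "hol3 (r/2/2) (8*M/r\<^sup>2) (\<lambda>x y z. deriv (\<lambda>z. ?G2 x y z) z)" using hol3_deriv3[OF G2 r2(1)] unfolding e .
  show "norm A1 \<le> 2 * M / r" unfolding A1_def by (rule hol3_bound[OF G2]) (use sub l z0 in auto)
  show "norm A2 \<le> 2 * M / r" unfolding A2_def by (rule hol3_bound[OF G3]) (use sub l z0 in auto)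
  show "norm A11 \<le> 8 * M / r\<^sup>2" unfolding A11_def by (rule hol3_bound[OF G22 sub(3) sub(3) sub(3)]) (use l z0 in auto)
  show "norm A22 \<le> 8 * M / r\<^sup>2" unfolding A22_def by (rule hol3_bound[OF G33 sub(3) sub(3) sub(3)]) (use l z0 in auto)
  show "norm A12 \<le> 8 * M / r\<^sup>2" unfolding A12_def by (rule hol3_bound[OF G23 sub(3) sub(3) sub(3)]) (use l z0 in auto)
  let ?K1 = "24 * M / r^3" and ?n = "norm y" and ?m = "norm z"
  have h2: "(\<lambda>\<alpha>. F l \<alpha> z) holomorphic_on ball 0 r" "\<And>\<alpha>. \<alpha> \<in> ball 0 r \<Longrightarrow> norm (F l \<alpha> z) \<le> M"
    using F sub(1)[OF l] sub(1)[OF y(2)] unfolding hol3_def by blast+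
  have h3: "(\<lambda>\<beta>. F l 0 \<beta>) holomorphic_on ball 0 r" "\<And>\<beta>. \<beta> \<in> ball 0 r \<Longrightarrow> norm (F l 0 \<beta>) \<le> M"
    using F sub(1)[OF l] sub(1)[OF z0] unfolding hol3_def by blast+
  have t1: "norm (F l y z - (F l 0 z + ?G2 l 0 z * y + deriv (\<lambda>y. ?G2 l y z) 0 * y\<^sup>2 / 2)) \<le> ?K1 * ?n^3"
    using taylor_2[OF h2 r sub(2)[OF y(1)]] .
  have t2: "norm (F l 0 z - (F l 0 0 + A2 * z + A22 * z\<^sup>2 / 2)) \<le> ?K1 * ?m^3"
    unfolding A2_def A22_def using taylor_2[OF h3 r sub(2)[OF y(2)]] .
  have t3: "norm (?G2 l 0 z - ?G2 l 0 0 - (z - 0) * deriv (\<lambda>z. ?G2 l 0 z) 0) \<le> 8 * (2*M/r) / (r/2)\<^sup>2 * norm (z - 0)^2"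
    using hol3_taylor1[OF hol3_swap12[OF hol3_swap23[OF G2]] r2(1) sub(3)[OF z0] sub(3)[OF l] sub(3)[OF z0] sub(3)[OF y(2)]] .
  have t4: "norm (deriv (\<lambda>y. ?G2 l y z) 0 - deriv (\<lambda>y. ?G2 l y 0) 0) \<le> 2 * (8*M/r\<^sup>2) / (r/2/2) * (norm (l - l) + norm (0 - 0 :: complex) + norm (z - 0))"
    by (rule hol3_lipschitz[OF G22 r2(2)]) (use sub(4) l z0 y in blast)+
  have e3: "8 * (2*M/r) / (r/2)\<^sup>2 = 64 * M / r^3" by (simp add: power2_eq_square power3_eq_cube)
  have e4: "2 * (8*M/r\<^sup>2) / (r/2/2) = 64 * M / r^3" by (simp add: power2_eq_square power3_eq_cube)
  have t3': "norm (?G2 l 0 z - A1 - z * A12) \<le> 64 * M / r^3 * ?m^2" using t3 unfolding e3 by (simp add: A1_def A12_def)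
  have t4': "norm (deriv (\<lambda>y. ?G2 l y z) 0 - A11) \<le> 64 * M / r^3 * ?m" using t4 unfolding e4 by (simp add: A11_def)
  have eq: "F l y z - (F l 0 0 + A1 * y + A2 * z + A11 * y\<^sup>2 / 2 + A22 * z\<^sup>2 / 2 + A12 * y * z) =
     (F l y z - (F l 0 z + ?G2 l 0 z * y + deriv (\<lambda>y. ?G2 l y z) 0 * y\<^sup>2 / 2)) + (F l 0 z - (F l 0 0 + A2 * z + A22 * z\<^sup>2 / 2))
     + (?G2 l 0 z - A1 - z * A12) * y + (deriv (\<lambda>y. ?G2 l y z) 0 - A11) * (y\<^sup>2 / 2)"
    by (simp add: algebra_simps add_divide_distrib diff_divide_distrib)
  have "norm (F l y z - (F l 0 0 + A1 * y + A2 * z + A11 * y\<^sup>2 / 2 + A22 * z\<^sup>2 / 2 + A12 * y * z)) \<le> ?K1 * ?n^3 + ?K1 * ?m^3 + (64 * M / r^3 * ?m^2) * ?n + (64 * M / r^3 * ?m) * (?n^2 / 2)"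
    unfolding eq
    by (intro norm_triangle_le add_mono t1 t2; simp only: norm_mult norm_divide norm_power; intro mult_mono t3' t4') (use M r in auto)
  also have "\<dots> \<le> 176 * M / r^3 * (?n + ?m)^3"
  proof -
    define K where "K = M / r^3"
    have K: "K \<ge> 0" using M r by (simp add: K_def)
    have "0 \<le> K * (152 * ?n^3 + 152 * ?m^3 + 464 * (?m^2 * ?n) + 496 * (?n^2 * ?m))"
      using K by (intro mult_nonneg_nonneg add_nonneg_nonneg) auto
    also have "\<dots> = 176 * K * (?n + ?m)^3 - (24 * K * ?n^3 + 24 * K * ?m^3 + (64 * K * ?m^2) * ?n + (64 * K * ?m) * (?n^2 / 2))"
      by (simp add: power3_eq_cube power2_eq_square algebra_simps)
    finally show ?thesis by (simp add: K_def)
  qed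
  finally show "norm (F l y z - (F l 0 0 + A1 * y + A2 * z + A11 * y\<^sup>2 / 2 + A22 * z\<^sup>2 / 2 + A12 * y * z)) \<le> 176 * M / r^3 * (norm y + norm z)^3" .
qed

text \<open>Kernels that agree with a heat kernel up to moments of order two, with total mass \<open>m0\<close>.\<close>

definition moments :: "complex \<Rightarrow> (real \<times> real \<Rightarrow> complex) \<Rightarrow> bool" where
  "moments m0 k \<longleftrightarrow> (\<forall>c0 c1 c2 d1 d2 d3. has_bochner_integral lborel (\<lambda>z. k z * (c0 + c1 * of_real (fst z) + c2 * of_real (snd z) + d1 * of_real ((fst z)^2) + d2 * of_real ((snd z)^2) + d3 * (of_real (fst z) * of_real (snd z)))) (m0 * c0 + 2 * (d1 + d2)))"

text \<open>The constant has to be uniform in \<open>l\<close>, since the Duhamel integral runs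
  through varying times, and in the scale \<open>p\<close>. The function \<open>G\<close> is tied to
  \<open>F\<close> near the origin only; elsewhere its bound is all that is known.\<close>

definition taylor_const :: "real \<Rightarrow> real \<Rightarrow> real \<Rightarrow> (complex \<Rightarrow> complex \<Rightarrow> complex \<Rightarrow> complex) \<Rightarrow> bool" where
  "taylor_const C r M F \<longleftrightarrow> (\<forall>l G p m0 k. l \<in> ball 0 (r/8) \<longrightarrow> G \<in> borel_measurable borel \<longrightarrow> (\<forall>w. norm (G w) \<le> M) \<longrightarrow>
      (\<forall>w. \<bar>fst w\<bar> < r \<longrightarrow> \<bar>snd w\<bar> < r \<longrightarrow> G w = F l (of_real (fst w)) (of_real (snd w))) \<longrightarrow> p > 0 \<longrightarrow> kern kC k \<longrightarrow>
      moments m0 k \<longrightarrow> norm (kconv k p G 0 - (m0 * F l 0 0 + of_real (p\<^sup>2) * lap F l)) \<le> C * p^3)"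

lemma taylor_constD:
  "taylor_const C r M F \<Longrightarrow> l \<in> ball 0 (r/8) \<Longrightarrow> G \<in> borel_measurable borel \<Longrightarrow> (\<And>w. norm (G w) \<le> M) \<Longrightarrow>
    (\<And>w. \<bar>fst w\<bar> < r \<Longrightarrow> \<bar>snd w\<bar> < r \<Longrightarrow> G w = F l (of_real (fst w)) (of_real (snd w))) \<Longrightarrow> p > 0 \<Longrightarrow> kern kC k \<Longrightarrow>
    moments m0 k \<Longrightarrow> norm (kconv k p G 0 - (m0 * F l 0 0 + of_real (p\<^sup>2) * lap F l)) \<le> C * p^3"
  unfolding taylor_const_def by blast

text \<open>The cubic remainder holds globally: near the origin by Taylor's formula, and beyond
  radius \<open>R\<close> because there a bounded function and a quadratic polynomial are dominated
  by a cube. Integrating the polynomial gives the main term by \<open>moments\<close>, and the third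
  Gaussian moment bounds the rest by \<open>p^3\<close>.\<close>

lemma kernel_taylor:
  assumes F: "hol3 r M F" and r: "r > 0"
  shows "\<exists>C\<ge>0. taylor_const C r M F"
proof -
  have M: "0 \<le> M" using hol3_bound[OF F, of 0 0 0] r by (simp add: order_trans[OF norm_ge_zero])
  define R where "R = r/8"
  have R: "R > 0" using r by (simp add: R_def)
  \<comment> \<open>The first summand serves the inner region, its \<open>8 = 2^3\<close> arising
    from the sum of two coordinates being at most \<open>2 * norm y\<close>; the bracket serves the
    outer region.\<close>
  define C1 where "C1 = 176 * M / r^3 * 8 + (2 * M / R^3 + 4 * M / r / R\<^sup>2 + 16 * M / r\<^sup>2 / R)"
  have C1: "C1 \<ge> 0" "176 * M / r^3 * 8 \<le> C1" "2 * M / R^3 + 4 * M / r / R\<^sup>2 + 16 * M / r\<^sup>2 / R \<le> C1" using M R r by (simp_all add: C1_def)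
  have "taylor_const (kC * C1 * gauss_mass) r M F" unfolding taylor_const_def
  proof (intro allI impI)
  fix l :: complex and G :: "real \<times> real \<Rightarrow> complex" and p :: real and m0 :: complex and k
  assume l: "l \<in> ball 0 (r/8)" and Gm[measurable]: "G \<in> borel_measurable borel" and "\<forall>w. norm (G w) \<le> M"
    and "\<forall>w. \<bar>fst w\<bar> < r \<longrightarrow> \<bar>snd w\<bar> < r \<longrightarrow> G w = F l (of_real (fst w)) (of_real (snd w))" and p: "p > 0" and k: "kern kC k"
    and "moments m0 k"
  then have GM: "norm (G w) \<le> M" and GF: "\<bar>fst w\<bar> < r \<Longrightarrow> \<bar>snd w\<bar> < r \<Longrightarrow> G w = F l (of_real (fst w)) (of_real (snd w))"
    and mk: "has_bochner_integral lborel (\<lambda>z. k z * (c0 + c1 * of_real (fst z) + c2 * of_real (snd z) + d1 * of_real ((fst z)^2) + d2 * of_real ((snd z)^2) + d3 * (of_real (fst z) * of_real (snd z)))) (m0 * c0 + 2 * (d1 + d2))" for w c0 c1 c2 d1 d2 d3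
    by (blast, blast, unfold moments_def, blast)
  define A1 A2 A11 A22 A12 where "A1 = deriv (\<lambda>\<alpha>. F l \<alpha> 0) 0" and "A2 = deriv (\<lambda>\<beta>. F l 0 \<beta>) 0"
    and "A11 = deriv (\<lambda>\<alpha>. deriv (\<lambda>\<alpha>. F l \<alpha> 0) \<alpha>) 0" and "A22 = deriv (\<lambda>\<beta>. deriv (\<lambda>\<beta>. F l 0 \<beta>) \<beta>) 0"
    and "A12 = deriv (\<lambda>\<beta>. deriv (\<lambda>\<alpha>. F l \<alpha> \<beta>) 0) 0"
  note T = hol3_taylor_2[OF F r l, folded A1_def A2_def A11_def A22_def A12_def]
  have b0: "(0::complex) \<in> ball 0 (r/8)" using r by simp
  note TA = T(2-6)[OF b0 b0]
  define P where "P y = F l 0 0 + A1 * of_real (fst y) + A2 * of_real (snd y) + A11 * of_real (fst y)^2 / 2 + A22 * of_real (snd y)^2 / 2 + A12 * of_real (fst y) * of_real (snd y)" for y :: "real \<times> real"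
  have rem: "norm (G y - P y) \<le> C1 * norm y ^ 3" for y
  proof -
    have f: "\<bar>fst y\<bar> \<le> norm y" "\<bar>snd y\<bar> \<le> norm y" using norm_fst_le[of "fst y" "snd y"] norm_snd_le[of "snd y" "fst y"] by auto
    show ?thesis
    proof (cases "norm y < R")
      case True
      then have "G y = F l (of_real (fst y)) (of_real (snd y))" using f r by (intro GF) (auto simp: R_def)
      moreover have "norm (F l (of_real (fst y)) (of_real (snd y)) - P y) \<le> 176 * M / r^3 * (norm (complex_of_real (fst y)) + norm (complex_of_real (snd y)))^3"
        unfolding P_def using f True by (intro T(1)) (auto simp: R_def)
      moreover have "176 * M / r^3 * (norm (complex_of_real (fst y)) + norm (complex_of_real (snd y)))^3 \<le> 176 * M / r^3 * (2 * norm y)^3"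
        using f M r by (intro mult_left_mono power_mono) auto
      moreover have "176 * M / r^3 * (2 * norm y)^3 = (176 * M / r^3 * 8) * norm y^3" by (simp add: power_mult_distrib)
      moreover have "(176 * M / r^3 * 8) * norm y^3 \<le> C1 * norm y^3" by (rule mult_right_mono[OF C1(2)]) simp
      ultimately show ?thesis by simp
    next
      case False
      then have n: "norm y \<ge> R" by simp
      define N where "N = norm y"
      have N: "N \<ge> R" "N > 0" using n R by (auto simp: N_def)
      have "norm (F l 0 0) \<le> M" using hol3_bound[OF F, of l 0 0] l r by auto
      moreover have "norm (A1 * of_real (fst y)) \<le> 2 * M / r * N" unfolding norm_mult using TA f M r by (intro mult_mono) (auto simp: N_def)
      moreover have "norm (A2 * of_real (snd y)) \<le> 2 * M / r * N" unfolding norm_mult using TA f M r by (intro mult_mono) (auto simp: N_def)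
      moreover have sq: "norm (complex_of_real (fst y)^2) \<le> N^2" "norm (complex_of_real (snd y)^2) \<le> N^2" using f unfolding norm_power N_def by (intro power_mono; simp)+
      moreover have "norm (A11 * of_real (fst y)^2 / 2) \<le> 8 * M / r\<^sup>2 * N^2 / 2"
        unfolding norm_divide norm_mult using TA sq M r by (intro divide_mono mult_mono) auto
      moreover have "norm (A22 * of_real (snd y)^2 / 2) \<le> 8 * M / r\<^sup>2 * N^2 / 2"
        unfolding norm_divide norm_mult using TA sq M r by (intro divide_mono mult_mono) auto
      moreover have "norm (A12 * of_real (fst y) * of_real (snd y)) \<le> 8 * M / r\<^sup>2 * N * N"
        unfolding norm_mult using TA f M r by (intro mult_mono) (auto simp: N_def)
      ultimately have "norm (G y - P y) \<le> M + (M + 2 * M / r * N + 2 * M / r * N + 8 * M / r\<^sup>2 * N^2 / 2 + 8 * M / r\<^sup>2 * N^2 / 2 + 8 * M / r\<^sup>2 * N * N)"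
        unfolding P_def by (intro norm_triangle_le_diff add_mono norm_triangle_le GM) auto
      also have "\<dots> = 2 * M * 1 + 4 * M / r * N + 16 * M / r\<^sup>2 * N^2" by (simp add: power2_eq_square)
      also have "\<dots> \<le> 2 * M * (N / R)^3 + 4 * M / r * (N * (N / R)^2) + 16 * M / r\<^sup>2 * (N^2 * (N / R)^1)"
      proof -
        have q: "1 \<le> (N / R)^j" for j using N R by (intro one_le_power) simp
        show ?thesis using M r N q[of 3] q[of 2] q[of 1] mult_left_mono[OF q[of 1], of "N^2"] by (intro add_mono mult_left_mono) auto
      qed
      also have "\<dots> = (2 * M / R^3 + 4 * M / r / R\<^sup>2 + 16 * M / r\<^sup>2 / R) * N^3"
        by (simp add: power_divide power3_eq_cube power2_eq_square algebra_simps)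
      also have "\<dots> \<le> C1 * N^3" using N by (intro mult_right_mono C1(3)) auto
      finally show ?thesis by (simp add: N_def)
    qed
  qed
  have ki: "has_bochner_integral lborel (\<lambda>z. k z * P (0 - p *\<^sub>R z)) (m0 * F l 0 0 + of_real (p\<^sup>2) * lap F l)"
  proof -
    have "has_bochner_integral lborel (\<lambda>z. k z * (F l 0 0 + (- p * A1) * of_real (fst z) + (- p * A2) * of_real (snd z) + (p^2 * A11 / 2) * of_real ((fst z)^2) + (p^2 * A22 / 2) * of_real ((snd z)^2) + (p^2 * A12) * (of_real (fst z) * of_real (snd z))))
      (m0 * F l 0 0 + 2 * (p^2 * A11 / 2 + p^2 * A22 / 2))" by (rule mk)
    also have "(\<lambda>z. k z * (F l 0 0 + (- p * A1) * of_real (fst z) + (- p * A2) * of_real (snd z) + (p^2 * A11 / 2) * of_real ((fst z)^2) + (p^2 * A22 / 2) * of_real ((snd z)^2) + (p^2 * A12) * (of_real (fst z) * of_real (snd z)))) = (\<lambda>z. k z * P (0 - p *\<^sub>R z))"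
      by (rule ext) (simp add: P_def power_mult_distrib power2_eq_square mult_ac)
    also have "m0 * F l 0 0 + 2 * (p^2 * A11 / 2 + p^2 * A22 / 2) = m0 * F l 0 0 + of_real (p\<^sup>2) * lap F l"
      by (simp add: lap_def A11_def A22_def algebra_simps)
    finally show ?thesis .
  qed
  have [measurable]: "(\<lambda>z::real\<times>real. fst z) \<in> borel_measurable borel" "(\<lambda>z::real\<times>real. snd z) \<in> borel_measurable borel"
    by (intro borel_measurable_continuous_onI continuous_intros)+
  have Pm[measurable]: "P \<in> borel_measurable borel" unfolding P_def by measurable
  have dm: "(\<lambda>z. G (0 - p *\<^sub>R z) - P (0 - p *\<^sub>R z)) \<in> borel_measurable borel" by measurable
  have db: "norm (G (0 - p *\<^sub>R z) - P (0 - p *\<^sub>R z)) \<le> (C1 * p^3) * (1 + norm z)^3" for z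
  proof -
    have "norm (G (0 - p *\<^sub>R z) - P (0 - p *\<^sub>R z)) \<le> C1 * norm (0 - p *\<^sub>R z) ^ 3" by (rule rem)
    also have "\<dots> = (C1 * p^3) * norm z ^ 3" using p by (simp add: power_mult_distrib)
    also have "\<dots> \<le> (C1 * p^3) * (1 + norm z)^3" using C1 p by (intro mult_left_mono power_mono) auto
    finally show ?thesis .
  qed
  have "(\<integral>z. k z * (G (0 - p *\<^sub>R z) - P (0 - p *\<^sub>R z)) \<partial>lborel) = kconv k p G 0 - (\<integral>z. k z * P (0 - p *\<^sub>R z) \<partial>lborel)"
    unfolding kconv_def right_diff_distrib
    by (rule Bochner_Integration.integral_diff[OF kconv_bound(1)[OF k Gm GM] integrable.intros[OF ki]])
  then show "norm (kconv k p G 0 - (m0 * F l 0 0 + of_real (p\<^sup>2) * lap F l)) \<le> kC * C1 * gauss_mass * p^3"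
    using kern_integrable(2)[OF k dm db] has_bochner_integral_integral_eq[OF ki] by (simp add: mult_ac)
  qed
  moreover have "kC * C1 * gauss_mass \<ge> 0" using kC_pos C1 gauss_mass_nonneg by simp
  ultimately show ?thesis by blast
qed

lemma moments_kernels: "moments 1 k1" "moments 0 l1"
  unfolding moments_def using moments_k1 moments_l1 by simp_all

lemma short_integral_bound:
  fixes h :: "real \<Rightarrow> complex"
  assumes i: "integrable lborel h" and b: "\<And>q. 0 < q \<Longrightarrow> q < s \<Longrightarrow> norm (h q - c) \<le> E" and s: "s > 0"
  shows "norm ((\<integral>q. indicator {0<..<s} q *\<^sub>R h q \<partial>lborel) - of_real s * c) \<le> s * E"
proof -
  have i1: "integrable lborel (\<lambda>q. indicator {0<..<s} q *\<^sub>R h q)" by (rule integrable_mult_indicator[OF _ i]) simp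
  have i2: "integrable lborel (\<lambda>q::real. indicator {0<..<s} q *\<^sub>R c)" "(\<integral>q. indicator {0<..<s} q *\<^sub>R c \<partial>(lborel::real measure)) = of_real s * c"
    using s by (simp_all add: scaleR_conv_of_real)
  have i3: "integrable lborel (\<lambda>q::real. indicator {0<..<s} q *\<^sub>R E)" "(\<integral>q. indicator {0<..<s} q *\<^sub>R E \<partial>(lborel::real measure)) = s * E"
    using s by simp_all
  have "(\<integral>q. indicator {0<..<s} q *\<^sub>R h q \<partial>lborel) - of_real s * c = (\<integral>q. indicator {0<..<s} q *\<^sub>R h q - indicator {0<..<s} q *\<^sub>R c \<partial>lborel)"
    unfolding i2(2)[symmetric] by (rule Bochner_Integration.integral_diff[OF i1 i2(1), symmetric])
  also have "norm \<dots> \<le> (\<integral>q. indicator {0<..<s} q *\<^sub>R E \<partial>lborel)"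
    by (rule Bochner_Integration.integral_norm_bound_integral[OF Bochner_Integration.integrable_diff[OF i1 i2(1)] i3(1)])
      (use b in \<open>auto simp: indicator_def\<close>)
  finally show ?thesis unfolding i3(2) .
qed

lemma kconv_rescale: "kconv k (c * p) \<phi> x = kconv k p (\<lambda>w. \<phi> (x + c *\<^sub>R w)) 0"
  by (simp add: kconv_def)

context small_data
begin

lemma hol3_log_rest:
  assumes "hol3 r M F"
  shows "hol3 r M (\<lambda>x y z. log_rest (F x y z))"
proof -
  have s: "norm (F x y z) \<le> M" if "x \<in> ball 0 r" "y \<in> ball 0 r" "z \<in> ball 0 r" for x y z
    by (rule hol3_bound[OF assms that])
  have b: "norm (log_rest w) \<le> M" if "norm w \<le> M" for w
  proof -
    have "norm (log_rest w - log_rest 0) \<le> 2 * M * norm (w - 0)" using that M by (intro log_rest_lipschitz) auto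
    also have "\<dots> \<le> 1 * M" using that M by (intro mult_mono) auto
    finally show ?thesis by simp
  qed
  have h: "(\<lambda>u. log_rest (g u)) holomorphic_on ball 0 r" if "g holomorphic_on ball 0 r" "\<And>u. u \<in> ball 0 r \<Longrightarrow> norm (g u) \<le> M" for g :: "complex \<Rightarrow> complex"
    unfolding log_rest_def
  proof (intro holomorphic_intros that(1))
    fix u assume "u \<in> ball (0::complex) r"
    then have "norm (g u) \<le> 1/4" using that(2)[of u] M by linarith
    then show "1 + g u \<notin> \<real>\<^sub>\<le>\<^sub>0" by (rule one_plus_small)
  qed
  show ?thesis unfolding hol3_def
    by (intro conjI ballI b s h) (use assms in \<open>unfold hol3_def, blast\<close>)+
qed

text \<open>Restart the solution at time \<open>a\<close> and expand the integral equation to first order in the elapsed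
  time.\<close>

lemma sol_pde:
  fixes x :: "real \<times> real"
  assumes \<phi>: "\<phi> \<in> borel_measurable borel" "\<And>y. norm (\<phi> y) \<le> e" and a: "a > 0"
  defines "F \<equiv> \<lambda>l \<alpha> \<beta>. sol \<phi> a x (1 + l) \<alpha> \<beta>"
  shows "deriv (\<lambda>l. F l 0 0) 0 = lap F 0 + lap (\<lambda>l \<alpha> \<beta>. log_rest (F l \<alpha> \<beta>)) 0"
proof -
  define Q where "Q = (\<lambda>l \<alpha> \<beta>. log_rest (F l \<alpha> \<beta>))"
  define f where "f = (\<lambda>s y. log_rest (sol \<phi> s y 1 0 0))"
  have F: "hol3 (1/4) M F" unfolding F_def by (rule sol_hol3[OF \<phi> a])
  have Qh: "hol3 (1/4) M Q" unfolding Q_def by (rule hol3_log_rest[OF F])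
  have f: "admissible (2 * M * M) M (1/4) f" unfolding f_def by (rule admissible_log_rest[OF sol_admissible[OF par_1 \<phi>] M(3)])
  have H: "admissible M M (1/4) (\<lambda>t x. sol \<phi> t x 1 0 0)" by (rule sol_admissible[OF par_1 \<phi>])
  have FH: "F (of_real l) (of_real \<alpha>) (of_real \<beta>) = sol \<phi> (a * (1 + l)) (x + sqrt a *\<^sub>R (\<alpha>, \<beta>)) 1 0 0" if "\<bar>l\<bar> < 1/4" for l \<alpha> \<beta>
    using sol_scale[OF \<phi>(1) _ a, of "1 + l" x \<alpha> \<beta>] that unfolding F_def by (simp add: mult.commute)
  obtain CF where CF: "CF \<ge> 0" "taylor_const CF (1/4) M F"
    using kernel_taylor[OF F] by auto
  obtain CQ where CQ: "CQ \<ge> 0" "taylor_const CQ (1/4) M Q"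
    using kernel_taylor[OF Qh] by auto
  let ?X = "lap F 0 + lap Q 0" and ?D = "deriv (\<lambda>l. F l 0 0) 0"
  \<comment> \<open>The sources act at times between \<open>a\<close> and \<open>a + s\<close>; this
    bound moves their Laplacian back to time \<open>a\<close>.\<close>
  obtain CL where CL: "CL \<ge> 0" "\<And>l. l \<in> ball 0 (1/32) \<Longrightarrow> norm (lap Q l - lap Q 0) \<le> CL * norm l"
  proof
    have q4: "(1/4::real) > 0" "(1/4/2::real) > 0" "(1/4/2/2::real) > 0" by auto
    note h2 = hol3_deriv2[OF hol3_deriv2[OF Qh q4(1)] q4(2)] and h3 = hol3_deriv3[OF hol3_deriv3[OF Qh q4(1)] q4(2)]
    let ?c = "2 * (2 * (2 * M / (1/4)) / (1/4/2)) / (1/4/2/2)"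
    show "2 * ?c \<ge> 0" using M by simp
    fix l :: complex assume l: "l \<in> ball 0 (1/32)"
    have z: "(0::complex) \<in> ball 0 (1/4/2/2/2)" "l \<in> ball 0 (1/4/2/2/2)" using l by auto
    have "norm (lap Q l - lap Q 0) \<le> ?c * (norm (l - 0) + norm (0 - 0 :: complex) + norm (0 - 0 :: complex)) + ?c * (norm (l - 0) + norm (0 - 0 :: complex) + norm (0 - 0 :: complex))"
      unfolding lap_def add_diff_add
      by (intro norm_triangle_le add_mono hol3_lipschitz[OF h2 q4(3) z(1,1,1,2,1,1)] hol3_lipschitz[OF h3 q4(3) z(1,1,1,2,1,1)])
    then show "norm (lap Q l - lap Q 0) \<le> 2 * ?c * norm l" by simp
  qed
  \<comment> \<open>Here \<open>\<sigma>\<close> is the elapsed time relative to \<open>a\<close>.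
    All errors are of order \<open>\<sigma> * sqrt \<sigma>\<close> against a first-order identity,
    so division by \<open>\<sigma>\<close> and the limit \<open>\<sigma> \<rightarrow> 0\<close>
    give equality.\<close>
  have key: "norm (of_real \<sigma> * (?D - ?X)) \<le> (8 * M * 16 + CF + CQ + CL) * (\<sigma> * sqrt \<sigma>)" if \<sigma>: "0 < \<sigma>" "\<sigma> < 1/64" for \<sigma>
  proof -
    define s where "s = a * \<sigma>"
    have s: "s > 0" and as: "a + s = a * (1 + \<sigma>)" "a + s > 0" using a \<sigma> by (simp_all add: s_def algebra_simps add_pos_pos)
    have sq: "\<sigma> \<le> sqrt \<sigma>" using min_one_le_sqrt[of \<sigma>] \<sigma> by simp
    have d1: "norm (F (of_real \<sigma>) 0 0 - F 0 0 0 - (of_real \<sigma> - 0) * ?D) \<le> 8 * M / (1/4)\<^sup>2 * norm (complex_of_real \<sigma> - 0)^2"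
      by (rule hol3_taylor1[OF F]) (use \<sigma> in auto)
    have "norm (complex_of_real \<sigma> - 0)^2 \<le> \<sigma> * sqrt \<sigma>" using \<sigma> sq by (simp add: power2_eq_square)
    then have "8 * M / (1/4)\<^sup>2 * norm (complex_of_real \<sigma> - 0)^2 \<le> 8 * M / (1/4)\<^sup>2 * (\<sigma> * sqrt \<sigma>)"
      using M by (intro mult_left_mono) auto
    with d1 have d1': "norm (F (of_real \<sigma>) 0 0 - F 0 0 0 - of_real \<sigma> * ?D) \<le> (8 * M * 16) * (\<sigma> * sqrt \<sigma>)"
      by (simp add: power2_eq_square)
    have d2: "norm (kconv k1 (sqrt s) (\<lambda>y. sol \<phi> a y 1 0 0) x - (1 * F 0 0 0 + of_real ((sqrt \<sigma>)\<^sup>2) * lap F 0)) \<le> CF * sqrt \<sigma> ^ 3"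
      unfolding s_def real_sqrt_mult kconv_rescale
    proof (rule taylor_constD[OF CF(2) _ _ _ _ _ k1_kern moments_kernels(1)])
      show "(\<lambda>w. sol \<phi> a (x + sqrt a *\<^sub>R w) 1 0 0) \<in> borel_measurable borel"
        by (rule measurable_compose[OF _ admissible_slice[OF H]]) measurable
      show "norm (sol \<phi> a (x + sqrt a *\<^sub>R w) 1 0 0) \<le> M" for w by (rule admissible_bound[OF H a])
      show "sol \<phi> a (x + sqrt a *\<^sub>R w) 1 0 0 = F 0 (of_real (fst w)) (of_real (snd w))" for w
        using FH[of 0 "fst w" "snd w"] by simp
    qed (use \<sigma> in auto)
    have s3: "sqrt \<sigma> ^ 3 = \<sigma> * sqrt \<sigma>" using \<sigma> by (simp add: power3_eq_cube)
    have d2': "norm (kconv k1 (sqrt s) (\<lambda>y. sol \<phi> a y 1 0 0) x - (F 0 0 0 + of_real \<sigma> * lap F 0)) \<le> CF * (\<sigma> * sqrt \<sigma>)"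
      using d2 \<sigma> unfolding s3 by simp
    \<comment> \<open>At each elapsed time \<open>q\<close> the integrand
      \<open>l1\<close>-convolution divided by \<open>q\<close> approaches the Laplacian of the
      source, with error \<open>sqrt (q / a)\<close>; thus the Duhamel part over a short time is its
      length times that Laplacian.\<close>
    have d3: "norm ((\<integral>q. indicator {0<..<s} q *\<^sub>R Ed f (a + s) x q \<partial>lborel) - of_real s * (lap Q 0 / of_real a)) \<le> s * ((CQ + CL) * sqrt \<sigma> / a)"
    proof (rule short_integral_bound[OF Ed_integral(1)[OF f as(2)] _ s])
      fix q assume q: "0 < q" "q < s"
      define l where "l = \<sigma> - q / a"
      have qa: "q / a < \<sigma>" "0 < q / a" using q a by (simp_all add: s_def field_simps)
      have l: "0 < l" "l < \<sigma>" "\<bar>l\<bar> < 1/4" using qa \<sigma> by (simp_all add: l_def)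
      have asq: "a + s - q = a * (1 + l)" using a by (simp add: l_def s_def field_simps)
      have pos: "a + s - q > 0" using q a by simp
      have qq: "sqrt q = sqrt a * sqrt (q / a)" using a by (simp add: real_sqrt_divide)
      have "norm (kconv l1 (sqrt q) (f (a + s - q)) x - (0 * Q (of_real l) 0 0 + of_real ((sqrt (q / a))\<^sup>2) * lap Q (of_real l))) \<le> CQ * sqrt (q / a) ^ 3"
        unfolding qq kconv_rescale
      proof (rule taylor_constD[OF CQ(2) _ _ _ _ _ l1_kern moments_kernels(2)])
        show "(\<lambda>w. f (a + s - q) (x + sqrt a *\<^sub>R w)) \<in> borel_measurable borel"
          by (rule measurable_compose[OF _ admissible_slice[OF f]]) measurable
        show "norm (f (a + s - q) (x + sqrt a *\<^sub>R w)) \<le> M" for w by (rule admissible_bound[OF f pos])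
        show "f (a + s - q) (x + sqrt a *\<^sub>R w) = Q (of_real l) (of_real (fst w)) (of_real (snd w))" for w
          unfolding f_def Q_def FH[OF l(3)] asq by simp
      qed (use l \<sigma> qa in auto)
      then have e1: "norm (kconv l1 (sqrt q) (f (a + s - q)) x - of_real (q / a) * lap Q (of_real l)) \<le> CQ * (q / a * sqrt (q / a))"
        using qa q a by (simp add: power3_eq_cube)
      have e2: "kconv l1 (sqrt q) (f (a + s - q)) x / of_real q - lap Q (of_real l) / of_real a
        = (kconv l1 (sqrt q) (f (a + s - q)) x - of_real (q / a) * lap Q (of_real l)) / of_real q"
        using q a by (simp add: diff_divide_distrib)
      have "norm (kconv l1 (sqrt q) (f (a + s - q)) x / of_real q - lap Q (of_real l) / of_real a) \<le> CQ * (q / a * sqrt (q / a)) / q"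
        unfolding e2 norm_divide using divide_right_mono[OF e1, of q] q by simp
      also have "\<dots> = CQ * sqrt (q / a) / a" using q by simp
      also have "\<dots> \<le> CQ * sqrt \<sigma> / a" using qa CQ(1) a by (intro divide_right_mono mult_left_mono) auto
      finally have 1: "norm (kconv l1 (sqrt q) (f (a + s - q)) x / of_real q - lap Q (of_real l) / of_real a) \<le> CQ * sqrt \<sigma> / a" .
      have "norm (lap Q (of_real l) - lap Q 0) \<le> CL * norm (complex_of_real l)" using l \<sigma> by (intro CL(2)) auto
      also have "\<dots> \<le> CL * sqrt \<sigma>" using l sq CL(1) by (intro mult_left_mono) auto
      finally have 2: "norm (lap Q (of_real l) / of_real a - lap Q 0 / of_real a) \<le> CL * sqrt \<sigma> / a"
        using a by (simp add: norm_divide divide_right_mono flip: diff_divide_distrib)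
      have Eq: "Ed f (a + s) x q = kconv l1 (sqrt q) (f (a + s - q)) x / of_real q" using q a by (simp add: Ed_def)
      have "norm (Ed f (a + s) x q - lap Q 0 / of_real a) \<le> norm (kconv l1 (sqrt q) (f (a + s - q)) x / of_real q - lap Q (of_real l) / of_real a)
         + norm (lap Q (of_real l) / of_real a - lap Q 0 / of_real a)"
        unfolding Eq by (rule norm_diff_triangle_ineq[of _ "lap Q (of_real l) / of_real a" "lap Q (of_real l) / of_real a", simplified] norm_diff_triangle_le[OF order_refl order_refl])
      also have "\<dots> \<le> CQ * sqrt \<sigma> / a + CL * sqrt \<sigma> / a" by (rule add_mono[OF 1 2])
      finally show "norm (Ed f (a + s) x q - lap Q 0 / of_real a) \<le> (CQ + CL) * sqrt \<sigma> / a"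
        by (simp add: algebra_simps add_divide_distrib)
    qed
    let ?I = "\<integral>q. indicator {0<..<s} q *\<^sub>R Ed f (a + s) x q \<partial>lborel" and ?c = "kconv k1 (sqrt s) (\<lambda>y. sol \<phi> a y 1 0 0) x"
    have d3': "norm (?I - of_real \<sigma> * lap Q 0) \<le> (CQ + CL) * (\<sigma> * sqrt \<sigma>)"
      using d3 a by (simp add: s_def mult_ac)
    have "F (of_real \<sigma>) 0 0 = sol \<phi> (a + s) x 1 0 0" using FH[of \<sigma> 0 0] \<sigma> by (simp add: as(1) flip: zero_prod_def)
    then have "F (of_real \<sigma>) 0 0 = ?c + ?I" using sol_restart[OF \<phi> a s, of x] by (simp add: f_def)
    then have "of_real \<sigma> * (?D - ?X) = (?c - (F 0 0 0 + of_real \<sigma> * lap F 0)) + (?I - of_real \<sigma> * lap Q 0) - (F (of_real \<sigma>) 0 0 - F 0 0 0 - of_real \<sigma> * ?D)"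
      by (simp add: algebra_simps)
    also have "norm \<dots> \<le> (CF * (\<sigma> * sqrt \<sigma>) + (CQ + CL) * (\<sigma> * sqrt \<sigma>)) + (8 * M * 16) * (\<sigma> * sqrt \<sigma>)"
      by (intro norm_triangle_le_diff add_mono norm_triangle_le d1' d2' d3')
    finally show ?thesis by (simp add: algebra_simps)
  qed
  define K where "K = 8 * M * 16 + CF + CQ + CL"
  have "norm (?D - ?X) \<le> K * sqrt \<sigma>" if "0 < \<sigma>" "\<sigma> < 1/64" for \<sigma>
  proof -
    have "\<sigma> * norm (?D - ?X) \<le> \<sigma> * (K * sqrt \<sigma>)" using key[OF that] that by (simp add: K_def norm_mult mult_ac)
    then show ?thesis using that by simp
  qed
  then have "\<forall>\<^sub>F \<sigma> in at_right 0. norm (?D - ?X) \<le> K * sqrt \<sigma>"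
    using eventually_at_right_real[of 0 "1/64"] by (auto elim!: eventually_mono)
  moreover have "((\<lambda>\<sigma>. K * sqrt \<sigma>) \<longlongrightarrow> K * sqrt 0) (at_right 0)" by (intro tendsto_intros)
  ultimately have "norm (?D - ?X) \<le> K * sqrt 0" using tendsto_lowerbound trivial_limit_at_right_real by blast
  then show ?thesis by (simp add: Q_def)
qed

end

section \<open>The real solution, its initial values and its equation\<close>

definition coords :: "real^2 \<Rightarrow> real \<times> real" where "coords v = (v$1, v$2)"

definition real_sol :: "(real \<times> real \<Rightarrow> real) \<Rightarrow> real \<Rightarrow> real \<times> real \<Rightarrow> real" where
  "real_sol \<phi> t x = Re (sol (\<lambda>y. of_real (\<phi> y)) t x 1 0 0)"

lemma hol3_rescale:
  assumes F: "hol3 r M F" and c: "c > 0" "d > 0" and r': "r' \<le> r * c" "r' \<le> r * d"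
  shows "hol3 r' M (\<lambda>x y z. F (x / of_real c) (y / of_real d) (z / of_real d))"
proof -
  have m: "x / of_real c \<in> ball 0 r" "x / of_real d \<in> ball 0 r" if "x \<in> ball 0 r'" for x :: complex
    using that c r' by (auto simp: norm_divide divide_less_eq)
  have h: "(\<lambda>x. g (x / of_real a)) holomorphic_on ball 0 r'" if "g holomorphic_on ball 0 r" "\<And>x::complex. x \<in> ball 0 r' \<Longrightarrow> x / of_real a \<in> ball 0 r" "a > 0" for g and a :: real
  proof -
    have 1: "(\<lambda>x. x / of_real a) ` ball 0 r' \<subseteq> ball (0::complex) r" using that(2) by blast
    have 2: "(\<lambda>x::complex. x / of_real a) holomorphic_on ball 0 r'" using that(3) by (intro holomorphic_intros) auto
    show ?thesis using holomorphic_on_compose_gen[OF 2 that(1) 1] by (simp add: o_def)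
  qed
  have F1: "(\<lambda>x. F x y z) holomorphic_on ball 0 r" "(\<lambda>x. F y x z) holomorphic_on ball 0 r" "(\<lambda>x. F y z x) holomorphic_on ball 0 r"
    if "y \<in> ball 0 r" "z \<in> ball 0 r" for y z
    using F that unfolding hol3_def by blast+
  show ?thesis unfolding hol3_def
  proof (intro conjI ballI)
    fix y z :: complex assume yz: "y \<in> ball 0 r'" "z \<in> ball 0 r'"
    show "norm (F (x / of_real c) (y / of_real d) (z / of_real d)) \<le> M" if "x \<in> ball 0 r'" for x
      by (rule hol3_bound[OF F m(1)[OF that] m(2)[OF yz(1)] m(2)[OF yz(2)]])
    show "(\<lambda>x. F (x / of_real c) (y / of_real d) (z / of_real d)) holomorphic_on ball 0 r'"
      by (rule h[OF F1(1)[OF m(2)[OF yz(1)] m(2)[OF yz(2)]] m(1) c(1)])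
    show "(\<lambda>x. F (y / of_real c) (x / of_real d) (z / of_real d)) holomorphic_on ball 0 r'"
      by (rule h[OF F1(2)[OF m(1)[OF yz(1)] m(2)[OF yz(2)]] m(2) c(2)])
    show "(\<lambda>x. F (y / of_real c) (z / of_real d) (x / of_real d)) holomorphic_on ball 0 r'"
      by (rule h[OF F1(3)[OF m(1)[OF yz(1)] m(2)[OF yz(2)]] m(2) c(2)])
  qed
qed

lemma holomorphic_real_derivative:
  assumes "f holomorphic_on ball 0 r" "\<bar>\<alpha>\<bar> < r"
  shows "((\<lambda>\<alpha>. Re (f (of_real \<alpha>))) has_field_derivative Re (deriv f (of_real \<alpha>))) (at \<alpha>)"
proof -
  have "(f has_field_derivative deriv f (of_real \<alpha>)) (at (of_real \<alpha>))"
    using assms by (intro holomorphic_on_deriv_ball[OF assms(1)]) simp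
  from has_vector_derivative_real_field[OF this]
  have "((\<lambda>\<alpha>. f (of_real \<alpha>)) has_vector_derivative deriv f (of_real \<alpha>)) (at \<alpha>)" .
  then have "((\<lambda>\<alpha>. Re (f (of_real \<alpha>))) has_vector_derivative Re (deriv f (of_real \<alpha>))) (at \<alpha>)"
    by (rule bounded_linear.has_vector_derivative[OF bounded_linear_Re])
  then show ?thesis by (simp add: has_real_derivative_iff_has_vector_derivative)
qed

lemma second_derivative_at_minimum:
  fixes f :: "real \<Rightarrow> real"
  assumes r: "r > 0" and f: "\<And>x. \<bar>x\<bar> < r \<Longrightarrow> (f has_field_derivative f' x) (at x)" and d: "(f' has_field_derivative d) (at 0)"
    and m: "\<And>x. \<bar>x\<bar> < r \<Longrightarrow> f 0 \<le> f x"
  shows "0 \<le> d"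
proof (rule ccontr)
  assume "\<not> 0 \<le> d"
  then have dn: "d < 0" by simp
  have f0: "f' 0 = 0" using DERIV_local_min[OF f[of 0] r] m r by auto
  obtain s where s: "s > 0" "\<And>h. 0 < h \<Longrightarrow> h < s \<Longrightarrow> f' h < f' 0"
    using DERIV_neg_dec_right[OF d dn] by auto
  define b where "b = min r s / 2"
  have b: "0 < b" "b < r" "b < s" using r s by (auto simp: b_def)
  obtain z where z: "0 < z" "z < b" "f b - f 0 = (b - 0) * f' z"
    using MVT2[OF b(1), of f f'] f b by (metis abs_of_nonneg le_less_trans)
  have "f' z < 0" using s(2)[of z] z b f0 by simp
  then have "f b < f 0" using z b by (smt (verit) mult_pos_neg)
  then show False using m[of b] b by simp
qed

context small_data
begin

text \<open>For Hoelder data the iteration preserves the seminorm with weight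
  \<open>\<beta> = 0\<close>: the heat flow keeps it up to the factor \<open>KK\<close>, and the
  Duhamel term returns less than half of the bound.\<close>

lemma sol_zero_data_hoelder:
  assumes p: "par l a b" and \<phi>: "\<phi> \<in> borel_measurable borel" "\<And>y. norm (\<phi> y) \<le> e" and A: "hoelder A \<phi>"
  shows "admissible (2 * KK * A) M 0 (\<lambda>t x. sol \<phi> t x l a b)"
proof -
  define A' where "A' = 2 * KK * A"
  have A0: "A \<ge> 0" by (rule hoelder_nonneg[OF A])
  have A'0: "A' \<ge> 0" using A0 KK_bounds by (simp add: A'_def)
  have picard: "admissible A' M 0 (\<lambda>t x. picard \<phi> n t x l a b)" for n
  proof (induction n)
    case 0
    then show ?case using M(1) A'0 by (simp add: admissible_def hoelder_def)
  next
    case (Suc n)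
    note N = admissible_log_rest[OF Suc M(3)]
    show ?case unfolding admissible_def
    proof (intro conjI allI impI picard_measurable \<phi>(1))
      fix t :: real assume t: "t > 0"
      show "norm (picard \<phi> (Suc n) t x l a b) \<le> M" for x by (rule admissible_bound[OF picard_admissible[OF p \<phi>] t])
      have 1: "hoelder (KK * A) (\<lambda>x. heat \<phi> t x l a b)"
        using KK_bounds A0 by (intro hoelder_mono[OF heat_hold'[OF p \<phi> A]] mult_right_mono) auto
      have 2: "hoelder (kH * (2 * M * A') * t powr (-0)) (\<lambda>x. duhamel (\<lambda>s y. log_rest (picard \<phi> n s y l a b)) t x l a b)"
        by (rule duhamel_hoelder[OF p N _ _ t]) auto
      have "kH * (2 * M * A') * t powr (-0) \<le> KK * (2 * M * A')" using t KK_bounds M A'0 by (simp add: mult_right_mono)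
      also have "\<dots> \<le> KK * A" using mult_right_mono[OF M(4) A'0] A'0 unfolding A'_def by (simp add: mult_ac)
      finally have 3: "KK * A + kH * (2 * M * A') * t powr (-0) \<le> A' * t powr - 0" using t by (simp add: A'_def mult_ac)
      show "hoelder (A' * t powr - 0) (\<lambda>x. picard \<phi> (Suc n) t x l a b)"
        unfolding picard.simps by (rule hoelder_mono[OF hoelder_add[OF 1 2] 3])
    qed
  qed
  show ?thesis unfolding A'_def[symmetric] admissible_def
  proof (intro conjI allI impI sol_measurable \<phi>)
    fix t :: real assume t: "t > 0"
    show "norm (sol \<phi> t x l a b) \<le> M" for x by (rule admissible_bound[OF sol_admissible[OF p \<phi>] t])
    show "hoelder (A' * t powr -0) (\<lambda>x. sol \<phi> t x l a b)"
      by (rule hoelder_limit[OF admissible_hoelder[OF picard t] picard_sol(1)[OF p \<phi> t]])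
  qed
qed

text \<open>With weight \<open>\<beta> = 0\<close> the Duhamel term is of order
  \<open>t powr (1/4)\<close>, and so is the heat flow minus Hoelder data. The initial values are
  attained uniformly in \<open>x\<close>, which the comparison principle uses as its starting
  point.\<close>

lemma sol_initial:
  assumes \<phi>: "\<phi> \<in> borel_measurable borel" "\<And>y. norm (\<phi> y) \<le> e" and A: "hoelder A \<phi>" and t: "t > 0"
  shows "norm (sol \<phi> t x 1 0 0 - \<phi> x) \<le> 2 * KK * A * t powr (1/4)"
proof -
  let ?A = "2 * KK * A"
  have A0: "A \<ge> 0" by (rule hoelder_nonneg[OF A])
  note N = admissible_log_rest[OF sol_zero_data_hoelder[OF par_1 \<phi> A] M(3)]
  have "norm (duhamel (\<lambda>s y. log_rest (sol \<phi> s y 1 0 0)) t x 1 0 0) \<le> kC * gauss_mass * w0 * (2 * M * ?A) * t powr (1/4 - 0)"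
    by (rule duhamel_bound[OF par_1 N _ _ t]) auto
  also have "\<dots> \<le> KK * (2 * M * ?A) * t powr (1/4)"
    using KK_bounds M A0 by (simp add: mult_right_mono)
  also have "\<dots> \<le> KK * A * t powr (1/4)"
  proof (rule mult_right_mono)
    have "(12 * M * KK) * (A * KK) \<le> 1 * (A * KK)" using M(4) A0 KK_bounds by (intro mult_right_mono) auto
    moreover have "0 \<le> (M * KK) * (A * KK)" using M(1) A0 KK_bounds by simp
    moreover have "KK * (2 * M * ?A) = 4 * ((M * KK) * (A * KK))" by simp
    ultimately show "KK * (2 * M * ?A) \<le> KK * A" by (simp only: mult.assoc mult.commute[of KK A])
  qed simp
  finally have 1: "norm (duhamel (\<lambda>s y. log_rest (sol \<phi> s y 1 0 0)) t x 1 0 0) \<le> KK * A * t powr (1/4)" .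
  have k1i: "has_bochner_integral lborel (\<lambda>z. k1 z * \<phi> x) (\<phi> x)"
    using moments_k1[of "\<phi> x" 0 0 0 0 0] by simp
  have [measurable]: "\<phi> \<in> borel_measurable borel" by (rule \<phi>(1))
  have "(\<integral>z. k1 z * (\<phi> (x - sqrt t *\<^sub>R z) - \<phi> x) \<partial>lborel) = kconv k1 (sqrt t) \<phi> x - (\<integral>z. k1 z * \<phi> x \<partial>lborel)"
    unfolding kconv_def right_diff_distrib
    by (rule Bochner_Integration.integral_diff[OF kconv_bound(1)[OF k1_kern \<phi>] integrable.intros[OF k1i]])
  then have eq: "heat \<phi> t x 1 0 0 - \<phi> x = (\<integral>z. k1 z * (\<phi> (x - sqrt t *\<^sub>R z) - \<phi> x) \<partial>lborel)"
    using has_bochner_integral_integral_eq[OF k1i] by (simp add: heat_1)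
  have b: "norm (\<phi> (x - sqrt t *\<^sub>R z) - \<phi> x) \<le> (A * t powr (1/4)) * (1 + norm z)^3" for z
  proof -
    have "norm (\<phi> (x - sqrt t *\<^sub>R z) - \<phi> x) \<le> A * sqrt (norm ((x - sqrt t *\<^sub>R z) - x))" by (rule hoelder_D[OF A])
    also have "\<dots> = A * t powr (1/4) * sqrt (norm z)" using t by (simp add: real_sqrt_mult sqrt_sqrt_powr(1))
    also have "\<dots> \<le> A * t powr (1/4) * (1 + norm z)^3" using A0 cube_ge(2)[of "norm z"] by (intro mult_left_mono) auto
    finally show ?thesis .
  qed
  have "norm (heat \<phi> t x 1 0 0 - \<phi> x) \<le> kC * (A * t powr (1/4)) * gauss_mass"
    unfolding eq by (rule kern_integrable(2)[OF k1_kern _ b]) measurable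
  also have "\<dots> = (kC * gauss_mass) * (A * t powr (1/4))" by simp
  also have "\<dots> \<le> KK * (A * t powr (1/4))" using KK_bounds A0 by (intro mult_right_mono) auto
  finally have 2: "norm (heat \<phi> t x 1 0 0 - \<phi> x) \<le> KK * A * t powr (1/4)" by simp
  have "sol \<phi> t x 1 0 0 - \<phi> x = (heat \<phi> t x 1 0 0 - \<phi> x) + duhamel (\<lambda>s y. log_rest (sol \<phi> s y 1 0 0)) t x 1 0 0"
    using sol_eq[OF par_1 \<phi> t, of x] by simp
  then have "norm (sol \<phi> t x 1 0 0 - \<phi> x) \<le> KK * A * t powr (1/4) + KK * A * t powr (1/4)"
    using norm_triangle_mono[OF 2 1] by (simp only:)
  then show ?thesis by linarith
qed

definition data :: "(real \<times> real \<Rightarrow> real) \<Rightarrow> bool" where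
  "data \<phi> \<longleftrightarrow> \<phi> \<in> borel_measurable borel \<and> (\<forall>y. \<bar>\<phi> y\<bar> \<le> e)"

lemma data_complex:
  assumes "data \<phi>"
  shows "(\<lambda>y. complex_of_real (\<phi> y)) \<in> borel_measurable borel" "norm (complex_of_real (\<phi> y)) \<le> e"
proof -
  have [measurable]: "\<phi> \<in> borel_measurable borel" using assms by (simp add: data_def)
  show "(\<lambda>y. complex_of_real (\<phi> y)) \<in> borel_measurable borel" by measurable
  show "norm (complex_of_real (\<phi> y)) \<le> e" using assms unfolding data_def norm_of_real by blast
qed

abbreviation FF :: "(real \<times> real \<Rightarrow> real) \<Rightarrow> real \<Rightarrow> real \<times> real \<Rightarrow> complex \<Rightarrow> complex \<Rightarrow> complex \<Rightarrow> complex" where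
  "FF \<phi> t x \<equiv> (\<lambda>l \<alpha> \<beta>. sol (\<lambda>y. of_real (\<phi> y)) t x (1 + l) \<alpha> \<beta>)"

lemma real_sol_sol:
  assumes "data \<phi>" "t > 0"
  shows "sol (\<lambda>y. of_real (\<phi> y)) t x 1 0 0 = of_real (real_sol \<phi> t x)"
  using sol_Reals[OF data_complex[OF assms(1)] _ assms(2), of x] unfolding real_sol_def by (simp add: of_real_Re)

lemma FF_hol3: "data \<phi> \<Longrightarrow> t > 0 \<Longrightarrow> hol3 (1/4) M (FF \<phi> t x)"
  by (rule sol_hol3[OF data_complex])

lemma FF_real:
  assumes "data \<phi>" "t > 0" "\<bar>l\<bar> < 1/4"
  shows "FF \<phi> t x (of_real l) (of_real \<alpha>) (of_real \<beta>) = of_real (real_sol \<phi> (t * (1 + l)) (x + sqrt t *\<^sub>R (\<alpha>, \<beta>)))"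
proof -
  have "FF \<phi> t x (of_real l) (of_real \<alpha>) (of_real \<beta>) = sol (\<lambda>y. of_real (\<phi> y)) ((1 + l) * t) (x + sqrt t *\<^sub>R (\<alpha>, \<beta>)) 1 0 0"
    using sol_scale[OF data_complex(1)[OF assms(1)] _ assms(2), of "1 + l" x \<alpha> \<beta>] assms(3) by simp
  also have "\<dots> = of_real (real_sol \<phi> ((1 + l) * t) (x + sqrt t *\<^sub>R (\<alpha>, \<beta>)))"
    by (rule real_sol_sol[OF assms(1)]) (use assms in simp)
  finally show ?thesis by (simp add: mult.commute)
qed

lemma real_sol_bound:
  assumes "data \<phi>" "t > 0"
  shows "\<bar>real_sol \<phi> t x\<bar> \<le> M"
proof -
  have "norm (sol (\<lambda>y. of_real (\<phi> y)) t x 1 0 0) \<le> M"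
    by (rule admissible_bound[OF sol_admissible[OF par_1 data_complex[OF assms(1)]] assms(2)])
  then show ?thesis unfolding real_sol_sol[OF assms] by simp
qed

lemma real_sol_param_analytic:
  assumes "data \<phi>"
  shows "param_analytic (\<lambda>q. real_sol \<phi> (fst q) (coords (snd q))) ({0<..} \<times> UNIV)"
  unfolding param_analytic_def
proof (intro ballI)
  fix q :: "real \<times> (real^2)" assume "q \<in> {0<..} \<times> UNIV"
  then obtain t v where q: "q = (t, v)" and t: "t > 0" by (cases q) auto
  define r where "r = min (1/4 * t) (1/4 * sqrt t)"
  have r: "r > 0" using t by (simp add: r_def)
  let ?f = "\<lambda>x y z. FF \<phi> t (coords v) (x / of_real t) (y / of_real (sqrt t)) (z / of_real (sqrt t))"
  have "hol3 r M ?f" by (rule hol3_rescale[OF FF_hol3[OF assms t]]) (use t in \<open>auto simp: r_def\<close>)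
  moreover have "real_sol \<phi> (fst (q + (\<tau>, y))) (coords (snd (q + (\<tau>, y)))) = Re (?f (of_real \<tau>) (of_real (y $ 1)) (of_real (y $ 2)))"
    if "\<bar>\<tau>\<bar> < r" for \<tau> y
  proof -
    have "\<bar>\<tau> / t\<bar> < 1/4" using that t by (simp add: r_def divide_less_eq)
    from FF_real[OF assms t this, of "coords v" "y$1 / sqrt t" "y$2 / sqrt t"]
    have "?f (of_real \<tau>) (of_real (y $ 1)) (of_real (y $ 2)) = of_real (real_sol \<phi> (t * (1 + \<tau> / t)) (coords v + sqrt t *\<^sub>R (y$1 / sqrt t, y$2 / sqrt t)))"
      by simp
    moreover have "t * (1 + \<tau> / t) = t + \<tau>" "coords v + sqrt t *\<^sub>R (y$1 / sqrt t, y$2 / sqrt t) = coords (v + y)"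
      using t by (simp_all add: field_simps coords_def)
    ultimately show ?thesis by (simp add: q)
  qed
  ultimately show "\<exists>r>0. \<exists>M f. hol3 r M f \<and> (\<forall>\<tau> y. \<bar>\<tau>\<bar> < r \<longrightarrow> \<bar>y$1\<bar> < r \<longrightarrow> \<bar>y$2\<bar> < r \<longrightarrow>
      real_sol \<phi> (fst (q + (\<tau>, y))) (coords (snd (q + (\<tau>, y)))) = Re (f (of_real \<tau>) (of_real (y$1)) (of_real (y$2))))"
    using r by blast
qed

text \<open>The equation in scale-free form: \<open>D\<close> is \<open>t\<close> times the time
  derivative, and \<open>d1\<close>, \<open>d2\<close> are second derivatives along coordinate lines
  with displacement measured in units of \<open>sqrt t\<close>. The bound \<open>8 * M\<close> is
  the Cauchy estimate on a disc of radius \<open>1/8\<close>. Derivatives along lines are the form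
  in which both the maximum principle and the curvature formula consume it.\<close>

lemma real_sol_local:
  assumes d: "data \<phi>" and t: "t > 0"
  obtains D P1 P2 d1 d2 where
    "((\<lambda>s. real_sol \<phi> s x) has_field_derivative D / t) (at t)" "\<bar>D\<bar> \<le> 8 * M" "D = d1 + d2"
    "\<And>\<alpha>. \<bar>\<alpha>\<bar> < 1/4 \<Longrightarrow> ((\<lambda>\<alpha>. ln (1 + real_sol \<phi> t (x + sqrt t *\<^sub>R (\<alpha>, 0)))) has_field_derivative P1 \<alpha>) (at \<alpha>)"
    "(P1 has_field_derivative d1) (at 0)"
    "\<And>\<alpha>. \<bar>\<alpha>\<bar> < 1/4 \<Longrightarrow> ((\<lambda>\<alpha>. ln (1 + real_sol \<phi> t (x + sqrt t *\<^sub>R (0, \<alpha>)))) has_field_derivative P2 \<alpha>) (at \<alpha>)"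
    "(P2 has_field_derivative d2) (at 0)"
proof -
  let ?F = "FF \<phi> t x"
  let ?Q = "\<lambda>l \<alpha> \<beta>. log_rest (?F l \<alpha> \<beta>)"
  note F = FF_hol3[OF d t, of x]
  note Q = hol3_log_rest[OF F]
  have b0: "(0::complex) \<in> ball 0 (1/4)" by simp
  define D where "D = Re (deriv (\<lambda>l. ?F l 0 0) 0)"
  let ?g1 = "\<lambda>\<alpha>. ?F 0 \<alpha> 0 + ?Q 0 \<alpha> 0" and ?g2 = "\<lambda>\<beta>. ?F 0 0 \<beta> + ?Q 0 0 \<beta>"
  have h1: "(\<lambda>\<alpha>. ?F 0 \<alpha> 0) holomorphic_on ball 0 (1/4)" "(\<lambda>\<alpha>. ?Q 0 \<alpha> 0) holomorphic_on ball 0 (1/4)"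
    using F Q b0 unfolding hol3_def by blast+
  have h2: "(\<lambda>\<beta>. ?F 0 0 \<beta>) holomorphic_on ball 0 (1/4)" "(\<lambda>\<beta>. ?Q 0 0 \<beta>) holomorphic_on ball 0 (1/4)"
    using F Q b0 unfolding hol3_def by blast+
  have h0: "(\<lambda>l. ?F l 0 0) holomorphic_on ball 0 (1/4)" using F b0 unfolding hol3_def by blast
  have g1: "?g1 holomorphic_on ball 0 (1/4)" and g2: "?g2 holomorphic_on ball 0 (1/4)"
    using h1 h2 by (intro holomorphic_intros; simp)+
  have dd: "deriv ?g1 holomorphic_on ball 0 (1/4)" "deriv ?g2 holomorphic_on ball 0 (1/4)"
    using g1 g2 by (intro holomorphic_deriv; simp)+
  define d1 d2 where "d1 = Re (deriv (deriv ?g1) 0)" and "d2 = Re (deriv (deriv ?g2) 0)"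
  have s1: "deriv (deriv ?g1) 0 = deriv (deriv (\<lambda>\<alpha>. ?F 0 \<alpha> 0)) 0 + deriv (deriv (\<lambda>\<alpha>. ?Q 0 \<alpha> 0)) 0"
    using higher_deriv_add[OF h1 open_ball b0, of 2] by (simp add: numeral_2_eq_2)
  have s2: "deriv (deriv ?g2) 0 = deriv (deriv (\<lambda>\<alpha>. ?F 0 0 \<alpha>)) 0 + deriv (deriv (\<lambda>\<alpha>. ?Q 0 0 \<alpha>)) 0"
    using higher_deriv_add[OF h2 open_ball b0, of 2] by (simp add: numeral_2_eq_2)
  have Dd: "D = d1 + d2"
    using sol_pde[OF data_complex[OF d] t, of x] unfolding D_def d1_def d2_def s1 s2 lap_def by simp

  have "norm (deriv (\<lambda>l. ?F l 0 0) 0) \<le> 8 * M"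
    using holomorphic_ball_bounds[OF h0, of M 0 "1/8" "1/8" 1] hol3_bound[OF F _ b0 b0] by simp
  then have Db: "\<bar>D\<bar> \<le> 8 * M" unfolding D_def using abs_Re_le_cmod order_trans by blast
  have dt: "((\<lambda>s. real_sol \<phi> s x) has_field_derivative D / t) (at t)"
  proof -
    have "((\<lambda>\<alpha>. Re (?F (of_real \<alpha>) 0 0)) has_field_derivative D) (at (t / t - 1))"
      using holomorphic_real_derivative[OF h0, of 0] t by (simp add: D_def)
    then have "((\<lambda>s. Re (?F (of_real (s / t - 1)) 0 0)) has_field_derivative D * (1 / t)) (at t)"
      by (rule DERIV_chain2) (use t in \<open>auto intro!: derivative_eq_intros\<close>)
    then have "((\<lambda>s. Re (?F (of_real (s / t - 1)) 0 0)) has_field_derivative D / t) (at t)" by simp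
    moreover have "Re (?F (of_real (s / t - 1)) 0 0) = real_sol \<phi> s x" if "s \<in> {3/4 * t <..< 5/4 * t}" for s
    proof -
      have "3/4 < s / t" "s / t < 5/4" using that t by (simp_all add: field_simps)
      then have "\<bar>s / t - 1\<bar> < 1/4" by linarith
      from FF_real[OF d t this, of x 0 0] show ?thesis using t by (simp add: field_simps flip: zero_prod_def)
    qed
    ultimately show ?thesis
      using has_field_derivative_transform_within_open[of "\<lambda>s. Re (?F (of_real (s / t - 1)) 0 0)" "D / t" t "{3/4 * t <..< 5/4 * t}" "\<lambda>s. real_sol \<phi> s x"] t by simp
  qed
  have Lr: "z + log_rest z = of_real (ln (1 + r))" if "z = of_real r" "\<bar>r\<bar> \<le> M" for z and r :: real
  proof -
    have "1 + r > 0" using that M by linarith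
    then show ?thesis using Ln_of_real[of "1 + r"] that(1) by (simp add: log_rest_def)
  qed
  have e1: "ln (1 + real_sol \<phi> t (x + sqrt t *\<^sub>R (\<alpha>, 0))) = Re (?g1 (of_real \<alpha>))" for \<alpha>
    using Lr[OF FF_real[OF d t, of 0 x \<alpha> 0] real_sol_bound[OF d]] t by simp
  have e2: "ln (1 + real_sol \<phi> t (x + sqrt t *\<^sub>R (0, \<alpha>))) = Re (?g2 (of_real \<alpha>))" for \<alpha>
    using Lr[OF FF_real[OF d t, of 0 x 0 \<alpha>] real_sol_bound[OF d]] t by simp
  show thesis
  proof (rule that[OF dt Db Dd])
    show "((\<lambda>\<alpha>. ln (1 + real_sol \<phi> t (x + sqrt t *\<^sub>R (\<alpha>, 0)))) has_field_derivative Re (deriv ?g1 (of_real \<alpha>))) (at \<alpha>)" if "\<bar>\<alpha>\<bar> < 1/4" for \<alpha>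
      unfolding e1 by (rule holomorphic_real_derivative[OF g1 that])
    show "((\<lambda>\<alpha>. ln (1 + real_sol \<phi> t (x + sqrt t *\<^sub>R (0, \<alpha>)))) has_field_derivative Re (deriv ?g2 (of_real \<alpha>))) (at \<alpha>)" if "\<bar>\<alpha>\<bar> < 1/4" for \<alpha>
      unfolding e2 by (rule holomorphic_real_derivative[OF g2 that])
    show "((\<lambda>\<alpha>. Re (deriv ?g1 (of_real \<alpha>))) has_field_derivative d1) (at 0)"
      using holomorphic_real_derivative[OF dd(1), of 0] by (simp add: d1_def)
    show "((\<lambda>\<alpha>. Re (deriv ?g2 (of_real \<alpha>))) has_field_derivative d2) (at 0)"
      using holomorphic_real_derivative[OF dd(2), of 0] by (simp add: d2_def)
  qed
qed

lemma real_sol_continuous: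
  assumes "data \<phi>"
  shows "continuous_on ({0<..} \<times> UNIV) (\<lambda>q. real_sol \<phi> (fst q) (snd q))"
proof -
  have A: "continuous_on ({0<..} \<times> UNIV) (\<lambda>q. real_sol \<phi> (fst q) (coords (snd q)))"
    using param_analytic_Ck_on[OF real_sol_param_analytic[OF assms], of 0 "1::real"] by (simp add: open_Times)
  let ?v = "\<lambda>q::real\<times>(real\<times>real). fst (snd q) *\<^sub>R axis 1 1 + snd (snd q) *\<^sub>R axis 2 1 :: real^2"
  have B: "continuous_on ({0<..} \<times> UNIV) (\<lambda>q. (fst q, ?v q))"
    by (intro continuous_intros)
  have "continuous_on ({0<..} \<times> UNIV) (\<lambda>q. real_sol \<phi> (fst (fst q, ?v q)) (coords (snd (fst q, ?v q))))"
    by (rule continuous_on_compose2[OF A B]) auto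
  then show ?thesis by (simp add: coords_def axis_def)
qed

end

section \<open>Comparison principle\<close>

lemma one_plus_bounds:
  fixes h :: real
  assumes "\<bar>h\<bar> \<le> 1/12"
  shows "1 / (1 + h) \<le> 2" "1 / (1 + h) > 0" "\<bar>ln (1 + h)\<bar> \<le> 1/2" "1 + h > 0"
proof -
  show p: "1 + h > 0" using assms by linarith
  show "1 / (1 + h) \<le> 2" "1 / (1 + h) > 0" using assms p by (simp_all add: divide_le_eq)
  have "ln (1 + h) \<le> h" using p ln_le_minus_one[of "1 + h"] by simp
  moreover have "- ln (1 + h) \<le> 1 / (1 + h) - 1" using p ln_le_minus_one[of "1 / (1 + h)"] by (simp add: ln_div)
  moreover have "1 / (1 + h) \<le> 3/2" using assms p by (simp add: divide_le_eq)
  ultimately show "\<bar>ln (1 + h)\<bar> \<le> 1/2" using assms by linarith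
qed

text \<open>The zeroth-order coefficient of the linearised equation is bounded through the convexity
  of \<open>exp\<close>: \<open>U / V\<close> is at least \<open>1 + ln U - ln V\<close>.\<close>

lemma inverse_diff_ln:
  fixes U V :: real
  assumes "U > 0" "V > 0" "1 / U \<le> 2" "ln U - ln V < 0"
  shows "\<bar>1 / U - 1 / V\<bar> \<le> 2 * (ln V - ln U)"
proof -
  have "U / V = exp (ln U - ln V)" using assms by (simp add: exp_diff)
  then have 1: "1 + (ln U - ln V) \<le> U / V" using exp_ge_add_one_self[of "ln U - ln V"] by linarith
  have "ln U < ln V" using assms by simp
  then have 2: "U < V" using assms by simp
  have "\<bar>1 / U - 1 / V\<bar> = 1 / U * (1 - U / V)" using assms 2 by (simp add: field_simps abs_if)
  also have "\<dots> \<le> 2 * (ln V - ln U)" using 1 2 assms by (intro mult_mono) (auto simp: divide_le_eq)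
  finally show ?thesis .
qed

context small_data
begin

text \<open>The exponential absorbs the zeroth-order term of the linearised equation. The quadratic term makes
  the minimum attained; as its Laplacian divided by \<open>u\<close> is at most \<open>8\<close>, the slope \<open>9\<close> in time suffices.\<close>

definition barrier :: "(real \<times> real \<Rightarrow> real) \<Rightarrow> (real \<times> real \<Rightarrow> real) \<Rightarrow> real \<Rightarrow> real \<Rightarrow> real \<Rightarrow> real \<times> real \<Rightarrow> real" where
  "barrier \<phi> \<psi> \<eta> t0 t x = exp (- (16 * M / t0) * (t - t0)) * (ln (1 + real_sol \<phi> t x) - ln (1 + real_sol \<psi> t x))
     + \<eta> * ((fst x)\<^sup>2 + (snd x)\<^sup>2 + 9 * (t - t0) + 1)"

lemma ln_real_sol_bounds:
  assumes "data \<phi>" "t > 0"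
  shows "1 / (1 + real_sol \<phi> t x) \<le> 2" "1 / (1 + real_sol \<phi> t x) > 0" "\<bar>ln (1 + real_sol \<phi> t x)\<bar> \<le> 1/2" "1 + real_sol \<phi> t x > 0"
  by (rule one_plus_bounds; use real_sol_bound[OF assms, of x] M in linarith)+

text \<open>At a negative minimum over past times and nearby points, the second space derivatives
  are nonnegative. The equation then makes the time derivative strictly positive, so the barrier was
  smaller shortly before.\<close>

lemma barrier_no_minimum:
  assumes d: "data \<phi>" "data \<psi>" and \<eta>: "\<eta> > 0" and t0: "t0 > 0" and t: "t0 < t"
    and neg: "barrier \<phi> \<psi> \<eta> t0 t x < 0"
    and mt: "\<And>s. t0 \<le> s \<Longrightarrow> s \<le> t \<Longrightarrow> barrier \<phi> \<psi> \<eta> t0 t x \<le> barrier \<phi> \<psi> \<eta> t0 s x"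
    and mx: "\<And>y. dist y x < 1 \<Longrightarrow> barrier \<phi> \<psi> \<eta> t0 t x \<le> barrier \<phi> \<psi> \<eta> t0 t y"
  shows False
proof -
  have t': "t > 0" using t t0 by simp
  define \<Lambda> where "\<Lambda> = 16 * M / t0"
  have \<Lambda>0: "\<Lambda> \<ge> 0" using M t0 by (simp add: \<Lambda>_def)
  define E where "E = exp (- \<Lambda> * (t - t0))"
  have E: "E > 0" by (simp add: E_def)
  define U V where "U = 1 + real_sol \<phi> t x" and "V = 1 + real_sol \<psi> t x"
  note UV = ln_real_sol_bounds[OF d(1) t', of x, folded U_def] ln_real_sol_bounds[OF d(2) t', of x, folded V_def]
  define w where "w = ln U - ln V"
  have b: "barrier \<phi> \<psi> \<eta> t0 t x = E * w + \<eta> * ((fst x)\<^sup>2 + (snd x)\<^sup>2 + 9 * (t - t0) + 1)"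
    by (simp add: barrier_def E_def w_def U_def V_def \<Lambda>_def)
  have "0 \<le> \<eta> * ((fst x)\<^sup>2 + (snd x)\<^sup>2 + 9 * (t - t0) + 1)" using \<eta> t by simp
  then have "E * w < 0" using neg b by linarith
  then have w: "w < 0" using E by (simp add: mult_less_0_iff)
  obtain D P1 P2 d1 d2 where H: "((\<lambda>s. real_sol \<phi> s x) has_field_derivative D / t) (at t)" "\<bar>D\<bar> \<le> 8 * M" "D = d1 + d2"
    "\<And>\<alpha>. \<bar>\<alpha>\<bar> < 1/4 \<Longrightarrow> ((\<lambda>\<alpha>. ln (1 + real_sol \<phi> t (x + sqrt t *\<^sub>R (\<alpha>, 0)))) has_field_derivative P1 \<alpha>) (at \<alpha>)"
    "(P1 has_field_derivative d1) (at 0)"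
    "\<And>\<alpha>. \<bar>\<alpha>\<bar> < 1/4 \<Longrightarrow> ((\<lambda>\<alpha>. ln (1 + real_sol \<phi> t (x + sqrt t *\<^sub>R (0, \<alpha>)))) has_field_derivative P2 \<alpha>) (at \<alpha>)"
    "(P2 has_field_derivative d2) (at 0)"
  proof (rule real_sol_local[OF d(1) t', of x], goal_cases)
    case (1 D P1 P2 d1 d2)
    show ?case by (rule 1(1)[OF 1(2-)])
  qed
  obtain D' P1' P2' d1' d2' where H': "((\<lambda>s. real_sol \<psi> s x) has_field_derivative D' / t) (at t)" "\<bar>D'\<bar> \<le> 8 * M" "D' = d1' + d2'"
    "\<And>\<alpha>. \<bar>\<alpha>\<bar> < 1/4 \<Longrightarrow> ((\<lambda>\<alpha>. ln (1 + real_sol \<psi> t (x + sqrt t *\<^sub>R (\<alpha>, 0)))) has_field_derivative P1' \<alpha>) (at \<alpha>)"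
    "(P1' has_field_derivative d1') (at 0)"
    "\<And>\<alpha>. \<bar>\<alpha>\<bar> < 1/4 \<Longrightarrow> ((\<lambda>\<alpha>. ln (1 + real_sol \<psi> t (x + sqrt t *\<^sub>R (0, \<alpha>)))) has_field_derivative P2' \<alpha>) (at \<alpha>)"
    "(P2' has_field_derivative d2') (at 0)"
  proof (rule real_sol_local[OF d(2) t', of x], goal_cases)
    case (1 D P1 P2 d1 d2)
    show ?case by (rule 1(1)[OF 1(2-)])
  qed
  \<comment> \<open>The first bound is the range of the derivative formulas; the second keeps
    displacements \<open>sqrt t * \<alpha>\<close> below \<open>1\<close>, where minimality in space
    is assumed.\<close>
  define r where "r = min (1/4) (1 / sqrt t)"
  have r1: "r > 0" "r \<le> 1/4" unfolding r_def using t' by (auto simp only: min_less_iff_conj min.cobounded1 real_sqrt_gt_0_iff zero_less_divide_iff zero_less_one zero_less_numeral) 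
  have r2: "\<bar>sqrt t * \<alpha>\<bar> < 1" if "\<bar>\<alpha>\<bar> < r" for \<alpha>
  proof -
    have "\<bar>\<alpha>\<bar> < 1 / sqrt t" using that unfolding r_def by linarith
    then have "\<bar>\<alpha>\<bar> * sqrt t < 1" using pos_less_divide_eq[of "sqrt t" "\<bar>\<alpha>\<bar>" 1] t' real_sqrt_gt_0_iff by blast
    moreover have "\<bar>sqrt t * \<alpha>\<bar> = \<bar>\<alpha>\<bar> * sqrt t" using real_sqrt_ge_zero[of t] t' by (simp only: abs_mult mult.commute abs_of_nonneg less_imp_le)
    ultimately show ?thesis by linarith
  qed
  note r = r1 r2
  have "0 \<le> E * (d1 - d1') + \<eta> * (2 * t)"
  proof (rule second_derivative_at_minimum[where r = r and f = "\<lambda>\<alpha>. barrier \<phi> \<psi> \<eta> t0 t (x + sqrt t *\<^sub>R (\<alpha>, 0))"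
        and f' = "\<lambda>\<alpha>. E * (P1 \<alpha> - P1' \<alpha>) + \<eta> * (2 * (fst x + sqrt t * \<alpha>) * sqrt t)"])
    show "r > 0" by (rule r)
    show "((\<lambda>\<alpha>. barrier \<phi> \<psi> \<eta> t0 t (x + sqrt t *\<^sub>R (\<alpha>, 0))) has_field_derivative E * (P1 \<alpha> - P1' \<alpha>) + \<eta> * (2 * (fst x + sqrt t * \<alpha>) * sqrt t)) (at \<alpha>)"
      if "\<bar>\<alpha>\<bar> < r" for \<alpha>
    proof -
      have "\<bar>\<alpha>\<bar> < 1/4" using that r by linarith
      note L = DERIV_cmult[OF DERIV_diff[OF H(4)[OF this] H'(4)[OF this]], of E]
      have "((\<lambda>\<alpha>. \<eta> * ((fst x + sqrt t * \<alpha>)\<^sup>2 + (snd x)\<^sup>2 + 9 * (t - t0) + 1)) has_field_derivative \<eta> * (2 * (fst x + sqrt t * \<alpha>) * sqrt t)) (at \<alpha>)"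
        by (auto intro!: derivative_eq_intros)
      from DERIV_add[OF L this] show ?thesis by (simp add: barrier_def E_def \<Lambda>_def)
    qed
    have "((\<lambda>\<alpha>. \<eta> * (2 * (fst x + sqrt t * \<alpha>) * sqrt t)) has_field_derivative \<eta> * (2 * t)) (at 0)"
      using t' by (auto intro!: derivative_eq_intros)
    from DERIV_add[OF DERIV_cmult[OF DERIV_diff[OF H(5) H'(5)], of E] this]
    show "((\<lambda>\<alpha>. E * (P1 \<alpha> - P1' \<alpha>) + \<eta> * (2 * (fst x + sqrt t * \<alpha>) * sqrt t)) has_field_derivative E * (d1 - d1') + \<eta> * (2 * t)) (at 0)" .
    show "barrier \<phi> \<psi> \<eta> t0 t (x + sqrt t *\<^sub>R (0, 0)) \<le> barrier \<phi> \<psi> \<eta> t0 t (x + sqrt t *\<^sub>R (\<alpha>, 0))" if "\<bar>\<alpha>\<bar> < r" for \<alpha>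
      using mx[of "x + sqrt t *\<^sub>R (\<alpha>, 0)"] r(3)[OF that] by (simp add: dist_norm norm_Pair flip: zero_prod_def)
  qed
  moreover have "0 \<le> E * (d2 - d2') + \<eta> * (2 * t)"
  proof (rule second_derivative_at_minimum[where r = r and f = "\<lambda>\<alpha>. barrier \<phi> \<psi> \<eta> t0 t (x + sqrt t *\<^sub>R (0, \<alpha>))"
        and f' = "\<lambda>\<alpha>. E * (P2 \<alpha> - P2' \<alpha>) + \<eta> * (2 * (snd x + sqrt t * \<alpha>) * sqrt t)"])
    show "r > 0" by (rule r)
    show "((\<lambda>\<alpha>. barrier \<phi> \<psi> \<eta> t0 t (x + sqrt t *\<^sub>R (0, \<alpha>))) has_field_derivative E * (P2 \<alpha> - P2' \<alpha>) + \<eta> * (2 * (snd x + sqrt t * \<alpha>) * sqrt t)) (at \<alpha>)"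
      if "\<bar>\<alpha>\<bar> < r" for \<alpha>
    proof -
      have "\<bar>\<alpha>\<bar> < 1/4" using that r by linarith
      note L = DERIV_cmult[OF DERIV_diff[OF H(6)[OF this] H'(6)[OF this]], of E]
      have "((\<lambda>\<alpha>. \<eta> * ((fst x)\<^sup>2 + (snd x + sqrt t * \<alpha>)\<^sup>2 + 9 * (t - t0) + 1)) has_field_derivative \<eta> * (2 * (snd x + sqrt t * \<alpha>) * sqrt t)) (at \<alpha>)"
        by (auto intro!: derivative_eq_intros)
      from DERIV_add[OF L this] show ?thesis by (simp add: barrier_def E_def \<Lambda>_def)
    qed
    have "((\<lambda>\<alpha>. \<eta> * (2 * (snd x + sqrt t * \<alpha>) * sqrt t)) has_field_derivative \<eta> * (2 * t)) (at 0)"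
      using t' by (auto intro!: derivative_eq_intros)
    from DERIV_add[OF DERIV_cmult[OF DERIV_diff[OF H(7) H'(7)], of E] this]
    show "((\<lambda>\<alpha>. E * (P2 \<alpha> - P2' \<alpha>) + \<eta> * (2 * (snd x + sqrt t * \<alpha>) * sqrt t)) has_field_derivative E * (d2 - d2') + \<eta> * (2 * t)) (at 0)" .
    show "barrier \<phi> \<psi> \<eta> t0 t (x + sqrt t *\<^sub>R (0, 0)) \<le> barrier \<phi> \<psi> \<eta> t0 t (x + sqrt t *\<^sub>R (0, \<alpha>))" if "\<bar>\<alpha>\<bar> < r" for \<alpha>
      using mx[of "x + sqrt t *\<^sub>R (0, \<alpha>)"] r(3)[OF that] by (simp add: dist_norm norm_Pair flip: zero_prod_def)
  qed
  ultimately have speed: "- (4 * \<eta> * t) \<le> E * (D - D')" by (simp add: H(3) H'(3) algebra_simps)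

  define G where "G = (D / t) / U - (D' / t) / V"
  have "((\<lambda>s. barrier \<phi> \<psi> \<eta> t0 s x) has_field_derivative - \<Lambda> * E * w + G * E + \<eta> * 9) (at t)"
  proof -
    have 1: "((\<lambda>s. ln (1 + real_sol \<phi> s x) - ln (1 + real_sol \<psi> s x)) has_field_derivative G) (at t)"
      unfolding G_def using UV(4,8) by (auto intro!: derivative_eq_intros H(1) H'(1) simp: U_def V_def divide_inverse)
    have 2: "((\<lambda>s. exp (- \<Lambda> * (s - t0))) has_field_derivative - \<Lambda> * E) (at t)"
      by (auto intro!: derivative_eq_intros simp: E_def)
    have 3: "((\<lambda>s. \<eta> * ((fst x)\<^sup>2 + (snd x)\<^sup>2 + 9 * (s - t0) + 1)) has_field_derivative \<eta> * 9) (at t)"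
      by (auto intro!: derivative_eq_intros)
    show ?thesis using DERIV_add[OF DERIV_mult[OF 2 1] 3] by (simp add: barrier_def \<Lambda>_def E_def w_def U_def V_def)
  qed
  note dt = this
  \<comment> \<open>The first part compares the two equations with equal coefficients and is
    controlled by the second derivatives. The second stems from the different coefficients
    \<open>1 / U\<close> and \<open>1 / V\<close>; it is bounded by a multiple of \<open>w\<close>,
    and this is what the exponential compensates.\<close>
  have "E * G = E * (D - D') / t * (1 / U) + E * (D' / t * (1 / U - 1 / V))"
    using t' UV(4,8) unfolding G_def by (simp add: field_simps)
  moreover have "E * (D - D') / t * (1 / U) \<ge> - (8 * \<eta>)"
  proof -
    have "- (4 * \<eta>) \<le> E * (D - D') / t" using speed t' by (simp add: pos_le_divide_eq)
    then have "- (4 * \<eta>) * (1 / U) \<le> E * (D - D') / t * (1 / U)" using UV(2) by (intro mult_right_mono) auto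
    moreover have "4 * \<eta> * (1 / U) \<le> 4 * \<eta> * 2" using UV(1) \<eta> by (intro mult_left_mono) auto
    ultimately show ?thesis by linarith
  qed
  moreover have "E * (D' / t * (1 / U - 1 / V)) \<ge> E * (\<Lambda> * w)"
  proof (rule mult_left_mono)
    have "\<bar>D' / t\<bar> * \<bar>1 / U - 1 / V\<bar> \<le> (8 * M / t0) * (2 * - w)"
    proof (rule mult_mono)
      have "\<bar>D' / t\<bar> = \<bar>D'\<bar> / t" using t' by simp
      also have "\<dots> \<le> 8 * M / t0" using H'(2) t t0 M(1) by (intro frac_le) auto
      finally show "\<bar>D' / t\<bar> \<le> 8 * M / t0" .
      show "\<bar>1 / U - 1 / V\<bar> \<le> 2 * - w" using inverse_diff_ln[OF UV(4) UV(8) UV(1)] w by (simp add: w_def)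
    qed (use M t0 in auto)
    moreover have "- (\<bar>D' / t\<bar> * \<bar>1 / U - 1 / V\<bar>) \<le> D' / t * (1 / U - 1 / V)"
      using abs_ge_minus_self[of "D' / t * (1 / U - 1 / V)"] by (simp only: abs_mult)
    moreover have "(8 * M / t0) * (2 * - w) = - (\<Lambda> * w)" by (simp add: \<Lambda>_def)
    ultimately show "\<Lambda> * w \<le> D' / t * (1 / U - 1 / V)" by linarith
  qed (use E in simp)
  \<comment> \<open>The terms in \<open>\<Lambda> * w\<close> cancel, and at least
    \<open>9 * \<eta> - 8 * \<eta>\<close> remains.\<close>
  ultimately have "0 < - \<Lambda> * E * w + G * E + \<eta> * 9" using \<eta> by (simp add: algebra_simps)
  then obtain h where h: "h > 0" "\<And>k. 0 < k \<Longrightarrow> k < h \<Longrightarrow> barrier \<phi> \<psi> \<eta> t0 (t - k) x < barrier \<phi> \<psi> \<eta> t0 t x"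
    using DERIV_pos_inc_left[OF dt] by blast
  define k where "k = min (h / 2) (t - t0)"
  have "0 < k" "k < h" "t0 \<le> t - k" using h t by (auto simp: k_def)
  then show False using h(2)[of k] mt[of "t - k"] by simp
qed

text \<open>Outside a ball the quadratic term outweighs the bounded logarithms, so a negative value
  forces a negative minimum on a compact cylinder. It cannot lie at time \<open>t0\<close> by the
  initial inequality, nor later by \<open>barrier_no_minimum\<close>.\<close>

lemma barrier_nonneg:
  assumes d: "data \<phi>" "data \<psi>" and \<eta>: "\<eta> > 0" and t0: "t0 > 0" and t: "t0 \<le> t"
    and init: "\<And>x. real_sol \<psi> t0 x \<le> real_sol \<phi> t0 x"
  shows "0 \<le> barrier \<phi> \<psi> \<eta> t0 t x"
proof (rule ccontr)
  let ?b = "barrier \<phi> \<psi> \<eta> t0"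
  assume "\<not> 0 \<le> ?b t x"
  then have neg: "?b t x < 0" by simp
  \<comment> \<open>A negative minimum has norm below \<open>1 + 1 / \<eta>\<close>; the extra
    \<open>1\<close> keeps the unit ball around it inside the cylinder, and \<open>norm x\<close>
    makes room for the given point.\<close>
  define R where "R = norm x + 2 + 1 / \<eta>"
  have R: "norm x \<le> R" "R > 0" using \<eta> by (auto simp: R_def intro!: add_nonneg_pos)
  have pos: "0 < ?b s y" if s: "s \<in> {t0..t}" and y: "norm y \<ge> 1 + 1 / \<eta>" for s y
  proof -
    have s0: "s > 0" using s t0 by auto
    define E where "E = exp (- (16 * M / t0) * (s - t0))"
    define w where "w = ln (1 + real_sol \<phi> s y) - ln (1 + real_sol \<psi> s y)"
    have "E \<le> 1" "E > 0" using s M t0 by (auto simp: E_def)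
    moreover have "\<bar>w\<bar> \<le> 1" using ln_real_sol_bounds(3)[OF d(1) s0, of y] ln_real_sol_bounds(3)[OF d(2) s0, of y] by (simp add: w_def)
    ultimately have "\<bar>E * w\<bar> \<le> 1 * 1" unfolding abs_mult by (intro mult_mono) auto
    moreover have "1 \<le> \<eta> * ((fst y)\<^sup>2 + (snd y)\<^sup>2)"
    proof -
      have "1 / \<eta> \<le> norm y" "1 \<le> norm y" using y \<eta> by (auto simp: add_increasing2 intro: order_trans[rotated])
      then have "1 / \<eta> * 1 \<le> norm y * norm y" using \<eta> by (intro mult_mono) auto
      also have "norm y * norm y = (fst y)\<^sup>2 + (snd y)\<^sup>2" by (simp add: norm_prod_def power2_eq_square)
      finally show ?thesis using \<eta> by (simp add: field_simps)
    qed
    moreover have "0 < \<eta> * (9 * (s - t0) + 1)" using s \<eta> by (intro mult_pos_pos) auto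
    moreover have "?b s y = E * w + \<eta> * ((fst y)\<^sup>2 + (snd y)\<^sup>2) + \<eta> * (9 * (s - t0) + 1)"
      by (simp add: barrier_def E_def w_def algebra_simps)
    ultimately show ?thesis by linarith
  qed
  let ?C = "{t0..t} \<times> cball (0::real\<times>real) R"
  have sub: "?C \<subseteq> {0<..} \<times> UNIV" using t0 by auto
  have pp: "1 + real_sol \<theta> (fst q) (snd q) \<noteq> 0" if "data \<theta>" "q \<in> ?C" for q \<theta>
    using ln_real_sol_bounds(4)[OF that(1), of "fst q" "snd q"] that(2) t0 by auto
  note hc = continuous_on_subset[OF real_sol_continuous[OF d(1)] sub] continuous_on_subset[OF real_sol_continuous[OF d(2)] sub]
  have cont: "continuous_on ?C (\<lambda>q. ?b (fst q) (snd q))"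
    unfolding barrier_def by (intro continuous_intros hc ballI pp d) (use t0 in auto)
  have ne: "(t, x) \<in> ?C" using t R by (simp add: mem_cball_0)
  have "\<exists>q\<in>?C. \<forall>p\<in>?C. ?b (fst q) (snd q) \<le> ?b (fst p) (snd p)"
    by (rule continuous_attains_inf[OF _ _ cont]) (use ne in \<open>blast intro: compact_Times compact_cball compact_Icc\<close>, use ne in blast)
  then obtain s y where sy: "(s, y) \<in> ?C" and mn: "\<And>p. p \<in> ?C \<Longrightarrow> ?b s y \<le> ?b (fst p) (snd p)"
    by fastforce
  have yneg: "?b s y < 0" using mn[OF ne] neg by simp
  have st: "t0 \<le> s" "s \<le> t" using sy by auto
  have "s \<noteq> t0"
  proof
    assume s: "s = t0"
    have "ln (1 + real_sol \<psi> t0 y) \<le> ln (1 + real_sol \<phi> t0 y)" using init[of y] ln_real_sol_bounds(4)[OF d(2) t0, of y] by simp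
    moreover have "0 \<le> \<eta> * ((fst y)\<^sup>2 + (snd y)\<^sup>2 + 1)" using \<eta> by simp
    ultimately have "0 \<le> ?b s y" by (simp add: barrier_def s)
    then show False using yneg by simp
  qed
  then have s: "t0 < s" using st by simp
  have ny: "norm y < 1 + 1 / \<eta>" using pos[of s y] yneg st by force
  show False
  proof (rule barrier_no_minimum[OF d \<eta> t0 s yneg])
    show "?b s y \<le> ?b s' y" if "t0 \<le> s'" "s' \<le> s" for s'
      using mn[of "(s', y)"] that sy by auto
    show "?b s y \<le> ?b s z" if "dist z y < 1" for z
    proof -
      have "norm z \<le> norm y + dist z y" by (metis dist_commute dist_norm norm_triangle_sub)
      then have "norm z \<le> R" using ny that norm_ge_zero[of x] unfolding R_def by linarith
      then show ?thesis using mn[of "(s, z)"] st by simp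
    qed
  qed
qed

lemma real_sol_mono_from:
  assumes d: "data \<phi>" "data \<psi>" and t0: "t0 > 0" and t: "t0 \<le> t"
    and init: "\<And>x. real_sol \<psi> t0 x \<le> real_sol \<phi> t0 x"
  shows "real_sol \<psi> t x \<le> real_sol \<phi> t x"
proof (rule ccontr)
  assume "\<not> ?thesis"
  then have lt: "real_sol \<phi> t x < real_sol \<psi> t x" by simp
  have t': "t > 0" using t t0 by simp
  define a where "a = exp (- (16 * M / t0) * (t - t0)) * (ln (1 + real_sol \<phi> t x) - ln (1 + real_sol \<psi> t x))"
  define c where "c = (fst x)\<^sup>2 + (snd x)\<^sup>2 + 9 * (t - t0) + 1"
  have c: "c > 0" using t by (auto simp: c_def intro!: add_nonneg_pos)
  have "ln (1 + real_sol \<phi> t x) < ln (1 + real_sol \<psi> t x)" using lt ln_real_sol_bounds(4)[OF d(1) t', of x] by simp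
  then have a: "a < 0" by (simp add: a_def mult_less_0_iff)
  \<comment> \<open>With this \<open>\<eta>\<close> the quadratic term is exactly
    \<open>- a / 2\<close>, so the barrier would equal \<open>a / 2 < 0\<close>.\<close>
  have "0 \<le> barrier \<phi> \<psi> (- a / (2 * c)) t0 t x"
    by (rule barrier_nonneg[OF d _ t0 t init]) (use a c in \<open>simp add: divide_less_0_iff\<close>)
  also have "\<dots> = a + (- a / (2 * c)) * c" by (simp add: barrier_def a_def c_def)
  also have "\<dots> < 0" using a c by (simp add: field_simps)
  finally show False by simp
qed

end

section \<open>Rough initial data\<close>

lemma small_time:
  fixes c \<delta> t :: real
  assumes "c \<ge> 0" "\<delta> > 0" "t > 0"
  obtains t0 where "0 < t0" "t0 \<le> t" "c * t0 powr (1/4) \<le> \<delta>"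
proof -
  define d where "d = \<delta> / (c + 1)"
  have d: "d > 0" "c * d \<le> \<delta>" using assms by (auto simp: d_def pos_divide_le_eq mult.commute)
  define t0 where "t0 = min t (d ^ 4)"
  have t0: "0 < t0" "t0 \<le> t" "t0 \<le> d ^ 4" using assms d by (auto simp: t0_def)
  have "t0 powr (1/4) \<le> (d ^ 4) powr (1/4)" using t0 by (intro powr_mono2) auto
  also have "d ^ 4 = d powr 4" using powr_realpow[OF d(1), of 4] by simp
  also have "(d powr 4) powr (1/4) = d" by (subst powr_powr) (use d in simp)
  finally have "c * t0 powr (1/4) \<le> c * d" using assms by (intro mult_left_mono) auto
  then show thesis using that[OF t0(1,2)] d(2) by linarith
qed

context small_data
begin

lemma real_sol_initial:
  assumes d: "data \<phi>" and A: "hoelder A (\<lambda>y. of_real (\<phi> y))" and t: "t > 0"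
  shows "\<bar>real_sol \<phi> t x - \<phi> x\<bar> \<le> 2 * KK * A * t powr (1/4)"
  using sol_initial[OF data_complex[OF d] A t, of x] unfolding real_sol_sol[OF d t] by (simp flip: of_real_diff)

lemma real_sol_data_tendsto:
  assumes "\<And>k. data (\<phi> k)" "data \<psi>" "\<And>y. (\<lambda>k. \<phi> k y) \<longlonglongrightarrow> \<psi> y" "t > 0"
  shows "(\<lambda>k. real_sol (\<phi> k) t x) \<longlonglongrightarrow> real_sol \<psi> t x"
  unfolding real_sol_def
  by (intro tendsto_Re sol_data_tendsto[OF par_1 data_complex[OF assms(1)] data_complex[OF assms(2)] tendsto_of_real[OF assms(3)] assms(4)])

text \<open>The maximum principle starts at a positive time. Raising \<open>\<phi>\<close> by
  \<open>\<delta> n\<close> opens a gap; as the initial values of Hoelder data are attained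
  uniformly, at a small \<open>t0\<close> the errors still fit into it. Then
  \<open>\<delta> n\<close> tends to \<open>0\<close> by continuity in the data. The bounds
  \<open>e / 2\<close> leave room for the raised data.\<close>

lemma real_sol_comparison:
  assumes e0: "e > 0" and m: "\<phi> \<in> borel_measurable borel" "\<psi> \<in> borel_measurable borel"
    and b: "\<And>y. \<bar>\<phi> y\<bar> \<le> e / 2" "\<And>y. \<bar>\<psi> y\<bar> \<le> e / 2"
    and A: "hoelder A (\<lambda>y. of_real (\<phi> y))" "hoelder B (\<lambda>y. of_real (\<psi> y))"
    and le: "\<And>y. \<psi> y \<le> \<phi> y" and t: "t > 0"
  shows "real_sol \<psi> t x \<le> real_sol \<phi> t x"
proof -
  note [measurable] = m
  define \<delta> where "\<delta> n = e / 2 * inverse (real (Suc n))" for n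
  have \<delta>: "0 < \<delta> n" "\<delta> n \<le> e / 2" for n using e0 by (auto simp: \<delta>_def field_simps)
  have dp: "data (\<lambda>y. \<phi> y + \<delta> n)" for n unfolding data_def
  proof (intro conjI allI)
    show "\<bar>\<phi> y + \<delta> n\<bar> \<le> e" for y using b(1)[of y] \<delta>[of n] by linarith
  qed measurable
  have "\<bar>\<phi> y\<bar> \<le> e" "\<bar>\<psi> y\<bar> \<le> e" for y using b[of y] e0 by linarith+
  then have d\<phi>: "data \<phi>" and d\<psi>: "data \<psi>" using m unfolding data_def by blast+
  have A0: "0 \<le> A" "0 \<le> B" using A hoelder_nonneg by blast+
  have "real_sol \<psi> t x \<le> real_sol (\<lambda>y. \<phi> y + \<delta> n) t x" for n
  proof -
    have Ad: "hoelder A (\<lambda>y. of_real (\<phi> y + \<delta> n))" using A(1) by (simp add: hoelder_def)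
    obtain t0 where t0: "0 < t0" "t0 \<le> t" "(2 * KK * A + 2 * KK * B) * t0 powr (1/4) \<le> \<delta> n"
      by (rule small_time[of "2 * KK * A + 2 * KK * B" "\<delta> n" t]) (use A0 KK_bounds \<delta> t in auto)
    show ?thesis
    proof (rule real_sol_mono_from[OF dp d\<psi> t0(1,2)])
      fix y
      show "real_sol \<psi> t0 y \<le> real_sol (\<lambda>y. \<phi> y + \<delta> n) t0 y"
        using real_sol_initial[OF dp Ad t0(1), of y] real_sol_initial[OF d\<psi> A(2) t0(1), of y] t0(3) le[of y]
        unfolding distrib_right by linarith
    qed
  qed
  moreover have "(\<lambda>n. real_sol (\<lambda>y. \<phi> y + \<delta> n) t x) \<longlonglongrightarrow> real_sol \<phi> t x"
  proof (rule real_sol_data_tendsto[OF dp d\<phi> _ t])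
    have "\<delta> \<longlonglongrightarrow> e / 2 * 0" unfolding \<delta>_def by (intro tendsto_intros LIMSEQ_inverse_real_of_nat)
    then show "(\<lambda>n. \<phi> y + \<delta> n) \<longlonglongrightarrow> \<phi> y" for y using tendsto_add[OF tendsto_const, of \<delta> 0 _ "\<phi> y"] by simp
  qed
  ultimately show ?thesis by (intro LIMSEQ_le_const) auto
qed

lemma real_sol_zero: "t > 0 \<Longrightarrow> real_sol (\<lambda>y. 0) t x = 0"
  using real_sol_initial[of "\<lambda>y. 0" 0 t x] e by (simp add: data_def hoelder_def)

text \<open>The Duhamel term is at most \<open>2 * KK * M^2\<close>, quadratic in \<open>e\<close>,
  whereas the heat mean is linear in the data. Small data thus leave a trace at time
  \<open>1\<close>.\<close>

lemma real_sol_ge_heat: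
  assumes d: "data \<phi>"
  shows "Re (kconv k1 1 (\<lambda>y. of_real (\<phi> y)) x) - 8 * KK^3 * e\<^sup>2 \<le> real_sol \<phi> 1 x"
proof -
  let ?\<phi> = "\<lambda>y. complex_of_real (\<phi> y)"
  note N = admissible_log_rest[OF sol_admissible[OF par_1 data_complex[OF d]] M(3)]
  let ?d = "duhamel (\<lambda>s y. log_rest (sol ?\<phi> s y 1 0 0)) 1 x 1 0 0"
  have "norm ?d \<le> kC * gauss_mass * w0 * (2 * M * M) * 1 powr (1/4 - 1/4)"
    by (rule duhamel_bound[OF par_1 N]) auto
  also have "\<dots> \<le> KK * (2 * M * M)" using KK_bounds M by (simp add: mult_right_mono)
  also have "\<dots> = 8 * KK^3 * e\<^sup>2" by (simp add: M_def power2_eq_square power3_eq_cube)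
  finally have 1: "\<bar>Re ?d\<bar> \<le> 8 * KK^3 * e\<^sup>2" using abs_Re_le_cmod order_trans by blast
  have "real_sol \<phi> 1 x = Re (kconv k1 1 ?\<phi> x) + Re ?d"
    unfolding real_sol_def sol_eq[OF par_1 data_complex[OF d] zero_less_one] heat_1 by simp
  then show ?thesis using 1 by linarith
qed

end

section \<open>The oscillating data\<close>

definition heat_density :: "real \<times> real \<Rightarrow> real" where "heat_density z = exp (- (norm z)\<^sup>2 / 4) / (4 * pi)"

lemma heat_density: "heat_density z \<ge> 0" "k1 z = of_real (heat_density z)"
  by (simp_all add: heat_density_def k1_eq)

lemma heat_density_measurable [measurable]: "heat_density \<in> borel_measurable borel"
  unfolding heat_density_def by measurable

lemma heat_density_integral: "has_bochner_integral lborel heat_density 1"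
proof -
  have "has_bochner_integral lborel (\<lambda>z. complex_of_real (heat_density z)) 1"
    using k1_moment[of 0 0] by (simp add: mom_values heat_density)
  from has_bochner_integral_Re[OF this] show ?thesis by simp
qed

lemma lborel_lines_null:
  fixes a b :: int
  assumes "(a, b) \<noteq> (0, 0)"
  shows "AE z in (lborel :: (real \<times> real) measure). of_int a * fst z + of_int b * snd z \<notin> \<int>"
proof -
  have N: "AE z in (lborel :: (real \<times> real) measure). of_int a * fst z + of_int b * snd z \<noteq> of_int m" for m :: int
  proof -
    have "negligible {z::real\<times>real. (of_int a, of_int b) \<bullet> z = of_int m}"
      by (rule negligible_hyperplane) (use assms in \<open>auto simp: zero_prod_def\<close>)
    then have "AE z::real\<times>real in lebesgue. z \<notin> {z. (of_int a, of_int b) \<bullet> z = of_int m}"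
      unfolding negligible_iff_null_sets by (rule AE_not_in)
    then show ?thesis unfolding AE_completion_iff by (simp add: inner_prod_def)
  qed
  have "AE z in (lborel :: (real \<times> real) measure). \<forall>m::int. of_int a * fst z + of_int b * snd z \<noteq> of_int m"
    unfolding AE_all_countable using N by blast
  then show ?thesis by eventually_elim (auto simp: Ints_def)
qed

text \<open>The pair \<open>(0, 0)\<close> would make \<open>wave\<close> identically
  \<open>1\<close> and annihilate the whole product, so it is replaced by
  \<open>(1, 0)\<close>.\<close>

definition direction :: "nat \<Rightarrow> int \<times> int" where
  "direction j = (if (from_nat j :: int \<times> int) = (0, 0) then (1, 0) else from_nat j)"

definition wave :: "nat \<Rightarrow> nat \<Rightarrow> real \<times> real \<Rightarrow> real" where
  "wave j n z = cos (pi * (of_int (fst (direction j)) * fst z + of_int (snd (direction j)) * snd z)) ^ (2 * n)"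

lemma direction_nonzero: "direction j \<noteq> (0, 0)" by (auto simp: direction_def)

lemma wave_measurable [measurable]: "wave j n \<in> borel_measurable borel"
  unfolding wave_def by (intro borel_measurable_continuous_onI continuous_intros)

lemma wave_bounds: "0 \<le> wave j n z" "wave j n z \<le> 1"
  unfolding wave_def power_mult by (simp_all add: power_le_one abs_square_le_1)

text \<open>Off the lines where the linear form is an integer, which form a null set, the squared
  cosine is less than \<open>1\<close> and its powers tend to \<open>0\<close>.\<close>

lemma wave_integral_tendsto: "(\<lambda>n. \<integral>z. heat_density z * wave j n z \<partial>lborel) \<longlonglongrightarrow> (\<integral>z. 0 \<partial>(lborel :: (real \<times> real) measure))"
proof (rule integral_dominated_convergence[where w = heat_density])
  show "integrable lborel heat_density" by (rule integrable.intros[OF heat_density_integral])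
  show "AE z in lborel. norm (heat_density z * wave j n z) \<le> heat_density z" for n
    using heat_density(1) wave_bounds by (intro AE_I2) (simp add: abs_mult mult_left_le)
  have "AE z in (lborel :: (real \<times> real) measure). of_int (fst (direction j)) * fst z + of_int (snd (direction j)) * snd z \<notin> \<int>"
    by (rule lborel_lines_null) (use direction_nonzero[of j] in simp)
  then show "AE z in lborel. (\<lambda>n. heat_density z * wave j n z) \<longlonglongrightarrow> 0"
  proof eventually_elim
    case (elim z)
    define \<theta> where "\<theta> = of_int (fst (direction j)) * fst z + of_int (snd (direction j)) * snd z"
    have "sin (pi * \<theta>) \<noteq> 0"
    proof
      assume "sin (pi * \<theta>) = 0"
      then obtain i :: int where "pi * \<theta> = of_int i * pi" by (auto simp: sin_zero_iff_int2)
      then have "\<theta> = of_int i" by simp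
      then show False using elim by (simp add: \<theta>_def)
    qed
    then have "(cos (pi * \<theta>))\<^sup>2 < 1" using sin_cos_squared_add[of "pi * \<theta>"] zero_less_power2[of "sin (pi * \<theta>)"] by linarith
    then have "(\<lambda>n. ((cos (pi * \<theta>))\<^sup>2) ^ n) \<longlonglongrightarrow> 0" by (intro LIMSEQ_realpow_zero) auto
    then have "(\<lambda>n. wave j n z) \<longlonglongrightarrow> 0" by (simp add: wave_def \<theta>_def power_mult)
    then show ?case using tendsto_mult_right_zero by blast
  qed
qed measurable

text \<open>The bounds on the means sum to at most \<open>1/2\<close>, so that half of the Gaussian mass of the infinite
  product survives.\<close>

definition exponent :: "nat \<Rightarrow> nat" where "exponent j = (SOME n. (\<integral>z. heat_density z * wave j n z \<partial>lborel) \<le> (1/2) ^ (j + 2))"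

lemma wave_exponent_integral: "(\<integral>z. heat_density z * wave j (exponent j) z \<partial>lborel) \<le> (1/2) ^ (j + 2)"
  unfolding exponent_def
proof (rule someI_ex)
  have "(\<lambda>n. \<integral>z. heat_density z * wave j n z \<partial>lborel) \<longlonglongrightarrow> 0" using wave_integral_tendsto by simp
  from order_tendstoD(2)[OF this, of "(1/2) ^ (j + 2)"]
  have "\<forall>\<^sub>F n in sequentially. (\<integral>z. heat_density z * wave j n z \<partial>lborel) < (1/2) ^ (j + 2)" by simp
  then show "\<exists>n. (\<integral>z. heat_density z * wave j n z \<partial>lborel) \<le> (1/2) ^ (j + 2)"
    by (auto simp: eventually_sequentially intro: less_imp_le)
qed

definition oscillation :: "nat \<Rightarrow> real \<times> real \<Rightarrow> real" where
  "oscillation k z = (\<Prod>j<k. 1 - wave j (exponent j) z)"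

lemma oscillation_Suc: "oscillation (Suc k) z = oscillation k z * (1 - wave k (exponent k) z)"
  by (simp add: oscillation_def mult.commute)

lemma oscillation_measurable [measurable]: "oscillation k \<in> borel_measurable borel"
  unfolding oscillation_def by measurable

lemma oscillation_bounds: "0 \<le> oscillation k z" "oscillation k z \<le> 1"
  unfolding oscillation_def by (auto intro!: prod_nonneg prod_le_1 simp: wave_bounds)

lemma oscillation_decseq: "decseq (\<lambda>k. oscillation k z)"
  unfolding decseq_Suc_iff oscillation_Suc using oscillation_bounds wave_bounds by (simp add: mult_left_le)

text \<open>For the evaluation of \<open>kconv\<close> at the origin, where the argument is
  reflected.\<close>

lemma oscillation_uminus: "oscillation k (- z) = oscillation k z"
proof -
  have "wave j n (- z) = wave j n z" for j n
    using cos_minus[of "pi * (of_int (fst (direction j)) * fst z + of_int (snd (direction j)) * snd z)"]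
    by (simp add: wave_def algebra_simps)
  then show ?thesis by (simp add: oscillation_def)
qed

lemma oscillation_zero:
  fixes a b :: int
  assumes "(a, b) \<noteq> (0, 0)"
  obtains k where "\<And>z. of_int a * fst z + of_int b * snd z \<in> \<int> \<Longrightarrow> oscillation k z = 0"
proof -
  let ?j = "to_nat (a, b)"
  have j: "direction ?j = (a, b)" using assms by (simp add: direction_def)
  show thesis
  proof (rule that)
    fix z :: "real \<times> real" assume "of_int a * fst z + of_int b * snd z \<in> \<int>"
    then obtain m :: int where m: "of_int a * fst z + of_int b * snd z = of_int m" by (auto elim: Ints_cases)
    have "sin (pi * of_int m) = 0" by (metis mult.commute sin_zero_iff_int2)
    then have "(cos (pi * of_int m))\<^sup>2 = 1" using sin_cos_squared_add[of "pi * of_int m"] by simp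
    then have "wave ?j n z = 1" for n by (simp add: wave_def j m power_mult)
    then show "oscillation (Suc ?j) z = 0" by (simp add: oscillation_Suc)
  qed
qed

lemma cos_lipschitz: "\<bar>cos x - cos y\<bar> \<le> \<bar>x - y\<bar>" for x y :: real
proof -
  have "norm (cos y - cos x) \<le> 1 * norm (y - x)"
    by (rule field_differentiable_bound[of UNIV cos "\<lambda>x. - sin x" 1])
      (auto intro!: derivative_eq_intros)
  then show ?thesis by (simp add: abs_minus_commute)
qed

lemma wave_lipschitz: "\<exists>L\<ge>0. \<forall>z w. \<bar>wave j n z - wave j n w\<bar> \<le> L * norm (z - w)"
proof (intro exI conjI allI)
  let ?a = "real_of_int (fst (direction j))" and ?b = "real_of_int (snd (direction j))"
  let ?L = "real (2 * n) * (pi * (\<bar>?a\<bar> + \<bar>?b\<bar>))"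
  show "0 \<le> ?L" by simp
  fix z w :: "real \<times> real"
  let ?A = "pi * (?a * fst z + ?b * snd z)" and ?B = "pi * (?a * fst w + ?b * snd w)"
  have "\<bar>wave j n z - wave j n w\<bar> \<le> real (2 * n) * \<bar>cos ?A - cos ?B\<bar>"
    using norm_power_diff[of "cos ?A" "cos ?B" "2 * n"] by (simp add: wave_def)
  also have "\<dots> \<le> real (2 * n) * \<bar>?A - ?B\<bar>" by (intro mult_left_mono cos_lipschitz) simp
  also have "\<dots> \<le> real (2 * n) * (pi * (\<bar>?a\<bar> * norm (z - w) + \<bar>?b\<bar> * norm (z - w)))"
  proof (rule mult_left_mono)
    have e: "?A - ?B = pi * (?a * fst (z - w) + ?b * snd (z - w))" by (simp add: algebra_simps)
    have "\<bar>?a * fst (z - w) + ?b * snd (z - w)\<bar> \<le> \<bar>?a\<bar> * \<bar>fst (z - w)\<bar> + \<bar>?b\<bar> * \<bar>snd (z - w)\<bar>"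
      by (metis abs_mult abs_triangle_ineq)
    also have "\<dots> \<le> \<bar>?a\<bar> * norm (z - w) + \<bar>?b\<bar> * norm (z - w)"
      using norm_fst_le[of "fst (z - w)" "snd (z - w)"] norm_snd_le[of "snd (z - w)" "fst (z - w)"]
      unfolding prod.collapse real_norm_def by (intro add_mono mult_left_mono) auto
    finally show "\<bar>?A - ?B\<bar> \<le> pi * (\<bar>?a\<bar> * norm (z - w) + \<bar>?b\<bar> * norm (z - w))" unfolding e by (simp add: abs_mult)
  qed simp
  finally show "\<bar>wave j n z - wave j n w\<bar> \<le> ?L * norm (z - w)" by (simp add: algebra_simps)
qed

lemma oscillation_lipschitz: "\<exists>L\<ge>0. \<forall>z w. \<bar>oscillation k z - oscillation k w\<bar> \<le> L * norm (z - w)"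
proof (induction k)
  case 0
  show ?case by (rule exI[of _ 0]) (simp add: oscillation_def)
next
  case (Suc k)
  obtain L where L: "L \<ge> 0" "\<And>z w. \<bar>oscillation k z - oscillation k w\<bar> \<le> L * norm (z - w)" using Suc by blast
  obtain L' where L': "L' \<ge> 0" "\<And>z w. \<bar>wave k (exponent k) z - wave k (exponent k) w\<bar> \<le> L' * norm (z - w)" using wave_lipschitz by blast
  have "\<bar>oscillation (Suc k) z - oscillation (Suc k) w\<bar> \<le> (L + L') * norm (z - w)" for z w
  proof -
    have "oscillation (Suc k) z - oscillation (Suc k) w = (oscillation k z - oscillation k w) * (1 - wave k (exponent k) z) + oscillation k w * (wave k (exponent k) w - wave k (exponent k) z)"
      by (simp add: oscillation_Suc algebra_simps)
    also have "\<bar>\<dots>\<bar> \<le> \<bar>oscillation k z - oscillation k w\<bar> * \<bar>1 - wave k (exponent k) z\<bar> + \<bar>oscillation k w\<bar> * \<bar>wave k (exponent k) w - wave k (exponent k) z\<bar>"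
      by (metis abs_mult abs_triangle_ineq)
    also have "\<dots> \<le> L * norm (z - w) * 1 + 1 * (L' * norm (w - z))"
      using oscillation_bounds[of k w] wave_bounds[of k "exponent k" z] L L' by (intro add_mono mult_mono) auto
    finally show ?thesis by (simp add: distrib_right norm_minus_commute)
  qed
  then show ?case using L L' by (intro exI[of _ "L + L'"]) auto
qed

text \<open>The seminorm is global, so the Lipschitz bound is used up to distance \<open>1\<close>
  and the bounds of the function itself beyond.\<close>

lemma oscillation_hoelder: "\<exists>A. hoelder A (\<lambda>z. of_real (\<epsilon> * oscillation k z))"
proof -
  obtain L where L: "L \<ge> 0" "\<And>z w. \<bar>oscillation k z - oscillation k w\<bar> \<le> L * norm (z - w)" using oscillation_lipschitz by blast
  have "\<bar>oscillation k z - oscillation k w\<bar> \<le> (L + 1) * sqrt (norm (z - w))" for z w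
  proof (cases "norm (z - w) \<le> 1")
    case True
    then have "norm (z - w) \<le> sqrt (norm (z - w))"
      by (intro real_le_rsqrt) (simp add: power2_eq_square mult_left_le)
    then have "L * norm (z - w) \<le> (L + 1) * sqrt (norm (z - w))" using L by (intro mult_mono) auto
    then show ?thesis using L(2)[of z w] by linarith
  next
    case False
    then have "1 * 1 \<le> (L + 1) * sqrt (norm (z - w))" using L by (intro mult_mono) auto
    then show ?thesis using oscillation_bounds[of k z] oscillation_bounds[of k w] by linarith
  qed
  then have "\<bar>\<epsilon>\<bar> * \<bar>oscillation k z - oscillation k w\<bar> \<le> \<bar>\<epsilon>\<bar> * ((L + 1) * sqrt (norm (z - w)))" for z w by (intro mult_left_mono) auto
  then have "norm (complex_of_real (\<epsilon> * oscillation k z) - of_real (\<epsilon> * oscillation k w)) \<le> (\<bar>\<epsilon>\<bar> * (L + 1)) * sqrt (norm (z - w))" for z w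
    unfolding of_real_diff[symmetric] norm_of_real right_diff_distrib[symmetric] abs_mult mult.assoc .
  then show ?thesis unfolding hoelder_def by blast
qed

text \<open>Weierstrass's product inequality. It reduces the Gaussian mean of the product to the sum
  of the means of the single waves.\<close>

lemma oscillation_ge: "1 - (\<Sum>j<k. wave j (exponent j) z) \<le> oscillation k z"
proof (induction k)
  case (Suc k)
  have "oscillation k z * wave k (exponent k) z \<le> wave k (exponent k) z" using oscillation_bounds wave_bounds by (simp add: mult_left_le_one_le)
  then show ?case using Suc by (simp add: oscillation_Suc right_diff_distrib)
qed (simp add: oscillation_def)

lemma oscillation_heat: "1/2 * \<epsilon> \<le> Re (kconv k1 1 (\<lambda>z. of_real (\<epsilon> * oscillation k z)) 0)" if \<epsilon>: "\<epsilon> \<ge> 0"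
proof -
  have i: "integrable lborel (\<lambda>z. heat_density z * wave j n z)" for j n
    by (rule Bochner_Integration.integrable_bound[OF integrable.intros[OF heat_density_integral]])
      (use heat_density(1) wave_bounds in \<open>auto simp: abs_mult mult_left_le\<close>)
  have i2: "integrable lborel (\<lambda>z. heat_density z * oscillation k z)"
    by (rule Bochner_Integration.integrable_bound[OF integrable.intros[OF heat_density_integral]])
      (use heat_density(1) oscillation_bounds in \<open>auto simp: abs_mult mult_left_le\<close>)
  have B: "has_bochner_integral lborel (\<lambda>z. heat_density z - (\<Sum>j<k. heat_density z * wave j (exponent j) z)) (1 - (\<Sum>j<k. \<integral>z. heat_density z * wave j (exponent j) z \<partial>lborel))"
    by (intro has_bochner_integral_diff heat_density_integral has_bochner_integral_sum has_bochner_integral_integrable i)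
  have "1 - (\<Sum>j<k. \<integral>z. heat_density z * wave j (exponent j) z \<partial>lborel) \<le> (\<integral>z. heat_density z * oscillation k z \<partial>lborel)"
    unfolding has_bochner_integral_integral_eq[OF B, symmetric]
  proof (rule integral_mono[OF integrable.intros[OF B] i2])
    show "heat_density z - (\<Sum>j<k. heat_density z * wave j (exponent j) z) \<le> heat_density z * oscillation k z" for z
      using mult_left_mono[OF oscillation_ge[where z = z and k = k] heat_density(1)[of z]] by (simp add: right_diff_distrib sum_distrib_left)
  qed
  moreover have "(\<Sum>j<k. \<integral>z. heat_density z * wave j (exponent j) z \<partial>lborel) \<le> (\<Sum>j<k. (1/2) ^ (j + 2))"
    by (intro sum_mono wave_exponent_integral)
  moreover have "(\<Sum>j<k. (1/2::real) ^ (j + 2)) = 1/2 - (1/2)^(k+1)" by (induction k) (auto simp: field_simps)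
  ultimately have I: "1/2 \<le> (\<integral>z. heat_density z * oscillation k z \<partial>lborel)"
    using zero_le_power[of "1/2::real" "k+1"] by linarith
  have "kconv k1 1 (\<lambda>z. of_real (\<epsilon> * oscillation k z)) 0 = of_real (\<epsilon> * (\<integral>z. heat_density z * oscillation k z \<partial>lborel))"
  proof -
    have "kconv k1 1 (\<lambda>z. of_real (\<epsilon> * oscillation k z)) 0 = (\<integral>z. complex_of_real (\<epsilon> * (heat_density z * oscillation k z)) \<partial>lborel)"
      by (simp add: kconv_def heat_density oscillation_uminus mult_ac)
    then show ?thesis by (simp only: integral_complex_of_real integral_mult_right_zero)
  qed
  then show ?thesis using mult_left_mono[OF I \<epsilon>] by (simp only: Re_complex_of_real mult.commute)
qed

section \<open>The limit of the data and its solution\<close>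

definition oscillation_limit :: "real \<times> real \<Rightarrow> real" where "oscillation_limit z = lim (\<lambda>k. oscillation k z)"

lemma oscillation_limit_tendsto: "(\<lambda>k. oscillation k z) \<longlonglongrightarrow> oscillation_limit z"
proof -
  obtain L where "(\<lambda>k. oscillation k z) \<longlonglongrightarrow> L" by (rule decseq_convergent[OF oscillation_decseq, of 0 z]) (use oscillation_bounds in auto)
  then show ?thesis unfolding oscillation_limit_def by (rule convergentI[THEN convergent_LIMSEQ_iff[THEN iffD1]])
qed

text \<open>The heat mean of the data at the origin is at least \<open>eps / 4\<close>. The value
  \<open>64\<close> makes the nonlinear correction \<open>8 * KK^3 * eps^2\<close> equal to
  \<open>eps / 8\<close>, half of that, and also meets the threshold \<open>e0\<close>.\<close>

definition eps :: real where "eps = 1 / (64 * KK^3)"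

lemma eps: "0 < eps" "eps \<le> e0" "8 * KK^3 * eps\<^sup>2 < eps / 4"
proof -
  have K1: "KK \<ge> 1" by (rule KK_bounds)
  then have K: "KK \<ge> 1" "0 < KK" by linarith+
  then show p: "0 < eps" by (simp add: eps_def)
  have "KK^2 \<le> KK^3" using K by (intro power_increasing) auto
  moreover have "0 < KK^2" using K by simp
  ultimately have "24 * KK^2 \<le> 64 * KK^3" "0 < 24 * KK^2" by linarith+
  then show "eps \<le> e0" unfolding eps_def e0_def by (intro frac_le) simp_all
  have "8 * KK^3 * eps\<^sup>2 = (8 * KK^3 * eps) * eps" by (simp add: power2_eq_square)
  also have "8 * KK^3 * eps = 1/8" using K by (simp add: eps_def)
  finally show "8 * KK^3 * eps\<^sup>2 < eps / 4" using p by simp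
qed

interpretation sd: small_data eps "2 * KK * eps"
  using eps by unfold_locales auto

text \<open>The factor \<open>eps / 2\<close> instead of \<open>eps\<close> provides the room
  required by \<open>real_sol_comparison\<close>.\<close>

definition hsol :: "real \<Rightarrow> real \<times> real \<Rightarrow> real" where "hsol = real_sol (\<lambda>z. eps / 2 * oscillation_limit z)"

lemma oscillation_data: "sd.data (\<lambda>z. eps / 2 * oscillation k z)" and oscillation_half: "\<bar>eps / 2 * oscillation k z\<bar> \<le> eps / 2"
proof -
  show 1: "\<bar>eps / 2 * oscillation k z\<bar> \<le> eps / 2" for z using eps(1) oscillation_bounds[of k z] by (simp add: abs_mult mult_left_le)
  show "sd.data (\<lambda>z. eps / 2 * oscillation k z)" unfolding sd.data_def
  proof (intro conjI allI)
    show "\<bar>eps / 2 * oscillation k z\<bar> \<le> eps" for z using 1[of z] eps(1) by linarith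
  qed measurable
qed

lemma oscillation_limit_data: "sd.data (\<lambda>z. eps / 2 * oscillation_limit z)"
  unfolding sd.data_def
proof (intro conjI allI)
  have [measurable]: "oscillation_limit \<in> borel_measurable borel"
    by (rule borel_measurable_LIMSEQ_real[OF oscillation_limit_tendsto]) measurable
  show "(\<lambda>z. eps / 2 * oscillation_limit z) \<in> borel_measurable borel" by measurable
  show "\<bar>eps / 2 * oscillation_limit z\<bar> \<le> eps" for z
  proof (rule LIMSEQ_le_const2)
    show "(\<lambda>k. \<bar>eps / 2 * oscillation k z\<bar>) \<longlonglongrightarrow> \<bar>eps / 2 * oscillation_limit z\<bar>" by (intro tendsto_intros oscillation_limit_tendsto)
    show "\<exists>N. \<forall>k\<ge>N. \<bar>eps / 2 * oscillation k z\<bar> \<le> eps" using oscillation_data unfolding sd.data_def by blast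
  qed
qed

lemma hsol_limit: "t > 0 \<Longrightarrow> (\<lambda>k. real_sol (\<lambda>z. eps / 2 * oscillation k z) t x) \<longlonglongrightarrow> hsol t x"
  unfolding hsol_def
  by (intro sd.real_sol_data_tendsto[OF oscillation_data oscillation_limit_data] tendsto_intros oscillation_limit_tendsto)

lemma hsol_nonneg: assumes t: "t > 0" shows "0 \<le> hsol t x"
proof -
  have "0 \<le> real_sol (\<lambda>z. eps / 2 * oscillation k z) t x" for k
  proof -
    obtain A where A: "hoelder A (\<lambda>z. complex_of_real (eps / 2 * oscillation k z))" using oscillation_hoelder by blast
    have "real_sol (\<lambda>z. 0) t x \<le> real_sol (\<lambda>z. eps / 2 * oscillation k z) t x"
      by (rule sd.real_sol_comparison[OF eps(1) _ _ oscillation_half _ A _ _ t, of _ 0])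
        (use eps(1) oscillation_bounds in \<open>auto simp: hoelder_def\<close>)
    then show ?thesis using sd.real_sol_zero[OF t] by simp
  qed
  then show ?thesis by (intro LIMSEQ_le_const[OF hsol_limit[OF t]]) blast
qed

text \<open>The products decrease, so all later solutions lie below the one for the
  \<open>k\<close>-th product, and so does their limit. That product is Hoelder, and its solution
  stays within \<open>C * t powr (1/4)\<close> of it. The constant depends on \<open>k\<close>;
  hence only finitely many segments can be treated at a time.\<close>

lemma hsol_upper: "\<exists>C\<ge>0. \<forall>t>0. \<forall>x. hsol t x \<le> eps / 2 * oscillation k x + C * t powr (1/4)"
proof -
  obtain A where A: "hoelder A (\<lambda>z. complex_of_real (eps / 2 * oscillation k z))" using oscillation_hoelder by blast
  have A0: "A \<ge> 0" by (rule hoelder_nonneg[OF A])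
  have "hsol t x \<le> eps / 2 * oscillation k x + 2 * KK * A * t powr (1/4)" if t: "t > 0" for t x
  proof -
    have "real_sol (\<lambda>z. eps / 2 * oscillation m z) t x \<le> real_sol (\<lambda>z. eps / 2 * oscillation k z) t x" if "m \<ge> k" for m
    proof -
      obtain B where B: "hoelder B (\<lambda>z. complex_of_real (eps / 2 * oscillation m z))" using oscillation_hoelder by blast
      show ?thesis
        by (rule sd.real_sol_comparison[OF eps(1) _ _ oscillation_half oscillation_half A B _ t])
          (use eps(1) decseqD[OF oscillation_decseq that] in \<open>auto intro: mult_left_mono\<close>)
    qed
    then have "hsol t x \<le> real_sol (\<lambda>z. eps / 2 * oscillation k z) t x"
      by (intro LIMSEQ_le_const2[OF hsol_limit[OF t]]) blast
    then show ?thesis using sd.real_sol_initial[OF oscillation_data A t, of x] by linarith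
  qed
  then show ?thesis using A0 KK_bounds by (intro exI[of _ "2 * KK * A"]) auto
qed

text \<open>The lower bound for the solution is the same for every partial product and therefore
  survives the limit.\<close>

lemma hsol_nontrivial: "hsol 1 0 > 0"
proof -
  have "eps / 4 - 8 * KK^3 * eps\<^sup>2 \<le> real_sol (\<lambda>z. eps / 2 * oscillation k z) 1 0" for k
    using oscillation_heat[of "eps / 2" k] sd.real_sol_ge_heat[OF oscillation_data, of k 0] eps(1) by linarith
  then have "eps / 4 - 8 * KK^3 * eps\<^sup>2 \<le> hsol 1 0"
    by (intro LIMSEQ_le_const[OF hsol_limit]) auto
  then show ?thesis using eps(3) by linarith
qed

lemma hsol_bound: "t > 0 \<Longrightarrow> \<bar>hsol t x\<bar> \<le> 1/12"
  using sd.real_sol_bound[OF oscillation_limit_data, of t x] sd.M(2) unfolding hsol_def by linarith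

lemmas hsol_param_analytic = sd.real_sol_param_analytic[OF oscillation_limit_data, folded hsol_def]
  and hsol_local = sd.real_sol_local[OF oscillation_limit_data, folded hsol_def]

section \<open>Curvature of conformal metrics\<close>

lemma mixed_difference:
  fixes F :: "real \<Rightarrow> real \<Rightarrow> real"
  assumes "\<And>a b. ((\<lambda>a. F a b) has_field_derivative Fa a b) (at a)" "\<And>a b. ((\<lambda>b. Fa a b) has_field_derivative Fab a b) (at b)" "h > 0"
  shows "\<exists>x y. 0 < x \<and> x < h \<and> 0 < y \<and> y < h \<and> F h h - F h 0 - F 0 h + F 0 0 = h\<^sup>2 * Fab x y"
proof -
  have "((\<lambda>a. F a h - F a 0) has_field_derivative Fa a h - Fa a 0) (at a)" for a
    by (intro DERIV_diff assms)
  then obtain x where x: "0 < x" "x < h" "(F h h - F h 0) - (F 0 h - F 0 0) = (h - 0) * (Fa x h - Fa x 0)"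
    using MVT2[OF assms(3), of "\<lambda>a. F a h - F a 0" "\<lambda>a. Fa a h - Fa a 0"] by blast
  obtain y where y: "0 < y" "y < h" "Fa x h - Fa x 0 = (h - 0) * Fab x y"
    using MVT2[OF assms(3), of "Fa x" "Fab x"] assms(2) by blast
  have "F h h - F h 0 - F 0 h + F 0 0 = h\<^sup>2 * Fab x y" using x(3) unfolding y(3) by (simp add: power2_eq_square)
  then show ?thesis using x y by blast
qed

text \<open>Schwarz's theorem: by \<open>mixed_difference\<close> the second difference over a small
  square equals its area times a value of either mixed derivative, and the squares shrink to the
  origin.\<close>

lemma symmetric_partial_derivatives:
  fixes F :: "real \<Rightarrow> real \<Rightarrow> real"
  assumes A: "\<And>a b. ((\<lambda>a. F a b) has_field_derivative Fa a b) (at a)" "\<And>a b. ((\<lambda>b. Fa a b) has_field_derivative Fab a b) (at b)"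
    and B: "\<And>a b. ((\<lambda>b. F a b) has_field_derivative Fb a b) (at b)" "\<And>a b. ((\<lambda>a. Fb a b) has_field_derivative Fba a b) (at a)"
    and C: "isCont (\<lambda>p. Fab (fst p) (snd p)) (0, 0)" "isCont (\<lambda>p. Fba (fst p) (snd p)) (0, 0)"
  shows "Fab 0 0 = Fba 0 0"
proof -
  define h where "h n = inverse (real (Suc n))" for n
  have h: "h n > 0" for n by (simp add: h_def)
  have h0: "h \<longlonglongrightarrow> 0" unfolding h_def by (rule LIMSEQ_inverse_real_of_nat)
  have "\<exists>x y x' y'. 0 < x \<and> x < h n \<and> 0 < y \<and> y < h n \<and> 0 < x' \<and> x' < h n \<and> 0 < y' \<and> y' < h n \<and> Fab x y = Fba x' y'" for n
  proof -
    obtain x y where 1: "0 < x" "x < h n" "0 < y" "y < h n" "F (h n) (h n) - F (h n) 0 - F 0 (h n) + F 0 0 = (h n)\<^sup>2 * Fab x y"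
      using mixed_difference[of F Fa Fab, OF A h[of n]] by blast
    obtain y' x' where 2: "0 < x'" "x' < h n" "0 < y'" "y' < h n" "F (h n) (h n) - F 0 (h n) - F (h n) 0 + F 0 0 = (h n)\<^sup>2 * Fba x' y'"
      using mixed_difference[of "\<lambda>b a. F a b" "\<lambda>b a. Fb a b" "\<lambda>b a. Fba a b", OF B h[of n]] by blast
    have "(h n)\<^sup>2 * Fab x y = (h n)\<^sup>2 * Fba x' y'" using 1(5) 2(5) by linarith
    then have "Fab x y = Fba x' y'" using h[of n] by simp
    then show ?thesis using 1 2 by blast
  qed
  then obtain x y x' y' where H: "\<And>n. 0 < x n" "\<And>n. x n < h n" "\<And>n. 0 < y n" "\<And>n. y n < h n"
    "\<And>n. 0 < x' n" "\<And>n. x' n < h n" "\<And>n. 0 < y' n" "\<And>n. y' n < h n" "\<And>n. Fab (x n) (y n) = Fba (x' n) (y' n)"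
    by metis
  have l: "z \<longlonglongrightarrow> 0" if "\<And>n. 0 < z n" "\<And>n. z n < h n" for z
    by (rule tendsto_sandwich[OF _ _ tendsto_const h0]) (intro always_eventually allI less_imp_le that)+
  have "(\<lambda>n. Fab (x n) (y n)) \<longlonglongrightarrow> Fab 0 0" "(\<lambda>n. Fba (x' n) (y' n)) \<longlonglongrightarrow> Fba 0 0"
    using isCont_tendsto_compose[OF C(1) tendsto_Pair[OF l[of x] l[of y]]] isCont_tendsto_compose[OF C(2) tendsto_Pair[OF l[of x'] l[of y']]] H
    by simp_all
  then show ?thesis unfolding H(9) by (rule LIMSEQ_unique)
qed

lemma pderiv_at_line:
  fixes f :: "real^'n \<Rightarrow> real"
  assumes "f differentiable (at (x + s *\<^sub>R axis i 1))"
  shows "((\<lambda>s. f (x + s *\<^sub>R axis i 1)) has_field_derivative pderiv_at i f (x + s *\<^sub>R axis i 1)) (at s)"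
proof -
  let ?D = "frechet_derivative f (at (x + s *\<^sub>R axis i 1))"
  have f: "(f has_derivative ?D) (at (x + s *\<^sub>R axis i 1))"
    using assms by (rule frechet_derivative_works[THEN iffD1])
  have g: "((\<lambda>s. x + s *\<^sub>R axis i 1) has_derivative (\<lambda>s. s *\<^sub>R axis i 1)) (at s)"
    by (auto intro!: derivative_eq_intros)
  have "((\<lambda>s. f (x + s *\<^sub>R axis i 1)) has_derivative (\<lambda>s. ?D (s *\<^sub>R axis i 1))) (at s)"
    using diff_chain_at[OF g f] by (simp add: o_def)
  then show ?thesis
    using linear_scale[OF has_derivative_linear[OF f]]
    by (simp add: has_field_derivative_def pderiv_at_def mult_commute_abs)
qed

lemma pderiv_at_cmult:
  fixes f :: "real^'n \<Rightarrow> real"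
  assumes "f differentiable (at x)"
  shows "pderiv_at i (\<lambda>x. c * f x) x = c * pderiv_at i f x"
proof -
  have "(f has_derivative frechet_derivative f (at x)) (at x)"
    using assms by (rule frechet_derivative_works[THEN iffD1])
  then have "((\<lambda>x. c * f x) has_derivative (\<lambda>v. c * frechet_derivative f (at x) v)) (at x)"
    by (rule has_derivative_mult_right)
  from frechet_derivative_at[OF this] show ?thesis unfolding pderiv_at_def by metis
qed

definition conformal :: "(real^2 \<Rightarrow> real) \<Rightarrow> 2 metric_field" where
  "conformal u x = u x *\<^sub>R mat 1"

lemma conformal_nth: "conformal u x $ i $ j = (if i = j then u x else 0)"
  by (simp add: conformal_def mat_def)

lemma matrix_inv_conformal:
  assumes "u x \<noteq> 0"
  shows "matrix_inv (conformal u x) $ k $ l = (if k = l then 1 / u x else 0)"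
proof -
  have "conformal u x ** ((1 / u x) *\<^sub>R mat 1) = mat 1" "((1 / u x) *\<^sub>R mat 1) ** conformal u x = mat 1"
    using assms by (simp_all add: conformal_def matrix_matrix_mult_def mat_def vec_eq_iff if_distrib[of "\<lambda>x. _ * x"] cong: if_cong)
  then have "invertible (conformal u x)" unfolding invertible_def by blast
  from someI_ex[OF this[unfolded invertible_def], folded matrix_inv_def, THEN conjunct1] have "(conformal u x ** matrix_inv (conformal u x)) $ k $ l = mat 1 $ k $ l" by simp
  then have "u x * matrix_inv (conformal u x) $ k $ l = (if k = l then 1 else 0)"
    by (simp add: matrix_matrix_mult_def conformal_nth mat_def if_distrib[of "\<lambda>x. x * _"] cong: if_cong)
  then show ?thesis using assms by (auto simp: field_simps split: if_splits)
qed

locale conformal_factor =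
  fixes u :: "real^2 \<Rightarrow> real"
  assumes C2: "Ck_on 2 u UNIV" and pos: "\<And>x. 0 < u x"
begin

text \<open>The partial derivatives of \<open>ln u\<close>, in which the Christoffel symbols are
  linear.\<close>

definition p :: "2 \<Rightarrow> real^2 \<Rightarrow> real" where "p i x = pderiv_at i u x / u x"

lemma u_differentiable: "u differentiable (at x)"
  and pderiv_u_differentiable: "pderiv_at i u differentiable (at x)"
  and pderiv2_u_continuous: "continuous_on UNIV (pderiv_at j (pderiv_at i u))"
  using C2 by (auto simp: numeral_2_eq_2 pderiv_at_def[abs_def])

lemma p_differentiable: "p i differentiable (at x)"
  unfolding p_def[abs_def] using pos[of x] by (intro differentiable_divide pderiv_u_differentiable u_differentiable) simp

lemma p_line: "((\<lambda>s. p i (x + s *\<^sub>R axis j 1)) has_field_derivative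
    (pderiv_at j (pderiv_at i u) (x + s *\<^sub>R axis j 1) - p i (x + s *\<^sub>R axis j 1) * pderiv_at j u (x + s *\<^sub>R axis j 1)) / u (x + s *\<^sub>R axis j 1)) (at s)"
  using pos[of "x + s *\<^sub>R axis j 1"] unfolding p_def
  by (auto intro!: derivative_eq_intros pderiv_at_line u_differentiable pderiv_u_differentiable simp: field_simps)

lemma pderiv_p: "pderiv_at j (p i) x = (pderiv_at j (pderiv_at i u) x - p i x * pderiv_at j u x) / u x"
  using DERIV_unique[OF pderiv_at_line[OF p_differentiable] p_line[of i x j 0]] by simp

lemma p_symmetric: "pderiv_at 2 (p 1) x = pderiv_at 1 (p 2) x"
proof -
  let ?x = "\<lambda>a b. x + a *\<^sub>R axis 1 1 + b *\<^sub>R axis 2 1"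
  have sw: "?x a b = (x + b *\<^sub>R axis 2 1) + a *\<^sub>R axis 1 1" for a b by simp
  have c: "isCont (\<lambda>q. pderiv_at j (pderiv_at i u) (?x (fst q) (snd q))) (0, 0)" for i j
  proof -
    have "continuous_on UNIV (\<lambda>q. pderiv_at j (pderiv_at i u) (?x (fst q) (snd q)))"
      by (rule continuous_on_compose2[OF pderiv2_u_continuous]) (auto intro!: continuous_intros)
    then show ?thesis by (simp add: continuous_on_eq_continuous_at)
  qed
  have "pderiv_at 2 (pderiv_at 1 u) (?x 0 0) = pderiv_at 1 (pderiv_at 2 u) (?x 0 0)"
  proof (rule symmetric_partial_derivatives[of "\<lambda>a b. u (?x a b)" "\<lambda>a b. pderiv_at 1 u (?x a b)" "\<lambda>a b. pderiv_at 2 (pderiv_at 1 u) (?x a b)"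
      "\<lambda>a b. pderiv_at 2 u (?x a b)" "\<lambda>a b. pderiv_at 1 (pderiv_at 2 u) (?x a b)"])
    fix a b :: real
    show "((\<lambda>a. u (?x a b)) has_field_derivative pderiv_at 1 u (?x a b)) (at a)"
      unfolding sw by (rule pderiv_at_line[OF u_differentiable])
    show "((\<lambda>b. pderiv_at 1 u (?x a b)) has_field_derivative pderiv_at 2 (pderiv_at 1 u) (?x a b)) (at b)"
      by (rule pderiv_at_line[OF pderiv_u_differentiable])
    show "((\<lambda>b. u (?x a b)) has_field_derivative pderiv_at 2 u (?x a b)) (at b)"
      by (rule pderiv_at_line[OF u_differentiable])
    show "((\<lambda>a. pderiv_at 2 u (?x a b)) has_field_derivative pderiv_at 1 (pderiv_at 2 u) (?x a b)) (at a)"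
      unfolding sw by (rule pderiv_at_line[OF pderiv_u_differentiable])
  qed (rule c)+
  then show ?thesis unfolding pderiv_p by (simp add: p_def mult.commute)
qed

lemma christoffel_conformal:
  "christoffel (conformal u) k i j x =
     1/2 * ((if j = k then p i x else 0) + (if i = k then p j x else 0) - (if i = j then p k x else 0))"
proof -
  have c: "pderiv_at i (\<lambda>y. conformal u y $ j $ l) x = (if j = l then pderiv_at i u x else 0)" for i j l
    by (simp add: conformal_nth pderiv_at_def)
  show ?thesis unfolding christoffel_def c matrix_inv_conformal[OF less_imp_neq[OF pos, symmetric]]
    by (simp add: p_def if_distrib[of "\<lambda>x. x * _"] add_divide_distrib diff_divide_distrib cong: if_cong)
qed

lemma christoffel_conformal_values:
  "christoffel (conformal u) 1 1 1 = (\<lambda>x. (1/2) * p 1 x)"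
  "christoffel (conformal u) 1 1 2 = (\<lambda>x. (1/2) * p 2 x)"
  "christoffel (conformal u) 1 2 1 = (\<lambda>x. (1/2) * p 2 x)"
  "christoffel (conformal u) 1 2 2 = (\<lambda>x. (-1/2) * p 1 x)"
  "christoffel (conformal u) 2 1 1 = (\<lambda>x. (-1/2) * p 2 x)"
  "christoffel (conformal u) 2 1 2 = (\<lambda>x. (1/2) * p 1 x)"
  "christoffel (conformal u) 2 2 1 = (\<lambda>x. (1/2) * p 1 x)"
  "christoffel (conformal u) 2 2 2 = (\<lambda>x. (1/2) * p 2 x)"
  by (auto simp: christoffel_conformal)

definition lap_ln :: "real^2 \<Rightarrow> real" where
  "lap_ln x = pderiv_at 1 (p 1) x + pderiv_at 2 (p 2) x"

text \<open>In dimension two the quadratic Christoffel terms cancel, and what remains is the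
  Laplacian of \<open>ln u\<close>. The components that should vanish do so by the symmetry of its
  second derivatives.\<close>

lemma riemann_conformal:
  "riemann (conformal u) 1 2 2 1 x = - lap_ln x / 2"
  "riemann (conformal u) 2 1 1 2 x = - lap_ln x / 2"
  "riemann (conformal u) 1 2 2 2 x = 0"
  "riemann (conformal u) 2 1 2 2 x = 0"
  "riemann (conformal u) 1 2 1 1 x = 0"
  "riemann (conformal u) i i k l x = 0"
  unfolding riemann_def lap_ln_def sum_2 christoffel_conformal_values pderiv_at_cmult[OF p_differentiable] p_symmetric
  by (simp_all add: algebra_simps)

lemma ricci_conformal: "ricci (conformal u) x = (- lap_ln x / 2) *\<^sub>R mat 1"
proof -
  have "ricci (conformal u) x $ i $ j = ((- lap_ln x / 2) *\<^sub>R mat 1) $ i $ j" for i j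
  proof -
    have "i = 1 \<or> i = 2" "j = 1 \<or> j = 2" using exhaust_2 by blast+
    then show ?thesis by (auto simp: ricci_def sum_2 riemann_conformal mat_def)
  qed
  then show ?thesis by (simp add: vec_eq_iff)
qed

lemma gauss_curvature_conformal: "gauss_curvature (conformal u) x = - lap_ln x / (2 * u x)"
  using pos[of x] by (simp add: gauss_curvature_def sum_2 riemann_conformal conformal_nth det_2 field_simps)

end

section \<open>The flow\<close>

lemma param_analytic_add_const: "param_analytic U S \<Longrightarrow> param_analytic (\<lambda>q. c + U q) S"
  unfolding param_analytic_def
proof
  fix q assume A: "\<forall>q\<in>S. \<exists>r>0. \<exists>M f. hol3 r M f \<and> (\<forall>\<tau> y. \<bar>\<tau>\<bar> < r \<longrightarrow> \<bar>y$1\<bar> < r \<longrightarrow> \<bar>y$2\<bar> < r \<longrightarrow>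
      U (q + (\<tau>, y)) = Re (f (of_real \<tau>) (of_real (y$1)) (of_real (y$2))))" and "q \<in> S"
  then obtain r M f where f: "r > 0" "hol3 r M f" "\<And>\<tau> y. \<bar>\<tau>\<bar> < r \<Longrightarrow> \<bar>y$1\<bar> < r \<Longrightarrow> \<bar>y$2\<bar> < r \<Longrightarrow>
      U (q + (\<tau>, y)) = Re (f (of_real \<tau>) (of_real (y$1)) (of_real (y$2)))"
    by meson
  have h: "hol3 r (\<bar>c\<bar> + M) (\<lambda>x y z. of_real c + f x y z)"
    unfolding hol3_def
  proof (intro conjI ballI)
    fix y z :: complex assume yz: "y \<in> ball 0 r" "z \<in> ball 0 r"
    show "norm (of_real c + f x y z) \<le> \<bar>c\<bar> + M" if "x \<in> ball 0 r" for x
      using hol3_bound[OF f(2) that yz] norm_triangle_ineq[of "of_real c" "f x y z"] by simp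
    have "(\<lambda>x. f x y z) holomorphic_on ball 0 r" "(\<lambda>x. f y x z) holomorphic_on ball 0 r" "(\<lambda>x. f y z x) holomorphic_on ball 0 r"
      using f(2) yz unfolding hol3_def by blast+
    note hf = holomorphic_on_add[OF holomorphic_on_const this(1)] holomorphic_on_add[OF holomorphic_on_const this(2)] holomorphic_on_add[OF holomorphic_on_const this(3)]
    show "(\<lambda>x. of_real c + f x y z) holomorphic_on ball 0 r" by (rule hf(1))
    show "(\<lambda>x. of_real c + f y x z) holomorphic_on ball 0 r" by (rule hf(2))
    show "(\<lambda>x. of_real c + f y z x) holomorphic_on ball 0 r" by (rule hf(3))
  qed
  have "\<forall>\<tau> y. \<bar>\<tau>\<bar> < r \<longrightarrow> \<bar>y$1\<bar> < r \<longrightarrow> \<bar>y$2\<bar> < r \<longrightarrow>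
      c + U (q + (\<tau>, y)) = Re (of_real c + f (of_real \<tau>) (of_real (y$1)) (of_real (y$2)))"
    using f(3) by simp
  then show "\<exists>r>0. \<exists>M f. hol3 r M f \<and> (\<forall>\<tau> y. \<bar>\<tau>\<bar> < r \<longrightarrow> \<bar>y$1\<bar> < r \<longrightarrow> \<bar>y$2\<bar> < r \<longrightarrow>
      c + U (q + (\<tau>, y)) = Re (f (of_real \<tau>) (of_real (y$1)) (of_real (y$2))))"
    using f(1) h by (intro exI[of _ r] conjI exI[of _ "\<bar>c\<bar> + M"] exI[of _ "\<lambda>x y z. of_real c + f x y z"])
qed

lemma (in conformal_factor) second_derivative_ln:
  assumes t: "t > 0"
    and P: "\<And>\<alpha>. \<bar>\<alpha>\<bar> < 1/4 \<Longrightarrow> ((\<lambda>\<alpha>. ln (u (x + (sqrt t * \<alpha>) *\<^sub>R axis i 1))) has_field_derivative P \<alpha>) (at \<alpha>)"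
    and d: "(P has_field_derivative d) (at 0)"
  shows "d = t * pderiv_at i (p i) x"
proof -
  let ?x = "\<lambda>s. x + s *\<^sub>R axis i 1"
  have s: "((\<lambda>\<alpha>. sqrt t * \<alpha>) has_field_derivative sqrt t) (at \<alpha>)" for \<alpha>
    by (auto intro!: derivative_eq_intros)
  have "P \<alpha> = sqrt t * p i (?x (sqrt t * \<alpha>))" if "\<bar>\<alpha>\<bar> < 1/4" for \<alpha>
  proof (rule DERIV_unique[OF P[OF that]])
    have "((\<lambda>s. ln (u (?x s))) has_field_derivative p i (?x s)) (at s)" for s
      using pos[of "?x s"] pderiv_at_line[OF u_differentiable, where x = x and s = s and i = i]
      by (auto intro!: derivative_eq_intros simp: p_def divide_inverse)
    from DERIV_chain2[OF this s]
    show "((\<lambda>\<alpha>. ln (u (?x (sqrt t * \<alpha>)))) has_field_derivative sqrt t * p i (?x (sqrt t * \<alpha>))) (at \<alpha>)"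
      by (simp add: mult.commute)
  qed
  then have "((\<lambda>\<alpha>. sqrt t * p i (?x (sqrt t * \<alpha>))) has_field_derivative d) (at 0)"
    by (intro has_field_derivative_transform_within_open[OF d, of "{-1/4<..<1/4}"]) auto
  moreover have "((\<lambda>\<alpha>. sqrt t * p i (?x (sqrt t * \<alpha>))) has_field_derivative sqrt t * (pderiv_at i (p i) (?x (sqrt t * 0)) * sqrt t)) (at 0)"
    by (intro DERIV_cmult DERIV_chain2[OF _ s] pderiv_at_line p_differentiable)
  ultimately have "d = sqrt t * (pderiv_at i (p i) (?x (sqrt t * 0)) * sqrt t)" by (rule DERIV_unique)
  then show ?thesis using t by simp
qed

definition flow_factor :: "real \<Rightarrow> real^2 \<Rightarrow> real" where "flow_factor t x = 1 + hsol t (coords x)"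

definition gflow :: "real \<Rightarrow> 2 metric_field" where "gflow t = conformal (flow_factor t)"

lemma flow_factor_bounds: "t > 0 \<Longrightarrow> 1 \<le> flow_factor t x" "t > 0 \<Longrightarrow> flow_factor t x \<le> 2"
  using hsol_nonneg[of t "coords x"] hsol_bound[of t "coords x"] by (simp_all add: flow_factor_def)

lemma flow_factor_Ck: "Ck_on k (\<lambda>q. flow_factor (fst q) (snd q) *\<^sub>R (c :: 'b :: real_normed_vector)) ({0<..} \<times> UNIV)"
  unfolding flow_factor_def by (rule param_analytic_Ck_on[OF param_analytic_add_const[OF hsol_param_analytic]]) (simp add: open_Times)

lemma flow_factor_Ck_slice: "t > 0 \<Longrightarrow> Ck_on k (\<lambda>x. flow_factor t x *\<^sub>R (c :: 'b :: real_normed_vector)) UNIV"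
  using Ck_on_slice[OF flow_factor_Ck, of t k c] by simp

lemma flow_factor_conformal_factor: "t > 0 \<Longrightarrow> conformal_factor (flow_factor t)"
  using flow_factor_Ck_slice[of t 2 "1::real"] flow_factor_bounds(1)[of t]
  by unfold_locales (auto intro: less_le_trans[OF zero_less_one])

text \<open>The second derivatives \<open>d1\<close>, \<open>d2\<close> along lines measured in
  units of \<open>sqrt t\<close> carry a factor \<open>t\<close>, so \<open>D = t * lap_ln\<close>.
  The scale-free bound on \<open>D\<close>, eight times a number at most \<open>1/12\<close>,
  becomes the decay rate \<open>1 / t\<close>.\<close>

lemma flow_factor_evolution:
  assumes t: "t > 0"
  shows "((\<lambda>s. flow_factor s x) has_field_derivative conformal_factor.lap_ln (flow_factor t) x) (at t)"
    "\<bar>conformal_factor.lap_ln (flow_factor t) x\<bar> \<le> 1 / t"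
proof -
  interpret conformal_factor "flow_factor t" by (rule flow_factor_conformal_factor[OF t])
  obtain D P1 P2 d1 d2 where H: "((\<lambda>s. hsol s (coords x)) has_field_derivative D / t) (at t)" "\<bar>D\<bar> \<le> 8 * (2 * KK * eps)" "D = d1 + d2"
    "\<And>\<alpha>. \<bar>\<alpha>\<bar> < 1/4 \<Longrightarrow> ((\<lambda>\<alpha>. ln (1 + hsol t (coords x + sqrt t *\<^sub>R (\<alpha>, 0)))) has_field_derivative P1 \<alpha>) (at \<alpha>)"
    "(P1 has_field_derivative d1) (at 0)"
    "\<And>\<alpha>. \<bar>\<alpha>\<bar> < 1/4 \<Longrightarrow> ((\<lambda>\<alpha>. ln (1 + hsol t (coords x + sqrt t *\<^sub>R (0, \<alpha>)))) has_field_derivative P2 \<alpha>) (at \<alpha>)"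
    "(P2 has_field_derivative d2) (at 0)"
  proof (rule hsol_local[OF t, of "coords x"], goal_cases)
    case (1 D P1 P2 d1 d2)
    show ?case by (rule 1(1)[OF 1(2-)])
  qed
  have e: "coords x + sqrt t *\<^sub>R (\<alpha>, 0) = coords (x + (sqrt t * \<alpha>) *\<^sub>R axis 1 1)"
    "coords x + sqrt t *\<^sub>R (0, \<alpha>) = coords (x + (sqrt t * \<alpha>) *\<^sub>R axis 2 1)" for \<alpha>
    by (simp_all add: coords_def axis_def)
  have "d1 = t * pderiv_at 1 (p 1) x"
    by (rule second_derivative_ln[OF t H(4)[unfolded e flow_factor_def[symmetric]] H(5)])
  moreover have "d2 = t * pderiv_at 2 (p 2) x"
    by (rule second_derivative_ln[OF t H(6)[unfolded e flow_factor_def[symmetric]] H(7)])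
  ultimately have D: "D = t * lap_ln x" using H(3) by (simp add: lap_ln_def distrib_left)
  then have Dt: "D / t = lap_ln x" using t by simp
  show "((\<lambda>s. flow_factor s x) has_field_derivative lap_ln x) (at t)"
    using DERIV_add[OF DERIV_const H(1), of 1] unfolding flow_factor_def Dt by simp
  have "\<bar>D\<bar> \<le> 1" using H(2) sd.M(2) by linarith
  then have "t * \<bar>lap_ln x\<bar> \<le> 1" using t unfolding D by (simp add: abs_mult)
  then show "\<bar>lap_ln x\<bar> \<le> 1 / t" using t by (simp add: pos_le_divide_eq mult.commute)
qed

lemma conformal_quadratic: "v \<bullet> (conformal u x *v v) = u x * (v \<bullet> v)"
  by (simp add: conformal_def scaleR_matrix_vector_assoc[symmetric])

lemma gflow_smooth_ricci_flow: "smooth_ricci_flow {0<..} gflow"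
  unfolding smooth_ricci_flow_def
proof (intro conjI ballI allI)
  have "smooth_map_on (\<lambda>q. flow_factor (fst q) (snd q) *\<^sub>R (mat 1 :: real^2^2)) ({0<..} \<times> UNIV)"
    using flow_factor_Ck unfolding smooth_map_on_def by blast
  moreover have "(\<lambda>(t, x). gflow t x) = (\<lambda>q. flow_factor (fst q) (snd q) *\<^sub>R (mat 1 :: real^2^2))"
    by (auto simp: fun_eq_iff gflow_def conformal_def)
  ultimately show "smooth_map_on (\<lambda>(t, x). gflow t x) ({0<..} \<times> UNIV)" by (simp only:)
  fix t :: real assume "t \<in> {0<..}"
  then have t: "t > 0" by simp
  interpret conformal_factor "flow_factor t" by (rule flow_factor_conformal_factor[OF t])
  show "riemannian_metric (gflow t)"
    unfolding riemannian_metric_def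
  proof (intro conjI allI impI)
    have "smooth_map_on (\<lambda>x. flow_factor t x *\<^sub>R (mat 1 :: real^2^2)) UNIV"
      using flow_factor_Ck_slice[OF t] unfolding smooth_map_on_def by blast
    then show "smooth_map_on (gflow t) UNIV" by (simp add: gflow_def conformal_def[abs_def])
    show "transpose (gflow t x) = gflow t x" for x
      by (simp add: gflow_def transpose_def vec_eq_iff conformal_nth)
    show "0 < v \<bullet> (gflow t x *v v)" if "v \<noteq> 0" for x v
      using pos[of x] that by (simp add: gflow_def conformal_quadratic)
  qed
  fix x
  have "((\<lambda>s. flow_factor s x) has_vector_derivative lap_ln x) (at t)"
    using flow_factor_evolution(1)[OF t] by (simp add: has_real_derivative_iff_has_vector_derivative)
  from has_vector_derivative_scaleR[OF flow_factor_evolution(1)[OF t, of x] has_vector_derivative_const[of "mat 1 :: real^2^2"]]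
  show "((\<lambda>s. gflow s x) has_vector_derivative (-2) *\<^sub>R ricci (gflow t) x) (at t)"
    by (simp add: gflow_def ricci_conformal conformal_def)
qed

lemma gflow_curvature: "t > 0 \<Longrightarrow> \<bar>gauss_curvature (gflow t) x\<bar> \<le> 1 / (2 * t)"
proof -
  assume t: "t > 0"
  interpret conformal_factor "flow_factor t" by (rule flow_factor_conformal_factor[OF t])
  have "\<bar>gauss_curvature (gflow t) x\<bar> = \<bar>lap_ln x\<bar> / (2 * flow_factor t x)"
    using pos[of x] by (simp add: gflow_def gauss_curvature_conformal)
  also have "\<dots> \<le> (1 / t) / (2 * 1)"
    using flow_factor_evolution(2)[OF t, of x] flow_factor_bounds(1)[OF t, of x] t by (intro frac_le mult_left_mono) auto
  finally show ?thesis by simp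
qed

lemma gflow_not_static: "gflow 1 \<noteq> standard_metric"
proof
  assume "gflow 1 = standard_metric"
  then have "gflow 1 0 $ 1 $ 1 = (standard_metric :: 2 metric_field) 0 $ 1 $ 1" by simp
  then have "flow_factor 1 0 = 1" by (simp add: gflow_def conformal_nth standard_metric_def mat_def)
  then show False using hsol_nontrivial by (simp add: flow_factor_def coords_def zero_prod_def)
qed

section \<open>Riemannian distance of conformal metrics\<close>

definition speed :: "(real^2 \<Rightarrow> real) \<Rightarrow> (real \<Rightarrow> real^2) \<Rightarrow> real \<Rightarrow> real" where
  "speed u \<gamma> t = sqrt (u (\<gamma> t)) * norm (vector_derivative \<gamma> (at t))"

text \<open>Integrability of the speed and the value of the length are joined in one
  \<open>has_integral\<close> statement, so that joining and reversing curves handle both at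
  once.\<close>

definition curves :: "(real^2 \<Rightarrow> real) \<Rightarrow> real^2 \<Rightarrow> real^2 \<Rightarrow> real \<Rightarrow> (real \<Rightarrow> real^2) \<Rightarrow> bool" where
  "curves u x y L \<gamma> \<longleftrightarrow> valid_path \<gamma> \<and> pathstart \<gamma> = x \<and> pathfinish \<gamma> = y \<and> (speed u \<gamma> has_integral L) {0..1}"

lemma riem_speed_conformal: "riem_speed (conformal u) \<gamma> = speed u \<gamma>"
  by (simp add: fun_eq_iff riem_speed_def speed_def conformal_quadratic real_sqrt_mult norm_eq_sqrt_inner Let_def)

lemma riem_dist_conformal: "riem_dist (conformal u) x y = Inf {L. \<exists>\<gamma>. curves u x y L \<gamma>}"
proof -
  have "{riem_length (conformal u) \<gamma> | \<gamma>. valid_path \<gamma> \<and> pathstart \<gamma> = x \<and> pathfinish \<gamma> = y \<and>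
      riem_speed (conformal u) \<gamma> integrable_on {0..1}} = {L. \<exists>\<gamma>. curves u x y L \<gamma>}"
    unfolding riem_length_def riem_speed_conformal curves_def has_integral_iff by auto
  then show ?thesis by (simp add: riem_dist_def)
qed

lemma valid_path_differentiable:
  assumes "valid_path (\<gamma> :: real \<Rightarrow> real^2)"
  obtains S where "finite S" "\<And>t. t \<in> {0..1} - S \<Longrightarrow> (\<gamma> has_vector_derivative vector_derivative \<gamma> (at t)) (at t)"
  using assms by (auto simp: valid_path_def piecewise_C1_differentiable_on_def C1_differentiable_on_eq vector_derivative_works)

lemma speed_affine:
  assumes \<gamma>: "(\<gamma> has_vector_derivative vector_derivative \<gamma> (at (m * t + c))) (at (m * t + c))"
    and T: "open T" "t \<in> T" "\<And>s. s \<in> T \<Longrightarrow> \<gamma>' s = \<gamma> (m * s + c)"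
  shows "speed u \<gamma>' t = \<bar>m\<bar> * speed u \<gamma> (m * t + c)"
proof -
  have "((\<lambda>s. m * s + c) has_vector_derivative m) (at t)"
    by (auto intro!: derivative_eq_intros simp flip: has_real_derivative_iff_has_vector_derivative)
  from vector_diff_chain_at[OF this \<gamma>]
  have "((\<lambda>s. \<gamma> (m * s + c)) has_vector_derivative m *\<^sub>R vector_derivative \<gamma> (at (m * t + c))) (at t)"
    by (simp add: o_def)
  then have "(\<gamma>' has_vector_derivative m *\<^sub>R vector_derivative \<gamma> (at (m * t + c))) (at t)"
    by (rule has_vector_derivative_transform_within_open[OF _ T(1,2)]) (simp add: T(3))
  from vector_derivative_at[OF this] show ?thesis by (simp add: speed_def T(2,3))
qed

lemma finite_affine_preimage: "finite S \<Longrightarrow> m \<noteq> 0 \<Longrightarrow> finite {t::real. m * t + c \<in> S}"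
  by (rule finite_subset[of _ "(\<lambda>s. (s - c) / m) ` S"]) (auto simp: image_iff field_simps)

lemma curves_join:
  assumes "curves u x y L1 \<gamma>1" "curves u y z L2 \<gamma>2"
  shows "curves u x z (L1 + L2) (\<gamma>1 +++ \<gamma>2)"
proof -
  have v: "valid_path \<gamma>1" "valid_path \<gamma>2" and i: "(speed u \<gamma>1 has_integral L1) {0..1}" "(speed u \<gamma>2 has_integral L2) {0..1}"
    and e: "pathstart \<gamma>1 = x" "pathfinish \<gamma>1 = y" "pathstart \<gamma>2 = y" "pathfinish \<gamma>2 = z"
    using assms by (auto simp: curves_def)
  obtain S1 where S1: "finite S1" "\<And>t. t \<in> {0..1} - S1 \<Longrightarrow> (\<gamma>1 has_vector_derivative vector_derivative \<gamma>1 (at t)) (at t)"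
    using valid_path_differentiable[OF v(1)] by blast
  obtain S2 where S2: "finite S2" "\<And>t. t \<in> {0..1} - S2 \<Longrightarrow> (\<gamma>2 has_vector_derivative vector_derivative \<gamma>2 (at t)) (at t)"
    using valid_path_differentiable[OF v(2)] by blast
  have i1: "((\<lambda>t. 2 * speed u \<gamma>1 (2 * t + 0)) has_integral L1) {0..1/2}"
    using has_integral_affinity01 [OF i(1), where m = 2 and c = 0, THEN has_integral_cmul [where c = 2]]
    by (simp_all only: image_affinity_atLeastAtMost_div_diff, simp_all)
  have i2: "((\<lambda>t. 2 * speed u \<gamma>2 (2 * t + (-1))) has_integral L2) {1/2..1}"
    using has_integral_affinity01 [OF i(2), where m = 2 and c = "-1", THEN has_integral_cmul [where c = 2]]
    by (simp_all only: image_affinity_atLeastAtMost_div_diff, simp_all)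
  \<comment> \<open>The joined curve has the rescaled derivative except at the junction and at the
    break points, a finite set that does not affect the integral; the same holds for the second
    half.\<close>
  have j1: "(speed u (\<gamma>1 +++ \<gamma>2) has_integral L1) {0..1/2}"
  proof (rule has_integral_spike_finite[OF _ _ i1])
    show "finite (insert (1/2) {t. 2 * t + 0 \<in> S1})" using finite_affine_preimage[OF S1(1), of 2 0] by simp
    fix t :: real assume t: "t \<in> {0..1/2} - insert (1/2) {t. 2 * t + 0 \<in> S1}"
    have "speed u (\<gamma>1 +++ \<gamma>2) t = \<bar>2\<bar> * speed u \<gamma>1 (2 * t + 0)"
      by (rule speed_affine[OF S1(2), where T = "{..<1/2}"]) (use t in \<open>auto simp: joinpaths_def\<close>)
    then show "speed u (\<gamma>1 +++ \<gamma>2) t = 2 * speed u \<gamma>1 (2 * t + 0)" by simp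
  qed
  have j2: "(speed u (\<gamma>1 +++ \<gamma>2) has_integral L2) {1/2..1}"
  proof (rule has_integral_spike_finite[OF _ _ i2])
    show "finite (insert (1/2) {t. 2 * t + (-1) \<in> S2})" using finite_affine_preimage[OF S2(1), of 2 "-1"] by simp
    fix t :: real assume t: "t \<in> {1/2..1} - insert (1/2) {t. 2 * t + (-1) \<in> S2}"
    have "speed u (\<gamma>1 +++ \<gamma>2) t = \<bar>2\<bar> * speed u \<gamma>2 (2 * t + (-1))"
      by (rule speed_affine[OF S2(2), where T = "{1/2<..}"]) (use t in \<open>auto simp: joinpaths_def\<close>)
    then show "speed u (\<gamma>1 +++ \<gamma>2) t = 2 * speed u \<gamma>2 (2 * t + (-1))" by simp
  qed
  have "(speed u (\<gamma>1 +++ \<gamma>2) has_integral L1 + L2) {0..1}"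
    by (rule has_integral_combine[OF _ _ j1 j2]) auto
  then show ?thesis using v e by (simp add: curves_def valid_path_join)
qed

lemma curves_reverse:
  assumes "curves u x y L \<gamma>"
  shows "curves u y x L (reversepath \<gamma>)"
proof -
  have v: "valid_path \<gamma>" and i: "(speed u \<gamma> has_integral L) {0..1}" using assms by (auto simp: curves_def)
  obtain S where S: "finite S" "\<And>t. t \<in> {0..1} - S \<Longrightarrow> (\<gamma> has_vector_derivative vector_derivative \<gamma> (at t)) (at t)"
    using valid_path_differentiable[OF v] by blast
  have i1: "((\<lambda>t. speed u \<gamma> (-1 * t + 1)) has_integral L) {0..1}"
    using has_integral_affinity01 [OF i, where m = "-1" and c = 1] by simp
  have "(speed u (reversepath \<gamma>) has_integral L) {0..1}"
  proof (rule has_integral_spike_finite[OF _ _ i1])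
    show "finite {t. -1 * t + 1 \<in> S}" using finite_affine_preimage[OF S(1), of "-1" 1] by simp
    fix t :: real assume t: "t \<in> {0..1} - {t. -1 * t + 1 \<in> S}"
    have "speed u (reversepath \<gamma>) t = \<bar>-1\<bar> * speed u \<gamma> (-1 * t + 1)"
      by (rule speed_affine[OF S(2), where T = UNIV]) (use t in \<open>auto simp: reversepath_def\<close>)
    then show "speed u (reversepath \<gamma>) t = speed u \<gamma> (-1 * t + 1)" by simp
  qed
  then show ?thesis using assms by (simp add: curves_def)
qed

locale distance_factor =
  fixes u :: "real^2 \<Rightarrow> real"
  assumes cont: "continuous_on UNIV u" and lower: "\<And>x. 1 \<le> u x" and upper: "\<And>x. u x \<le> 2"
begin

abbreviation d :: "real^2 \<Rightarrow> real^2 \<Rightarrow> real" where "d \<equiv> riem_dist (conformal u)"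

lemma curves_lower:
  assumes "curves u x y L \<gamma>"
  shows "dist x y \<le> L"
proof -
  have v: "valid_path \<gamma>" and i: "(speed u \<gamma> has_integral L) {0..1}" and e: "\<gamma> 0 = x" "\<gamma> 1 = y"
    using assms by (auto simp: curves_def pathstart_def pathfinish_def)
  obtain S where S: "finite S" "\<And>t. t \<in> {0..1} - S \<Longrightarrow> (\<gamma> has_vector_derivative vector_derivative \<gamma> (at t)) (at t)"
    using valid_path_differentiable[OF v] by blast
  have c: "continuous_on {0..1} \<gamma>" using valid_path_imp_path[OF v] by (simp add: path_def)
  have I: "((\<lambda>t. vector_derivative \<gamma> (at t)) has_integral (\<gamma> 1 - \<gamma> 0)) {0..1}"
    by (rule fundamental_theorem_of_calculus_strong[OF S(1) _ S(2) c]) auto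
  have "norm (integral {0..1} (\<lambda>t. vector_derivative \<gamma> (at t))) \<le> integral {0..1} (speed u \<gamma>)"
  proof (rule Henstock_Kurzweil_Integration.integral_norm_bound_integral)
    show "(\<lambda>t. vector_derivative \<gamma> (at t)) integrable_on {0..1}" "speed u \<gamma> integrable_on {0..1}"
      using I i by (auto simp: integrable_on_def)
    have "1 \<le> sqrt (u (\<gamma> t))" for t using lower[of "\<gamma> t"] by simp
    then show "norm (vector_derivative \<gamma> (at t)) \<le> speed u \<gamma> t" for t
      unfolding speed_def using mult_right_mono[of 1 "sqrt (u (\<gamma> t))" "norm (vector_derivative \<gamma> (at t))"] by simp
  qed
  then show ?thesis using integral_unique[OF I] integral_unique[OF i] e by (simp add: dist_norm norm_minus_commute)
qed

lemma curves_line: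
  assumes c: "\<And>s. 0 \<le> s \<Longrightarrow> s \<le> 1 \<Longrightarrow> u (linepath x y s) \<le> c"
  shows "\<exists>L\<le>sqrt c * dist x y. \<exists>\<gamma>. curves u x y L \<gamma>"
proof -
  let ?f = "\<lambda>s. sqrt (u (linepath x y s)) * norm (y - x)"
  have "continuous_on {0..1} ?f"
    by (intro continuous_intros continuous_on_compose2[OF cont]) auto
  then have i: "?f integrable_on {0..1}" by (rule integrable_continuous_real)
  have speed: "speed u (linepath x y) = ?f" by (simp add: speed_def fun_eq_iff)
  have "integral {0..1} ?f \<le> integral {0..1} (\<lambda>s::real. sqrt c * norm (y - x))"
    by (intro integral_le i mult_right_mono) (use c in auto)
  then have "integral {0..1} ?f \<le> sqrt c * dist x y" by (simp add: dist_norm norm_minus_commute)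
  moreover have "curves u x y (integral {0..1} ?f) (linepath x y)"
    using integrable_integral[OF i] unfolding curves_def speed by simp
  ultimately show ?thesis by blast
qed

lemma curves_exist: "\<exists>L\<le>sqrt 2 * dist x y. \<exists>\<gamma>. curves u x y L \<gamma>"
  by (rule curves_line[OF upper])

lemma d_le: "curves u x y L \<gamma> \<Longrightarrow> d x y \<le> L"
  unfolding riem_dist_conformal by (intro cInf_lower bdd_belowI[of _ "dist x y"]) (auto dest: curves_lower)

lemma d_less:
  assumes "d x y < r"
  obtains L \<gamma> where "curves u x y L \<gamma>" "L < r"
proof -
  have "{L. \<exists>\<gamma>. curves u x y L \<gamma>} \<noteq> {}" using curves_exist by blast
  from cInf_lessD[OF this] assms show thesis using that unfolding riem_dist_conformal by blast
qed

lemma dist_le_d: "dist x y \<le> d x y"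
proof (rule ccontr)
  assume "\<not> dist x y \<le> d x y"
  then have "d x y < dist x y" by simp
  then obtain L \<gamma> where "curves u x y L \<gamma>" "L < dist x y" by (rule d_less)
  then show False using curves_lower[of x y L \<gamma>] by linarith
qed

lemma d_le_line:
  assumes "\<And>s. 0 \<le> s \<Longrightarrow> s \<le> 1 \<Longrightarrow> u (linepath x y s) \<le> c"
  shows "d x y \<le> sqrt c * dist x y"
  using curves_line[of x y c] assms d_le order_trans by blast

lemma d_le_2: "d x y \<le> 2 * dist x y"
proof -
  have "sqrt 2 \<le> sqrt 4" by (intro real_sqrt_le_mono) simp
  then have "sqrt 2 * dist x y \<le> 2 * dist x y" by (intro mult_right_mono) auto
  then show ?thesis using d_le_line[OF upper, of x y] by linarith
qed

lemma d_triangle: "d x z \<le> d x y + d y z"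
proof (rule field_le_epsilon)
  fix r :: real assume r: "r > 0"
  obtain L1 \<gamma>1 where 1: "curves u x y L1 \<gamma>1" "L1 < d x y + r / 2" by (rule d_less[of x y "d x y + r / 2"]) (use r in auto)
  obtain L2 \<gamma>2 where 2: "curves u y z L2 \<gamma>2" "L2 < d y z + r / 2" by (rule d_less[of y z "d y z + r / 2"]) (use r in auto)
  show "d x z \<le> d x y + d y z + r" using d_le[OF curves_join[OF 1(1) 2(1)]] 1(2) 2(2) by linarith
qed

lemma d_commute: "d x y = d y x"
proof -
  have "{L. \<exists>\<gamma>. curves u x y L \<gamma>} = {L. \<exists>\<gamma>. curves u y x L \<gamma>}" using curves_reverse by blast
  then show ?thesis by (simp add: riem_dist_conformal)
qed

lemma d_metric_space: "Metric_space UNIV d"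
proof
  fix x y z
  show "0 \<le> d x y" using dist_le_d[of x y] zero_le_dist[of x y] by linarith
  show "d x y = d y x" by (rule d_commute)
  show "d x z \<le> d x y + d y z" by (rule d_triangle)
  have "x = y" if "d x y = 0" using dist_le_d[of x y] that by simp
  moreover have "d x x = 0" using dist_le_d[of x x] d_le_2[of x x] by simp
  ultimately show "d x y = 0 \<longleftrightarrow> x = y" by blast
qed

text \<open>Since \<open>dist \<le> d \<le> 2 * dist\<close>, the distance \<open>d\<close> has the
  same Cauchy sequences and limits as the Euclidean distance.\<close>

lemma d_complete: "complete_metric (conformal u)"
proof -
  interpret Metric_space UNIV d by (rule d_metric_space)
  have "\<exists>x. limitin mtopology \<sigma> x sequentially" if \<sigma>: "MCauchy \<sigma>" for \<sigma>
  proof -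
    have "Cauchy \<sigma>" unfolding Cauchy_def
    proof (intro allI impI)
      fix r :: real assume "r > 0"
      then obtain N where "\<And>n n'. N \<le> n \<Longrightarrow> N \<le> n' \<Longrightarrow> d (\<sigma> n) (\<sigma> n') < r" using \<sigma> unfolding MCauchy_def by meson
      then show "\<exists>N. \<forall>m\<ge>N. \<forall>n\<ge>N. dist (\<sigma> m) (\<sigma> n) < r" using dist_le_d le_less_trans by meson
    qed
    then obtain x where x: "\<sigma> \<longlonglongrightarrow> x" using Cauchy_convergent convergent_def by blast
    have "\<exists>N. \<forall>n\<ge>N. d (\<sigma> n) x < r" if rp: "r > 0" for r
    proof -
      obtain N where N: "\<And>n. n \<ge> N \<Longrightarrow> dist (\<sigma> n) x < r / 2"
        using metric_LIMSEQ_D[OF x half_gt_zero[OF rp]] by blast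
      have "d (\<sigma> n) x < r" if "n \<ge> N" for n using d_le_2[of "\<sigma> n" x] N[OF that] by linarith
      then show ?thesis by blast
    qed
    then have "limitin mtopology \<sigma> x sequentially" unfolding limit_metric_sequentially by simp
    then show ?thesis ..
  qed
  then show ?thesis unfolding complete_metric_def mcomplete_def by blast
qed

end

lemma standard_metric_dist: "riem_dist standard_metric x y = dist x y" for x :: "real^2"
proof -
  interpret distance_factor "\<lambda>x. 1" by unfold_locales auto
  have "standard_metric = conformal (\<lambda>x. 1)" by (simp add: fun_eq_iff standard_metric_def conformal_def)
  then show ?thesis using dist_le_d[of x y] d_le_line[where x = x and y = y and c = 1] by simp
qed

section \<open>Convergence of the distances\<close>

lemma flow_factor_distance_factor: "t > 0 \<Longrightarrow> distance_factor (flow_factor t)"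
proof (unfold_locales)
  assume t: "t > 0"
  show "continuous_on UNIV (flow_factor t)" using flow_factor_Ck_slice[OF t, of 0 "1::real"] by simp
  show "1 \<le> flow_factor t x" "flow_factor t x \<le> 2" for x using flow_factor_bounds[OF t] by auto
qed

definition grid :: "nat \<Rightarrow> int \<times> int \<Rightarrow> real^2" where
  "grid N m = (\<chi> i. of_int (if i = 1 then fst m else snd m) / real N)"

text \<open>The line through two points of a grid of mesh \<open>1/N\<close> lies in one of the sets \<open>a x + b y \<in> \<int>\<close>.\<close>

lemma grid_segment_vanishing:
  assumes "N > 0" "m \<noteq> n"
  obtains k where "\<And>s. oscillation k (coords (linepath (grid N m) (grid N n) s)) = 0"
proof -
  \<comment> \<open>A normal vector of the line, multiplied by \<open>N\<close>: the coordinates of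
    a grid point have denominator \<open>N\<close>, so the linear form takes an integer value on the
    whole line.\<close>
  define a b where "a = - (snd n - snd m) * int N" and "b = (fst n - fst m) * int N"
  have "(a, b) \<noteq> (0, 0)" using assms by (auto simp: a_def b_def prod_eq_iff)
  then obtain k where k: "\<And>z. of_int a * fst z + of_int b * snd z \<in> \<int> \<Longrightarrow> oscillation k z = 0" using oscillation_zero by blast
  show thesis
  proof (rule that, rule k)
    fix s
    have "of_int a * fst (coords (linepath (grid N m) (grid N n) s)) + of_int b * snd (coords (linepath (grid N m) (grid N n) s))
        = real_of_int (- (snd n - snd m) * fst m + (fst n - fst m) * snd m)"
      using assms(1) by (simp add: coords_def linepath_def grid_def a_def b_def field_simps)
    then show "of_int a * fst (coords (linepath (grid N m) (grid N n) s)) + of_int b * snd (coords (linepath (grid N m) (grid N n) s)) \<in> \<int>"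
      by (simp only: Ints_of_int)
  qed
qed

text \<open>Along the entire segment some partial product vanishes, so \<open>hsol_upper\<close>
  bounds the conformal factor there by \<open>1 + C * t powr (1/4)\<close>, and the straight segment
  is a nearly optimal curve. Both the product and \<open>C\<close> depend on the pair of grid
  points.\<close>

lemma grid_distance_limit:
  assumes N: "N > 0" and r: "r > 0"
  shows "\<forall>\<^sub>F t in at_right 0. riem_dist (gflow t) (grid N m) (grid N n) < dist (grid N m) (grid N n) + r"
proof (cases "m = n")
  case True
  have "riem_dist (gflow t) (grid N m) (grid N n) < dist (grid N m) (grid N n) + r" if "t > 0" for t
    using distance_factor.d_le_2[OF flow_factor_distance_factor[OF that], of "grid N m" "grid N n"] True r by (simp add: gflow_def)
  then show ?thesis by (auto simp: eventually_at_right_field intro!: exI[of _ 1])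
next
  case False
  let ?p = "grid N m" and ?q = "grid N n"
  obtain k where k: "\<And>s. oscillation k (coords (linepath ?p ?q s)) = 0" using grid_segment_vanishing[OF N False] by blast
  obtain C where C: "C \<ge> 0" "\<And>t x. t > 0 \<Longrightarrow> hsol t x \<le> eps / 2 * oscillation k x + C * t powr (1/4)" using hsol_upper[of k] by blast
  have "((\<lambda>t. sqrt (1 + C * t powr (1/4)) * dist ?p ?q) \<longlongrightarrow> sqrt (1 + C * 0) * dist ?p ?q) (at_right 0)"
    by (intro tendsto_intros tendsto_zero_powrI eventually_at_right_less[THEN eventually_mono]) auto
  then have "((\<lambda>t. sqrt (1 + C * t powr (1/4)) * dist ?p ?q) \<longlongrightarrow> dist ?p ?q) (at_right 0)" by simp
  from order_tendstoD(2)[OF this, of "dist ?p ?q + r"] r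
  have "\<forall>\<^sub>F t in at_right 0. sqrt (1 + C * t powr (1/4)) * dist ?p ?q < dist ?p ?q + r" by simp
  moreover have "\<forall>\<^sub>F t in at_right (0::real). t > 0" by (rule eventually_at_right_less)
  ultimately show ?thesis
  proof eventually_elim
    case (elim t)
    have "flow_factor t (linepath ?p ?q s) \<le> 1 + C * t powr (1/4)" for s
      using C(2)[OF elim(2), of "coords (linepath ?p ?q s)"] k[of s] by (simp add: flow_factor_def)
    then have "riem_dist (gflow t) ?p ?q \<le> sqrt (1 + C * t powr (1/4)) * dist ?p ?q"
      unfolding gflow_def by (intro distance_factor.d_le_line[OF flow_factor_distance_factor[OF elim(2)]])
    then show ?case using elim(1) by linarith
  qed
qed

definition near :: "nat \<Rightarrow> real^2 \<Rightarrow> int \<times> int" where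
  "near N x = (\<lfloor>real N * x $ 1\<rfloor>, \<lfloor>real N * x $ 2\<rfloor>)"

lemma dist_near:
  assumes "N > 0"
  shows "dist x (grid N (near N x)) \<le> 2 / real N"
proof -
  have f: "\<bar>y - of_int \<lfloor>real N * y\<rfloor> / real N\<bar> \<le> 1 / real N" for y
  proof -
    have "\<bar>real N * y - of_int \<lfloor>real N * y\<rfloor>\<bar> \<le> 1" using floor_correct[of "real N * y"] by linarith
    then have "\<bar>real N * y - of_int \<lfloor>real N * y\<rfloor>\<bar> / real N \<le> 1 / real N" using assms by (intro divide_right_mono) auto
    moreover have "\<bar>y - of_int \<lfloor>real N * y\<rfloor> / real N\<bar> = \<bar>real N * y - of_int \<lfloor>real N * y\<rfloor>\<bar> / real N"
    proof -
      have "y - of_int \<lfloor>real N * y\<rfloor> / real N = (real N * y - of_int \<lfloor>real N * y\<rfloor>) / real N"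
        using assms by (simp add: field_simps)
      then show ?thesis by (simp only: abs_divide abs_of_nat)
    qed
    ultimately show ?thesis by linarith
  qed
  have "dist x (grid N (near N x)) \<le> (\<Sum>i\<in>UNIV. \<bar>(x - grid N (near N x)) $ i\<bar>)"
    unfolding dist_norm by (rule norm_le_l1_cart)
  also have "\<dots> \<le> 1 / real N + 1 / real N"
    unfolding sum_2 using f[of "x $ 1"] f[of "x $ 2"] by (intro add_mono) (auto simp: grid_def near_def)
  finally show ?thesis by simp
qed

lemma near_bounded:
  assumes "norm x < R"
  shows "near N x \<in> {\<lfloor>- (real N * R)\<rfloor>..\<lfloor>real N * R\<rfloor>} \<times> {\<lfloor>- (real N * R)\<rfloor>..\<lfloor>real N * R\<rfloor>}"
proof -
  have "\<lfloor>- (real N * R)\<rfloor> \<le> \<lfloor>real N * x $ i\<rfloor> \<and> \<lfloor>real N * x $ i\<rfloor> \<le> \<lfloor>real N * R\<rfloor>" for i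
  proof -
    have "- R \<le> x $ i" "x $ i \<le> R" using component_le_norm_cart[of x i] assms by linarith+
    then have "real N * - R \<le> real N * x $ i" "real N * x $ i \<le> real N * R" by (intro mult_left_mono; simp)+
    then show ?thesis by (intro conjI floor_mono) simp_all
  qed
  then show ?thesis by (simp add: near_def)
qed

text \<open>A bounded region involves finitely many pairs of grid points, for which the estimate
  becomes simultaneous. Other points are joined to the grid by detours whose cost is controlled
  uniformly in time by \<open>d \<le> 2 * dist\<close>. The lower bound \<open>dist \<le> d\<close>
  holds at every time.\<close>

lemma gflow_initial_distance:
  "locally_uniform_limit UNIV (\<lambda>t (x, y). riem_dist (gflow t) x y) (\<lambda>(x, y). riem_dist standard_metric x y) (at_right 0)"
  unfolding locally_uniform_limit_def
proof
  fix p :: "(real^2) \<times> (real^2)"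
  define R where "R = norm (fst p) + norm (snd p) + 1"
  let ?U = "ball (0::real^2) R \<times> ball (0::real^2) R"
  have "norm (fst p) < R" "norm (snd p) < R" by (simp_all add: R_def add_pos_nonneg add_nonneg_pos add.assoc)
  then have "p \<in> ?U" by (simp add: mem_Times_iff)
  moreover have "uniform_limit (UNIV \<inter> ?U) (\<lambda>t (x, y). riem_dist (gflow t) x y) (\<lambda>(x, y). riem_dist standard_metric x y) (at_right 0)"
  proof (rule uniform_limitI)
    fix r :: real assume r: "r > 0"
    \<comment> \<open>Each detour of Euclidean length \<open>2 / N\<close> costs at most
      \<open>4 / N\<close> in \<open>d\<close> and \<open>2 / N\<close> in comparing Euclidean
      distances; both ends together cost \<open>12 / N\<close>, which should be below
      \<open>r / 2\<close>.\<close>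
    obtain N where N: "N > 0" "24 / r < real N"
    proof -
      obtain N where "24 / r < real N" using reals_Archimedean2 by blast
      moreover from this have "N > 0" using r by (intro gr0I) auto
      ultimately show thesis using that by blast
    qed
    have Nr: "12 / real N < r / 2" using N r by (simp add: field_simps)
    let ?I = "{\<lfloor>- (real N * R)\<rfloor>..\<lfloor>real N * R\<rfloor>} \<times> {\<lfloor>- (real N * R)\<rfloor>..\<lfloor>real N * R\<rfloor>}"
    have "\<forall>\<^sub>F t in at_right 0. \<forall>m\<in>?I. \<forall>n\<in>?I. riem_dist (gflow t) (grid N m) (grid N n) < dist (grid N m) (grid N n) + r / 2"
      using r by (intro eventually_ball_finite finite_cartesian_product finite_atLeastAtMost_int ballI grid_distance_limit N) auto
    moreover have "\<forall>\<^sub>F t in at_right (0::real). t > 0" by (rule eventually_at_right_less)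
    ultimately show "\<forall>\<^sub>F t in at_right 0. \<forall>q\<in>UNIV \<inter> ?U. dist (case q of (x, y) \<Rightarrow> riem_dist (gflow t) x y) (case q of (x, y) \<Rightarrow> riem_dist standard_metric x y) < r"
    proof eventually_elim
      case (elim t)
      interpret distance_factor "flow_factor t" by (rule flow_factor_distance_factor[OF elim(2)])
      have "dist (d x y) (dist x y) < r" if "norm x < R" "norm y < R" for x y
      proof -
        let ?x = "grid N (near N x)" and ?y = "grid N (near N y)"
        have 1: "d ?x ?y < dist ?x ?y + r / 2"
          by (rule bspec[OF bspec[OF elim(1)[unfolded gflow_def] near_bounded[OF that(1)]] near_bounded[OF that(2)]])
        have 2: "d x y \<le> d x ?x + d ?x ?y + d ?y y" using d_triangle[of x y ?x] d_triangle[of ?x y ?y] by linarith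
        have 3: "d x ?x \<le> 4 / real N" "d ?y y \<le> 4 / real N" "dist x ?x \<le> 2 / real N" "dist y ?y \<le> 2 / real N"
          using d_le_2[of x ?x] d_le_2[of ?y y] dist_near[OF N(1), of x] dist_near[OF N(1), of y] by (simp_all add: dist_commute)
        have 4: "dist ?x ?y \<le> dist x ?x + dist x y + dist y ?y"
          using dist_triangle[of ?x ?y x] dist_triangle[of x ?y y] by (simp add: dist_commute)
        have "12 / real N = 4 / real N + 4 / real N + 2 / real N + 2 / real N" by simp
        then have "d x y < dist x y + r" using 1 2 3 4 Nr by linarith
        then show ?thesis using dist_le_d[of x y] by (simp add: dist_real_def)
      qed
      then show ?case unfolding standard_metric_dist gflow_def by auto
    qed
  qed
  ultimately show "\<exists>U. open U \<and> p \<in> U \<and> uniform_limit (UNIV \<inter> U) (\<lambda>t (x, y). riem_dist (gflow t) x y) (\<lambda>(x, y). riem_dist standard_metric x y) (at_right 0)"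
    by (intro exI[of _ ?U]) (simp add: open_Times)
qed

theorem theorem1p3:
  shows "\<exists>g :: real \<Rightarrow> 2 metric_field.
    complete_ricci_flow {0<..} g \<and>
    locally_uniform_limit UNIV
      (\<lambda>t (x, y). riem_dist (g t) x y) (\<lambda>(x, y). riem_dist standard_metric x y) (at_right 0) \<and>
    (\<forall>t>0. \<forall>x. \<bar>gauss_curvature (g t) x\<bar> \<le> 1 / (2 * t)) \<and>
    \<not> (\<forall>t>0. g t = standard_metric)"
proof (intro exI[of _ gflow] conjI allI impI gflow_initial_distance)
  show "complete_ricci_flow {0<..} gflow"
    unfolding complete_ricci_flow_def
    using gflow_smooth_ricci_flow distance_factor.d_complete[OF flow_factor_distance_factor] by (simp add: gflow_def)
  show "\<bar>gauss_curvature (gflow t) x\<bar> \<le> 1 / (2 * t)" if "t > 0" for t x by (rule gflow_curvature[OF that])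
  show "\<not> (\<forall>t>0. gflow t = standard_metric)" using gflow_not_static zero_less_one by blast
qed

end
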